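(* Let $(X_k)_{k\in\mathbb{Z}}$ and $(M_k)_{k\in\mathbb{Z}}$ be as in the context. As $x\to\infty$, $$\mathcal{L}\biggl(\biggl(\frac1x\bigl(X_k^{3/2},\,X_kM_{k+1}\bigr)\biggr)_{k\ge0}\,\bigg|\,(X_0^{3/2}\vee X_0|M_1|)>x\biggr)\ \longrightarrow\ \mathcal{L}\Bigl(\bigl(\mu_A^{3k/2}\widetilde{Y},\ \mu_A^{3k/2}\widetilde{Y}\widetilde{Z}_k\bigr)_{k\ge0}\Bigr)$$ in the sense of convergence of finite dimensional distributions, where $\widetilde{Z}_k$, $k\in\mathbb{N}$, is an i.i.d. sequence of $\mathcal{N}(0,\sigma_A^2)$-distributed random variables, the distribution of $(\widetilde{Y},\widetilde{Z}_0)$ is given by $$\mathbb{P}(\widetilde{Y}>y,\ \widetilde{Z}_0>v_0)=\frac{\mathbb{E}\Bigl[\bigl(y\vee(1\vee|Z_0|)^{-1}\bigr)^{-2\alpha/3}\,\mathbf{1}_{(v_0,\infty)}(Z_0)\Bigr]}{\mathbb{E}\bigl[(1\vee|Z_0|)^{2\alpha/3}\bigr]},\qquad y,v_0\in\mathbb{R},$$ with $Z_0\stackrel{d}{=}\mathcal{N}(0,\sigma_A^2)$, and the random vector $(\widetilde{Y},\widetilde{Z}_0)$ is independent of the variables $\widetilde{Z}_k$, $k\in\mathbb{N}$. Consequently, the strongly stationary process $(X_k^{3/2},X_kM_{k+1})_{k\in\mathbb{Z}}$ is jointly regularly varying with tail index $\frac{2\alpha}{3}$, i.e. all its finite dimensional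 distributions are regularly varying with tail index $\frac{2\alpha}{3}$. The process $\bigl(\mu_A^{3k/2}\widetilde{Y},\mu_A^{3k/2}\widetilde{Y}\widetilde{Z}_k\bigr)_{k\ge0}$ is the forward tail process of $(X_k^{3/2},X_kM_{k+1})_{k\in\mathbb{Z}}$. Moreover, there exists a (whole) tail process of $(X_k^{3/2},X_kM_{k+1})_{k\in\mathbb{Z}}$ as well.
   Context: Setting: $\{A,A_j^{(i)}:j\in\mathbb{N},\,i\in\mathbb{Z}\}$ are i.i.d. nonnegative integer-valued random variables, independent of the i.i.d. family $\{B,B_i:i\in\mathbb{Z}\}$ of nonnegative integer-valued random variables. Assume $\mu_A:=\mathbb{E}[A]\in(0,1)$, $\sigma_A^2:=\mathrm{Var}(A)\in(0,\infty)$, and that $B$ is regularly varying with tail index $\alpha\in(1,2)$, i.e. $\lim_{x\to\infty}\mathbb{P}(B>qx)/\mathbb{P}(B>x)=q^{-\alpha}$ for all $q\in(0,\infty)$. In particular $\mu_B:=\mathbb{E}[B]\in(0,\infty)$. $(X_i)_{i\in\mathbb{Z}}$ is the strongly stationary process satisfying $X_i=\sum_{j=1}^{X_{i-1}}A_j^{(i)}+B_i$ for all $i\in\mathbb{Z}$ (the strongly stationary extension to $\mathbb{Z}$ of the corresponding Markov chain; $X_{i-1}$ is independent of $\{A_j^{(k)},B_k:j\in\mathbb{N},k\ge i\}$). Put $M_i:=X_i-\mu_AX_{i-1}-\mu_B$, $i\in\mathbb{Z}$. Notation: $a\vee b:=\max\{a,b\}$; $\mathcal{L}(\cdot)$ is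 the law and $\mathcal{L}(\cdot\mid E)$ the law conditional on the event $E$; $\mathbb{N}=\{1,2,\dots\}$. A random vector $\xi$ in $\mathbb{R}^d$ is regularly varying with tail index $\beta>0$ if there is a random vector $\Theta$ on the unit sphere such that for every $u>0$ the measures $\mathbb{P}(\|\xi\|>ux,\ \xi/\|\xi\|\in\cdot)/\mathbb{P}(\|\xi\|>x)$ converge weakly to $u^{-\beta}\,\mathbb{P}(\Theta\in\cdot)$ as $x\to\infty$. For a strongly stationary $\mathbb{R}^2$-valued process $(\xi_k)_{k\in\mathbb{Z}}$, with $\|\cdot\|$ the maximum norm on $\mathbb{R}^2$, a process $(\Upsilon_k)_{k\ge0}$ is its forward tail process (respectively $(\Upsilon_k)_{k\in\mathbb{Z}}$ is its (whole) tail process) if the finite dimensional distributions of $(x^{-1}\xi_k)_{k\ge0}$ (respectively $(x^{-1}\xi_k)_{k\in\mathbb{Z}}$) conditional on $\|\xi_0\|>x$ converge weakly to those of $(\Upsilon_k)$ as $x\to\infty$. *)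

theory Defs
  imports "HOL-Probability.Probability"
begin

(* The driving noise as one family: Inl (j, i) is A_j^(i), Inr i is B_i. *)
definition noise ::
  "(nat \<Rightarrow> int \<Rightarrow> 'a \<Rightarrow> nat) \<Rightarrow> (int \<Rightarrow> 'a \<Rightarrow> nat) \<Rightarrow> (nat \<times> int) + int \<Rightarrow> 'a \<Rightarrow> nat" where
  "noise A B = case_sum (\<lambda>(j, i). A j i) B"

(* The library's "indep_var" requires both random elements to have the same type. *)
definition indep_elements ::
  "'a measure \<Rightarrow> 'b measure \<Rightarrow> ('a \<Rightarrow> 'b) \<Rightarrow> 'c measure \<Rightarrow> ('a \<Rightarrow> 'c) \<Rightarrow> bool" where
  "indep_elements M S U T V \<longleftrightarrow>
     U \<in> measurable M S \<and> V \<in> measurable M T \<and>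
     prob_space.indep_set M {U -` C \<inter> space M | C. C \<in> sets S} {V -` D \<inter> space M | D. D \<in> sets T}"

definition regularly_varying_rv :: "'a measure \<Rightarrow> ('a \<Rightarrow> real) \<Rightarrow> real \<Rightarrow> bool" where
  "regularly_varying_rv M B \<alpha> \<longleftrightarrow>
     (\<forall>q>0. ((\<lambda>x. measure M {\<omega> \<in> space M. B \<omega> > q * x} / measure M {\<omega> \<in> space M. B \<omega> > x})
        \<longlongrightarrow> q powr (- \<alpha>)) at_top)"

definition fdd :: "'a measure \<Rightarrow> 'c measure \<Rightarrow> ('i \<Rightarrow> 'a \<Rightarrow> 'c) \<Rightarrow> 'i set \<Rightarrow> ('i \<Rightarrow> 'c) measure" where
  "fdd M N \<xi> J = distr M (PiM J (\<lambda>_. N)) (\<lambda>\<omega>. \<lambda>k\<in>J. \<xi> k \<omega>)"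

definition strongly_stationary :: "'a measure \<Rightarrow> 'c measure \<Rightarrow> (int \<Rightarrow> 'a \<Rightarrow> 'c) \<Rightarrow> bool" where
  "strongly_stationary M N \<xi> \<longleftrightarrow>
     (\<forall>k. \<xi> k \<in> measurable M N) \<and>
     (\<forall>J h. finite J \<longrightarrow> fdd M N (\<lambda>k. \<xi> (k + h)) J = fdd M N \<xi> J)"

(* Weak convergence of finite measures as x tends to infinity. It is only used for finite products
   of Euclidean spaces with their Borel sets, where the test functions are measurable. *)
definition weak_conv_in :: "'c topology \<Rightarrow> (real \<Rightarrow> 'c measure) \<Rightarrow> 'c measure \<Rightarrow> bool" where
  "weak_conv_in T \<nu> \<nu>' \<longleftrightarrow>
     (\<forall>f. continuous_map T euclideanreal f \<and> bounded (f ` topspace T) \<longrightarrow>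
        ((\<lambda>x. \<integral>z. f z \<partial>\<nu> x) \<longlongrightarrow> (\<integral>z. f z \<partial>\<nu>')) at_top)"

definition fdd_conv ::
  "(real \<Rightarrow> 'a measure) \<Rightarrow> (real \<Rightarrow> 'i \<Rightarrow> 'a \<Rightarrow> 'c::topological_space)
    \<Rightarrow> 'b measure \<Rightarrow> ('i \<Rightarrow> 'b \<Rightarrow> 'c) \<Rightarrow> bool" where
  "fdd_conv M \<xi> P \<Upsilon> \<longleftrightarrow>
     (\<forall>J. finite J \<longrightarrow>
        weak_conv_in (product_topology (\<lambda>_. euclidean) J)
          (\<lambda>x. fdd (M x) borel (\<xi> x) J) (fdd P borel \<Upsilon> J))"

(* Vectors with coordinate set J are functions in "extensional J". Nonnegativity of N and N 0 = 0
   follow from the conditions below. *)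
definition norm_on :: "'i set \<Rightarrow> (('i \<Rightarrow> 'c::real_vector) \<Rightarrow> real) \<Rightarrow> bool" where
  "norm_on J N \<longleftrightarrow>
     (\<forall>x\<in>extensional J. N x = 0 \<longrightarrow> x = (\<lambda>k\<in>J. 0)) \<and>
     (\<forall>x\<in>extensional J. \<forall>c. N (\<lambda>k\<in>J. c *\<^sub>R x k) = \<bar>c\<bar> * N x) \<and>
     (\<forall>x\<in>extensional J. \<forall>y\<in>extensional J. N (\<lambda>k\<in>J. x k + y k) \<le> N x + N y)"

(* S is the law of the spectral vector Theta for the norm N. The measures in the limit relation
   are P(N V > u x, V / N V \<in> .) / P(N V > x). *)
definition regularly_varying_wrt ::
  "'a measure \<Rightarrow> 'i set \<Rightarrow> (('i \<Rightarrow> 'c::euclidean_space) \<Rightarrow> real) \<Rightarrow> ('a \<Rightarrow> 'i \<Rightarrow> 'c) \<Rightarrow> real \<Rightarrow> bool" where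
  "regularly_varying_wrt M J N V \<beta> \<longleftrightarrow>
     (\<exists>S. prob_space S \<and> sets S = sets (PiM J (\<lambda>_. borel)) \<and> (AE \<theta> in S. N \<theta> = 1) \<and>
        (\<forall>u>0. weak_conv_in (product_topology (\<lambda>_. euclidean) J)
           (\<lambda>x. scale_measure (ennreal (1 / measure M {\<omega> \<in> space M. N (V \<omega>) > x}))
                  (distr (restrict_space M {\<omega> \<in> space M. N (V \<omega>) > u * x}) (PiM J (\<lambda>_. borel))
                     (\<lambda>\<omega>. \<lambda>k\<in>J. V \<omega> k /\<^sub>R N (V \<omega>))))
           (scale_measure (ennreal (u powr (- \<beta>))) S)))"

(* The choice of the norm is immaterial for regular variation, so none is singled out:
   the defining property is required for every norm. *)
definition regularly_varying ::
  "'a measure \<Rightarrow> 'i set \<Rightarrow> ('a \<Rightarrow> 'i \<Rightarrow> 'c::euclidean_space) \<Rightarrow> real \<Rightarrow> bool" where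
  "regularly_varying M J V \<beta> \<longleftrightarrow>
     0 < \<beta> \<and> V \<in> measurable M (PiM J (\<lambda>_. borel)) \<and>
     (\<forall>N. norm_on J N \<longrightarrow> regularly_varying_wrt M J N V \<beta>)"

definition jointly_regularly_varying ::
  "'a measure \<Rightarrow> ('i \<Rightarrow> 'a \<Rightarrow> 'c::euclidean_space) \<Rightarrow> real \<Rightarrow> bool" where
  "jointly_regularly_varying M \<xi> \<beta> \<longleftrightarrow>
     (\<forall>J. finite J \<and> J \<noteq> {} \<longrightarrow> regularly_varying M J (\<lambda>\<omega>. \<lambda>k\<in>J. \<xi> k \<omega>) \<beta>)"

(* "infnorm" is the maximum norm on the plane; "uniform_measure" is conditioning on an event. *)
definition forward_tail_process ::
  "'a measure \<Rightarrow> (int \<Rightarrow> 'a \<Rightarrow> real \<times> real) \<Rightarrow> 'b measure \<Rightarrow> (nat \<Rightarrow> 'b \<Rightarrow> real \<times> real) \<Rightarrow> bool" where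
  "forward_tail_process M \<xi> P \<Upsilon> \<longleftrightarrow>
     prob_space P \<and> (\<forall>k. \<Upsilon> k \<in> borel_measurable P) \<and>
     fdd_conv (\<lambda>x. uniform_measure M {\<omega> \<in> space M. infnorm (\<xi> 0 \<omega>) > x})
       (\<lambda>x k \<omega>. \<xi> (int k) \<omega> /\<^sub>R x) P \<Upsilon>"

definition tail_process ::
  "'a measure \<Rightarrow> (int \<Rightarrow> 'a \<Rightarrow> real \<times> real) \<Rightarrow> 'b measure \<Rightarrow> (int \<Rightarrow> 'b \<Rightarrow> real \<times> real) \<Rightarrow> bool" where
  "tail_process M \<xi> P \<Upsilon> \<longleftrightarrow>
     prob_space P \<and> (\<forall>k. \<Upsilon> k \<in> borel_measurable P) \<and>
     fdd_conv (\<lambda>x. uniform_measure M {\<omega> \<in> space M. infnorm (\<xi> 0 \<omega>) > x})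
       (\<lambda>x k \<omega>. \<xi> k \<omega> /\<^sub>R x) P \<Upsilon>"

abbreviation normal_law :: "real \<Rightarrow> real measure" where
  "normal_law \<sigma> \<equiv> density lborel (\<lambda>z. ennreal (normal_density 0 \<sigma> z))"

(* The joint law of Y~ and the Z~_k, with sigma the standard deviation; the expectations over the
   auxiliary normal variable Z_0 are integrals against its law. *)
definition limit_variables ::
  "real \<Rightarrow> real \<Rightarrow> 'b measure \<Rightarrow> ('b \<Rightarrow> real) \<Rightarrow> (nat \<Rightarrow> 'b \<Rightarrow> real) \<Rightarrow> bool" where
  "limit_variables \<alpha> \<sigma> P Y Z \<longleftrightarrow>
     prob_space P \<and> Y \<in> borel_measurable P \<and> Z 0 \<in> borel_measurable P \<and>
     (\<forall>k\<ge>1. distributed P lborel (Z k) (normal_density 0 \<sigma>)) \<and>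
     prob_space.indep_vars P (\<lambda>_. borel) Z {1..} \<and>
     indep_elements P borel (\<lambda>\<omega>. (Y \<omega>, Z 0 \<omega>))
       (PiM {1..} (\<lambda>_. borel)) (\<lambda>\<omega>. \<lambda>k\<in>{1..}. Z k \<omega>) \<and>
     (\<forall>y v. measure P {\<omega> \<in> space P. Y \<omega> > y \<and> Z 0 \<omega> > v} =
        (\<integral>z. max y (1 / max 1 \<bar>z\<bar>) powr (- (2 * \<alpha> / 3)) * indicator {v<..} z \<partial>normal_law \<sigma>) /
        (\<integral>z. max 1 \<bar>z\<bar> powr (2 * \<alpha> / 3) \<partial>normal_law \<sigma>))"

end

theory Submission
  imports Defs
begin

text \<open>
The theorem rests on one limit: for a bounded functional $f$ of a finite window of the scaled process
$\xi / x$ that vanishes near the origin, the expectation of $f$, divided by the tail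
$H(x^{2/3})$ of the stationary law, converges to an explicit functional $\Lambda f$
(lemmas \<open>lipschitz_limit\<close>, \<open>continuous_limit\<close> and, for functionals cut off at an exceedance of a norm,
\<open>norm_exceedance_limit\<close>). Everything else is read off from $\Lambda$.

Where the limit comes from. The immigration $B$ has a regularly varying tail $T$ of index $-\alpha$.
The number of offspring of $m$ individuals is $\mu m$ up to a Gaussian error of order
$\sqrt m$, so the tail $H$ of the stationary law satisfies approximately
$H(x) = T(x) + H(x/\mu)$; the error is invisible because $\alpha < 2$. Hence $H/T \rightarrow 1/(1-\mu^\alpha)$ (\<open>R_tendsto\<close>) and $H$ is regularly
varying as well (\<open>H_rv\<close>). Given $X_0 > \delta s$, the scaled value $X_0/s$ converges to a
Pareto law, and by the central limit theorem the following path behaves like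
$X_k \approx \mu^k X_0$ with innovations $M_{k+1} \approx \sqrt{X_k}\,z_k$, the $z_k$ independent normal
(\<open>path_limit\<close>). With $s = x^{2/3}$ this makes $(X_k^{3/2}, X_k M_{k+1})/x$ converge to the
\<open>trail\<close> $(\mu^k q)^{3/2}(1, z_k)$. Paths that start below $\delta s$ can still exceed
through $X_0 M_1$. The offspring part of $M_1$ has variance $\sigma^2 X_0$, so its contribution is
bounded by the third moment of the stationary law truncated at level $\delta s$, which doubling bounds
by a multiple of $(\delta s)^3 H(\delta s)$ (\<open>truncated_third_moment\<close>) and which vanishes with $\delta$ relative
to $s^3 H(s)$; the immigration part is independent of $X_0$ and negligible (\<open>product_negligible\<close>).

From the first time of a window to all times. The above treats functionals that vanish when the
first coordinate of the window vanishes (\<open>anchored_limit\<close>). Writing a functional as a telescoping sum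
over the time at which its argument starts, and using stationarity to move every term to the first
time, gives all windows. The limit is the integral against the measure \<open>Xi\<close>, under which a trail starts
at an arbitrary integer time with $q$ distributed according to $\alpha q^{-\alpha-1}dq$, times
$1-\mu^\alpha$ (\<open>Lam_def\<close>, \<open>Xi_integral\<close>): each trail is one large immigration and its decay.

Consequences. The power scaling of $q$ gives $\Lambda$ the homogeneity of index $2\alpha/3$ (\<open>Lam_scale\<close>),
which is joint regular variation for every norm (\<open>xi_regularly_varying_wrt\<close>). Conditioning on an
exceedance of the norm at time $0$ gives the two-sided tail process as the law of a random trail
(\<open>tail_process_xi\<close>). For functionals of the times $k \ge 0$ only the trails started at time $0$
remain in $\Lambda$ (\<open>Lam_anchored\<close>), and conditioning such a trail on
$q^{3/2} \max(1, |z_0|) > 1$ yields the joint law of the limit variables (\<open>law_unfold_trail\<close>,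
\<open>measure_first_law\<close>), which is determined by the defining properties (\<open>limit_variables_law\<close>).
\<close>

section \<open>Generalities: expectations of mixtures, weak convergence, regularly varying tails\<close>

lemma expectation_bind_pmf:
  fixes f :: "'b \<Rightarrow> real"
  assumes f: "\<And>x. \<bar>f x\<bar> \<le> C"
  shows "measure_pmf.expectation (bind_pmf p k) f
    = measure_pmf.expectation p (\<lambda>x. measure_pmf.expectation (k x) f)"
proof -
  have C: "0 \<le> C" using order_trans[OF abs_ge_zero f] .
  have pos: "measure_pmf.expectation (bind_pmf p k) g
    = measure_pmf.expectation p (\<lambda>x. measure_pmf.expectation (k x) g)"
    if g: "\<And>x. 0 \<le> g x" "\<And>x. g x \<le> D" for g :: "'b \<Rightarrow> real" and D
  proof -
    have i: "integrable (measure_pmf q) g" for q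
      by (rule measure_pmf.integrable_const_bound[where B=D]) (use g in auto)
    have b: "measure_pmf.expectation q g \<in> {0..D}" for q
      using g by (auto intro!: measure_pmf.integral_le_const[OF i] integral_nonneg_AE)
    have "ennreal (measure_pmf.expectation (bind_pmf p k) g) = (\<integral>\<^sup>+x. g x \<partial>bind_pmf p k)"
      using g by (subst nn_integral_eq_integral[OF i]) auto
    also have "\<dots> = (\<integral>\<^sup>+x. ennreal (measure_pmf.expectation (k x) g) \<partial>p)"
      using g by (subst nn_integral_bind_pmf) (auto simp: nn_integral_eq_integral[OF i])
    also have "\<dots> = ennreal (measure_pmf.expectation p (\<lambda>x. measure_pmf.expectation (k x) g))"
      using b by (intro nn_integral_eq_integral measure_pmf.integrable_const_bound[where B=D]) auto
    finally show ?thesis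
      using b g by (subst (asm) ennreal_inj) (auto intro!: integral_nonneg_AE)
  qed
  have i: "integrable (measure_pmf q) f" for q
    by (rule measure_pmf.integrable_const_bound[where B=C]) (use f in auto)
  have ib: "integrable (measure_pmf p) (\<lambda>x. measure_pmf.expectation (k x) f)"
  proof (rule measure_pmf.integrable_const_bound[where B=C])
    show "AE x in measure_pmf p. norm (measure_pmf.expectation (k x) f) \<le> C"
      using f by (intro AE_I2 order_trans[OF integral_norm_bound] measure_pmf.integral_le_const) (auto intro: integrable_norm[OF i, simplified])
  qed simp
  have "measure_pmf.expectation (bind_pmf p k) (\<lambda>x. f x + C)
    = measure_pmf.expectation p (\<lambda>x. measure_pmf.expectation (k x) (\<lambda>x. f x + C))"
    using f C by (intro pos[where D="2*C"]) (auto simp: abs_le_iff algebra_simps; smt)+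
  then show ?thesis using i ib by simp
qed

text \<open>The extended continuous mapping theorem. By Skorohod representation the laws are realised as almost surely convergent variables, and dominated convergence applies to functions that converge along convergent sequences.\<close>

lemma weak_conv_extended_mapping:
  fixes \<mu> :: "nat \<Rightarrow> real measure" and g :: "nat \<Rightarrow> real \<Rightarrow> real"
  assumes \<mu>: "\<And>n. real_distribution (\<mu> n)" "real_distribution \<nu>" "weak_conv_m \<mu> \<nu>"
  and g: "\<And>n. g n \<in> borel_measurable borel" "h \<in> borel_measurable borel" "\<And>n x. \<bar>g n x\<bar> \<le> C"
  and conv: "AE y in \<nu>. \<forall>x. x \<longlonglongrightarrow> y \<longrightarrow> (\<lambda>n. g n (x n)) \<longlonglongrightarrow> h y"
  shows "(\<lambda>n. \<integral>x. g n x \<partial>\<mu> n) \<longlonglongrightarrow> (\<integral>x. h x \<partial>\<nu>)"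
proof -
  from Skorohod[OF \<mu>] obtain \<Omega> :: "real measure" and Y Z where
    \<Omega>: "prob_space \<Omega>" and Y[measurable]: "\<And>n. Y n \<in> measurable \<Omega> borel" and dY: "\<And>n. distr \<Omega> borel (Y n) = \<mu> n"
    and Z: "Z \<in> measurable \<Omega> lborel" and dZ: "distr \<Omega> borel Z = \<nu>"
    and lim: "\<And>x. x \<in> space \<Omega> \<Longrightarrow> (\<lambda>n. Y n x) \<longlonglongrightarrow> Z x" by blast
  interpret prob_space \<Omega> by fact
  have Z'[measurable]: "Z \<in> borel_measurable \<Omega>" using Z by simp
  note g(1,2)[measurable]
  have "AE x in \<Omega>. \<forall>X. X \<longlonglongrightarrow> Z x \<longrightarrow> (\<lambda>n. g n (X n)) \<longlonglongrightarrow> h (Z x)"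
    using conv AE_distrD[OF Z'] unfolding dZ[symmetric] by blast
  then have "AE x in \<Omega>. (\<lambda>n. g n (Y n x)) \<longlonglongrightarrow> h (Z x)"
    by (rule AE_mp) (use lim in \<open>auto intro!: AE_I2\<close>)
  then have "(\<lambda>n. \<integral>x. g n (Y n x) \<partial>\<Omega>) \<longlonglongrightarrow> (\<integral>x. h (Z x) \<partial>\<Omega>)"
    by (intro integral_dominated_convergence[where w="\<lambda>_. C"]) (use g(3) in auto)
  then show ?thesis
    unfolding dY[symmetric] dZ[symmetric] by (simp add: integral_distr)
qed

text \<open>Every point from $x_0$ on is a power of $2$ times a point of $[x_0, 2 x_0]$, so one doubling step suffices. This is how regular variation is turned into global bounds below.\<close>

lemma doubling_bound:
  fixes h :: "real \<Rightarrow> real"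
  assumes "0 < x0" and "\<And>x. x0 \<le> x \<Longrightarrow> x \<le> 2 * x0 \<Longrightarrow> h x \<le> D"
    and "\<And>x. x0 \<le> x \<Longrightarrow> h x \<le> D \<Longrightarrow> h (2 * x) \<le> D" and "x0 \<le> x"
  shows "h x \<le> D"
proof -
  have *: "\<forall>x. x0 \<le> x \<longrightarrow> x \<le> 2 ^ Suc n * x0 \<longrightarrow> h x \<le> D" for n
  proof (induction n)
    case (Suc n)
    show ?case
    proof (intro allI impI)
      fix x assume x: "x0 \<le> x" "x \<le> 2 ^ Suc (Suc n) * x0"
      show "h x \<le> D"
      proof (cases "x \<le> 2 * x0")
        case False
        then have "x0 \<le> x / 2" "x / 2 \<le> 2 ^ Suc n * x0" using x by auto
        then show ?thesis using Suc assms(3)[of "x/2"] by simp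
      qed (use assms x in auto)
    qed
  qed (use assms in auto)
  obtain n where "x / x0 < 2 ^ n" using real_arch_pow[of 2 "x/x0"] by auto
  then have "x \<le> 2 ^ Suc n * x0" using \<open>0 < x0\<close> \<open>x0 \<le> x\<close> by (auto simp: field_simps)
  then show ?thesis using * \<open>x0 \<le> x\<close> by blast
qed

definition rv_tail :: "(real \<Rightarrow> real) \<Rightarrow> real \<Rightarrow> bool" where
  "rv_tail T \<alpha> \<longleftrightarrow> antimono T \<and> (\<forall>x. 0 < T x) \<and>
     (\<forall>q>0. ((\<lambda>x. T (q * x) / T x) \<longlongrightarrow> q powr (- \<alpha>)) at_top)"

lemma eventually_at_top_ge_one:
  fixes P :: "real \<Rightarrow> bool"
  assumes "eventually P at_top"
  shows "\<exists>x0\<ge>1. \<forall>x\<ge>x0. P x"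
  using assms unfolding eventually_at_top_linorder by (meson max.boundedE max.cobounded1)

text \<open>Half of the Potter bounds: the ratio at $2$ is eventually below $2^{-\gamma}$, and monotonicity interpolates between powers of $2$.\<close>

lemma rv_tail_upper:
  assumes T: "rv_tail T \<alpha>" and \<gamma>: "\<gamma> < \<alpha>" "0 < \<gamma>"
  shows "\<exists>C>0. \<forall>\<^sub>F x in at_top. T x \<le> C * x powr (- \<gamma>)"
proof -
  have pos: "\<And>x. 0 < T x" and anti: "antimono T" using T by (auto simp: rv_tail_def)
  have "((\<lambda>x. T (2 * x) / T x * 2 powr \<gamma>) \<longlongrightarrow> 2 powr (- \<alpha>) * 2 powr \<gamma>) at_top"
    using T by (intro tendsto_intros) (auto simp: rv_tail_def)
  moreover have "2 powr (- \<alpha>) * 2 powr \<gamma> < (1::real)"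
    using \<gamma> by (simp add: powr_add[symmetric] powr_less_one)
  ultimately have "\<forall>\<^sub>F x in at_top. T (2 * x) / T x * 2 powr \<gamma> < 1" by (rule order_tendstoD)
  from eventually_at_top_ge_one[OF this] obtain x0
    where x0: "1 \<le> x0" "\<And>x. x0 \<le> x \<Longrightarrow> T (2 * x) / T x * 2 powr \<gamma> < 1"
    by blast
  define D where "D = T x0 * (2 * x0) powr \<gamma>"
  have D: "D > 0" using pos x0 by (simp add: D_def)
  have "T x * x powr \<gamma> \<le> D" if "x0 \<le> x" for x
  proof (rule doubling_bound[where h="\<lambda>x. T x * x powr \<gamma>", OF _ _ _ that])
    fix x assume "x0 \<le> x" "x \<le> 2 * x0"
    then show "T x * x powr \<gamma> \<le> D" unfolding D_def
      using anti x0 \<gamma> less_imp_le[OF pos] by (intro mult_mono powr_mono2) (auto simp: antimono_def)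
  next
    fix x assume x: "x0 \<le> x" "T x * x powr \<gamma> \<le> D"
    have "T (2 * x) * (2 * x) powr \<gamma> = (T (2 * x) / T x * 2 powr \<gamma>) * (T x * x powr \<gamma>)"
      using pos[of x] x x0 by (simp add: powr_mult)
    also have "\<dots> \<le> 1 * (T x * x powr \<gamma>)"
      using x0(2)[OF x(1)] pos[of x] by (intro mult_right_mono) auto
    finally show "T (2 * x) * (2 * x) powr \<gamma> \<le> D" using x by simp
  qed (use x0 in simp)
  then have "T x \<le> D * x powr (- \<gamma>)" if "x0 \<le> x" for x
    using that x0 by (simp add: powr_minus field_simps)
  then show ?thesis using D unfolding eventually_at_top_linorder by blast
qed

text \<open>The other half of the Potter bounds.\<close>

lemma rv_tail_lower:
  assumes T: "rv_tail T \<alpha>" and \<gamma>: "\<alpha> < \<gamma>" "0 < \<gamma>"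
  shows "\<exists>c>0. \<forall>\<^sub>F x in at_top. c * x powr (- \<gamma>) \<le> T x"
proof -
  have pos: "\<And>x. 0 < T x" and anti: "antimono T" using T by (auto simp: rv_tail_def)
  have "((\<lambda>x. T (2 * x) / T x * 2 powr \<gamma>) \<longlongrightarrow> 2 powr (- \<alpha>) * 2 powr \<gamma>) at_top"
    using T by (intro tendsto_intros) (auto simp: rv_tail_def)
  moreover have "2 powr (- \<alpha>) * 2 powr \<gamma> > (1::real)"
    using \<gamma> by (simp add: powr_add[symmetric])
  ultimately have "\<forall>\<^sub>F x in at_top. T (2 * x) / T x * 2 powr \<gamma> > 1" by (rule order_tendstoD)
  from eventually_at_top_ge_one[OF this] obtain x0
    where x0: "1 \<le> x0" "\<And>x. x0 \<le> x \<Longrightarrow> T (2 * x) / T x * 2 powr \<gamma> > 1"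
    by blast
  define D where "D = 1 / (T (2 * x0) * x0 powr \<gamma>)"
  have D: "D > 0" using pos x0 by (simp add: D_def)
  have *: "1 / (T x * x powr \<gamma>) \<le> D" if "x0 \<le> x" for x
  proof (rule doubling_bound[where h="\<lambda>x. 1 / (T x * x powr \<gamma>)", OF _ _ _ that])
    fix x assume "x0 \<le> x" "x \<le> 2 * x0"
    then show "1 / (T x * x powr \<gamma>) \<le> D" unfolding D_def
      using anti x0 \<gamma> less_imp_le[OF pos] pos 
      by (intro divide_left_mono mult_mono powr_mono2 mult_pos_pos) (auto simp: antimono_def)
  next
    fix x assume x: "x0 \<le> x" "1 / (T x * x powr \<gamma>) \<le> D"
    have "T (2 * x) * (2 * x) powr \<gamma> = (T (2 * x) / T x * 2 powr \<gamma>) * (T x * x powr \<gamma>)"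
      using pos[of x] x x0 by (simp add: powr_mult)
    moreover have "\<dots> \<ge> 1 * (T x * x powr \<gamma>)"
      using x0(2)[OF x(1)] pos[of x] by (intro mult_right_mono) auto
    ultimately have "1 / (T (2 * x) * (2 * x) powr \<gamma>) \<le> 1 / (T x * x powr \<gamma>)"
      using pos[of x] x x0 by (intro divide_left_mono) (auto intro!: mult_pos_pos pos)
    then show "1 / (T (2 * x) * (2 * x) powr \<gamma>) \<le> D" using x by simp
  qed (use x0 in simp)
  have "1 / D * x powr (- \<gamma>) \<le> T x" if "x0 \<le> x" for x
  proof -
    have "0 < T x * x powr \<gamma>" "1 / (T x * x powr \<gamma>) \<le> D"
      using *[OF that] that x0 pos[of x] by auto
    then have "1 \<le> D * (T x * x powr \<gamma>)" by (simp add: divide_le_eq)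
    then show ?thesis using that x0 D by (simp add: powr_minus field_simps)
  qed
  moreover have "1 / D > 0" using D by simp
  ultimately show ?thesis unfolding eventually_at_top_linorder by blast
qed

section \<open>The stationary branching law and the tail of one generation\<close>

definition tail :: "nat pmf \<Rightarrow> real \<Rightarrow> real" where
  "tail p x = measure_pmf.prob p {l. x < real l}"

lemma tail_antimono: "antimono (tail p)"
  unfolding tail_def antimono_def by (auto intro!: measure_pmf.finite_measure_mono)

lemma tail_nonneg: "0 \<le> tail p x" and tail_le_1: "tail p x \<le> 1"
  by (auto simp: tail_def)

lemma tail_mono: "x \<le> y \<Longrightarrow> tail p y \<le> tail p x"
  using tail_antimono by (auto simp: antimono_def)

lemma tail_tendsto_0: "(tail p \<longlongrightarrow> 0) at_top"
proof -
  have "(\<lambda>n. measure_pmf.prob p {l. n < l}) \<longlonglongrightarrow> measure_pmf.prob p (\<Inter>n. {l. n < l})"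
    by (rule measure_pmf.finite_Lim_measure_decseq) (auto simp: decseq_def)
  moreover have "(\<Inter>n. {l::nat. n < l}) = {}" by auto
  ultimately have lim: "(\<lambda>n. tail p (real n)) \<longlonglongrightarrow> 0" by (simp add: tail_def)
  show ?thesis
  proof (rule order_tendstoI)
    fix a :: real assume "0 < a"
    then have "\<forall>\<^sub>F n in sequentially. tail p (real n) < a" using lim by (auto dest: order_tendstoD)
    then obtain N where "tail p (real N) < a" by (auto simp: eventually_sequentially)
    then have "tail p x < a" if "real N \<le> x" for x
      using tail_mono[OF that, of p] by simp
    then show "\<forall>\<^sub>F x in at_top. tail p x < a" by (auto simp: eventually_at_top_linorder)
  next
    fix a :: real assume "a < 0"
    then have "a < tail p x" for x using tail_nonneg[of p x] by simp
    then show "\<forall>\<^sub>F x in at_top. a < tail p x" by simp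
  qed
qed

lemma prob_pair_pmf_Times:
  fixes p :: "'a::countable pmf" and q :: "'b::countable pmf"
  shows "measure_pmf.prob (pair_pmf p q) (A \<times> B) = measure_pmf.prob p A * measure_pmf.prob q B"
  by (rule measure_pmf_prob_product) (rule countableI_type)+

lemma prob_bind_pmf:
  "measure_pmf.prob (bind_pmf p k) A = measure_pmf.expectation p (\<lambda>x. measure_pmf.prob (k x) A)"
  using expectation_bind_pmf[of "indicator A :: _ \<Rightarrow> real" 1 p k] by (auto simp: indicator_def)

text \<open>Iterating the inequality, the a priori bound enters with a factor $\theta^n$ and disappears in the limit.\<close>

lemma contraction_iterate:
  fixes r :: "real \<Rightarrow> real"
  assumes q: "1 \<le> q" and \<theta>: "0 \<le> \<theta>" "\<theta> < 1" and x0: "0 < x0"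
    and step: "\<And>x. x0 \<le> x \<Longrightarrow> r x \<le> \<theta> * r (q * x) + \<kappa>"
    and bdd: "\<And>x. x0 \<le> x \<Longrightarrow> r x \<le> C" and x: "x0 \<le> x"
  shows "r x \<le> \<kappa> / (1 - \<theta>)"
proof -
  define L where "L = \<kappa> / (1 - \<theta>)"
  have L: "L = \<theta> * L + \<kappa>" using \<theta> by (simp add: L_def field_simps)
  have "\<forall>x\<ge>x0. r x - L \<le> \<theta> ^ n * (C - L)" for n
  proof (induction n)
    case (Suc n)
    show ?case
    proof (intro allI impI)
      fix x assume x: "x0 \<le> x"
      have "1 * x \<le> q * x" using q x x0 by (intro mult_right_mono) auto
      then have "r (q * x) - L \<le> \<theta> ^ n * (C - L)" using Suc x by auto
      then have "\<theta> * (r (q * x) - L) \<le> \<theta> * (\<theta> ^ n * (C - L))" using \<theta> by (intro mult_left_mono)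
      then show "r x - L \<le> \<theta> ^ Suc n * (C - L)" using step[OF x] L by (simp add: algebra_simps)
    qed
  qed (use bdd in auto)
  moreover have "(\<lambda>n. \<theta> ^ n * (C - L)) \<longlonglongrightarrow> 0"
    using \<theta> by (intro tendsto_mult_left_zero LIMSEQ_realpow_zero)
  ultimately have "r x - L \<le> 0" using x by (intro LIMSEQ_le_const) auto
  then show ?thesis by (simp add: L_def)
qed

text \<open>The one-dimensional laws that govern the chain: offspring of $m$ individuals, immigration and stationary law. The offspring law enters only through its first two moments and the central limit theorem, so that the analysis is separated from the construction of the process.\<close>

locale branching =
  fixes S :: "nat \<Rightarrow> nat pmf" and Bp \<pi> :: "nat pmf" and \<mu> \<sigma> \<alpha> \<mu>B :: real
  assumes mu: "0 < \<mu>" "\<mu> < 1" and sig: "0 < \<sigma>" and al: "1 < \<alpha>" "\<alpha> < 2"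
    and S_int: "\<And>m. integrable (S m) (\<lambda>l. (real l - \<mu> * real m)\<^sup>2)"
    and S_mean: "\<And>m. measure_pmf.expectation (S m) real = \<mu> * real m"
    and S_var: "\<And>m. measure_pmf.expectation (S m) (\<lambda>l. (real l - \<mu> * real m)\<^sup>2) = \<sigma>\<^sup>2 * real m"
    and S_clt: "weak_conv_m (\<lambda>m. distr (S m) borel (\<lambda>l. (real l - \<mu> * real m) / sqrt (real m))) (normal_law \<sigma>)"
    and B_rv: "regularly_varying_rv (measure_pmf Bp) real \<alpha>"
    and stationary: "bind_pmf \<pi> (\<lambda>m. map_pmf (\<lambda>(s, b). s + b) (pair_pmf (S m) Bp)) = \<pi>"
begin

abbreviation "T \<equiv> tail Bp"
abbreviation "H \<equiv> tail \<pi>"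

definition K :: "nat \<Rightarrow> nat pmf" where
  "K m = map_pmf (\<lambda>(s, b). s + b) (pair_pmf (S m) Bp)"

text \<open>Joint law of a generation and its number of offspring, before immigration.\<close>

definition MS :: "(nat \<times> nat) pmf" where
  "MS = bind_pmf \<pi> (\<lambda>m. map_pmf (Pair m) (S m))"

lemma stationary_MS: "\<pi> = map_pmf (\<lambda>((m, s), b). s + b) (pair_pmf MS Bp)"
proof -
  have "map_pmf (\<lambda>((m, s), b). s + b) (pair_pmf MS Bp)
      = bind_pmf \<pi> (\<lambda>m. map_pmf (\<lambda>(s, b). s + b) (pair_pmf (S m) Bp))"
    by (simp add: MS_def pair_pmf_def map_pmf_def bind_assoc_pmf bind_return_pmf)
  then show ?thesis by (simp only: stationary)
qed

lemma MS_fst: "map_pmf fst MS = \<pi>"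
  by (simp add: MS_def map_bind_pmf pmf.map_comp o_def map_pmf_const bind_return_pmf')

lemma T_rv: "rv_tail T \<alpha>"
proof -
  have lim: "((\<lambda>x. T (q * x) / T x) \<longlongrightarrow> q powr (- \<alpha>)) at_top" if "0 < q" for q
    using B_rv that by (auto simp: regularly_varying_rv_def tail_def)
  have "\<forall>\<^sub>F x in at_top. T (1 * x) / T x > 0"
    using lim[of 1] by (intro order_tendstoD[OF lim[of 1]]) auto
  then have ev: "\<forall>\<^sub>F x in at_top. T x > 0"
    using tail_nonneg[of Bp] by (auto elim!: eventually_mono simp: less_le)
  have "0 < T x" for x
  proof -
    have "\<forall>\<^sub>F y in at_top. T y > 0 \<and> x \<le> y" using ev eventually_ge_at_top by (rule eventually_conj)
    from eventually_happens'[OF trivial_limit_at_top_linorder this]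
    obtain y where "T y > 0" "x \<le> y" by blast
    then show ?thesis using tail_mono[of x y Bp] by simp
  qed
  then show ?thesis using lim tail_antimono by (auto simp: rv_tail_def)
qed

lemma T_pos: "0 < T x" and T_ratio: "0 < q \<Longrightarrow> ((\<lambda>x. T (q * x) / T x) \<longlongrightarrow> q powr (- \<alpha>)) at_top"
  using T_rv by (auto simp: rv_tail_def)

lemma B_integrable: "integrable (measure_pmf Bp) real"
proof -
  obtain C where C: "C > 0" "\<forall>\<^sub>F x in at_top. T x \<le> C * x powr (- ((1 + \<alpha>) / 2))"
    using rv_tail_upper[OF T_rv, of "(1 + \<alpha>) / 2"] al by auto
  have "summable (\<lambda>n. C * real n powr (- ((1 + \<alpha>) / 2)))"
    using al by (intro summable_mult) (simp add: summable_real_powr_iff)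
  moreover have "\<forall>\<^sub>F n in sequentially. norm (T (real n)) \<le> C * real n powr (- ((1 + \<alpha>) / 2))"
    using eventually_compose_filterlim[OF C(2) filterlim_real_sequentially] by (simp add: tail_nonneg)
  ultimately have "summable (\<lambda>n. T (real n))"
    by (rule summable_comparison_test_ev[rotated])
  then have "(\<Sum>n. ennreal (T (real n))) \<noteq> \<infinity>"
    using tail_nonneg by (subst suminf_ennreal2) auto
  then have "(\<integral>\<^sup>+x. of_nat x \<partial>measure_pmf Bp) < \<infinity>"
    by (subst nn_integral_nat_function)
      (auto simp: tail_def measure_pmf.emeasure_eq_measure top.not_eq_extremum)
  then show ?thesis
    by (intro integrableI_nonneg) (auto simp: ennreal_of_nat_eq_real_of_nat)
qed

lemma B_integrable_snd: "integrable (pair_pmf p Bp) (\<lambda>z. real (snd z))"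
proof -
  have "integrable (measure_pmf (map_pmf snd (pair_pmf p Bp))) real"
    using B_integrable by (simp only: map_snd_pair_pmf)
  then show ?thesis by (simp add: integrable_map_pmf_eq)
qed

lemma S_integrable: "integrable (S m) real"
proof -
  have "integrable (S m) (\<lambda>l. real l - \<mu> * real m)"
    by (rule measure_pmf.square_integrable_imp_integrable) (use S_int in auto)
  then have "integrable (S m) (\<lambda>l. (real l - \<mu> * real m) + \<mu> * real m)"
    by (intro Bochner_Integration.integrable_add) auto
  then show ?thesis by simp
qed

lemma S_chebyshev:
  assumes "0 < a"
  shows "measure_pmf.prob (S m) {l. a \<le> \<bar>real l - \<mu> * real m\<bar>} \<le> \<sigma>\<^sup>2 * real m / a\<^sup>2"
proof -
  have e: "measure_pmf.expectation (S m) (\<lambda>l. real l - \<mu> * real m) = 0"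
    using S_integrable by (simp add: S_mean)
  show ?thesis
    using measure_pmf.Chebyshev_inequality[of "\<lambda>l. real l - \<mu> * real m" "S m" a] S_int assms
    by (simp add: e S_var)
qed

text \<open>Stationarity bounds the truncated mean by $\mu$ times itself plus the mean of the immigration, uniformly in the level; monotone convergence then gives integrability.\<close>

lemma X_truncated_mean:
  "(1 - \<mu>) * measure_pmf.expectation \<pi> (\<lambda>l. real l * indicator {..k} l) \<le> measure_pmf.expectation Bp real"
proof -
  let ?E = "measure_pmf.expectation"
  let ?f = "\<lambda>l::nat. min (real l) (real k)"
  have bf: "\<bar>?f l\<bar> \<le> real k" for l by auto
  have i: "integrable (measure_pmf p) (\<lambda>x. min (real (g x)) (real k))" for g :: "'b \<Rightarrow> nat" and p
    by (rule measure_pmf.integrable_const_bound[where B="real k"]) auto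
  have ii: "integrable (measure_pmf p) (\<lambda>l. real l * indicator {..k} l)" for p
    by (rule measure_pmf.integrable_const_bound[where B="real k"]) (auto simp: indicator_def)
  have iii: "integrable (measure_pmf p) (indicator A :: nat \<Rightarrow> real)" for A p
    by (rule measure_pmf.integrable_const_bound[where B=1]) (auto simp: indicator_def)
  have split: "?f l = real l * indicator {..k} l + real k * indicator {k<..} l" for l
    by (auto simp: indicator_def)
  have "?E \<pi> ?f = ?E (pair_pmf MS Bp) (\<lambda>z. ?f (snd (fst z) + snd z))"
    by (subst stationary_MS) (simp add: case_prod_unfold)
  also have "\<dots> \<le> ?E (pair_pmf MS Bp) (\<lambda>z. ?f (snd (fst z)) + real (snd z))"
    by (rule integral_mono[OF i Bochner_Integration.integrable_add[OF i B_integrable_snd]]) auto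
  also have "\<dots> = ?E (pair_pmf MS Bp) (\<lambda>z. ?f (snd (fst z))) + ?E (pair_pmf MS Bp) (\<lambda>z. real (snd z))"
    by (rule Bochner_Integration.integral_add[OF i B_integrable_snd])
  also have "?E (pair_pmf MS Bp) (\<lambda>z. ?f (snd (fst z))) = ?E MS (\<lambda>z. ?f (snd z))"
    by (rule expectation_pair_pmf_fst)
  also have "\<dots> = ?E \<pi> (\<lambda>m. ?E (S m) ?f)"
    unfolding MS_def by (subst expectation_bind_pmf[where C="real k"]) auto
  also have "\<dots> \<le> ?E \<pi> (\<lambda>m. \<mu> * (real m * indicator {..k} m) + real k * indicator {k<..} m)"
  proof (rule integral_mono)
    have E: "?E (S m) ?f \<le> min (\<mu> * real m) (real k)" for m
    proof -
      have "?E (S m) ?f \<le> ?E (S m) real" by (rule integral_mono[OF i S_integrable]) auto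
      moreover have "?E (S m) ?f \<le> real k" by (rule measure_pmf.integral_le_const[OF i]) auto
      ultimately show ?thesis by (simp add: S_mean)
    qed
    show "?E (S m) ?f \<le> \<mu> * (real m * indicator {..k} m) + real k * indicator {k<..} m" for m
      using E[of m] by (auto simp: indicator_def)
    have "0 \<le> ?E (S m) ?f" for m by (auto intro!: integral_nonneg_AE)
    then show "integrable \<pi> (\<lambda>m. ?E (S m) ?f)"
      using E by (intro measure_pmf.integrable_const_bound[where B="real k"]) (auto)
  qed (use ii iii in auto)
  also have "\<dots> = \<mu> * ?E \<pi> (\<lambda>l. real l * indicator {..k} l) + real k * ?E \<pi> (indicator {k<..})"
    using ii iii by (subst Bochner_Integration.integral_add) auto
  finally have "?E \<pi> ?f \<le> \<mu> * ?E \<pi> (\<lambda>l. real l * indicator {..k} l) + real k * ?E \<pi> (indicator {k<..}) + ?E Bp real"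
    by (simp add: expectation_pair_pmf_snd[where f=real])
  moreover have "?E \<pi> ?f = ?E \<pi> (\<lambda>l. real l * indicator {..k} l) + real k * ?E \<pi> (indicator {k<..})"
    unfolding split using ii iii by (subst Bochner_Integration.integral_add) auto
  ultimately show ?thesis by (simp add: algebra_simps)
qed

lemma X_integrable: "integrable (measure_pmf \<pi>) real"
proof -
  define C where "C = measure_pmf.expectation Bp real / (1 - \<mu>)"
  have ii: "integrable (measure_pmf p) (\<lambda>l. real l * indicator {..k} l)" for p k
    by (rule measure_pmf.integrable_const_bound[where B="real k"]) (auto simp: indicator_def)
  have "(\<integral>\<^sup>+l. ennreal (real l) \<partial>\<pi>) = (\<integral>\<^sup>+l. (SUP k. ennreal (real l * indicator {..k} l)) \<partial>\<pi>)"
  proof (intro nn_integral_cong antisym)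
    fix l show "ennreal (real l) \<le> (SUP k. ennreal (real l * indicator {..k} l))"
      by (rule SUP_upper2[of l]) auto
  qed (auto intro!: SUP_least ennreal_leI simp: indicator_def)
  also have "\<dots> = (SUP k. \<integral>\<^sup>+l. ennreal (real l * indicator {..k} l) \<partial>\<pi>)"
    by (rule nn_integral_monotone_convergence_SUP)
      (auto simp: incseq_def le_fun_def indicator_def intro!: ennreal_leI)
  also have "\<dots> \<le> ennreal C"
  proof (rule SUP_least)
    fix k
    have "measure_pmf.expectation \<pi> (\<lambda>l. real l * indicator {..k} l) \<le> C"
      using X_truncated_mean[of k] mu by (simp add: C_def field_simps)
    then show "(\<integral>\<^sup>+l. ennreal (real l * indicator {..k} l) \<partial>\<pi>) \<le> ennreal C"
      using ii by (subst nn_integral_eq_integral) (auto intro: ennreal_leI)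
  qed
  finally show ?thesis
    by (intro integrableI_nonneg) (auto simp: less_top[symmetric] top_unique)
qed

definition V where "V = \<sigma>\<^sup>2 * measure_pmf.expectation \<pi> real"

lemma prob_MS: "measure_pmf.prob MS A = measure_pmf.expectation \<pi> (\<lambda>m. measure_pmf.prob (S m) {s. (m, s) \<in> A})"
  by (simp add: MS_def prob_bind_pmf vimage_def)

lemma prob_MS_le:
  assumes "\<And>m. measure_pmf.prob (S m) {s. (m, s) \<in> A} \<le> c * real m"
  shows "measure_pmf.prob MS A \<le> c * measure_pmf.expectation \<pi> real"
proof -
  have "measure_pmf.prob MS A \<le> measure_pmf.expectation \<pi> (\<lambda>m. c * real m)"
    unfolding prob_MS
  proof (rule integral_mono)
    show "integrable (measure_pmf \<pi>) (\<lambda>m. measure_pmf.prob (S m) {s. (m, s) \<in> A})"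
      by (rule measure_pmf.integrable_const_bound[where B=1]) auto
  qed (use assms X_integrable in auto)
  then show ?thesis using X_integrable by simp
qed

text \<open>A large number of offspring needs a large parent generation, unless the offspring number deviates from its mean, which Chebyshev makes an event of probability $O(x^{-2})$.\<close>

lemma offspring_upper:
  assumes x: "0 < x" and c: "0 < c" "\<mu> * q + c \<le> e"
  shows "measure_pmf.prob MS {z. e * x < real (snd z)} \<le> H (q * x) + V / (c * x)\<^sup>2"
proof -
  let ?A = "{z. real (fst z) \<le> q * x \<and> e * x < real (snd z)}"
  have "measure_pmf.prob MS {z. e * x < real (snd z)}
      \<le> measure_pmf.prob MS ({z. q * x < real (fst z)} \<union> ?A)"
    by (intro measure_pmf.finite_measure_mono) auto
  also have "\<dots> \<le> measure_pmf.prob MS {z. q * x < real (fst z)} + measure_pmf.prob MS ?A"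
    by (rule measure_Un_le) auto
  also have "measure_pmf.prob MS {z. q * x < real (fst z)} = H (q * x)"
    by (subst MS_fst[symmetric]) (simp add: tail_def vimage_def)
  also have "measure_pmf.prob MS ?A \<le> (\<sigma>\<^sup>2 / (c * x)\<^sup>2) * measure_pmf.expectation \<pi> real"
  proof (rule prob_MS_le)
    fix m
    show "measure_pmf.prob (S m) {s. (m, s) \<in> ?A} \<le> (\<sigma>\<^sup>2 / (c * x)\<^sup>2) * real m"
    proof (cases "real m \<le> q * x")
      case True
      have "c * x \<le> \<bar>real s - \<mu> * real m\<bar>" if "e * x < real s" for s
      proof -
        have "\<mu> * real m \<le> \<mu> * (q * x)" using True mu by (intro mult_left_mono) auto
        moreover have "(\<mu> * q + c) * x \<le> e * x" using c x by (intro mult_right_mono) auto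
        ultimately show ?thesis using that by (simp add: algebra_simps)
      qed
      then have "measure_pmf.prob (S m) {s. (m, s) \<in> ?A}
          \<le> measure_pmf.prob (S m) {l. c * x \<le> \<bar>real l - \<mu> * real m\<bar>}"
        by (intro measure_pmf.finite_measure_mono) auto
      also have "\<dots> \<le> \<sigma>\<^sup>2 * real m / (c * x)\<^sup>2" using c x by (intro S_chebyshev) auto
      finally show ?thesis by simp
    qed simp
  qed
  finally show ?thesis by (simp add: V_def)
qed

lemma tail_split:
  "H x = measure_pmf.prob (pair_pmf MS Bp) {z. x < real (snd (fst z)) + real (snd z)}"
  by (subst stationary_MS) (simp add: tail_def vimage_def case_prod_unfold)

lemma prob_MS_B: "measure_pmf.prob (pair_pmf MS Bp) {z. P (fst z) \<and> Q (snd z)}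
    = measure_pmf.prob MS {z. P z} * measure_pmf.prob Bp {b. Q b}"
proof -
  have "{z. P (fst z) \<and> Q (snd z)} = {z. P z} \<times> {b. Q b}" by auto
  then show ?thesis by (simp only: prob_pair_pmf_Times)
qed

lemma prob_MS_B1: "measure_pmf.prob (pair_pmf MS Bp) {z. P (fst z)} = measure_pmf.prob MS {z. P z}"
  and prob_MS_B2: "measure_pmf.prob (pair_pmf MS Bp) {z. Q (snd z)} = measure_pmf.prob Bp {b. Q b}"
  using prob_MS_B[of P "\<lambda>_. True"] prob_MS_B[of "\<lambda>_. True" Q] by simp_all

text \<open>Here $\alpha < 2$ enters: fluctuations of finite variance are invisible at the scale of the tail.\<close>

lemma inverse_square_negligible: "((\<lambda>x. (c / x\<^sup>2) / T x) \<longlongrightarrow> 0) at_top"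
proof -
  obtain C where C: "C > 0" "\<forall>\<^sub>F x in at_top. C * x powr (- ((\<alpha> + 2) / 2)) \<le> T x"
    using rv_tail_lower[OF T_rv, of "(\<alpha> + 2) / 2"] al by auto
  have "((\<lambda>x::real. x powr (- ((2 - \<alpha>) / 2))) \<longlongrightarrow> 0) at_top"
    using al by (intro tendsto_neg_powr filterlim_ident) auto
  then have lim: "((\<lambda>x. \<bar>c\<bar> / C * x powr (- ((2 - \<alpha>) / 2))) \<longlongrightarrow> \<bar>c\<bar> / C * 0) at_top"
    by (intro tendsto_intros)
  have "\<forall>\<^sub>F x in at_top. norm ((c / x\<^sup>2) / T x) \<le> \<bar>c\<bar> / C * x powr (- ((2 - \<alpha>) / 2))"
    using C(2) eventually_gt_at_top[of 0]
  proof eventually_elim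
    case (elim x)
    have "norm ((c / x\<^sup>2) / T x) = \<bar>c\<bar> / x\<^sup>2 / T x" using elim T_pos[of x] by (simp add: abs_mult)
    also have "\<dots> \<le> \<bar>c\<bar> / x\<^sup>2 / (C * x powr (- ((\<alpha> + 2) / 2)))"
      using elim C T_pos[of x] by (intro divide_left_mono) auto
    also have "\<dots> = \<bar>c\<bar> / C * (x powr (- 2) / x powr (- ((\<alpha> + 2) / 2)))"
      using elim by (simp add: powr_minus field_simps)
    also have "x powr (- 2) / x powr (- ((\<alpha> + 2) / 2)) = x powr (- ((2 - \<alpha>) / 2))"
    proof -
      have "- 2 - - ((\<alpha> + 2) / 2) = - ((2 - \<alpha>) / 2)" by (simp add: field_simps)
      then show ?thesis by (simp only: powr_diff[symmetric])
    qed
    finally show ?case .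
  qed
  from Lim_null_comparison[OF this] lim show ?thesis by simp
qed

end

section \<open>The stationary law inherits the tail of the immigration\<close>

context branching begin

lemma mu_powr_less_1: "\<mu> powr \<alpha> < 1"
  using powr_less_mono2[of \<alpha> \<mu> 1] mu al by simp

lemma T_scale_eventually: 
  assumes "0 < q" "q powr (- \<alpha>) < \<theta>"
  shows "\<forall>\<^sub>F x in at_top. T (q * x) \<le> \<theta> * T x"
proof -
  have "\<forall>\<^sub>F x in at_top. T (q * x) / T x < \<theta>"
    using T_ratio[OF assms(1)] assms(2) by (rule order_tendstoD)
  then show ?thesis by eventually_elim (use T_pos in \<open>auto simp: field_simps intro: less_imp_le\<close>)
qed

text \<open>An a priori bound, needed to make the ratio $H/T$ bounded before its limit is identified.\<close>

lemma X_tail_le: "\<exists>C>0. \<forall>\<^sub>F x in at_top. H x \<le> C * T x"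
proof -
  define r where "r = (1 - \<mu>) / 4"
  define lam where "lam = 1 + r"
  define \<rho> where "\<rho> = (1 + lam powr (- \<alpha>)) / 2"
  have r: "0 < r" "r < 1" using mu by (auto simp: r_def)
  have lam: "1 < lam" using r by (simp add: lam_def)
  have "lam powr (- \<alpha>) < 1" using lam al by (intro powr_less_one) auto
  then have \<rho>: "0 < \<rho>" "\<rho> < 1" "lam powr (- \<alpha>) < \<rho>" using lam by (auto simp: \<rho>_def add_pos_nonneg)
  have c: "\<mu> * lam + r \<le> 1 - r"
  proof -
    have a: "\<mu> * r \<le> 1 * r" using mu r by (intro mult_right_mono) auto
    have "4 * r = 1 - \<mu>" by (simp add: r_def)
    then show ?thesis using r a unfolding lam_def distrib_left by linarith
  qed
  have ev1: "\<forall>\<^sub>F x in at_top. (V / r\<^sup>2) / x\<^sup>2 / T x < 1"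
    using inverse_square_negligible[of "V / r\<^sup>2"] by (rule order_tendstoD) simp
  define C1 where "C1 = r powr (- \<alpha>) + 1"
  have C1: "C1 > 0" by (simp add: C1_def add_nonneg_pos)
  have ev2: "\<forall>\<^sub>F x in at_top. T (r * x) \<le> C1 * T x"
    using r by (intro T_scale_eventually) (auto simp: C1_def)
  have ev3: "\<forall>\<^sub>F x in at_top. T (lam * x) \<le> \<rho> * T x"
    using lam \<rho> by (intro T_scale_eventually) auto
  have "\<forall>\<^sub>F x in at_top. (V / r\<^sup>2) / x\<^sup>2 / T x < 1 \<and> T (r * x) \<le> C1 * T x \<and> T (lam * x) \<le> \<rho> * T x"
    using ev1 ev2 ev3 by eventually_elim simp
  from eventually_at_top_ge_one[OF this] obtain x0 where x0: "1 \<le> x0"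
    and e1: "\<And>x. x0 \<le> x \<Longrightarrow> (V / r\<^sup>2) / x\<^sup>2 / T x < 1"
    and e2: "\<And>x. x0 \<le> x \<Longrightarrow> T (r * x) \<le> C1 * T x"
    and e3: "\<And>x. x0 \<le> x \<Longrightarrow> T (lam * x) \<le> \<rho> * T x" by blast
  define C2 where "C2 = C1 + 1"
  have C2: "C2 > 0" using C1 by (simp add: C2_def)
  have step: "H x \<le> H (lam * x) + C2 * T x" if x: "x0 \<le> x" for x
  proof -
    have xpos: "0 < x" using x x0 by simp
    have "H x \<le> measure_pmf.prob (pair_pmf MS Bp) ({z. (1 - r) * x < real (snd (fst z))} \<union> {z. r * x < real (snd z)})"
      unfolding tail_split by (intro measure_pmf.finite_measure_mono) (auto simp: algebra_simps)
    also have "\<dots> \<le> measure_pmf.prob MS {z. (1 - r) * x < real (snd z)} + T (r * x)"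
      by (rule order_trans[OF measure_Un_le]) (simp_all add: prob_MS_B1[of "\<lambda>z. (1 - r) * x < real (snd z)"] prob_MS_B2[of "\<lambda>b. r * x < real b"] tail_def)
    also have "measure_pmf.prob MS {z. (1 - r) * x < real (snd z)} \<le> H (lam * x) + V / (r * x)\<^sup>2"
      using xpos r c by (intro offspring_upper) auto
    also have "V / (r * x)\<^sup>2 \<le> T x"
    proof -
      have "(V / r\<^sup>2) / x\<^sup>2 < T x" using e1[OF x] T_pos[of x] by (simp only: divide_less_eq_1_pos)
      then show ?thesis by (simp add: power_mult_distrib)
    qed
    also have "T (r * x) \<le> C1 * T x" using e2[OF x] .
    finally show ?thesis by (simp add: C2_def algebra_simps)
  qed
  have bound: "\<forall>x\<ge>x0. H x \<le> H (lam ^ n * x) + C2 / (1 - \<rho>) * (1 - \<rho> ^ n) * T x" for n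
  proof (induction n)
    case (Suc n)
    show ?case
    proof (intro allI impI)
      fix x assume x: "x0 \<le> x"
      have "1 * x \<le> lam * x" using lam x x0 by (intro mult_right_mono) auto
      then have "H (lam * x) \<le> H (lam ^ n * (lam * x)) + C2 / (1 - \<rho>) * (1 - \<rho> ^ n) * T (lam * x)"
        using Suc x by auto
      also have "C2 / (1 - \<rho>) * (1 - \<rho> ^ n) * T (lam * x) \<le> C2 / (1 - \<rho>) * (1 - \<rho> ^ n) * (\<rho> * T x)"
        using C2 \<rho> e3[OF x] by (intro mult_left_mono mult_nonneg_nonneg) (auto simp: power_le_one)
      finally have "H x \<le> H (lam ^ Suc n * x) + (C2 / (1 - \<rho>) * (1 - \<rho> ^ n) * \<rho> + C2) * T x"
        using step[OF x] by (simp add: algebra_simps)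
      also have "C2 / (1 - \<rho>) * (1 - \<rho> ^ n) * \<rho> + C2 = C2 / (1 - \<rho>) * (1 - \<rho> ^ Suc n)"
        using \<rho> by (simp add: field_simps)
      finally show "H x \<le> H (lam ^ Suc n * x) + C2 / (1 - \<rho>) * (1 - \<rho> ^ Suc n) * T x" .
    qed
  qed simp
  have "H x \<le> C2 / (1 - \<rho>) * T x" if x: "x0 \<le> x" for x
  proof -
    have "filterlim (\<lambda>n. x * lam ^ n) at_top sequentially"
    proof (intro filterlim_tendsto_pos_mult_at_top[OF tendsto_const])
      show "filterlim ((^) lam) at_top sequentially"
        using lam by (intro filterlim_at_infinity_imp_filterlim_at_top filterlim_realpow_sequentially_gt1) auto
    qed (use x x0 in auto)
    then have "(\<lambda>n. H (lam ^ n * x)) \<longlonglongrightarrow> 0"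
      using filterlim_compose[OF tail_tendsto_0[of \<pi>]] by (simp add: mult.commute)
    then have "(\<lambda>n. H (lam ^ n * x) + C2 / (1 - \<rho>) * (1 - \<rho> ^ n) * T x) \<longlonglongrightarrow> 0 + C2 / (1 - \<rho>) * (1 - 0) * T x"
      using \<rho> by (intro tendsto_intros LIMSEQ_realpow_zero) auto
    then have "H x \<le> 0 + C2 / (1 - \<rho>) * (1 - 0) * T x"
      using bound x by (intro LIMSEQ_le_const) auto
    then show ?thesis by simp
  qed
  then show ?thesis using C2 \<rho> by (intro exI[of _ "C2 / (1 - \<rho>)"]) (auto simp: eventually_at_top_linorder)
qed

lemma offspring_tail_tendsto_0:
  assumes "0 < e"
  shows "((\<lambda>x. measure_pmf.prob MS {z. e * x < real (snd z)}) \<longlongrightarrow> 0) at_top"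
proof -
  have "((\<lambda>x. tail (map_pmf snd MS) (e * x)) \<longlongrightarrow> 0) at_top"
    using assms by (intro filterlim_compose[OF tail_tendsto_0] filterlim_tendsto_pos_mult_at_top[OF tendsto_const]) (auto simp: filterlim_ident)
  then show ?thesis by (simp add: tail_def vimage_def)
qed

definition R where "R x = H x / T x"

text \<open>The upper bound for $H/T$: the approximate inequality between $H(x)$ and $T(x) + H(x/\mu)$ is a contraction for the ratio, with a factor close to $\mu^\alpha < 1$.\<close>

lemma R_eventually_less:
  assumes L: "1 / (1 - \<mu> powr \<alpha>) < a"
  shows "\<forall>\<^sub>F x in at_top. R x < a"
proof -
  define q where "q \<epsilon> = (1 - 2 * \<epsilon>) / \<mu>" for \<epsilon>
  define f where "f \<epsilon> = ((1 - \<epsilon>) powr (- \<alpha>) + \<epsilon>) / (1 - (q \<epsilon> powr (- \<alpha>) + \<epsilon>))" for \<epsilon>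
  have "\<mu> powr \<alpha> < 1" by (rule mu_powr_less_1)
  moreover have q0: "q 0 powr (- \<alpha>) = \<mu> powr \<alpha>" using mu by (simp add: q_def powr_divide powr_minus)
  ultimately have "((\<lambda>\<epsilon>. f \<epsilon>) \<longlongrightarrow> f 0) (at_right 0)"
    unfolding f_def q_def using mu by (intro tendsto_intros) auto
  moreover have "f 0 < a" using L q0 by (simp add: f_def)
  ultimately have ev1: "\<forall>\<^sub>F \<epsilon> in at_right 0. f \<epsilon> < a" by (rule order_tendstoD)
  have "((\<lambda>\<epsilon>. q \<epsilon> powr (- \<alpha>) + \<epsilon>) \<longlongrightarrow> q 0 powr (- \<alpha>) + 0) (at_right 0)"
    unfolding q_def using mu by (intro tendsto_intros) auto
  then have ev2: "\<forall>\<^sub>F \<epsilon> in at_right 0. q \<epsilon> powr (- \<alpha>) + \<epsilon> < 1"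
    by (rule order_tendstoD) (use q0 \<open>\<mu> powr \<alpha> < 1\<close> in simp)
  have ev3: "\<forall>\<^sub>F \<epsilon> in at_right 0. 0 < \<epsilon> \<and> \<epsilon> < (1 - \<mu>) / 2"
    using mu by (intro eventually_at_rightI[of 0 "(1 - \<mu>) / 2"]) auto
  obtain \<epsilon> where \<epsilon>: "f \<epsilon> < a" "q \<epsilon> powr (- \<alpha>) + \<epsilon> < 1" "0 < \<epsilon>" "\<epsilon> < (1 - \<mu>) / 2"
    using eventually_happens'[OF _ eventually_conj[OF ev1 eventually_conj[OF ev2 ev3]]] by auto
  define \<theta> where "\<theta> = q \<epsilon> powr (- \<alpha>) + \<epsilon>"
  define \<kappa> where "\<kappa> = (1 - \<epsilon>) powr (- \<alpha>) + \<epsilon>"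
  have q: "1 < q \<epsilon>" using \<epsilon> mu by (simp add: q_def field_simps)
  have \<theta>: "0 \<le> \<theta>" "\<theta> < 1" using \<epsilon> by (auto simp: \<theta>_def)
  obtain C where C: "C > 0" "\<forall>\<^sub>F x in at_top. H x \<le> C * T x" using X_tail_le by blast
  have evT: "\<forall>\<^sub>F x in at_top. T (q \<epsilon> * x) \<le> \<theta> * T x"
    using q \<epsilon> by (intro T_scale_eventually) (auto simp: \<theta>_def)
  have "((\<lambda>x. (V / \<epsilon>\<^sup>2 / x\<^sup>2) / T x + T ((1 - \<epsilon>) * x) / T x
      + measure_pmf.prob MS {z. \<epsilon> * x < real (snd z)} * (T (\<epsilon> * x) / T x)) \<longlongrightarrow>
      0 + (1 - \<epsilon>) powr (- \<alpha>) + 0 * \<epsilon> powr (- \<alpha>)) at_top"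
    using \<epsilon> mu by (intro tendsto_intros inverse_square_negligible T_ratio offspring_tail_tendsto_0) auto
  then have ev\<kappa>: "\<forall>\<^sub>F x in at_top. (V / \<epsilon>\<^sup>2 / x\<^sup>2) / T x + T ((1 - \<epsilon>) * x) / T x
      + measure_pmf.prob MS {z. \<epsilon> * x < real (snd z)} * (T (\<epsilon> * x) / T x) < \<kappa>"
    by (rule order_tendstoD) (use \<epsilon> in \<open>simp add: \<kappa>_def\<close>)
  from eventually_at_top_ge_one[OF eventually_conj[OF C(2) eventually_conj[OF evT ev\<kappa>]]]
  obtain x0 where x0: "1 \<le> x0" and e1: "\<And>x. x0 \<le> x \<Longrightarrow> H x \<le> C * T x"
    and e2: "\<And>x. x0 \<le> x \<Longrightarrow> T (q \<epsilon> * x) \<le> \<theta> * T x"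
    and e3: "\<And>x. x0 \<le> x \<Longrightarrow> (V / \<epsilon>\<^sup>2 / x\<^sup>2) / T x + T ((1 - \<epsilon>) * x) / T x
      + measure_pmf.prob MS {z. \<epsilon> * x < real (snd z)} * (T (\<epsilon> * x) / T x) < \<kappa>" by blast
  have "R x \<le> \<kappa> / (1 - \<theta>)" if "x0 \<le> x" for x
  proof (rule contraction_iterate[where r=R, OF _ \<theta> _ _ _ that])
    show "1 \<le> q \<epsilon>" "0 < x0" using q x0 by auto
    show "R x \<le> C" if "x0 \<le> x" for x
      using e1[OF that] T_pos[of x] by (simp add: R_def divide_le_eq)
    fix x assume x: "x0 \<le> x"
    then have xpos: "0 < x" using x0 by simp
    let ?P = "\<lambda>c. measure_pmf.prob MS {z. c * x < real (snd z)}"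
    have "H x \<le> measure_pmf.prob (pair_pmf MS Bp) (({z. (1 - \<epsilon>) * x < real (snd (fst z))} \<union> {z. (1 - \<epsilon>) * x < real (snd z)})
        \<union> {z. \<epsilon> * x < real (snd (fst z)) \<and> \<epsilon> * x < real (snd z)})"
      unfolding tail_split by (intro measure_pmf.finite_measure_mono) (auto simp: algebra_simps)
    also have "\<dots> \<le> (?P (1 - \<epsilon>) + T ((1 - \<epsilon>) * x)) + ?P \<epsilon> * T (\<epsilon> * x)"
      apply (rule order_trans[OF measure_Un_le], simp, simp)
      apply (rule add_mono)
       apply (rule order_trans[OF measure_Un_le], simp, simp)
       apply (simp add: prob_MS_B1[of "\<lambda>z. (1 - \<epsilon>) * x < real (snd z)"] prob_MS_B2[of "\<lambda>b. (1 - \<epsilon>) * x < real b"] tail_def)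
      apply (simp add: prob_MS_B[of "\<lambda>z. \<epsilon> * x < real (snd z)" "\<lambda>b. \<epsilon> * x < real b"] tail_def)
      done
    also have "?P (1 - \<epsilon>) \<le> H (q \<epsilon> * x) + V / (\<epsilon> * x)\<^sup>2"
      using mu \<epsilon> xpos by (intro offspring_upper) (auto simp: q_def)
    finally have "R x \<le> (H (q \<epsilon> * x) + V / (\<epsilon> * x)\<^sup>2 + T ((1 - \<epsilon>) * x) + ?P \<epsilon> * T (\<epsilon> * x)) / T x"
      using T_pos[of x] unfolding R_def by (intro divide_right_mono) auto
    also have "\<dots> = H (q \<epsilon> * x) / T x + ((V / \<epsilon>\<^sup>2 / x\<^sup>2) / T x + T ((1 - \<epsilon>) * x) / T x + ?P \<epsilon> * (T (\<epsilon> * x) / T x))"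
      by (simp add: add_divide_distrib power_mult_distrib)
    also have "\<dots> \<le> H (q \<epsilon> * x) / T x + \<kappa>" using e3[OF x] by simp
    also have "H (q \<epsilon> * x) / T x = R (q \<epsilon> * x) * (T (q \<epsilon> * x) / T x)"
      using T_pos[of "q \<epsilon> * x"] by (simp add: R_def)
    also have "\<dots> \<le> R (q \<epsilon> * x) * \<theta>"
      using e2[OF x] T_pos[of x] T_pos[of "q \<epsilon> * x"] tail_nonneg[of \<pi>]
      by (intro mult_left_mono) (auto simp: R_def divide_le_eq intro!: divide_nonneg_pos)
    finally show "R x \<le> \<theta> * R (q \<epsilon> * x) + \<kappa>" by (simp add: mult.commute)
  qed
  moreover have "\<kappa> / (1 - \<theta>) < a" using \<epsilon>(1) by (simp add: f_def \<kappa>_def \<theta>_def)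
  ultimately show ?thesis unfolding eventually_at_top_linorder by (meson le_less_trans)
qed

lemma offspring_lower:
  assumes \<epsilon>: "0 < \<epsilon>" and x: "0 < x"
  shows "H ((1 + \<epsilon>) / \<mu> * x) * (1 - (\<sigma>\<^sup>2 * (1 + \<epsilon>) / (\<mu> * \<epsilon>\<^sup>2)) / x) \<le> measure_pmf.prob MS {z. x < real (snd z)}"
proof -
  let ?q = "(1 + \<epsilon>) / \<mu>" and ?c = "\<sigma>\<^sup>2 * (1 + \<epsilon>) / (\<mu> * \<epsilon>\<^sup>2) / x"
  have ptw: "indicator {l. ?q * x < real l} m * (1 - ?c) \<le> measure_pmf.prob (S m) {s. x < real s}" for m
  proof (cases "?q * x < real m")
    case True
    define a where "a = \<mu> * real m - x"
    have mm: "(1 + \<epsilon>) * x < \<mu> * real m" using True mu by (simp add: field_simps)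
    have a0: "0 < a" using mm \<epsilon> x by (simp add: a_def algebra_simps) (smt (verit) mult_pos_pos)
    have a1: "\<mu> * real m * \<epsilon> / (1 + \<epsilon>) \<le> a"
      using mm \<epsilon> by (simp add: a_def field_simps)
    have mpos: "0 < real m" using True x mu \<epsilon> by (smt (verit) divide_pos_pos mult_pos_pos)
    have "measure_pmf.prob (S m) {s. real s \<le> x} \<le> measure_pmf.prob (S m) {l. a \<le> \<bar>real l - \<mu> * real m\<bar>}"
      by (intro measure_pmf.finite_measure_mono) (auto simp: a_def)
    also have "\<dots> \<le> \<sigma>\<^sup>2 * real m / a\<^sup>2" by (rule S_chebyshev[OF a0])
    also have "\<dots> \<le> \<sigma>\<^sup>2 * real m / ((\<mu> * real m * \<epsilon> / (1 + \<epsilon>)) * (\<epsilon> * x))"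
    proof (rule divide_left_mono)
      have "\<epsilon> * x \<le> a" using mm by (simp add: a_def algebra_simps)
      then show "\<mu> * real m * \<epsilon> / (1 + \<epsilon>) * (\<epsilon> * x) \<le> a\<^sup>2"
        unfolding power2_eq_square using a1 a0 \<epsilon> x by (intro mult_mono) auto
    qed (use \<epsilon> x mpos mu a0 in auto)
    also have "\<dots> = ?c" using \<epsilon> x mpos mu by (simp add: field_simps power2_eq_square)
    finally have "measure_pmf.prob (S m) {s. real s \<le> x} \<le> ?c" .
    moreover have "measure_pmf.prob (S m) {s. x < real s} = 1 - measure_pmf.prob (S m) {s. real s \<le> x}"
      using measure_pmf.prob_compl[of "{s. real s \<le> x}" "S m"] by (simp add: Compl_eq_Diff_UNIV[symmetric] set_diff_eq not_le)
    ultimately show ?thesis using True by simp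
  qed simp
  have "H (?q * x) * (1 - ?c) = measure_pmf.expectation \<pi> (\<lambda>m. indicator {l. ?q * x < real l} m * (1 - ?c))"
    by (simp add: tail_def)
  also have "\<dots> \<le> measure_pmf.prob MS {z. x < real (snd z)}"
    unfolding prob_MS
  proof (rule integral_mono)
    show "integrable (measure_pmf \<pi>) (\<lambda>m. measure_pmf.prob (S m) {s. (m, s) \<in> {z. x < real (snd z)}})"
      by (rule measure_pmf.integrable_const_bound[where B=1]) auto
    show "integrable (measure_pmf \<pi>) (\<lambda>m. indicator {l. ?q * x < real l} m * (1 - ?c))"
      by (rule measure_pmf.integrable_const_bound[where B="\<bar>1 - ?c\<bar>"]) (auto simp: indicator_def)
  qed (use ptw in auto)
  finally show ?thesis .
qed

text \<open>The lower bound: the two ways to exceed, a large immigrant number or a large parent generation, are nearly disjoint.\<close>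

lemma R_eventually_greater:
  assumes L: "a < 1 / (1 - \<mu> powr \<alpha>)"
  shows "\<forall>\<^sub>F x in at_top. a < R x"
proof -
  define q where "q \<epsilon> = (1 + \<epsilon>) / \<mu>" for \<epsilon>
  define f where "f \<epsilon> = (1 - \<epsilon>) / (1 - (q \<epsilon> powr (- \<alpha>) - \<epsilon>))" for \<epsilon>
  have m1: "\<mu> powr \<alpha> < 1" by (rule mu_powr_less_1)
  have q0: "q 0 powr (- \<alpha>) = \<mu> powr \<alpha>" using mu by (simp add: q_def powr_divide powr_minus)
  have "((\<lambda>\<epsilon>. f \<epsilon>) \<longlongrightarrow> f 0) (at_right 0)"
    using q0 m1 unfolding f_def q_def using mu by (intro tendsto_intros) auto
  moreover have "a < f 0" using L q0 by (simp add: f_def)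
  ultimately have ev1: "\<forall>\<^sub>F \<epsilon> in at_right 0. a < f \<epsilon>" by (rule order_tendstoD)
  have lim2: "((\<lambda>\<epsilon>. q \<epsilon> powr (- \<alpha>) - \<epsilon>) \<longlongrightarrow> q 0 powr (- \<alpha>) - 0) (at_right 0)"
    unfolding q_def using mu by (intro tendsto_intros) auto
  then have ev2: "\<forall>\<^sub>F \<epsilon> in at_right 0. q \<epsilon> powr (- \<alpha>) - \<epsilon> < 1"
    by (rule order_tendstoD) (use q0 m1 in simp)
  have ev2': "\<forall>\<^sub>F \<epsilon> in at_right 0. q \<epsilon> powr (- \<alpha>) - \<epsilon> > 0"
    using lim2 by (rule order_tendstoD) (use q0 mu in simp)
  have ev3: "\<forall>\<^sub>F \<epsilon> in at_right 0. 0 < \<epsilon> \<and> \<epsilon> < (1 - \<mu>) / 2"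
    using mu by (intro eventually_at_rightI[of 0 "(1 - \<mu>) / 2"]) auto
  obtain \<epsilon> where \<epsilon>: "a < f \<epsilon>" "q \<epsilon> powr (- \<alpha>) - \<epsilon> < 1" "q \<epsilon> powr (- \<alpha>) - \<epsilon> > 0" "0 < \<epsilon>" "\<epsilon> < (1 - \<mu>) / 2"
    using eventually_happens'[OF _ eventually_conj[OF ev1 eventually_conj[OF ev2 eventually_conj[OF ev2' ev3]]]] by auto
  define \<theta> where "\<theta> = q \<epsilon> powr (- \<alpha>) - \<epsilon>"
  define \<kappa> where "\<kappa> = 1 - \<epsilon>"
  have q: "1 < q \<epsilon>" using \<epsilon> mu by (simp add: q_def field_simps)
  have \<theta>: "0 \<le> \<theta>" "\<theta> < 1" using \<epsilon> by (auto simp: \<theta>_def)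
  define c where "c = \<sigma>\<^sup>2 * (1 + \<epsilon>) / (\<mu> * \<epsilon>\<^sup>2)"
  have "((\<lambda>x. T (q \<epsilon> * x) / T x * (1 - c / x)) \<longlongrightarrow> q \<epsilon> powr (- \<alpha>) * (1 - 0)) at_top"
    using q by (intro tendsto_intros T_ratio tendsto_divide_0[OF tendsto_const] filterlim_at_top_imp_at_infinity filterlim_ident) auto
  then have evT: "\<forall>\<^sub>F x in at_top. T (q \<epsilon> * x) / T x * (1 - c / x) > \<theta>"
    by (rule order_tendstoD) (use \<epsilon> in \<open>simp add: \<theta>_def\<close>)
  have ev\<kappa>: "\<forall>\<^sub>F x in at_top. measure_pmf.prob MS {z. 1 * x < real (snd z)} < \<epsilon>"
    using offspring_tail_tendsto_0[of 1] by (rule order_tendstoD) (use \<epsilon> in auto)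
  from eventually_at_top_ge_one[OF eventually_conj[OF evT ev\<kappa>]]
  obtain x0 where x0: "1 \<le> x0"
    and e2: "\<And>x. x0 \<le> x \<Longrightarrow> T (q \<epsilon> * x) / T x * (1 - c / x) > \<theta>"
    and e3: "\<And>x. x0 \<le> x \<Longrightarrow> measure_pmf.prob MS {z. x < real (snd z)} < \<epsilon>" by auto
  have Rnn: "0 \<le> R x" for x using T_pos[of x] tail_nonneg[of \<pi> x] by (simp add: R_def)
  have "- R x \<le> (- \<kappa>) / (1 - \<theta>)" if "x0 \<le> x" for x
  proof (rule contraction_iterate[where r="\<lambda>x. - R x" and C=0, OF _ \<theta> _ _ _ that])
    show "1 \<le> q \<epsilon>" "0 < x0" using q x0 by auto
    show "- R x \<le> 0" for x using Rnn by simp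
    fix x assume x: "x0 \<le> x"
    then have xpos: "0 < x" using x0 by simp
    define p where "p = measure_pmf.prob MS {z. x < real (snd z)}"
    have split: "measure_pmf.prob (pair_pmf MS Bp) ({z. x < real (snd (fst z))} \<union> {z. x < real (snd z)}) = p + T x - p * T x"
    proof -
      have eq: "measure_pmf.prob (pair_pmf MS Bp) ({z. x < real (snd (fst z))} \<union> {z. x < real (snd z)})
         = measure_pmf.prob (pair_pmf MS Bp) {z. x < real (snd (fst z))} + measure_pmf.prob (pair_pmf MS Bp) {z. x < real (snd z)}
         - measure_pmf.prob (pair_pmf MS Bp) {z. x < real (snd (fst z)) \<and> x < real (snd z)}"
        by (subst measure_pmf.finite_measure_Union') (auto simp: measure_pmf.finite_measure_Diff' Int_def conj_commute)
      show ?thesis unfolding eq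
        by (simp add: prob_MS_B[of "\<lambda>z. x < real (snd z)" "\<lambda>b. x < real b"] prob_MS_B1[of "\<lambda>z. x < real (snd z)"]
            prob_MS_B2[of "\<lambda>b. x < real b"] p_def tail_def)
    qed
    have "p + T x - p * T x \<le> H x"
      unfolding split[symmetric] tail_split by (intro measure_pmf.finite_measure_mono) auto
    moreover have "p * T x \<le> \<epsilon> * T x" using e3[OF x] T_pos[of x] by (intro mult_right_mono) (auto simp: p_def)
    moreover have "H (q \<epsilon> * x) * (1 - c / x) \<le> p"
      using offspring_lower[OF \<epsilon>(4) xpos] by (simp add: p_def q_def c_def)
    ultimately have "H (q \<epsilon> * x) * (1 - c / x) + \<kappa> * T x \<le> H x" by (simp add: \<kappa>_def algebra_simps)
    then have "(H (q \<epsilon> * x) * (1 - c / x) + \<kappa> * T x) / T x \<le> R x"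
      unfolding R_def using T_pos[of x] by (intro divide_right_mono) auto
    also have "(H (q \<epsilon> * x) * (1 - c / x) + \<kappa> * T x) / T x = R (q \<epsilon> * x) * (T (q \<epsilon> * x) / T x * (1 - c / x)) + \<kappa>"
      using T_pos[of x] T_pos[of "q \<epsilon> * x"] by (simp add: R_def add_divide_distrib)
    finally have "R (q \<epsilon> * x) * (T (q \<epsilon> * x) / T x * (1 - c / x)) + \<kappa> \<le> R x" .
    moreover have "R (q \<epsilon> * x) * \<theta> \<le> R (q \<epsilon> * x) * (T (q \<epsilon> * x) / T x * (1 - c / x))"
      using e2[OF x] Rnn by (intro mult_left_mono) auto
    ultimately show "- R x \<le> \<theta> * - R (q \<epsilon> * x) + - \<kappa>" by (simp add: mult.commute)
  qed
  moreover have "a < \<kappa> / (1 - \<theta>)" using \<epsilon>(1) by (simp add: f_def \<kappa>_def \<theta>_def)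
  ultimately have "a < R x" if "x0 \<le> x" for x using that by (force simp: minus_divide_left[symmetric])
  then show ?thesis unfolding eventually_at_top_linorder by blast
qed

lemma R_tendsto: "(R \<longlongrightarrow> 1 / (1 - \<mu> powr \<alpha>)) at_top"
  by (rule order_tendstoI) (auto intro: R_eventually_less R_eventually_greater)

lemma H_rv: "rv_tail H \<alpha>"
proof -
  define L where "L = 1 / (1 - \<mu> powr \<alpha>)"
  have "\<mu> powr \<alpha> < 1" by (rule mu_powr_less_1)
  then have L: "0 < L" by (simp add: L_def)
  have Rl: "(R \<longlongrightarrow> L) at_top" using R_tendsto by (simp add: L_def)
  have ev: "\<forall>\<^sub>F x in at_top. H x > 0"
    using order_tendstoD(1)[OF Rl L] by eventually_elim (use T_pos in \<open>auto simp: R_def zero_less_divide_iff dest: less_asym\<close>)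
  have pos: "0 < H x" for x
  proof -
    from eventually_happens'[OF trivial_limit_at_top_linorder eventually_conj[OF ev eventually_ge_at_top[of x]]]
    obtain y where "H y > 0" "x \<le> y" by blast
    then show ?thesis using tail_mono[of x y \<pi>] by simp
  qed
  have "((\<lambda>x. H (q * x) / H x) \<longlongrightarrow> q powr (- \<alpha>)) at_top" if q: "0 < q" for q
  proof -
    have "((\<lambda>x. R (q * x)) \<longlongrightarrow> L) at_top"
      using q by (intro filterlim_compose[OF Rl] filterlim_tendsto_pos_mult_at_top[OF tendsto_const]) (auto simp: filterlim_ident)
    then have "((\<lambda>x. R (q * x) / R x * (T (q * x) / T x)) \<longlongrightarrow> L / L * q powr (- \<alpha>)) at_top"
      using L q Rl by (intro tendsto_intros T_ratio) auto
    moreover have "R (q * x) / R x * (T (q * x) / T x) = H (q * x) / H x" for x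
      using T_pos[of x] T_pos[of "q * x"] by (simp add: R_def)
    ultimately show ?thesis using L by simp
  qed
  then show ?thesis using pos tail_antimono by (simp add: rv_tail_def)
qed

end

section \<open>Moments at the truncation level, negligible parts, and the conditional central limit theorem\<close>

lemma integrable_pmf_bounded:
  fixes f :: "'b \<Rightarrow> real"
  assumes "\<And>x. \<bar>f x\<bar> \<le> C"
  shows "integrable (measure_pmf p) f"
  by (rule measure_pmf.integrable_const_bound[where B=C]) (use assms in auto)

context branching begin

lemma H_pos: "0 < H x" and H_ratio: "0 < q \<Longrightarrow> ((\<lambda>x. H (q * x) / H x) \<longlongrightarrow> q powr (- \<alpha>)) at_top"
  using H_rv by (auto simp: rv_tail_def)

definition X3 :: "real \<Rightarrow> real" where
  "X3 s = measure_pmf.expectation \<pi> (\<lambda>l. real l ^ 3 * indicator {l. real l \<le> s} l)"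

lemma X3_integrable: "integrable (measure_pmf \<pi>) (\<lambda>l. real l ^ 3 * indicator {l. real l \<le> s} l)"
  by (rule integrable_pmf_bounded[where C="\<bar>s\<bar> ^ 3"])
    (auto simp: indicator_def intro!: power_mono)

lemma X3_le: "0 \<le> s \<Longrightarrow> X3 s \<le> s ^ 3"
  unfolding X3_def
  by (rule measure_pmf.integral_le_const[OF X3_integrable]) (auto simp: indicator_def intro!: power_mono)

text \<open>Splitting at $s$: what is added between $s$ and $2s$ is at most $(2s)^3 H(s)$.\<close>

lemma X3_double: assumes "0 \<le> s" shows "X3 (2 * s) \<le> X3 s + 8 * s ^ 3 * H s"
proof -
  have i: "integrable (measure_pmf \<pi>) (\<lambda>l. 8 * s ^ 3 * indicator {l. s < real l} l)"
    by (rule integrable_pmf_bounded[where C="\<bar>8 * s ^ 3\<bar>"]) (auto simp: indicator_def)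
  have "X3 (2 * s) \<le> measure_pmf.expectation \<pi> (\<lambda>l. real l ^ 3 * indicator {l. real l \<le> s} l + 8 * s ^ 3 * indicator {l. s < real l} l)"
    unfolding X3_def
  proof (rule integral_mono[OF X3_integrable Bochner_Integration.integrable_add[OF X3_integrable i]])
    fix l :: nat
    have "real l ^ 3 \<le> (2 * s) ^ 3" if "real l \<le> 2 * s" using that by (intro power_mono) auto
    then show "real l ^ 3 * indicator {l. real l \<le> 2 * s} l
        \<le> real l ^ 3 * indicator {l. real l \<le> s} l + 8 * s ^ 3 * indicator {l. s < real l} l"
      using assms by (auto simp: indicator_def power_mult_distrib)
  qed
  also have "\<dots> = X3 s + 8 * s ^ 3 * H s"
    by (subst Bochner_Integration.integral_add[OF X3_integrable i]) (simp add: X3_def tail_def)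
  finally show ?thesis .
qed

text \<open>As $s^3 H(s)$ varies regularly with the positive index $3 - \alpha$, the contributions of all earlier doublings are dominated by the last one.\<close>

lemma truncated_third_moment: "\<exists>C>0. \<forall>\<^sub>F s in at_top. X3 s \<le> C * (s ^ 3 * H s)"
proof -
  have "(1/4 :: real) = 2 powr (- 2)" by (simp add: powr_minus)
  also have "\<dots> < 2 powr (- \<alpha>)" using al by (intro powr_less_mono) auto
  finally have "\<forall>\<^sub>F s in at_top. 1 / 4 < H (2 * s) / H s"
    by (intro order_tendstoD(1)[OF H_ratio]) auto
  from eventually_at_top_ge_one[OF this] obtain x0 where x0: "1 \<le> x0"
    and q: "\<And>s. x0 \<le> s \<Longrightarrow> 1 / 4 < H (2 * s) / H s" by blast
  define D where "D = max 8 (8 / H (2 * x0))"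
  have "X3 s / (s ^ 3 * H s) \<le> D" if "x0 \<le> s" for s
  proof (rule doubling_bound[where h="\<lambda>s. X3 s / (s ^ 3 * H s)", OF _ _ _ that])
    fix s assume s: "x0 \<le> s" "s \<le> 2 * x0"
    have "X3 s / (s ^ 3 * H s) \<le> s ^ 3 / (s ^ 3 * H s)"
      using s x0 H_pos[of s] by (intro divide_right_mono X3_le) auto
    also have "\<dots> = 1 / H s" using s x0 by simp
    also have "\<dots> \<le> 8 / H (2 * x0)"
      using tail_mono[OF s(2), of \<pi>] H_pos[of s] H_pos[of "2 * x0"] by (intro frac_le) auto
    finally show "X3 s / (s ^ 3 * H s) \<le> D" by (simp add: D_def)
  next
    fix s assume s: "x0 \<le> s" "X3 s / (s ^ 3 * H s) \<le> D"
    have "X3 (2 * s) / ((2 * s) ^ 3 * H (2 * s)) \<le> (X3 s + 8 * s ^ 3 * H s) / ((2 * s) ^ 3 * H (2 * s))"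
      using s x0 H_pos[of "2 * s"] by (intro divide_right_mono X3_double) auto
    also have "\<dots> \<le> (X3 s + 8 * s ^ 3 * H s) / (2 * s ^ 3 * H s)"
    proof (rule divide_left_mono)
      have "H s \<le> 4 * H (2 * s)" using q[OF s(1)] H_pos[of s] by (simp add: field_simps)
      then have "2 * s ^ 3 * H s \<le> 2 * s ^ 3 * (4 * H (2 * s))" using s x0 by (intro mult_left_mono) auto
      then show "2 * s ^ 3 * H s \<le> (2 * s) ^ 3 * H (2 * s)" by (simp add: power_mult_distrib)
      have "0 \<le> X3 s" unfolding X3_def by (auto intro!: integral_nonneg_AE)
      then show "0 \<le> X3 s + 8 * s ^ 3 * H s" using H_pos[of s] s x0 by simp
    qed (use s x0 H_pos in auto)
    also have "\<dots> = X3 s / (s ^ 3 * H s) / 2 + 4"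
      using s x0 H_pos[of s] by (simp add: field_simps)
    also have "\<dots> \<le> D" using s(2) by (simp add: D_def)
    finally show "X3 (2 * s) / ((2 * s) ^ 3 * H (2 * s)) \<le> D" .
  qed (use x0 in auto)
  then have "X3 s \<le> D * (s ^ 3 * H s)" if "x0 \<le> s" for s
    using that x0 H_pos[of s] by (simp add: divide_le_eq)
  moreover have "0 < D" by (simp add: D_def)
  ultimately show ?thesis unfolding eventually_at_top_linorder by blast
qed

text \<open>Chebyshev inequality for the innovation, conditionally on the starting value; the sum over starting values below $\delta s$ is a truncated third moment.\<close>

lemma small_start_large_fluctuation:
  "\<exists>C>0. \<forall>\<delta>>0. \<forall>\<eta>>0. \<forall>\<^sub>F s in at_top.
     measure_pmf.prob MS {z. real (fst z) \<le> \<delta> * s \<and> \<eta> * s powr (3/2) < real (fst z) * \<bar>real (snd z) - \<mu> * real (fst z)\<bar>}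
       \<le> C * \<delta> powr (3 - \<alpha>) / \<eta>\<^sup>2 * H s"
proof -
  obtain C where C: "C > 0" "\<forall>\<^sub>F s in at_top. X3 s \<le> C * (s ^ 3 * H s)"
    using truncated_third_moment by blast
  show ?thesis
  proof (intro exI[of _ "2 * \<sigma>\<^sup>2 * C"] conjI allI impI)
    show "0 < 2 * \<sigma>\<^sup>2 * C" using C sig by simp
    fix \<delta> \<eta> :: real assume d: "0 < \<delta>" and e: "0 < \<eta>"
    let ?A = "\<lambda>s. {z::nat \<times> nat. real (fst z) \<le> \<delta> * s \<and> \<eta> * s powr (3/2) < real (fst z) * \<bar>real (snd z) - \<mu> * real (fst z)\<bar>}"
    have lin: "filterlim (\<lambda>s. \<delta> * s) at_top at_top"
      using d by (intro filterlim_tendsto_pos_mult_at_top[OF tendsto_const]) (auto simp: filterlim_ident)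
    have ev1: "\<forall>\<^sub>F s in at_top. X3 (\<delta> * s) \<le> C * ((\<delta> * s) ^ 3 * H (\<delta> * s))"
      using eventually_compose_filterlim[OF C(2) lin] .
    have ev2: "\<forall>\<^sub>F s in at_top. H (\<delta> * s) / H s < 2 * \<delta> powr (- \<alpha>)"
      using d by (intro order_tendstoD(2)[OF H_ratio]) auto
    show "\<forall>\<^sub>F s in at_top. measure_pmf.prob MS (?A s) \<le> 2 * \<sigma>\<^sup>2 * C * \<delta> powr (3 - \<alpha>) / \<eta>\<^sup>2 * H s"
      using ev1 ev2 eventually_gt_at_top[of 0]
    proof eventually_elim
      case (elim s)
      have "measure_pmf.prob (S m) {l. (m, l) \<in> ?A s}
          \<le> \<sigma>\<^sup>2 / (\<eta>\<^sup>2 * s ^ 3) * (real m ^ 3 * indicator {l. real l \<le> \<delta> * s} m)" for m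
      proof (cases "real m \<le> \<delta> * s \<and> 0 < m")
        case True
        define a where "a = \<eta> * s powr (3/2) / real m"
        have a: "0 < a" using True elim e by (simp add: a_def)
        have "measure_pmf.prob (S m) {l. (m, l) \<in> ?A s} \<le> measure_pmf.prob (S m) {l. a \<le> \<bar>real l - \<mu> * real m\<bar>}"
          using True by (intro measure_pmf.finite_measure_mono) (auto simp: a_def field_simps)
        also have "\<dots> \<le> \<sigma>\<^sup>2 * real m / a\<^sup>2" by (rule S_chebyshev[OF a])
        also have "a\<^sup>2 = \<eta>\<^sup>2 * s ^ 3 / (real m)\<^sup>2"
          using elim by (simp add: a_def power_mult_distrib power_divide powr_power powr_numeral)
        also have "\<sigma>\<^sup>2 * real m / (\<eta>\<^sup>2 * s ^ 3 / (real m)\<^sup>2) = \<sigma>\<^sup>2 / (\<eta>\<^sup>2 * s ^ 3) * real m ^ 3"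
          by (simp add: power2_eq_square power3_eq_cube)
        finally show ?thesis using True by simp
      next
        case False
        then have emp: "{l. (m, l) \<in> ?A s} = {}" using elim e by (auto simp: not_less)
        show ?thesis unfolding emp using elim by (simp add: indicator_def)
      qed
      then have "measure_pmf.prob MS (?A s)
          \<le> measure_pmf.expectation \<pi> (\<lambda>m. \<sigma>\<^sup>2 / (\<eta>\<^sup>2 * s ^ 3) * (real m ^ 3 * indicator {l. real l \<le> \<delta> * s} m))"
        unfolding prob_MS
        by (intro integral_mono integrable_mult_right X3_integrable integrable_pmf_bounded[where C=1]) auto
      also have "\<dots> = \<sigma>\<^sup>2 / (\<eta>\<^sup>2 * s ^ 3) * X3 (\<delta> * s)" by (simp add: X3_def)
      also have "\<dots> \<le> \<sigma>\<^sup>2 / (\<eta>\<^sup>2 * s ^ 3) * (C * ((\<delta> * s) ^ 3 * H (\<delta> * s)))"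
        using elim by (intro mult_left_mono) auto
      also have "\<dots> = \<sigma>\<^sup>2 * C * \<delta> ^ 3 / \<eta>\<^sup>2 * H (\<delta> * s)"
        using elim e by (simp add: power_mult_distrib)
      also have "\<dots> \<le> \<sigma>\<^sup>2 * C * \<delta> ^ 3 / \<eta>\<^sup>2 * (2 * \<delta> powr (- \<alpha>) * H s)"
        using elim C d H_pos[of s] by (intro mult_left_mono) (auto simp: divide_less_eq)
      also have "\<dots> = 2 * \<sigma>\<^sup>2 * C * (\<delta> powr 3 * \<delta> powr (- \<alpha>)) / \<eta>\<^sup>2 * H s"
        using d by (simp add: powr_numeral)
      also have "\<delta> powr 3 * \<delta> powr (- \<alpha>) = \<delta> powr (3 - \<alpha>)" by (simp add: powr_add[symmetric])
      finally show ?case .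
    qed
  qed
qed

lemma powr_at_top: "0 < a \<Longrightarrow> filterlim (\<lambda>s::real. s powr a) at_top at_top"
proof -
  assume a: "0 < a"
  have "filterlim (\<lambda>s::real. exp (a * ln s)) at_top at_top"
    by (rule filterlim_compose[OF exp_at_top]
        filterlim_tendsto_pos_mult_at_top[OF tendsto_const a ln_at_top])+
  then show ?thesis
    by (rule filterlim_cong[THEN iffD1, rotated 3])
      (use eventually_gt_at_top[of "0::real"] in \<open>auto simp: powr_def elim!: eventually_mono\<close>)
qed

text \<open>The immigration part of $X_0 M_1$. Both factors are independent with tails of index $\alpha$, so their product exceeds $s^{3/2}$ with probability of order $s^{-3\alpha/2}$, up to small powers, against $s^{-\alpha}$ for $H(s)$. The exponents close to $\alpha$ leave room for the Potter bounds.\<close>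

lemma product_negligible:
  assumes \<eta>: "0 < \<eta>" and c: "0 \<le> c"
  shows "((\<lambda>s. measure_pmf.prob (pair_pmf MS Bp)
      {z. \<eta> * s powr (3/2) < real (fst (fst z)) * (real (snd z) + c)} / H s) \<longlongrightarrow> 0) at_top"
proof -
  define \<gamma> where "\<gamma> = 20 / 21 * \<alpha>"
  define \<gamma>' where "\<gamma>' = 26 / 25 * \<alpha>"
  have g: "0 < \<gamma>" "\<gamma> < \<alpha>" "\<alpha> < \<gamma>'" "0 < \<gamma>'" using al by (auto simp: \<gamma>_def \<gamma>'_def)
  obtain C1 where C1: "C1 > 0" "\<forall>\<^sub>F x in at_top. H x \<le> C1 * x powr (- \<gamma>)"
    using rv_tail_upper[OF H_rv] g by auto
  obtain C2 where C2: "C2 > 0" "\<forall>\<^sub>F x in at_top. T x \<le> C2 * x powr (- \<gamma>)"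
    using rv_tail_upper[OF T_rv] g by auto
  obtain c3 where c3: "c3 > 0" "\<forall>\<^sub>F x in at_top. c3 * x powr (- \<gamma>') \<le> H x"
    using rv_tail_lower[OF H_rv] g by auto
  define C2' where "C2' = C2 * (\<eta> / 2) powr (- \<gamma>)"
  have C2': "C2' > 0" using C2 \<eta> by (simp add: C2'_def)
  have evH: "\<forall>\<^sub>F s in at_top. H (s powr a) \<le> C1 * s powr (- (a * \<gamma>))" if "0 < a" for a
    using eventually_compose_filterlim[OF C1(2) powr_at_top[OF that]] by (simp add: powr_powr)
  have evT: "\<forall>\<^sub>F s in at_top. T (\<eta> * s powr a - c) \<le> C2' * s powr (- (a * \<gamma>))" if "0 < a" for a
  proof -
    have l: "filterlim (\<lambda>s. \<eta> / 2 * s powr a) at_top at_top"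
      using \<eta> by (intro filterlim_tendsto_pos_mult_at_top[OF tendsto_const _ powr_at_top[OF that]]) auto
    have e1: "\<forall>\<^sub>F s in at_top. c \<le> \<eta> / 2 * s powr a"
      using l by (simp add: filterlim_at_top)
    show ?thesis
      using e1 eventually_compose_filterlim[OF C2(2) l] eventually_gt_at_top[of 0]
    proof eventually_elim
      case (elim s)
      have "T (\<eta> * s powr a - c) \<le> T (\<eta> / 2 * s powr a)" using elim by (intro tail_mono) simp
      also have "\<dots> \<le> C2 * (\<eta> / 2 * s powr a) powr (- \<gamma>)" by (rule elim)
      also have "(\<eta> / 2 * s powr a) powr (- \<gamma>) = (\<eta> / 2) powr (- \<gamma>) * s powr (- (a * \<gamma>))"
        using elim \<eta> by (subst powr_mult) (auto simp: powr_powr)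
      also have "C2 * ((\<eta> / 2) powr (- \<gamma>) * s powr (- (a * \<gamma>))) = C2' * s powr (- (a * \<gamma>))"
        by (simp add: C2'_def)
      finally show ?case .
    qed
  qed
  let ?A = "\<lambda>s. {z. \<eta> * s powr (3/2) < real (fst (fst z)) * (real (snd z) + c)} :: ((nat \<times> nat) \<times> nat) set"
  let ?e = "11 / 10 * \<gamma>"
  define D where "D = C2' + C1 * C2' + C1 * C2' + C1"
  have pos: "(0::real) < 11/10" "(0::real) < 2/5" "(0::real) < 7/10" "(0::real) < 4/5" "(0::real) < 3/10" "(0::real) < 6/5"
    by simp_all
  have "\<forall>\<^sub>F s in at_top. measure_pmf.prob (pair_pmf MS Bp) (?A s) \<le> D * s powr (- ?e)"
    using evT[OF pos(1)] evH[OF pos(2)] evT[OF pos(3)] evH[OF pos(4)] evT[OF pos(5)] evH[OF pos(6)] eventually_gt_at_top[of 1]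
  proof eventually_elim
    case (elim s)
    let ?X = "\<lambda>z::(nat \<times> nat) \<times> nat. real (fst (fst z))"
    let ?b = "\<lambda>a (z::(nat \<times> nat) \<times> nat). \<eta> * s powr a - c < real (snd z)"
    have layer: "?b (3/2 - a) z" if "z \<in> ?A s" "?X z \<le> s powr a" for a z
    proof -
      have "\<eta> * s powr (3/2) < s powr a * (real (snd z) + c)"
        using that c by (auto elim!: order.strict_trans2 intro!: mult_right_mono)
      moreover have "s powr (3/2) = s powr a * s powr (3/2 - a)" by (simp add: powr_add[symmetric])
      ultimately have "s powr a * (\<eta> * s powr (3/2 - a)) < s powr a * (real (snd z) + c)"
        by (simp add: mult_ac)
      then show ?thesis using elim by simp
    qed
    have "?A s \<subseteq> {z. True \<and> ?b (11/10) z} \<union> {z. s powr (2/5) < ?X z \<and> ?b (7/10) z}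
        \<union> {z. s powr (4/5) < ?X z \<and> ?b (3/10) z} \<union> {z. s powr (6/5) < ?X z \<and> True}"
    proof
      fix z assume z: "z \<in> ?A s"
      have l1: "?X z \<le> s powr (2/5) \<Longrightarrow> ?b (11/10) z" using layer[OF z, of "2/5"] by simp
      have l2: "?X z \<le> s powr (4/5) \<Longrightarrow> ?b (7/10) z" using layer[OF z, of "4/5"] by simp
      have l3: "?X z \<le> s powr (6/5) \<Longrightarrow> ?b (3/10) z" using layer[OF z, of "6/5"] by simp
      show "z \<in> {z. True \<and> ?b (11/10) z} \<union> {z. s powr (2/5) < ?X z \<and> ?b (7/10) z}
        \<union> {z. s powr (4/5) < ?X z \<and> ?b (3/10) z} \<union> {z. s powr (6/5) < ?X z \<and> True}"
        using l1 l2 l3 unfolding Un_iff mem_Collect_eq by (meson not_le)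
    qed
    then have "measure_pmf.prob (pair_pmf MS Bp) (?A s) \<le> measure_pmf.prob (pair_pmf MS Bp)
       ({z. True \<and> ?b (11/10) z} \<union> {z. s powr (2/5) < ?X z \<and> ?b (7/10) z}
        \<union> {z. s powr (4/5) < ?X z \<and> ?b (3/10) z} \<union> {z. s powr (6/5) < ?X z \<and> True})"
      by (intro measure_pmf.finite_measure_mono) auto
    also have "\<dots> \<le> measure_pmf.prob (pair_pmf MS Bp) {z. True \<and> ?b (11/10) z}
       + measure_pmf.prob (pair_pmf MS Bp) {z. s powr (2/5) < ?X z \<and> ?b (7/10) z}
       + measure_pmf.prob (pair_pmf MS Bp) {z. s powr (4/5) < ?X z \<and> ?b (3/10) z}
       + measure_pmf.prob (pair_pmf MS Bp) {z. s powr (6/5) < ?X z \<and> True}"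
      by (intro order_trans[OF measure_Un_le] add_mono order_refl) auto
    also have "measure_pmf.prob (pair_pmf MS Bp) {z. True \<and> ?b (11/10) z} = T (\<eta> * s powr (11/10) - c)"
      by (subst prob_MS_B[where P="\<lambda>_. True"]) (simp add: tail_def)
    also have "measure_pmf.prob (pair_pmf MS Bp) {z. s powr (2/5) < ?X z \<and> ?b (7/10) z}
        = H (s powr (2/5)) * T (\<eta> * s powr (7/10) - c)"
      by (subst prob_MS_B[where P="\<lambda>z. s powr (2/5) < real (fst z)"]) (simp add: tail_def, subst (2) MS_fst[symmetric], simp add: vimage_def)
    also have "measure_pmf.prob (pair_pmf MS Bp) {z. s powr (4/5) < ?X z \<and> ?b (3/10) z}
        = H (s powr (4/5)) * T (\<eta> * s powr (3/10) - c)"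
      by (subst prob_MS_B[where P="\<lambda>z. s powr (4/5) < real (fst z)"]) (simp add: tail_def, subst (2) MS_fst[symmetric], simp add: vimage_def)
    also have "measure_pmf.prob (pair_pmf MS Bp) {z. s powr (6/5) < ?X z \<and> True} = H (s powr (6/5))"
      by (subst prob_MS_B[where P="\<lambda>z. s powr (6/5) < real (fst z)"]) (simp add: tail_def, subst (2) MS_fst[symmetric], simp add: vimage_def)
    also have "H (s powr (2/5)) * T (\<eta> * s powr (7/10) - c) \<le> (C1 * s powr (- (2/5 * \<gamma>))) * (C2' * s powr (- (7/10 * \<gamma>)))"
      using elim C1 by (intro mult_mono) (auto simp: tail_nonneg)
    also have "H (s powr (4/5)) * T (\<eta> * s powr (3/10) - c) \<le> (C1 * s powr (- (4/5 * \<gamma>))) * (C2' * s powr (- (3/10 * \<gamma>)))"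
      using elim C1 by (intro mult_mono) (auto simp: tail_nonneg)
    also have "(C1 * s powr (- (2/5 * \<gamma>))) * (C2' * s powr (- (7/10 * \<gamma>))) = C1 * C2' * s powr (- ?e)"
      by (simp add: powr_add[symmetric] field_simps)
    also have "(C1 * s powr (- (4/5 * \<gamma>))) * (C2' * s powr (- (3/10 * \<gamma>))) = C1 * C2' * s powr (- ?e)"
      by (simp add: powr_add[symmetric] field_simps)
    also have "T (\<eta> * s powr (11/10) - c) \<le> C2' * s powr (- ?e)" using elim by simp
    also have "H (s powr (6/5)) \<le> C1 * s powr (- ?e)"
    proof -
      have "s powr (- (6/5 * \<gamma>)) \<le> s powr (- ?e)" using elim g by (intro powr_mono) auto
      then show ?thesis using elim C1 by (meson mult_left_mono order_trans less_imp_le)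
    qed
    finally show ?case by (simp add: D_def algebra_simps)
  qed
  then have bound: "\<forall>\<^sub>F s in at_top. norm (measure_pmf.prob (pair_pmf MS Bp) (?A s) / H s) \<le> D / c3 * s powr (- (?e - \<gamma>'))"
    using c3(2) eventually_gt_at_top[of 1]
  proof eventually_elim
    case (elim s)
    have "norm (measure_pmf.prob (pair_pmf MS Bp) (?A s) / H s) = measure_pmf.prob (pair_pmf MS Bp) (?A s) / H s"
      using H_pos[of s] by simp
    also have "\<dots> \<le> (D * s powr (- ?e)) / (c3 * s powr (- \<gamma>'))"
      using elim c3 H_pos[of s] C1 C2' by (intro frac_le) (auto simp: D_def intro!: mult_nonneg_nonneg add_nonneg_nonneg)
    also have "\<dots> = D / c3 * s powr (- (?e - \<gamma>'))"
    proof -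
      have "s powr (- ?e) / s powr (- \<gamma>') = s powr (- (?e - \<gamma>'))" by (simp add: powr_diff[symmetric])
      then show ?thesis by (simp only: times_divide_times_eq[symmetric])
    qed
    finally show ?case .
  qed
  have "((\<lambda>s. D / c3 * s powr (- (?e - \<gamma>'))) \<longlongrightarrow> D / c3 * 0) at_top"
    using al by (intro tendsto_intros tendsto_neg_powr filterlim_ident) (simp add: \<gamma>_def \<gamma>'_def)
  from Lim_null_comparison[OF bound] this show ?thesis by simp
qed

lemma expectation_K:
  fixes f :: "nat \<Rightarrow> real"
  assumes "\<And>l. \<bar>f l\<bar> \<le> C"
  shows "measure_pmf.expectation (K m) f = measure_pmf.expectation Bp (\<lambda>b. measure_pmf.expectation (S m) (\<lambda>s. f (s + b)))"
proof -
  have "K m = bind_pmf Bp (\<lambda>b. map_pmf (\<lambda>s. s + b) (S m))"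
    unfolding K_def pair_pmf_def map_bind_pmf
    by (subst bind_commute_pmf) (simp add: map_pmf_def bind_assoc_pmf bind_return_pmf)
  then show ?thesis using assms by (simp add: expectation_bind_pmf[where C=C])
qed

text \<open>Adding an immigrant number does not affect the central limit theorem for the offspring, since it is negligible compared with $\sqrt m$.\<close>

lemma K_clt:
  fixes m :: "nat \<Rightarrow> nat" and \<Phi> :: "nat \<Rightarrow> nat \<Rightarrow> real"
  assumes m: "filterlim (\<lambda>i. real (m i)) at_top sequentially"
    and \<Phi>: "\<And>i l. \<bar>\<Phi> i l\<bar> \<le> C" and h: "h \<in> borel_measurable borel"
    and conv: "\<And>w l. (\<lambda>i. (real (l i) - \<mu> * real (m i) - \<mu>B) / sqrt (real (m i))) \<longlonglongrightarrow> w \<Longrightarrow> (\<lambda>i. \<Phi> i (l i)) \<longlonglongrightarrow> h w"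
  shows "(\<lambda>i. measure_pmf.expectation (K (m i)) (\<Phi> i)) \<longlonglongrightarrow> (\<integral>w. h w \<partial>normal_law \<sigma>)"
proof -
  have sq: "filterlim (\<lambda>i. sqrt (real (m i))) at_top sequentially"
    by (rule filterlim_compose[OF sqrt_at_top m])
  have "(\<lambda>i. measure_pmf.expectation (S (m i)) (\<lambda>s. \<Phi> i (s + b))) \<longlonglongrightarrow> (\<integral>w. h w \<partial>normal_law \<sigma>)" for b
  proof -
    let ?n = "\<lambda>i l. (real l - \<mu> * real (m i)) / sqrt (real (m i))"
    define \<nu> where "\<nu> i = distr (S (m i)) borel (?n i)" for i
    define g where "g i w = \<Phi> i (nat \<lfloor>w * sqrt (real (m i)) + \<mu> * real (m i) + 1 / 2\<rfloor> + b)" for i w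
    have nat_m: "filterlim m at_top sequentially"
      using m by (simp add: filterlim_real_sequentially filterlim_sequentially_iff_filterlim_real)
    have "(\<lambda>i. \<integral>w. g i w \<partial>\<nu> i) \<longlonglongrightarrow> (\<integral>w. h w \<partial>normal_law \<sigma>)"
    proof (rule weak_conv_extended_mapping)
      show "real_distribution (\<nu> i)" for i
        unfolding \<nu>_def by (intro prob_space.real_distribution_distr measure_pmf.prob_space_axioms) auto
      show "real_distribution (normal_law \<sigma>)"
        using sig prob_space_normal_density by (auto simp: real_distribution_def real_distribution_axioms_def)
      show "weak_conv_m \<nu> (normal_law \<sigma>)"
        unfolding weak_conv_m_def weak_conv_def \<nu>_def
        using S_clt filterlim_compose[OF _ nat_m] unfolding weak_conv_m_def weak_conv_def by blast
      show "g i \<in> borel_measurable borel" for i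
        unfolding g_def by measurable
      show "h \<in> borel_measurable borel" "\<bar>g i w\<bar> \<le> C" for i w using h \<Phi> by (auto simp: g_def)
      show "AE y in normal_law \<sigma>. \<forall>x. x \<longlonglongrightarrow> y \<longrightarrow> (\<lambda>i. g i (x i)) \<longlonglongrightarrow> h y"
      proof (intro AE_I2 allI impI)
        fix y x assume x: "x \<longlonglongrightarrow> (y::real)"
        define l where "l i = nat \<lfloor>x i * sqrt (real (m i)) + \<mu> * real (m i) + 1 / 2\<rfloor> + b" for i
        have "filterlim (\<lambda>i. x i + \<mu> * sqrt (real (m i))) at_top sequentially"
          using mu by (intro filterlim_tendsto_add_at_top[OF x] filterlim_tendsto_pos_mult_at_top[OF tendsto_const _ sq])
        then have "\<forall>\<^sub>F i in sequentially. 0 \<le> x i + \<mu> * sqrt (real (m i))" by (simp add: filterlim_at_top)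
        moreover have "\<forall>\<^sub>F i in sequentially. 1 \<le> sqrt (real (m i))" using sq unfolding filterlim_at_top by blast
        ultimately have bound: "\<forall>\<^sub>F i in sequentially. norm ((real (l i) - \<mu> * real (m i) - \<mu>B) / sqrt (real (m i)) - x i)
            \<le> (1 + \<bar>real b - \<mu>B\<bar>) / sqrt (real (m i))"
        proof eventually_elim
          case (elim i)
          let ?r = "sqrt (real (m i))" and ?y = "x i * sqrt (real (m i)) + \<mu> * real (m i)"
          have "?y = ?r * (x i + \<mu> * ?r)" by (simp add: algebra_simps flip: power2_eq_square)
          then have "0 \<le> ?y" using elim by simp
          then have "\<bar>real (l i) - real b - ?y\<bar> \<le> 1" unfolding l_def by linarith
          then have "\<bar>(real (l i) - \<mu> * real (m i) - \<mu>B) - x i * ?r\<bar> \<le> 1 + \<bar>real b - \<mu>B\<bar>" by linarith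
          then have "\<bar>(real (l i) - \<mu> * real (m i) - \<mu>B) - x i * ?r\<bar> / ?r \<le> (1 + \<bar>real b - \<mu>B\<bar>) / ?r"
            by (intro divide_right_mono) auto
          moreover have "\<bar>(real (l i) - \<mu> * real (m i) - \<mu>B) - x i * ?r\<bar> / ?r = norm ((real (l i) - \<mu> * real (m i) - \<mu>B) / ?r - x i)"
          proof -
            have "((real (l i) - \<mu> * real (m i) - \<mu>B) - x i * ?r) / ?r = (real (l i) - \<mu> * real (m i) - \<mu>B) / ?r - x i"
              using elim by (simp add: diff_divide_distrib)
            then show ?thesis using elim by (metis abs_divide abs_of_nonneg real_norm_def real_sqrt_ge_zero of_nat_0_le_iff)
          qed
          ultimately show ?case by simp
        qed
        have "((\<lambda>i. (1 + \<bar>real b - \<mu>B\<bar>) / sqrt (real (m i))) \<longlongrightarrow> 0) sequentially"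
          by (rule tendsto_divide_0[OF tendsto_const filterlim_at_top_imp_at_infinity[OF sq]])
        from Lim_transform[OF x Lim_null_comparison[OF bound this]]
        have "(\<lambda>i. (real (l i) - \<mu> * real (m i) - \<mu>B) / sqrt (real (m i))) \<longlonglongrightarrow> y" .
        then show "(\<lambda>i. g i (x i)) \<longlonglongrightarrow> h y" unfolding g_def l_def[symmetric] by (rule conv)
      qed
    qed
    moreover have "\<forall>\<^sub>F i in sequentially. (\<integral>w. g i w \<partial>\<nu> i) = measure_pmf.expectation (S (m i)) (\<lambda>s. \<Phi> i (s + b))"
    proof -
      have "\<forall>\<^sub>F i in sequentially. 1 \<le> sqrt (real (m i))" using sq unfolding filterlim_at_top by blast
      then show ?thesis
      proof eventually_elim
        case (elim i)
        have [measurable]: "g i \<in> borel_measurable borel" unfolding g_def by measurable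
        have "\<lfloor>real l + 1 / 2\<rfloor> = int l" for l by linarith
        then have "g i (?n i l) = \<Phi> i (l + b)" for l using elim by (simp add: g_def)
        then show ?case unfolding \<nu>_def by (subst integral_distr) auto
      qed
    qed
    ultimately show ?thesis by (rule Lim_transform_eventually)
  qed
  then have "(\<lambda>i. measure_pmf.expectation Bp (\<lambda>b. measure_pmf.expectation (S (m i)) (\<lambda>s. \<Phi> i (s + b))))
      \<longlonglongrightarrow> measure_pmf.expectation Bp (\<lambda>b. \<integral>w. h w \<partial>normal_law \<sigma>)"
  proof (intro integral_dominated_convergence[where w="\<lambda>_. C"])
    fix i
    show "AE b in measure_pmf Bp. norm (measure_pmf.expectation (S (m i)) (\<lambda>s. \<Phi> i (s + b))) \<le> C"
    proof (rule AE_I2)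
      fix b
      have "integrable (S (m i)) (\<lambda>s. \<bar>\<Phi> i (s + b)\<bar>)" using \<Phi> by (intro integrable_pmf_bounded[where C=C]) auto
      then show "norm (measure_pmf.expectation (S (m i)) (\<lambda>s. \<Phi> i (s + b))) \<le> C"
        using \<Phi> by (intro order_trans[OF integral_norm_bound] measure_pmf.integral_le_const) auto
    qed
  qed auto
  then show ?thesis using \<Phi> by (simp add: expectation_K[where C=C])
qed

end

section \<open>Scaling limit of a path started at a high level\<close>

lemma integral_uniform_measure_eq:
  fixes f :: "'b \<Rightarrow> real"
  assumes A: "A \<in> sets M" "emeasure M A \<noteq> 0" "emeasure M A \<noteq> \<infinity>" and f: "f \<in> borel_measurable M"
  shows "(\<integral>x. f x \<partial>uniform_measure M A) = (\<integral>x. f x * indicator A x \<partial>M) / measure M A"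
proof -
  have pos: "0 < measure M A"
    using A by (simp add: measure_def enn2real_positive_iff less_top[symmetric] zero_less_iff_neq_zero)
  have "uniform_measure M A = density M (\<lambda>x. ennreal (indicator A x / measure M A))"
    unfolding uniform_measure_def using A pos
    by (intro density_cong AE_I2)
      (auto simp: emeasure_eq_ennreal_measure indicator_def divide_ennreal[symmetric] ennreal_1[symmetric] simp del: ennreal_1)
  then have "(\<integral>x. f x \<partial>uniform_measure M A) = (\<integral>x. (indicator A x / measure M A) *\<^sub>R f x \<partial>M)"
    using A f by (simp add: integral_density)
  also have "\<dots> = (\<integral>x. (f x * indicator A x) / measure M A \<partial>M)"
    by (intro Bochner_Integration.integral_cong) auto
  finally show ?thesis by simp
qed

context branching begin

definition nu :: "real measure" where
  "nu = density lborel (\<lambda>q. ennreal (\<alpha> * q powr (- \<alpha> - 1)) * indicator {0<..} q)"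

lemma sets_nu[simp, measurable_cong]: "sets nu = sets borel"
  and space_nu[simp]: "space nu = UNIV"
  by (simp_all add: nu_def)

lemma emeasure_nu: assumes q: "0 < q" shows "emeasure nu {q<..} = ennreal (q powr (- \<alpha>))"
proof -
  have "((\<lambda>x. - (x powr (- \<alpha>))) \<longlongrightarrow> - 0) at_top"
    using al by (intro tendsto_intros tendsto_neg_powr filterlim_ident) auto
  then have "(\<integral>\<^sup>+x. ennreal (\<alpha> * x powr (- \<alpha> - 1)) * indicator {q..} x \<partial>lborel) = 0 - (- (q powr (- \<alpha>)))"
  proof (intro nn_integral_FTC_atLeast)
    fix x assume "q \<le> x"
    then show "DERIV (\<lambda>x. - (x powr (- \<alpha>))) x :> \<alpha> * x powr (- \<alpha> - 1)"
      using q by (auto intro!: derivative_eq_intros)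
    show "0 \<le> \<alpha> * x powr (- \<alpha> - 1)" using al by simp
  qed auto
  moreover have "emeasure nu {q<..} = (\<integral>\<^sup>+x. ennreal (\<alpha> * x powr (- \<alpha> - 1)) * indicator {q..} x \<partial>lborel)"
    unfolding nu_def using q
    by (subst emeasure_density)
      (auto intro!: nn_integral_cong_AE simp: indicator_def intro: AE_mp[OF AE_lborel_singleton[of q]])
  ultimately show ?thesis by simp
qed

lemma measure_nu: "0 < q \<Longrightarrow> measure nu {q<..} = q powr (- \<alpha>)"
  by (simp add: measure_def emeasure_nu)

lemma AE_nu_pos: "AE q in nu. 0 < q"
  unfolding nu_def by (subst AE_density) (auto simp: indicator_def)

lemma sigma_finite_nu: "sigma_finite_measure nu"
proof
  have "emeasure nu {..0} = 0"
    using AE_nu_pos by (subst AE_iff_measurable[symmetric, of _ _ "\<lambda>q. 0 < q"]) (auto simp: not_less)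
  then show "\<exists>A. countable A \<and> A \<subseteq> sets nu \<and> \<Union> A = space nu \<and> (\<forall>a\<in>A. emeasure nu a \<noteq> \<infinity>)"
  proof (intro exI[of _ "insert {..0} (range (\<lambda>n::nat. {1 / real (Suc n)<..}))"] conjI ballI)
    show "\<Union> (insert {..0} (range (\<lambda>n::nat. {1 / real (Suc n)<..}))) = space nu"
    proof (auto, rule ccontr)
      fix x :: real assume "\<not> x \<le> 0" and *: "\<forall>n. \<not> 1 / (1 + real n) < x"
      then obtain n where "1 / real (Suc n) < x" using nat_approx_posE[of x] by (auto simp: not_le)
      then show False using * by (auto simp: add.commute)
    qed
  qed (auto simp: emeasure_nu)
qed

abbreviation "NL \<equiv> normal_law \<sigma>"

lemma prob_space_NL: "prob_space NL"
  using sig by (rule prob_space_normal_density)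

text \<open>Above a fixed fraction $\delta s$, the starting value scaled by $s$ has the Pareto measure \<open>nu\<close> as its limit; this is regular variation of $H$ turned into weak convergence.\<close>

lemma start_limit:
  fixes s :: "nat \<Rightarrow> real" and g :: "nat \<Rightarrow> nat \<Rightarrow> real"
  assumes s: "filterlim s at_top sequentially" and \<delta>: "0 < \<delta>"
    and g: "\<And>i l. \<bar>g i l\<bar> \<le> C" and h: "h \<in> borel_measurable borel"
    and conv: "\<And>l q. (\<lambda>i. real (l i) / s i) \<longlonglongrightarrow> q \<Longrightarrow> 0 < q \<Longrightarrow> (\<lambda>i. g i (l i)) \<longlonglongrightarrow> h q"
  shows "(\<lambda>i. measure_pmf.expectation \<pi> (\<lambda>l. g i l * indicator {l. \<delta> * s i < real l} l) / H (s i))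
    \<longlonglongrightarrow> (\<integral>q. h q * indicator {\<delta><..} q \<partial>nu)"
proof -
  define A where "A i = {l. \<delta> * s i < real l}" for i
  define g' where "g' i w = g i (nat \<lfloor>w * s i + 1 / 2\<rfloor>)" for i w
  define L where "L i = distr (uniform_measure (measure_pmf \<pi>) (A i)) borel (\<lambda>l. real l / s i)" for i
  define P where "P = uniform_measure nu {\<delta><..}"
  have Apos: "measure_pmf.prob \<pi> (A i) = H (\<delta> * s i)" for i by (simp add: A_def tail_def)
  have A0: "emeasure (measure_pmf \<pi>) (A i) \<noteq> 0" for i
    using H_pos[of "\<delta> * s i"] by (simp add: measure_pmf.emeasure_eq_measure Apos)
  have psA: "prob_space (uniform_measure (measure_pmf \<pi>) (A i))" for i
    by (intro prob_space_uniform_measure A0) simp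
  have psP: "prob_space P" unfolding P_def
    by (intro prob_space_uniform_measure) (use \<delta> in \<open>auto simp: emeasure_nu\<close>)
  have rL: "real_distribution (L i)" for i
    unfolding L_def by (intro prob_space.real_distribution_distr[OF psA]) simp
  have rP: "real_distribution P"
    using psP by (auto simp: real_distribution_def real_distribution_axioms_def P_def)
  have slim: "\<forall>\<^sub>F i in sequentially. 0 < s i" using s by (auto simp: filterlim_at_top_dense)
  have cdf_eq: "cdf M x = 1 - measure M {x<..}" if "real_distribution M" for M x
  proof -
    interpret real_distribution M by fact
    have "{..x} = space M - {x<..}" by auto
    then show ?thesis using prob_compl[of "{x<..}"] unfolding cdf_def by simp
  qed
  have Lm: "measure (L i) {x<..} = (if x < \<delta> then 1 else H (x * s i) / H (\<delta> * s i))" if "0 < s i" for x i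
  proof -
    have "measure (L i) {x<..} = measure (uniform_measure (measure_pmf \<pi>) (A i)) {l. x * s i < real l}"
      unfolding L_def using that by (subst measure_distr) (auto simp: vimage_def field_simps)
    also have "\<dots> = measure_pmf.prob \<pi> (A i \<inter> {l. x * s i < real l}) / H (\<delta> * s i)"
      using A0 by (subst measure_uniform_measure) (auto simp: Apos)
    also have "A i \<inter> {l. x * s i < real l} = (if x < \<delta> then A i else {l. x * s i < real l})"
    proof (cases "x < \<delta>")
      case True
      then have "x * s i \<le> \<delta> * s i" using that by (intro mult_right_mono) auto
      then show ?thesis using True by (auto simp: A_def)
    next
      case False
      then have "\<delta> * s i \<le> x * s i" using that by (intro mult_right_mono) auto
      then show ?thesis using False by (auto simp: A_def)
    qed
    finally show ?thesis using Apos[of i] H_pos[of "\<delta> * s i"] by (auto simp: tail_def)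
  qed
  have Pm: "measure P {x<..} = (if x < \<delta> then 1 else x powr (- \<alpha>) / \<delta> powr (- \<alpha>))" for x
  proof -
    have "measure P {x<..} = measure nu ({\<delta><..} \<inter> {x<..}) / measure nu {\<delta><..}"
      unfolding P_def using \<delta> by (subst measure_uniform_measure) (auto simp: emeasure_nu)
    also have "{\<delta><..} \<inter> {x<..} = (if x < \<delta> then {\<delta><..} else {x<..})" by auto
    finally show ?thesis using \<delta> by (auto simp: measure_nu)
  qed
  have wc: "weak_conv_m L P"
    unfolding weak_conv_m_def weak_conv_def
  proof (intro allI impI)
    fix x
    have "(\<lambda>i. 1 - (if x < \<delta> then 1 else H (x * s i) / H (\<delta> * s i))) \<longlonglongrightarrow> 1 - (if x < \<delta> then 1 else x powr (- \<alpha>) / \<delta> powr (- \<alpha>))"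
    proof (cases "x < \<delta>")
      case False
      then have "0 < x" using \<delta> by simp
      then have "((\<lambda>t. (H (x * t) / H t) / (H (\<delta> * t) / H t)) \<longlongrightarrow> x powr (- \<alpha>) / \<delta> powr (- \<alpha>)) at_top"
        using \<delta> by (intro tendsto_intros H_ratio) auto
      then have "((\<lambda>t. H (x * t) / H (\<delta> * t)) \<longlongrightarrow> x powr (- \<alpha>) / \<delta> powr (- \<alpha>)) at_top"
        by (rule Lim_transform_eventually) (use H_pos in \<open>auto intro!: always_eventually simp: less_imp_neq[symmetric] dest: less_imp_neq[THEN not_sym]\<close>)
      from filterlim_compose[OF this s] show ?thesis using False by (auto intro!: tendsto_intros)
    qed simp
    then have "(\<lambda>i. 1 - measure (L i) {x<..}) \<longlonglongrightarrow> 1 - measure P {x<..}"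
      unfolding Pm by (rule Lim_transform_eventually) (use slim Lm in \<open>auto elim!: eventually_mono\<close>)
    then show "(\<lambda>i. cdf (L i) x) \<longlonglongrightarrow> cdf P x" by (simp add: cdf_eq rL rP)
  qed
  have "(\<lambda>i. \<integral>w. g' i w \<partial>L i) \<longlonglongrightarrow> (\<integral>q. h q \<partial>P)"
  proof (rule weak_conv_extended_mapping[OF rL rP wc])
    show "g' i \<in> borel_measurable borel" "\<bar>g' i w\<bar> \<le> C" for i w
      unfolding g'_def using g by measurable
    have "AE y in P. y \<in> {\<delta><..}"
      unfolding P_def using \<delta> by (intro AE_uniform_measureI) auto
    then show "AE y in P. \<forall>x. x \<longlonglongrightarrow> y \<longrightarrow> (\<lambda>i. g' i (x i)) \<longlonglongrightarrow> h y"
    proof eventually_elim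
      case (elim y)
      then have y: "0 < y" using \<delta> by simp
      show ?case
      proof (intro allI impI)
        fix x assume x: "x \<longlonglongrightarrow> y"
        define l where "l i = nat \<lfloor>x i * s i + 1 / 2\<rfloor>" for i
        have "\<forall>\<^sub>F i in sequentially. 0 < x i" using x y by (rule order_tendstoD)
        then have bound: "\<forall>\<^sub>F i in sequentially. norm (real (l i) / s i - x i) \<le> 1 / s i"
          using slim
        proof eventually_elim
          case (elim i)
          have "0 \<le> x i * s i" using elim by simp
          then have "\<bar>real (l i) - x i * s i\<bar> \<le> 1" unfolding l_def by linarith
          then have "\<bar>real (l i) - x i * s i\<bar> / s i \<le> 1 / s i" using elim by (intro divide_right_mono) auto
          moreover have "real (l i) / s i - x i = (real (l i) - x i * s i) / s i" using elim by (simp add: diff_divide_distrib)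
          ultimately show ?case using elim by (simp add: abs_divide)
        qed
        have "((\<lambda>i. 1 / s i) \<longlongrightarrow> 0) sequentially"
          by (rule tendsto_divide_0[OF tendsto_const filterlim_at_top_imp_at_infinity[OF s]])
        from Lim_transform[OF x Lim_null_comparison[OF bound this]]
        have "(\<lambda>i. real (l i) / s i) \<longlonglongrightarrow> y" .
        then show "(\<lambda>i. g' i (x i)) \<longlonglongrightarrow> h y" unfolding g'_def l_def[symmetric] using y by (rule conv)
      qed
    qed
  qed (rule h)
  moreover have "\<forall>\<^sub>F i in sequentially. (\<integral>w. g' i w \<partial>L i) = measure_pmf.expectation \<pi> (\<lambda>l. g i l * indicator (A i) l) / H (\<delta> * s i)"
    using slim
  proof eventually_elim
    case (elim i)
    have [measurable]: "g' i \<in> borel_measurable borel" unfolding g'_def by measurable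
    have "\<lfloor>real l + 1 / 2\<rfloor> = int l" for l by linarith
    then have "g' i (real l / s i) = g i l" for l using elim by (simp add: g'_def)
    then have "(\<integral>w. g' i w \<partial>L i) = (\<integral>l. g i l \<partial>uniform_measure (measure_pmf \<pi>) (A i))"
      unfolding L_def by (subst integral_distr) auto
    also have "\<dots> = measure_pmf.expectation \<pi> (\<lambda>l. g i l * indicator (A i) l) / measure_pmf.prob \<pi> (A i)"
      using A0 by (intro integral_uniform_measure_eq) auto
    finally show ?case by (simp add: Apos)
  qed
  ultimately have "(\<lambda>i. measure_pmf.expectation \<pi> (\<lambda>l. g i l * indicator (A i) l) / H (\<delta> * s i)) \<longlonglongrightarrow> (\<integral>q. h q \<partial>P)"
    by (rule Lim_transform_eventually)
  moreover have "(\<lambda>i. H (\<delta> * s i) / H (s i)) \<longlonglongrightarrow> \<delta> powr (- \<alpha>)"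
    using filterlim_compose[OF H_ratio[OF \<delta>] s] .
  ultimately have "(\<lambda>i. (measure_pmf.expectation \<pi> (\<lambda>l. g i l * indicator (A i) l) / H (\<delta> * s i)) * (H (\<delta> * s i) / H (s i)))
      \<longlonglongrightarrow> (\<integral>q. h q \<partial>P) * \<delta> powr (- \<alpha>)"
    by (rule tendsto_mult)
  also have "(\<lambda>i. (measure_pmf.expectation \<pi> (\<lambda>l. g i l * indicator (A i) l) / H (\<delta> * s i)) * (H (\<delta> * s i) / H (s i)))
     = (\<lambda>i. measure_pmf.expectation \<pi> (\<lambda>l. g i l * indicator (A i) l) / H (s i))"
  proof
    fix i show "(measure_pmf.expectation \<pi> (\<lambda>l. g i l * indicator (A i) l) / H (\<delta> * s i)) * (H (\<delta> * s i) / H (s i))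
     = measure_pmf.expectation \<pi> (\<lambda>l. g i l * indicator (A i) l) / H (s i)"
      using H_pos[of "\<delta> * s i"] by simp
  qed
  also have "(\<integral>q. h q \<partial>P) * \<delta> powr (- \<alpha>) = (\<integral>q. h q * indicator {\<delta><..} q \<partial>nu)"
    unfolding P_def using \<delta> h by (subst integral_uniform_measure_eq) (auto simp: emeasure_nu measure_nu)
  finally show ?thesis by (simp add: A_def)
qed

abbreviation "NN \<equiv> PiM (UNIV :: nat set) (\<lambda>_. NL)"

lemma prob_space_NN: "prob_space NN"
  by (intro prob_space_PiM prob_space_NL)

lemma sets_NN[measurable_cong]: "sets NN = sets (PiM UNIV (\<lambda>_. borel))"
  by (intro sets_PiM_cong) auto

lemma space_NN[simp]: "space NN = UNIV"
  by (simp add: space_PiM)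

text \<open>A coordinate of an i.i.d. normal sequence may be replaced by a fresh normal variable; this is how one step of the chain appends one normal coordinate to the limit.\<close>

lemma resample_coordinate:
  fixes f :: "(nat \<Rightarrow> real) \<Rightarrow> real"
  assumes f[measurable]: "f \<in> borel_measurable (PiM UNIV (\<lambda>_. borel))" and b: "\<And>z. \<bar>f z\<bar> \<le> C"
  shows "(\<integral>z. (\<integral>w. f (z(n := w)) \<partial>NL) \<partial>NN) = (\<integral>z. f z \<partial>NN)"
proof -
  interpret N: prob_space NL by (rule prob_space_NL)
  interpret I: prob_space NN by (rule prob_space_NN)
  interpret NI: pair_prob_space NL NN ..
  have m: "(\<lambda>(w, z). z(n := w)) \<in> NL \<Otimes>\<^sub>M NN \<rightarrow>\<^sub>M NN"
    unfolding case_prod_beta by (rule measurable_fun_upd[where J=UNIV]) auto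
  have i: "integrable (NL \<Otimes>\<^sub>M NN) (\<lambda>(w, z). f (z(n := w)))"
    using measurable_compose[OF m, of f borel] b
    by (intro NI.P.integrable_const_bound[where B=C]) (auto simp: case_prod_beta')
  have "(\<integral>z. f z \<partial>NN) = (\<integral>z. f z \<partial>distr (NL \<Otimes>\<^sub>M NN) NN (\<lambda>(w, z). z(n := w)))"
    using distr_pair_PiM_eq_PiM[of UNIV "\<lambda>_. NL" n] prob_space_NL by simp
  also have "\<dots> = (\<integral>x. (case x of (w, z) \<Rightarrow> f (z(n := w))) \<partial>(NL \<Otimes>\<^sub>M NN))"
    by (subst integral_distr[OF m]) (auto simp: case_prod_beta')
  also have "\<dots> = (\<integral>z. (\<integral>w. f (z(n := w)) \<partial>NL) \<partial>NN)"
    using NI.integral_snd[OF i] by simp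
  finally show ?thesis by simp
qed

primrec path :: "nat \<Rightarrow> (nat \<Rightarrow> nat) pmf" where
  "path 0 = map_pmf (\<lambda>m. (\<lambda>_. 0)(0 := m)) \<pi>"
| "path (Suc n) = bind_pmf (path n) (\<lambda>p. map_pmf (\<lambda>l. p(Suc n := l)) (K (p n)))"

definition innov :: "(nat \<Rightarrow> nat) \<Rightarrow> nat \<Rightarrow> real" where
  "innov p k = (real (p (Suc k)) - \<mu> * real (p k) - \<mu>B) / sqrt (real (p k))"

text \<open>As long as the normalised innovations converge, each step is $X_{k+1} = \mu X_k$ up to an error of order $\sqrt{X_k}$, invisible on the scale $s$.\<close>

lemma path_scaling:
  assumes s: "filterlim s at_top sequentially" and q: "(\<lambda>i. real (p i 0) / s i) \<longlonglongrightarrow> q" "0 < q"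
    and z: "\<And>k. k < n \<Longrightarrow> (\<lambda>i. innov (p i) k) \<longlonglongrightarrow> z k" and k: "k \<le> n"
  shows "(\<lambda>i. real (p i k) / s i) \<longlonglongrightarrow> \<mu> ^ k * q"
  using k
proof (induction k)
  case (Suc k)
  then have IH: "(\<lambda>i. real (p i k) / s i) \<longlonglongrightarrow> \<mu> ^ k * q" and zk: "(\<lambda>i. innov (p i) k) \<longlonglongrightarrow> z k"
    using z by auto
  have s0: "((\<lambda>i. c / s i) \<longlonglongrightarrow> 0)" for c
    by (rule tendsto_divide_0[OF tendsto_const filterlim_at_top_imp_at_infinity[OF s]])
  have sq0: "((\<lambda>i. 1 / sqrt (s i)) \<longlonglongrightarrow> 0)"
    by (rule tendsto_divide_0[OF tendsto_const filterlim_at_top_imp_at_infinity[OF filterlim_compose[OF sqrt_at_top s]]])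
  have "(\<lambda>i. \<mu> * (real (p i k) / s i) + sqrt (real (p i k) / s i) * (1 / sqrt (s i)) * innov (p i) k + \<mu>B / s i)
      \<longlonglongrightarrow> \<mu> * (\<mu> ^ k * q) + sqrt (\<mu> ^ k * q) * 0 * z k + 0"
    by (intro tendsto_intros IH zk s0 sq0)
  moreover have "\<forall>\<^sub>F i in sequentially. \<mu> * (real (p i k) / s i) + sqrt (real (p i k) / s i) * (1 / sqrt (s i)) * innov (p i) k + \<mu>B / s i
      = real (p i (Suc k)) / s i"
  proof -
    have "0 < \<mu> ^ k * q" using mu q by simp
    with IH have "\<forall>\<^sub>F i in sequentially. 0 < real (p i k) / s i" by (rule order_tendstoD)
    moreover have "\<forall>\<^sub>F i in sequentially. 0 < s i" using s by (auto simp: filterlim_at_top_dense)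
    ultimately show ?thesis
    proof eventually_elim
      case (elim i)
      then have pos: "0 < s i" "0 < real (p i k)" by (auto simp: zero_less_divide_iff)
      have "sqrt (real (p i k) / s i) * (1 / sqrt (s i)) * innov (p i) k = (real (p i (Suc k)) - \<mu> * real (p i k) - \<mu>B) / s i"
        using pos by (simp add: innov_def real_sqrt_divide)
      then show ?case using pos by (simp add: field_simps)
    qed
  qed
  ultimately have "(\<lambda>i. real (p i (Suc k)) / s i) \<longlonglongrightarrow> \<mu> * (\<mu> ^ k * q) + sqrt (\<mu> ^ k * q) * 0 * z k + 0"
    by (rule Lim_transform_eventually)
  then show ?case by (simp add: mult.assoc)
qed (use q in simp)

text \<open>Induction on the length of the path. The functionals may depend on all scaled values and innovations, but only the initial value and the normal coordinates survive in the limit, since $X_{k+1}/X_k \rightarrow \mu$.\<close>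

lemma path_limit:
  fixes s :: "nat \<Rightarrow> real" and \<Phi> :: "nat \<Rightarrow> (nat \<Rightarrow> nat) \<Rightarrow> real" and h :: "real \<Rightarrow> (nat \<Rightarrow> real) \<Rightarrow> real"
  assumes s: "filterlim s at_top sequentially" and \<delta>: "0 < \<delta>"
    and "\<And>i p. \<bar>\<Phi> i p\<bar> \<le> C" and "\<And>q z. \<bar>h q z\<bar> \<le> C"
    and "(\<lambda>(q, z). h q z) \<in> borel_measurable (borel \<Otimes>\<^sub>M PiM UNIV (\<lambda>_. borel))"
    and "\<And>q z z'. (\<And>k. k < n \<Longrightarrow> z k = z' k) \<Longrightarrow> h q z = h q z'"
    and "\<And>p q z. (\<lambda>i. real (p i 0) / s i) \<longlonglongrightarrow> q \<Longrightarrow> 0 < q \<Longrightarrow> (\<And>k. k < n \<Longrightarrow> (\<lambda>i. innov (p i) k) \<longlonglongrightarrow> z k)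
        \<Longrightarrow> (\<lambda>i. \<Phi> i (p i)) \<longlonglongrightarrow> h q z"
  shows "(\<lambda>i. measure_pmf.expectation (path n) (\<lambda>p. \<Phi> i p * indicator {p. \<delta> * s i < real (p 0)} p) / H (s i))
    \<longlonglongrightarrow> (\<integral>q. (\<integral>z. h q z \<partial>NN) * indicator {\<delta><..} q \<partial>nu)"
  using assms(3-)
proof (induction n arbitrary: \<Phi> h)
  case 0
  interpret I: prob_space NN by (rule prob_space_NN)
  have hc: "h q z = h q (\<lambda>_. 0)" for q z by (rule 0(4)) simp
  have int: "(\<integral>z. h q z \<partial>NN) = h q (\<lambda>_. 0)" for q
    by (subst hc) (simp add: I.prob_space[unfolded space_NN])
  have "(\<lambda>q. (\<lambda>(q, z). h q z) (q, (\<lambda>_. 0))) \<in> borel_measurable borel"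
    by (rule measurable_compose[OF _ 0(3)]) (auto simp: space_PiM)
  then have meas: "(\<lambda>q. h q (\<lambda>_. 0)) \<in> borel_measurable borel" by simp
  have "(\<lambda>i. measure_pmf.expectation \<pi> (\<lambda>l. \<Phi> i ((\<lambda>_. 0)(0 := l)) * indicator {l. \<delta> * s i < real l} l) / H (s i))
    \<longlonglongrightarrow> (\<integral>q. h q (\<lambda>_. 0) * indicator {\<delta><..} q \<partial>nu)"
  proof (rule start_limit[OF s \<delta> _ meas])
    show "\<bar>\<Phi> i ((\<lambda>_. 0)(0 := l))\<bar> \<le> C" for i l by (rule 0(1))
    show "(\<lambda>i. \<Phi> i ((\<lambda>_. 0)(0 := l i))) \<longlonglongrightarrow> h q (\<lambda>_. 0)" if "(\<lambda>i. real (l i) / s i) \<longlonglongrightarrow> q" "0 < q" for l q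
      by (rule 0(5)) (use that in simp_all)
  qed
  then show ?case by (simp add: int indicator_def)
next
  case (Suc n)
  interpret N: prob_space NL by (rule prob_space_NL)
  interpret I: prob_space NN by (rule prob_space_NN)
  note hm[measurable] = Suc.prems(3)
  define \<Phi>' where "\<Phi>' i p = measure_pmf.expectation (K (p n)) (\<lambda>l. \<Phi> i (p(Suc n := l)))" for i p
  define h' where "h' q z = (\<integral>w. h q (z(n := w)) \<partial>NL)" for q and z :: "nat \<Rightarrow> real"
  have upd: "(\<lambda>x. (snd (fst x))(n := snd x)) \<in> (borel \<Otimes>\<^sub>M PiM UNIV (\<lambda>_. borel)) \<Otimes>\<^sub>M borel \<rightarrow>\<^sub>M PiM (UNIV :: nat set) (\<lambda>_. borel :: real measure)"
    by (rule measurable_fun_upd[where J=UNIV]) auto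
  have "(\<lambda>x. (\<lambda>(q, z). h q z) (fst (fst x), (snd (fst x))(n := snd x))) \<in> borel_measurable ((borel \<Otimes>\<^sub>M PiM UNIV (\<lambda>_. borel)) \<Otimes>\<^sub>M borel)"
    by (rule measurable_compose[OF _ hm]) (intro measurable_Pair upd, auto)
  then have m1: "(\<lambda>(x, w). h (fst x) ((snd x)(n := w))) \<in> borel_measurable ((borel \<Otimes>\<^sub>M PiM UNIV (\<lambda>_. borel)) \<Otimes>\<^sub>M NL)"
    by (simp add: case_prod_beta')
  have hs: "(\<lambda>z. h q z) \<in> borel_measurable (PiM UNIV (\<lambda>_. borel))" for q
    using measurable_compose[OF measurable_Pair1' hm, of q] by simp
  have hw: "(\<lambda>w. h q (z(n := w))) \<in> borel_measurable borel" for q z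
    using measurable_compose[OF measurable_Pair1' m1, of "(q, z)"] by (auto simp: space_pair_measure space_PiM)
  have "(\<lambda>i. measure_pmf.expectation (path n) (\<lambda>p. \<Phi>' i p * indicator {p. \<delta> * s i < real (p 0)} p) / H (s i))
    \<longlonglongrightarrow> (\<integral>q. (\<integral>z. h' q z \<partial>NN) * indicator {\<delta><..} q \<partial>nu)"
  proof (rule Suc.IH)
    show "\<bar>\<Phi>' i p\<bar> \<le> C" for i p
    proof -
      have "integrable (K (p n)) (\<lambda>l. \<bar>\<Phi> i (p(Suc n := l))\<bar>)" using Suc.prems(1) by (intro integrable_pmf_bounded[where C=C]) auto
      then show ?thesis unfolding \<Phi>'_def
        using Suc.prems(1) by (intro order_trans[OF integral_abs_bound] measure_pmf.integral_le_const) auto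
    qed
    show "\<bar>h' q z\<bar> \<le> C" for q z
    proof -
      have "integrable NL (\<lambda>w. \<bar>h q (z(n := w))\<bar>)" using Suc.prems(2) hw by (intro N.integrable_const_bound[where B=C]) auto
      then show ?thesis unfolding h'_def
        using Suc.prems(2) by (intro order_trans[OF integral_abs_bound] N.integral_le_const) auto
    qed
    have "(\<lambda>x. \<integral>w. h (fst x) ((snd x)(n := w)) \<partial>NL) \<in> borel_measurable (borel \<Otimes>\<^sub>M PiM UNIV (\<lambda>_. borel))"
      by (rule N.borel_measurable_lebesgue_integral[OF m1])
    then show "(\<lambda>(q, z). h' q z) \<in> borel_measurable (borel \<Otimes>\<^sub>M PiM UNIV (\<lambda>_. borel))"
      by (simp add: h'_def case_prod_beta')
    show "h' q z = h' q z'" if "\<And>k. k < n \<Longrightarrow> z k = z' k" for q z z'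
      unfolding h'_def using that by (intro Bochner_Integration.integral_cong refl Suc.prems(4)) (auto simp: less_Suc_eq)
    fix p q z
    assume p: "(\<lambda>i. real (p i 0) / s i) \<longlonglongrightarrow> q" "0 < q" "\<And>k. k < n \<Longrightarrow> (\<lambda>i. innov (p i) k) \<longlonglongrightarrow> z k"
    have sc: "(\<lambda>i. real (p i n) / s i) \<longlonglongrightarrow> \<mu> ^ n * q"
      by (rule path_scaling[OF s p]) auto
    have "filterlim (\<lambda>i. real (p i n) / s i * s i) at_top sequentially"
      using mu p by (intro filterlim_tendsto_pos_mult_at_top[OF sc _ s]) auto
    moreover have "\<forall>\<^sub>F i in sequentially. real (p i n) / s i * s i = real (p i n)"
      using filterlim_at_top_dense[THEN iffD1, OF s, rule_format, of 0] by eventually_elim auto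
    ultimately have inf: "filterlim (\<lambda>i. real (p i n)) at_top sequentially"
      by (rule filterlim_cong[THEN iffD1, OF refl refl, rotated])
    show "(\<lambda>i. \<Phi>' i (p i)) \<longlonglongrightarrow> h' q z"
      unfolding \<Phi>'_def h'_def
    proof (rule K_clt[OF inf Suc.prems(1)])
      show "(\<lambda>w. h q (z(n := w))) \<in> borel_measurable borel" by (rule hw)
      fix w l assume l: "(\<lambda>i. (real (l i) - \<mu> * real (p i n) - \<mu>B) / sqrt (real (p i n))) \<longlonglongrightarrow> w"
      show "(\<lambda>i. \<Phi> i ((p i)(Suc n := l i))) \<longlonglongrightarrow> h q (z(n := w))"
      proof (rule Suc.prems(5))
        show "(\<lambda>i. innov ((p i)(Suc n := l i)) k) \<longlonglongrightarrow> (z(n := w)) k" if "k < Suc n" for k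
        proof (cases "k = n")
          case True then show ?thesis using l by (simp add: innov_def)
        next
          case False
          then have "innov ((p i)(Suc n := l i)) k = innov (p i) k" for i using that by (simp add: innov_def)
          then show ?thesis using p(3)[of k] False that by simp
        qed
      qed (use p in auto)
    qed
  qed
  moreover have "(\<integral>z. h' q z \<partial>NN) = (\<integral>z. h q z \<partial>NN)" for q
    unfolding h'_def by (rule resample_coordinate[OF hs Suc.prems(2)])
  moreover have "measure_pmf.expectation (path (Suc n)) (\<lambda>p. \<Phi> i p * indicator {p. \<delta> * s i < real (p 0)} p)
      = measure_pmf.expectation (path n) (\<lambda>p. \<Phi>' i p * indicator {p. \<delta> * s i < real (p 0)} p)" for i
  proof -
    have "\<bar>\<Phi> i p * indicator {p. \<delta> * s i < real (p 0)} p\<bar> \<le> C" for p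
      using Suc.prems(1)[of i p] order_trans[OF abs_ge_zero Suc.prems(1)[of i p]] by (simp add: indicator_def)
    then show ?thesis
      by (simp add: expectation_bind_pmf[where C=C] \<Phi>'_def indicator_def)
  qed
  ultimately show ?case by simp
qed

end

section \<open>Trails, windows and the exponent measure of the two-sided process\<close>

text \<open>A one-sided path is placed on the integers at its starting time $i$, with zeros before: nothing has happened yet.\<close>

definition embed :: "int \<Rightarrow> (nat \<Rightarrow> 'c) \<Rightarrow> int \<Rightarrow> 'c::zero" where
  "embed i y k = (if k < i then 0 else y (nat (k - i)))"

text \<open>Bounded functionals of the coordinates in a finite window of times that vanish on a neighbourhood of the origin: the test functions of vague convergence away from the origin.\<close>

definition window_test :: "int \<Rightarrow> int \<Rightarrow> real \<Rightarrow> real \<Rightarrow> ((int \<Rightarrow> real \<times> real) \<Rightarrow> real) \<Rightarrow> bool" where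
  "window_test a b C \<epsilon> f \<longleftrightarrow> 0 < \<epsilon> \<and> f \<in> borel_measurable (PiM UNIV (\<lambda>_. borel)) \<and>
     (\<forall>x. \<bar>f x\<bar> \<le> C) \<and> (\<forall>x. (\<forall>k\<in>{a..b}. norm (x k) \<le> \<epsilon>) \<longrightarrow> f x = 0) \<and>
     (\<forall>x y. (\<forall>k\<in>{a..b}. x k = y k) \<longrightarrow> f x = f y)"

lemma embed_measurable[measurable]:
  "embed i \<in> PiM UNIV (\<lambda>_. borel) \<rightarrow>\<^sub>M PiM (UNIV :: int set) (\<lambda>_. borel :: (real \<times> real) measure)"
proof (rule measurable_PiM_single')
  fix k :: int
  have "(\<lambda>y::nat \<Rightarrow> real \<times> real. y (nat (k - i))) \<in> PiM UNIV (\<lambda>_. borel) \<rightarrow>\<^sub>M borel"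
    by (rule measurable_component_singleton) simp
  then show "(\<lambda>y::nat \<Rightarrow> real \<times> real. embed i y k) \<in> PiM UNIV (\<lambda>_. borel) \<rightarrow>\<^sub>M borel"
    by (cases "k < i") (simp_all add: embed_def)
qed auto

context branching begin

text \<open>The asymptotic path after one large value $q$, on the scale of $(X^{3/2}, X M)$.\<close>

definition trail :: "real \<Rightarrow> (nat \<Rightarrow> real) \<Rightarrow> nat \<Rightarrow> real \<times> real" where
  "trail q z k = ((\<mu> ^ k * q) powr (3/2), (\<mu> ^ k * q) powr (3/2) * z k)"

abbreviation "QN \<equiv> nu \<Otimes>\<^sub>M NN"

lemma sets_QN[measurable_cong]: "sets QN = sets (borel \<Otimes>\<^sub>M PiM UNIV (\<lambda>_. borel))"
  by (intro sets_pair_measure_cong) (auto simp: sets_NN)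

lemma space_QN[simp]: "space QN = UNIV"
  by (simp add: space_pair_measure)

lemma pair_sf: "pair_sigma_finite nu NN"
  using sigma_finite_nu prob_space_NN by (simp add: pair_sigma_finite_def prob_space_imp_sigma_finite)

lemma trail_measurable[measurable]:
  "(\<lambda>\<omega>. trail (fst \<omega>) (snd \<omega>)) \<in> borel \<Otimes>\<^sub>M PiM UNIV (\<lambda>_. borel) \<rightarrow>\<^sub>M PiM UNIV (\<lambda>_. borel)"
  by (rule measurable_PiM_single') (auto simp: trail_def)

lemma trail_norm_le: "norm (trail q z j) \<le> (\<mu> ^ j * q) powr (3/2) * (1 + \<bar>z j\<bar>)"
  using norm_Pair_le[of "(\<mu> ^ j * q) powr (3/2)" "(\<mu> ^ j * q) powr (3/2) * z j"]
  by (simp add: trail_def abs_mult distrib_left)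

lemma AE_QN_pos: "AE \<omega> in QN. 0 < fst \<omega>"
proof -
  interpret pair_sigma_finite nu NN by (rule pair_sf)
  show ?thesis
  proof (rule AE_pair_measure)
    show "{\<omega> \<in> space QN. 0 < fst \<omega>} \<in> sets QN" by measurable
    show "AE q in nu. AE z in NN. 0 < fst (q, z)" using AE_nu_pos by eventually_elim simp
  qed
qed

text \<open>The trail exceeds $\epsilon$ at step $j$ only if $q$ exceeds a multiple of $(1+|z_j|)^{-2/3}$; the measure of this event is bounded by a second moment of the normal law.\<close>

lemma trail_large_finite:
  assumes e: "0 < \<epsilon>"
  shows "emeasure QN {\<omega> \<in> space QN. 0 < fst \<omega> \<and> \<epsilon> < norm (trail (fst \<omega>) (snd \<omega>) j)} < \<infinity>"
proof -
  interpret pair_sigma_finite nu NN by (rule pair_sf)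
  define D where "D = (\<mu> ^ j) powr \<alpha> * \<epsilon> powr (- (2 * \<alpha> / 3))"
  have D: "0 \<le> D" by (simp add: D_def)
  let ?A = "{\<omega> \<in> space QN. 0 < fst \<omega> \<and> \<epsilon> < norm (trail (fst \<omega>) (snd \<omega>) j)}"
  have A: "?A \<in> sets QN"
    using measurable_compose[OF trail_measurable measurable_component_singleton[of j UNIV]] by measurable
  have "emeasure QN ?A = (\<integral>\<^sup>+z. emeasure nu ((\<lambda>q. (q, z)) -` ?A) \<partial>NN)"
    by (rule emeasure_pair_measure_alt2[OF A])
  also have "\<dots> \<le> (\<integral>\<^sup>+z. ennreal (D * (1 + \<bar>z j\<bar>)\<^sup>2) \<partial>NN)"
  proof (rule nn_integral_mono)
    fix z :: "nat \<Rightarrow> real"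
    define t where "t = (\<epsilon> / (1 + \<bar>z j\<bar>)) powr (2/3) / \<mu> ^ j"
    have t: "0 < t" using e mu by (simp add: t_def add_pos_nonneg zero_less_divide_iff)
    have "(\<lambda>q. (q, z)) -` ?A \<subseteq> {t<..}"
    proof
      fix q assume "q \<in> (\<lambda>q. (q, z)) -` ?A"
      then have q: "0 < q" "\<epsilon> < (\<mu> ^ j * q) powr (3/2) * (1 + \<bar>z j\<bar>)"
        using trail_norm_le[of q z j] by auto
      then have "\<epsilon> / (1 + \<bar>z j\<bar>) < (\<mu> ^ j * q) powr (3/2)"
        by (simp add: divide_less_eq add_pos_nonneg)
      then have "(\<epsilon> / (1 + \<bar>z j\<bar>)) powr (2/3) < ((\<mu> ^ j * q) powr (3/2)) powr (2/3)"
        using e by (intro powr_less_mono2) auto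
      also have "\<dots> = \<mu> ^ j * q" using q mu by (simp add: powr_powr)
      finally show "q \<in> {t<..}" using mu by (simp add: t_def divide_less_eq mult.commute)
    qed
    then have "emeasure nu ((\<lambda>q. (q, z)) -` ?A) \<le> emeasure nu {t<..}"
      by (intro emeasure_mono) auto
    also have "\<dots> = ennreal (t powr (- \<alpha>))" by (rule emeasure_nu[OF t])
    also have "t powr (- \<alpha>) \<le> D * (1 + \<bar>z j\<bar>)\<^sup>2"
    proof -
      let ?w = "1 + \<bar>z j\<bar>"
      have w: "1 \<le> ?w" by simp
      have "t powr (- \<alpha>) = ((\<epsilon> / ?w) powr (2/3)) powr (- \<alpha>) / (\<mu> ^ j) powr (- \<alpha>)"
        unfolding t_def by (rule powr_divide)
      also have "((\<epsilon> / ?w) powr (2/3)) powr (- \<alpha>) = (\<epsilon> / ?w) powr (- (2 * \<alpha> / 3))"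
        by (simp add: powr_powr)
      also have "(\<epsilon> / ?w) powr (- (2 * \<alpha> / 3)) / (\<mu> ^ j) powr (- \<alpha>) = (\<epsilon> / ?w) powr (- (2 * \<alpha> / 3)) * (\<mu> ^ j) powr \<alpha>"
        by (simp only: powr_minus[of "\<mu> ^ j"] divide_inverse inverse_inverse_eq)
      also have "(\<epsilon> / ?w) powr (- (2 * \<alpha> / 3)) = \<epsilon> powr (- (2 * \<alpha> / 3)) * ?w powr (2 * \<alpha> / 3)"
      proof -
        have "(\<epsilon> / ?w) powr (- (2 * \<alpha> / 3)) = \<epsilon> powr (- (2 * \<alpha> / 3)) / ?w powr (- (2 * \<alpha> / 3))"
          by (rule powr_divide)
        then show ?thesis by (simp only: powr_minus[of ?w] divide_inverse inverse_inverse_eq)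
      qed
      also have "?w powr (2 * \<alpha> / 3) \<le> ?w powr 2" using al w by (intro powr_mono) auto
      also have "?w powr 2 = ?w\<^sup>2" using w by (simp add: powr_numeral)
      finally show ?thesis by (simp add: D_def mult_ac mult_left_mono mult_right_mono)
    qed
    finally show "emeasure nu ((\<lambda>q. (q, z)) -` ?A) \<le> ennreal (D * (1 + \<bar>z j\<bar>)\<^sup>2)"
      by (simp add: ennreal_leI)
  qed
  also have "\<dots> = (\<integral>\<^sup>+w. ennreal (D * (1 + \<bar>w\<bar>)\<^sup>2) \<partial>distr NN NL (\<lambda>z. z j))"
    by (subst nn_integral_distr) (auto intro!: measurable_component_singleton)
  also have "distr NN NL (\<lambda>z. z j) = NL"
    by (rule distr_PiM_component) (auto intro: prob_space_NL)
  also have "(\<integral>\<^sup>+w. ennreal (D * (1 + \<bar>w\<bar>)\<^sup>2) \<partial>NL) < \<infinity>"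
  proof -
    have "integrable lborel (\<lambda>w. D * (normal_density 0 \<sigma> w + 2 * (normal_density 0 \<sigma> w * \<bar>w - 0\<bar> ^ 1) + normal_density 0 \<sigma> w * (w - 0)^2))"
      using sig by (intro integrable_mult_right Bochner_Integration.integrable_add integrable_normal_density
          integrable_normal_moment_abs integrable_normal_moment)
    then have "integrable lborel (\<lambda>w. normal_density 0 \<sigma> w *\<^sub>R (D * (1 + \<bar>w\<bar>)\<^sup>2))"
      by (rule Bochner_Integration.integrable_cong[THEN iffD1, rotated 2]) (auto simp: power2_eq_square algebra_simps)
    then have "integrable NL (\<lambda>w. D * (1 + \<bar>w\<bar>)\<^sup>2)"
      by (subst integrable_density) auto
    then show ?thesis using D by (subst nn_integral_eq_integral) auto
  qed
  finally show ?thesis .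
qed

lemma integrable_QN:
  fixes f :: "real \<times> (nat \<Rightarrow> real) \<Rightarrow> real"
  assumes f: "f \<in> borel_measurable QN" and C: "\<And>\<omega>. \<bar>f \<omega>\<bar> \<le> C" and e: "0 < \<epsilon>"
    and 0: "\<And>\<omega>. (\<And>j. j \<le> n \<Longrightarrow> norm (trail (fst \<omega>) (snd \<omega>) j) \<le> \<epsilon>) \<Longrightarrow> f \<omega> = 0"
  shows "integrable QN f"
proof -
  let ?A = "\<lambda>j. {\<omega> \<in> space QN. 0 < fst \<omega> \<and> \<epsilon> < norm (trail (fst \<omega>) (snd \<omega>) j)}"
  have C0: "0 \<le> C" using order_trans[OF abs_ge_zero C] .
  have A: "?A j \<in> sets QN" for j
    using measurable_compose[OF trail_measurable measurable_component_singleton[of j UNIV]] by measurable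
  have "integrable QN (\<lambda>\<omega>. \<Sum>j\<le>n. C * indicator (?A j) \<omega>)"
    using A trail_large_finite[OF e] by (intro Bochner_Integration.integrable_sum integrable_mult_right integrable_real_indicator) auto
  then show ?thesis
  proof (rule Bochner_Integration.integrable_bound[OF _ f])
    show "AE \<omega> in QN. norm (f \<omega>) \<le> norm (\<Sum>j\<le>n. C * indicator (?A j) \<omega>)"
      using AE_QN_pos
    proof eventually_elim
      case (elim \<omega>)
      have nn: "0 \<le> (\<Sum>j\<le>n. C * indicator (?A j) \<omega>)" using C0 by (intro sum_nonneg) auto
      show ?case
      proof (cases "\<forall>j\<le>n. norm (trail (fst \<omega>) (snd \<omega>) j) \<le> \<epsilon>")
        case True then show ?thesis using 0[of \<omega>] by simp
      next
        case False
        then obtain j where "j \<le> n" "\<omega> \<in> ?A j" using elim by auto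
        then have "C * indicator (?A j) \<omega> \<le> (\<Sum>j\<le>n. C * indicator (?A j) \<omega>)"
          using C0 by (intro member_le_sum) auto
        then show ?thesis using C[of \<omega>] \<open>\<omega> \<in> ?A j\<close> nn by simp
      qed
    qed
  qed
qed

text \<open>The measure \<open>nu\<close> is homogeneous of order $-\alpha$; all homogeneity below descends from this.\<close>

lemma nu_scaling:
  assumes mu: "0 < c" and F: "F \<in> borel_measurable borel"
  shows "(\<integral>q. F (c * q) \<partial>nu) = c powr \<alpha> * (\<integral>q. (F q :: real) \<partial>nu)"
proof -
  define d where "d q = \<alpha> * q powr (- \<alpha> - 1) * indicator {0<..} q" for q :: real
  have d: "nu = density lborel (\<lambda>q. ennreal (d q))"
    unfolding nu_def d_def by (intro density_cong) (auto simp: indicator_def)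
  have dn: "0 \<le> d q" for q using al by (simp add: d_def)
  have dm: "d \<in> borel_measurable borel" unfolding d_def by measurable
  have int: "(\<integral>q. G q \<partial>nu) = (\<integral>q. d q * G q \<partial>lborel)" if "G \<in> borel_measurable borel" for G :: "real \<Rightarrow> real"
    unfolding d using that dm dn by (subst integral_density) auto
  have dq: "d (c * q) = c powr (- \<alpha> - 1) * d q" for q
    using mu by (auto simp: d_def indicator_def powr_mult zero_less_mult_iff)
  have "(\<integral>q. F q \<partial>nu) = (\<integral>q. d q * F q \<partial>lborel)" using F by (rule int)
  also have "\<dots> = \<bar>c\<bar> *\<^sub>R (\<integral>q. d (0 + c * q) * F (0 + c * q) \<partial>lborel)"
    using mu by (subst lborel_integral_real_affine[of c _ 0]) auto
  also have "\<dots> = c * (\<integral>q. c powr (- \<alpha> - 1) * (d q * F (c * q)) \<partial>lborel)"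
    using mu by (simp only: dq add_0 abs_of_pos real_scaleR_def mult.assoc)
  also have "\<dots> = c * c powr (- \<alpha> - 1) * (\<integral>q. d q * F (c * q) \<partial>lborel)" by simp
  also have "(\<integral>q. d q * F (c * q) \<partial>lborel) = (\<integral>q. F (c * q) \<partial>nu)"
    by (intro int[symmetric] measurable_compose[OF _ F]) measurable
  also have "c * c powr (- \<alpha> - 1) = c powr (- \<alpha>)"
    using mu by (simp add: powr_diff powr_one)
  finally show ?thesis using mu by (simp add: powr_minus)
qed

lemma NN_shift:
  assumes F: "F \<in> borel_measurable (PiM UNIV (\<lambda>_. borel))"
  shows "(\<integral>z. F (\<lambda>j. z (Suc j)) \<partial>NN) = (\<integral>z. (F z :: real) \<partial>NN)"
proof -
  have "distr NN NN (\<lambda>\<omega>. \<lambda>n\<in>UNIV. \<omega> (Suc n)) = NN"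
    using distr_PiM_reindex[of UNIV "\<lambda>_. NL" Suc UNIV] prob_space_NL by simp
  then have eq: "NN = distr NN NN (\<lambda>z j. z (Suc j))" by (simp add: restrict_def)
  have m: "(\<lambda>z j. z (Suc j)) \<in> NN \<rightarrow>\<^sub>M NN"
    by (rule measurable_PiM_single') (auto intro!: measurable_component_singleton)
  show ?thesis
    by (subst (2) eq, subst integral_distr[OF m]) (use F in \<open>auto cong: measurable_cong_sets simp: measurable_cong_sets[OF sets_NN refl]\<close>)
qed

text \<open>Contribution of the trails that start at time $i$.\<close>

definition Q :: "((int \<Rightarrow> real \<times> real) \<Rightarrow> real) \<Rightarrow> int \<Rightarrow> real" where
  "Q f i = (\<integral>\<omega>. f (embed i (trail (fst \<omega>) (snd \<omega>))) \<partial>QN)"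

lemma trail_shift: "trail q z (Suc j) = trail (\<mu> * q) (\<lambda>j. z (Suc j)) j"
  by (simp add: trail_def mult_ac)

lemma embed_small: "(\<And>j. j \<le> nat (b - i) \<Longrightarrow> norm (y j) \<le> \<epsilon>) \<Longrightarrow> 0 \<le> \<epsilon> \<Longrightarrow> k \<le> b \<Longrightarrow> norm (embed i y k) \<le> (\<epsilon>::real)"
  by (auto simp: embed_def)

lemma window_test_measurable: "window_test a b C \<epsilon> f \<Longrightarrow> f \<in> borel_measurable (PiM UNIV (\<lambda>_. borel))"
  by (simp add: window_test_def)

lemma window_test_embed_measurable:
  assumes "window_test a b C \<epsilon> f"
  shows "(\<lambda>\<omega>. f (embed i (trail (fst \<omega>) (snd \<omega>)))) \<in> borel_measurable QN"
  using window_test_measurable[OF assms] by measurable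

lemma integrable_window:
  assumes f: "window_test a b C \<epsilon> f"
  shows "integrable QN (\<lambda>\<omega>. f (embed i (trail (fst \<omega>) (snd \<omega>))))"
proof (rule integrable_QN[where C=C and \<epsilon>=\<epsilon> and n="nat (b - i)"])
  fix \<omega> assume *: "\<And>j. j \<le> nat (b - i) \<Longrightarrow> norm (trail (fst \<omega>) (snd \<omega>) j) \<le> \<epsilon>"
  have "\<forall>k\<in>{a..b}. norm (embed i (trail (fst \<omega>) (snd \<omega>)) k) \<le> \<epsilon>"
    using * f by (auto intro!: embed_small[where b=b] simp: window_test_def)
  then show "f (embed i (trail (fst \<omega>) (snd \<omega>))) = 0" using f unfolding window_test_def by blast
qed (use f window_test_embed_measurable[OF f] in \<open>auto simp: window_test_def\<close>)

lemma integrable_window_shift: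
  assumes f: "window_test a b C \<epsilon> f"
  shows "integrable QN (\<lambda>\<omega>. f (embed i (\<lambda>j. trail (fst \<omega>) (snd \<omega>) (Suc j))))"
proof (rule integrable_QN[where C=C and \<epsilon>=\<epsilon> and n="Suc (nat (b - i))"])
  note [measurable] = window_test_measurable[OF f]
  have "(\<lambda>\<omega>. \<lambda>j. trail (fst \<omega>) (snd \<omega>) (Suc j)) \<in> borel \<Otimes>\<^sub>M PiM UNIV (\<lambda>_. borel) \<rightarrow>\<^sub>M PiM UNIV (\<lambda>_. borel)"
    by (rule measurable_PiM_single') (auto simp: trail_def)
  then show "(\<lambda>\<omega>. f (embed i (\<lambda>j. trail (fst \<omega>) (snd \<omega>) (Suc j)))) \<in> borel_measurable QN"
    by measurable
  fix \<omega> assume *: "\<And>j. j \<le> Suc (nat (b - i)) \<Longrightarrow> norm (trail (fst \<omega>) (snd \<omega>) j) \<le> \<epsilon>"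
  have "\<forall>k\<in>{a..b}. norm (embed i (\<lambda>j. trail (fst \<omega>) (snd \<omega>) (Suc j)) k) \<le> \<epsilon>"
    using * f by (auto intro!: embed_small[where b=b] simp: window_test_def)
  then show "f (embed i (\<lambda>j. trail (fst \<omega>) (snd \<omega>) (Suc j))) = 0" using f unfolding window_test_def by blast
qed (use f in \<open>auto simp: window_test_def\<close>)

text \<open>Dropping the first step of a trail rescales $q$ by $\mu$ and shifts the noise, hence multiplies the integral by $\mu^\alpha$.\<close>

lemma Q_shift:
  assumes f: "window_test a b C \<epsilon> f"
  shows "(\<integral>\<omega>. f (embed i (\<lambda>j. trail (fst \<omega>) (snd \<omega>) (Suc j))) \<partial>QN) = \<mu> powr \<alpha> * Q f i"
proof -
  interpret pair_sigma_finite nu NN by (rule pair_sf)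
  interpret I: prob_space NN by (rule prob_space_NN)
  note [measurable] = window_test_measurable[OF f]
  let ?G = "\<lambda>q z. f (embed i (trail q z))"
  have Gm: "(\<lambda>\<omega>. ?G (fst \<omega>) (snd \<omega>)) \<in> borel_measurable (borel \<Otimes>\<^sub>M PiM UNIV (\<lambda>_. borel))"
    by measurable
  have Gm': "?G q \<in> borel_measurable (PiM UNIV (\<lambda>_. borel))" for q
    using measurable_compose[OF measurable_Pair1' Gm, of q] by simp
  have "(\<lambda>(x, y). ?G x y) \<in> borel_measurable (borel \<Otimes>\<^sub>M NN)" using Gm
    by (simp add: case_prod_beta' measurable_cong_sets[OF sets_pair_measure_cong[OF refl sets_NN] refl])
  then have Im: "(\<lambda>q. \<integral>z. ?G q z \<partial>NN) \<in> borel_measurable borel"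
    by (rule M2.borel_measurable_lebesgue_integral)
  have i1: "integrable QN (\<lambda>(q, z). f (embed i (\<lambda>j. trail q z (Suc j))))"
    using integrable_window_shift[OF f, of i] by (simp add: case_prod_beta')
  have i2: "integrable QN (\<lambda>(q, z). ?G q z)"
    using integrable_window[OF f, of i] by (simp add: case_prod_beta')
  have "(\<integral>\<omega>. f (embed i (\<lambda>j. trail (fst \<omega>) (snd \<omega>) (Suc j))) \<partial>QN)
      = (\<integral>q. (\<integral>z. f (embed i (\<lambda>j. trail q z (Suc j))) \<partial>NN) \<partial>nu)"
    using integral_fst[OF i1] by (simp add: case_prod_beta')
  also have "\<dots> = (\<integral>q. (\<integral>z. ?G (\<mu> * q) (\<lambda>j. z (Suc j)) \<partial>NN) \<partial>nu)"
    by (simp add: trail_shift)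
  also have "\<dots> = (\<integral>q. (\<integral>z. ?G (\<mu> * q) z \<partial>NN) \<partial>nu)"
    by (simp add: NN_shift[OF Gm'])
  also have "\<dots> = \<mu> powr \<alpha> * (\<integral>q. (\<integral>z. ?G q z \<partial>NN) \<partial>nu)"
    by (rule nu_scaling[OF mu(1) Im])
  also have "(\<integral>q. (\<integral>z. ?G q z \<partial>NN) \<partial>nu) = Q f i"
    using integral_fst[OF i2] by (simp add: case_prod_beta' Q_def)
  finally show ?thesis .
qed

lemma Q_zero: assumes "window_test a b C \<epsilon> f" "b < i" shows "Q f i = 0"
proof -
  have "f (embed i y) = 0" for y using assms by (auto simp: window_test_def embed_def)
  then show ?thesis by (simp add: Q_def)
qed

text \<open>Trails that started before the window look inside it like rescaled trails started one step later; the contributions decay geometrically into the past.\<close>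

lemma Q_before: assumes f: "window_test a b C \<epsilon> f" "i < a" shows "Q f i = \<mu> powr \<alpha> * Q f (i + 1)"
proof -
  have "f (embed i y) = f (embed (i + 1) (\<lambda>j. y (Suc j)))" for y
  proof -
    have "embed i y k = embed (i + 1) (\<lambda>j. y (Suc j)) k" if "k \<in> {a..b}" for k
    proof -
      have "nat (k - i) = Suc (nat (k - (i + 1)))" using that f(2) by auto
      then show ?thesis using that f(2) by (auto simp: embed_def)
    qed
    then show ?thesis using f(1) unfolding window_test_def by blast
  qed
  then have "Q f i = (\<integral>\<omega>. f (embed (i + 1) (\<lambda>j. trail (fst \<omega>) (snd \<omega>) (Suc j))) \<partial>QN)"
    unfolding Q_def by (intro Bochner_Integration.integral_cong refl)
  then show ?thesis by (simp only: Q_shift[OF f(1)])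
qed

abbreviation "Xi \<equiv> count_space (UNIV :: int set) \<Otimes>\<^sub>M QN"

text \<open>The process determined by a starting time, an initial size and a noise sequence.\<close>

definition U :: "int \<times> real \<times> (nat \<Rightarrow> real) \<Rightarrow> int \<Rightarrow> real \<times> real" where
  "U \<omega> = embed (fst \<omega>) (trail (fst (snd \<omega>)) (snd (snd \<omega>)))"

lemma pair_sf_Xi: "pair_sigma_finite (count_space (UNIV :: int set)) QN"
proof -
  interpret pair_sigma_finite nu NN by (rule pair_sf)
  show ?thesis
    by (simp add: pair_sigma_finite_def sigma_finite_measure_count_space sigma_finite_measure_axioms)
qed

lemma U_measurable[measurable]: "U \<in> Xi \<rightarrow>\<^sub>M PiM UNIV (\<lambda>_. borel)"
proof -
  have "(\<lambda>\<omega>. (\<lambda>i \<omega>. embed i (trail (fst (snd \<omega>)) (snd (snd \<omega>)))) (fst \<omega>) \<omega>) \<in> Xi \<rightarrow>\<^sub>M PiM UNIV (\<lambda>_. borel)"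
    by (rule measurable_compose_countable) measurable
  then show ?thesis by (simp add: U_def[abs_def])
qed

lemma geometric_abs_summable:
  fixes t :: "int \<Rightarrow> real"
  assumes t: "\<And>i. i < a \<Longrightarrow> t i = r * t (i + 1)" "\<And>i. b < i \<Longrightarrow> t i = 0" and r: "0 \<le> r" "r < 1"
  shows "Infinite_Set_Sum.abs_summable_on t UNIV"
proof -
  have tj: "t (a - int j) = r ^ j * t a" for j
  proof (induction j)
    case (Suc j)
    have "t (a - int (Suc j)) = r * t (a - int (Suc j) + 1)" by (rule t(1)) simp
    then show ?case using Suc by simp
  qed simp
  have "Infinite_Set_Sum.abs_summable_on (\<lambda>j. t (a - int j)) (UNIV :: nat set)"
    unfolding tj abs_summable_on_nat_iff' using r by (simp add: abs_mult power_abs summable_mult2 summable_geometric)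
  moreover have "bij_betw (\<lambda>j. a - int j) UNIV {..a}"
    by (rule bij_betwI[where g="\<lambda>i. nat (a - i)"]) auto
  ultimately have 1: "Infinite_Set_Sum.abs_summable_on t {..a}"
    using abs_summable_on_reindex_bij_betw[of "\<lambda>j. a - int j" UNIV "{..a}" t] by simp
  have 2: "Infinite_Set_Sum.abs_summable_on t {a<..b}" by (intro abs_summable_on_finite) auto
  have 3: "Infinite_Set_Sum.abs_summable_on t {max a b<..}"
  proof (rule Infinite_Set_Sum.abs_summable_on_cong[THEN iffD1, OF _ refl])
    show "Infinite_Set_Sum.abs_summable_on (\<lambda>_. 0 :: real) {max a b<..}" by simp
  qed (use t(2) in auto)
  have "(UNIV :: int set) = ({..a} \<union> {a<..b}) \<union> {max a b<..}" by auto
  then show ?thesis using 1 2 3 by (metis abs_summable_on_union)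
qed

lemma window_test_abs: "window_test a b C \<epsilon> f \<Longrightarrow> window_test a b C \<epsilon> (\<lambda>x. \<bar>f x\<bar>)"
  unfolding window_test_def by (auto intro: borel_measurable_abs) metis+

lemma Q_abs_summable: "window_test a b C \<epsilon> f \<Longrightarrow> Infinite_Set_Sum.abs_summable_on (Q f) UNIV"
  using mu_powr_less_1 by (intro geometric_abs_summable[where r="\<mu> powr \<alpha>" and a=a and b=b] Q_before Q_zero) auto

lemma integrable_Xi:
  assumes f: "window_test a b C \<epsilon> f"
  shows "integrable Xi (\<lambda>\<omega>. f (U \<omega>))"
proof -
  interpret pair_sigma_finite "count_space (UNIV :: int set)" QN by (rule pair_sf_Xi)
  show ?thesis
  proof (rule Fubini_integrable)
    show "(\<lambda>\<omega>. f (U \<omega>)) \<in> borel_measurable Xi" using window_test_measurable[OF f] by measurable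
    have "Infinite_Set_Sum.abs_summable_on (Q (\<lambda>x. \<bar>f x\<bar>)) UNIV" by (rule Q_abs_summable[OF window_test_abs[OF f]])
    then show "integrable (count_space UNIV) (\<lambda>i. \<integral>\<omega>. norm (f (U (i, \<omega>))) \<partial>QN)"
      by (simp add: abs_summable_on_def Q_def[abs_def] U_def)
    show "AE i in count_space UNIV. integrable QN (\<lambda>\<omega>. f (U (i, \<omega>)))"
      using integrable_window[OF f] by (simp add: U_def)
  qed
qed

text \<open>The sum over all starting times telescopes against its $\mu^\alpha$-rescaled shift, so only the starting times inside the window remain.\<close>

lemma Xi_integral:
  assumes f: "window_test a b C \<epsilon> f"
  shows "(1 - \<mu> powr \<alpha>) * (\<integral>\<omega>. f (U \<omega>) \<partial>Xi) = (\<Sum>i=a..b. Q f i - \<mu> powr \<alpha> * Q f (i + 1))"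
proof -
  interpret pair_sigma_finite "count_space (UNIV :: int set)" QN by (rule pair_sf_Xi)
  have Qi: "integrable (count_space UNIV) (Q f)"
    using Q_abs_summable[OF f] by (simp add: abs_summable_on_def)
  have bij: "bij_betw (\<lambda>i::int. i + 1) UNIV UNIV" by (rule bij_betwI[where g="\<lambda>i. i - 1"]) auto
  have sh: "(\<integral>i. Q f (i + 1) \<partial>count_space UNIV) = (\<integral>i. Q f i \<partial>count_space UNIV)"
    by (rule integral_bij_count_space[OF bij])
  have Qi1: "integrable (count_space UNIV) (\<lambda>i. Q f (i + 1))"
    using integrable_bij_count_space[OF bij, of "Q f"] Qi by simp
  have "(\<integral>\<omega>. f (U \<omega>) \<partial>Xi) = (\<integral>i. Q f i \<partial>count_space UNIV)"
    using integral_fst'[OF integrable_Xi[OF f]] by (simp add: Q_def[abs_def] U_def)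
  then have eq: "(1 - \<mu> powr \<alpha>) * (\<integral>\<omega>. f (U \<omega>) \<partial>Xi) = (\<integral>i. Q f i - \<mu> powr \<alpha> * Q f (i + 1) \<partial>count_space UNIV)"
    using Qi Qi1 sh by (simp add: algebra_simps)
  have supp: "{i \<in> UNIV. Q f i - \<mu> powr \<alpha> * Q f (i + 1) \<noteq> 0} \<subseteq> {a..b}"
  proof
    fix i assume "i \<in> {i \<in> UNIV. Q f i - \<mu> powr \<alpha> * Q f (i + 1) \<noteq> 0}"
    then show "i \<in> {a..b}"
      using Q_before[OF f, of i] Q_zero[OF f, of i] Q_zero[OF f, of "i + 1"] by (cases "i < a"; cases "b < i") auto
  qed
  have "(\<integral>i. Q f i - \<mu> powr \<alpha> * Q f (i + 1) \<partial>count_space UNIV) = (\<Sum>i | i \<in> UNIV \<and> Q f i - \<mu> powr \<alpha> * Q f (i + 1) \<noteq> 0. Q f i - \<mu> powr \<alpha> * Q f (i + 1))"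
    by (rule lebesgue_integral_count_space_finite_support) (rule finite_subset[OF supp], simp)
  also have "\<dots> = (\<Sum>i=a..b. Q f i - \<mu> powr \<alpha> * Q f (i + 1))"
    by (rule sum.mono_neutral_left) (use supp in auto)
  finally show ?thesis by (simp add: eq)
qed

end

section \<open>Functionals anchored at the first time of a window\<close>

context branching begin

declare path.simps(2) [simp del]
lemmas path_Suc = path.simps(2)

text \<open>Stationarity of the chain on the level of paths.\<close>

lemma path_shift: "map_pmf (\<lambda>p j. p (Suc j)) (path (Suc n)) = path n"
proof (induction n)
  case 0
  have "(\<lambda>j. ((\<lambda>_. 0)(0 := m, Suc 0 := l)) (Suc j)) = (\<lambda>_. 0)(0 := l)" for m l :: nat by auto
  then have "map_pmf (\<lambda>p j. p (Suc j)) (path (Suc 0)) = map_pmf (\<lambda>l. (\<lambda>_. 0)(0 := l)) (bind_pmf \<pi> K)"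
    by (simp add: path_Suc map_bind_pmf bind_map_pmf pmf.map_comp o_def)
  moreover have "bind_pmf \<pi> K = \<pi>" using stationary by (simp add: K_def[abs_def])
  ultimately show ?case by simp
next
  case (Suc n)
  have eq: "(\<lambda>j. (p(Suc (Suc n) := l)) (Suc j)) = (\<lambda>j. p (Suc j))(Suc n := l)" for p :: "nat \<Rightarrow> nat" and l by auto
  have "map_pmf (\<lambda>p j. p (Suc j)) (path (Suc (Suc n)))
      = bind_pmf (path (Suc n)) (\<lambda>p. map_pmf (\<lambda>l. (\<lambda>j. p (Suc j))(Suc n := l)) (K (p (Suc n))))"
    by (subst path_Suc) (simp only: map_bind_pmf pmf.map_comp o_def eq)
  also have "\<dots> = bind_pmf (map_pmf (\<lambda>p j. p (Suc j)) (path (Suc n))) (\<lambda>p. map_pmf (\<lambda>l. p(Suc n := l)) (K (p n)))"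
    by (simp only: bind_map_pmf)
  finally show ?case by (simp only: Suc) (rule path_Suc[symmetric])
qed

lemma path_shift_iter: "map_pmf (\<lambda>p j. p (j + k)) (path (n + k)) = path n"
proof (induction k)
  case (Suc k)
  have "map_pmf (\<lambda>p j. p (j + Suc k)) (path (n + Suc k))
      = map_pmf (\<lambda>p j. p (j + k)) (map_pmf (\<lambda>p j. p (Suc j)) (path (Suc (n + k))))"
    by (simp add: pmf.map_comp o_def)
  then show ?case by (simp only: path_shift Suc)
qed simp

lemma path_first_pair: "map_pmf (\<lambda>p. (p 0, p 1)) (path (Suc n)) = map_pmf (\<lambda>p. (p 0, p 1)) (path 1)"
proof (induction n)
  case (Suc n)
  have "map_pmf (\<lambda>p. (p 0, p 1)) (path (Suc (Suc n)))
     = bind_pmf (path (Suc n)) (\<lambda>p. map_pmf (\<lambda>l. ((p(Suc (Suc n) := l)) 0, (p(Suc (Suc n) := l)) 1)) (K (p (Suc n))))"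
    by (subst path_Suc) (simp only: map_bind_pmf pmf.map_comp o_def)
  also have "\<dots> = map_pmf (\<lambda>p. (p 0, p 1)) (path (Suc n))"
    by (simp add: map_pmf_const map_pmf_def)
  finally show ?case using Suc by simp
qed simp

lemma path_pair: "k < n \<Longrightarrow> map_pmf (\<lambda>p. (p k, p (Suc k))) (path n) = map_pmf (\<lambda>p. (p 0, p 1)) (path 1)"
proof -
  assume "k < n"
  then obtain m where n: "n = Suc m + k" using less_imp_Suc_add[of k n] by auto
  have "map_pmf (\<lambda>p. (p k, p (Suc k))) (path n) = map_pmf (\<lambda>p. (p 0, p 1)) (map_pmf (\<lambda>p j. p (j + k)) (path (Suc m + k)))"
    unfolding n by (simp add: pmf.map_comp o_def)
  then show ?thesis by (simp only: path_shift_iter path_first_pair)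
qed

lemma path_1_MS: "map_pmf (\<lambda>p. (p 0, p 1)) (path 1) = map_pmf (\<lambda>z. (fst (fst z), snd (fst z) + snd z)) (pair_pmf MS Bp)"
  by (simp add: path_Suc K_def MS_def pair_pmf_def map_pmf_def bind_assoc_pmf bind_return_pmf)

definition zeta :: "real \<Rightarrow> (nat \<Rightarrow> nat) \<Rightarrow> nat \<Rightarrow> real \<times> real" where
  "zeta x p k = (1 / x) *\<^sub>R (real (p k) powr (3/2), real (p k) * (real (p (Suc k)) - \<mu> * real (p k) - \<mu>B))"

text \<open>The deterministic core of the scaling: convergence of the scaled values and innovations implies convergence of the scaled process to the trail.\<close>

lemma zeta_tendsto:
  assumes s: "filterlim s at_top sequentially" and q: "(\<lambda>i. real (p i 0) / s i) \<longlonglongrightarrow> q" "0 < q"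
    and z: "\<And>k. k < Suc n \<Longrightarrow> (\<lambda>i. innov (p i) k) \<longlonglongrightarrow> z k" and k: "k \<le> n"
  shows "(\<lambda>i. zeta (s i powr (3/2)) (p i) k) \<longlonglongrightarrow> trail q z k"
proof -
  have sc: "(\<lambda>i. real (p i k) / s i) \<longlonglongrightarrow> \<mu> ^ k * q"
    by (rule path_scaling[OF s q z]) (use k in auto)
  have pos: "0 < \<mu> ^ k * q" using mu q by simp
  have e: "x powr (3/2) = x * sqrt x" if "0 \<le> x" for x :: real
    using that by (cases "x = 0") (simp_all add: powr_half_sqrt[symmetric] powr_mult_base)
  have zk: "(\<lambda>i. innov (p i) k) \<longlonglongrightarrow> z k" using z k by simp
  have "(\<lambda>i. ((real (p i k) / s i) powr (3/2), (real (p i k) / s i) * sqrt (real (p i k) / s i) * innov (p i) k))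
      \<longlonglongrightarrow> ((\<mu> ^ k * q) powr (3/2), (\<mu> ^ k * q) * sqrt (\<mu> ^ k * q) * z k)"
    by (intro tendsto_Pair tendsto_powr[OF sc tendsto_const] tendsto_mult sc tendsto_real_sqrt zk) (rule less_imp_neq[OF pos, symmetric])
  also have "((\<mu> ^ k * q) powr (3/2), (\<mu> ^ k * q) * sqrt (\<mu> ^ k * q) * z k) = trail q z k"
    using pos by (simp add: trail_def e)
  finally have lim: "(\<lambda>i. ((real (p i k) / s i) powr (3/2), (real (p i k) / s i) * sqrt (real (p i k) / s i) * innov (p i) k)) \<longlonglongrightarrow> trail q z k" .
  have "\<forall>\<^sub>F i in sequentially. 0 < s i" using s by (auto simp: filterlim_at_top_dense)
  then have "\<forall>\<^sub>F i in sequentially. ((real (p i k) / s i) powr (3/2), (real (p i k) / s i) * sqrt (real (p i k) / s i) * innov (p i) k)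
      = zeta (s i powr (3/2)) (p i) k"
  proof eventually_elim
    case (elim i)
    have a: "(real (p i k) / s i) * sqrt (real (p i k) / s i) * innov (p i) k
        = real (p i k) * (sqrt (real (p i k)) * innov (p i) k) / (s i * sqrt (s i))"
      by (simp add: real_sqrt_divide)
    have b: "real (p i k) * (sqrt (real (p i k)) * innov (p i) k)
        = real (p i k) * (real (p i (Suc k)) - \<mu> * real (p i k) - \<mu>B)"
      by (cases "p i k = 0") (simp_all add: innov_def)
    have c: "s i powr (3/2) = s i * sqrt (s i)" using elim by (intro e) simp
    have d: "(real (p i k) / s i) powr (3/2) = real (p i k) powr (3/2) / (s i * sqrt (s i))"
      unfolding c[symmetric] by (rule powr_divide)
    show ?case unfolding a b d zeta_def c by simp
  qed
  then show ?thesis by (rule Lim_transform_eventually[OF lim])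
qed

lemma norm_zeta_le:
  assumes "0 < x"
  shows "norm (zeta x p 0) \<le> real (p 0) powr (3/2) / x + real (p 0) * \<bar>real (p 1) - \<mu> * real (p 0) - \<mu>B\<bar> / x"
proof -
  have "norm (zeta x p 0) = (1 / x) * norm (real (p 0) powr (3/2), real (p 0) * (real (p 1) - \<mu> * real (p 0) - \<mu>B))"
    using assms by (simp add: zeta_def del: scaleR_Pair)
  also have "\<dots> \<le> (1 / x) * (norm (real (p 0) powr (3/2)) + norm (real (p 0) * (real (p 1) - \<mu> * real (p 0) - \<mu>B)))"
    using assms by (intro mult_left_mono norm_Pair_le) auto
  finally show ?thesis by (simp add: abs_mult distrib_left)
qed

text \<open>A large first coordinate after a small start is due to the innovation; its offspring part is controlled by a multiple of $\delta^{3-\alpha}$, its immigration part is negligible for every $\delta$.\<close>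

lemma small_start_negligible:
  assumes \<eta>: "0 < \<eta>" and \<kappa>: "0 < \<kappa>"
  shows "\<exists>\<delta>0>0. \<forall>\<delta>. 0 < \<delta> \<longrightarrow> \<delta> \<le> \<delta>0 \<longrightarrow> (\<forall>\<^sub>F s in at_top.
    measure_pmf.prob (path 1) {p. real (p 0) \<le> \<delta> * s \<and> \<eta> < norm (zeta (s powr (3/2)) p 0)} \<le> \<kappa> * H s)"
proof -
  obtain C where C: "C > 0" "\<And>\<delta> \<eta>. 0 < \<delta> \<Longrightarrow> 0 < \<eta> \<Longrightarrow> \<forall>\<^sub>F s in at_top.
     measure_pmf.prob MS {z. real (fst z) \<le> \<delta> * s \<and> \<eta> * s powr (3/2) < real (fst z) * \<bar>real (snd z) - \<mu> * real (fst z)\<bar>}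
       \<le> C * \<delta> powr (3 - \<alpha>) / \<eta>\<^sup>2 * H s"
    using small_start_large_fluctuation by blast
  have "((\<lambda>\<delta>. C * \<delta> powr (3 - \<alpha>) / (\<eta> / 4)\<^sup>2) \<longlongrightarrow> C * 0 powr (3 - \<alpha>) / (\<eta> / 4)\<^sup>2) (at_right 0)"
    using al \<eta> by (intro tendsto_intros tendsto_powr') (auto simp: eventually_at_filter)
  then have ev1: "\<forall>\<^sub>F \<delta> in at_right 0. C * \<delta> powr (3 - \<alpha>) / (\<eta> / 4)\<^sup>2 < \<kappa> / 2"
    by (rule order_tendstoD) (use \<kappa> in simp)
  have "((\<lambda>\<delta>::real. \<delta> powr (3/2)) \<longlongrightarrow> 0 powr (3/2)) (at_right 0)"
    by (intro tendsto_intros tendsto_powr') (auto simp: eventually_at_filter)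
  then have ev2: "\<forall>\<^sub>F \<delta>::real in at_right 0. \<delta> powr (3/2) < \<eta> / 2"
    by (rule order_tendstoD) (use \<eta> in simp)
  obtain \<delta>1 where \<delta>1: "0 < \<delta>1" and d1: "\<And>\<delta>. 0 < \<delta> \<Longrightarrow> \<delta> < \<delta>1 \<Longrightarrow> C * \<delta> powr (3 - \<alpha>) / (\<eta> / 4)\<^sup>2 < \<kappa> / 2 \<and> \<delta> powr (3/2) < \<eta> / 2"
    using eventually_conj[OF ev1 ev2] unfolding eventually_at_right_field by blast
  show ?thesis
  proof (intro exI[of _ "\<delta>1 / 2"] conjI allI impI)
    fix \<delta> assume "0 < \<delta>" "\<delta> \<le> \<delta>1 / 2"
    then have \<delta>: "0 < \<delta>" "C * \<delta> powr (3 - \<alpha>) / (\<eta> / 4)\<^sup>2 < \<kappa> / 2" "\<delta> powr (3/2) < \<eta> / 2"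
      using d1[of \<delta>] \<delta>1 by auto
    let ?A = "\<lambda>s. {z::nat \<times> nat. real (fst z) \<le> \<delta> * s \<and> \<eta> / 4 * s powr (3/2) < real (fst z) * \<bar>real (snd z) - \<mu> * real (fst z)\<bar>}"
    let ?B = "\<lambda>s. {z::(nat \<times> nat) \<times> nat. \<eta> / 4 * s powr (3/2) < real (fst (fst z)) * (real (snd z) + \<bar>\<mu>B\<bar>)}"
    have ev3: "\<forall>\<^sub>F s in at_top. measure_pmf.prob (pair_pmf MS Bp) (?B s) / H s < \<kappa> / 2"
      using \<eta> \<kappa> by (intro order_tendstoD(2)[OF product_negligible]) auto
    have ev4: "\<forall>\<^sub>F s in at_top. measure_pmf.prob MS (?A s) \<le> C * \<delta> powr (3 - \<alpha>) / (\<eta> / 4)\<^sup>2 * H s"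
      using \<delta> \<eta> by (intro C) auto
    show "\<forall>\<^sub>F s in at_top. measure_pmf.prob (path 1) {p. real (p 0) \<le> \<delta> * s \<and> \<eta> < norm (zeta (s powr (3/2)) p 0)} \<le> \<kappa> * H s"
      using ev3 ev4 eventually_gt_at_top[of 0]
    proof eventually_elim
      case (elim s)
      define E where "E = {z::nat \<times> nat. real (fst z) \<le> \<delta> * s \<and> \<eta> / 2 * s powr (3/2) < real (fst z) * \<bar>real (snd z) - \<mu> * real (fst z) - \<mu>B\<bar>}"
      have sub: "{p. real (p 0) \<le> \<delta> * s \<and> \<eta> < norm (zeta (s powr (3/2)) p 0)} \<subseteq> {p. (p 0, p 1) \<in> E}"
      proof safe
        fix p assume p: "real (p 0) \<le> \<delta> * s" "\<eta> < norm (zeta (s powr (3/2)) p 0)"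
        have "real (p 0) powr (3/2) \<le> (\<delta> * s) powr (3/2)" using p by (intro powr_mono2) auto
        also have "\<dots> = \<delta> powr (3/2) * s powr (3/2)" by (rule powr_mult)
        also have "\<dots> \<le> \<eta> / 2 * s powr (3/2)" using \<delta> by (intro mult_right_mono) auto
        finally have "real (p 0) powr (3/2) / s powr (3/2) \<le> \<eta> / 2" using elim by (simp add: divide_le_eq)
        moreover have "\<eta> < real (p 0) powr (3/2) / s powr (3/2) + real (p 0) * \<bar>real (p 1) - \<mu> * real (p 0) - \<mu>B\<bar> / s powr (3/2)"
          using less_le_trans[OF p(2) norm_zeta_le] elim by simp
        ultimately have "\<eta> / 2 < real (p 0) * \<bar>real (p 1) - \<mu> * real (p 0) - \<mu>B\<bar> / s powr (3/2)" by linarith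
        then show "(p 0, p 1) \<in> E" using p elim by (simp add: E_def less_divide_eq)
      qed
      have "measure_pmf.prob (path 1) {p. real (p 0) \<le> \<delta> * s \<and> \<eta> < norm (zeta (s powr (3/2)) p 0)}
          \<le> measure_pmf.prob (path 1) {p. (p 0, p 1) \<in> E}"
        by (intro measure_pmf.finite_measure_mono sub) auto
      also have "\<dots> = measure_pmf.prob (map_pmf (\<lambda>p. (p 0, p 1)) (path 1)) E"
        by (simp add: vimage_def)
      also have "\<dots> = measure_pmf.prob (pair_pmf MS Bp) {z. (fst (fst z), snd (fst z) + snd z) \<in> E}"
        unfolding path_1_MS by (simp add: vimage_def)
      also have "\<dots> \<le> measure_pmf.prob (pair_pmf MS Bp) ({z. fst z \<in> ?A s} \<union> ?B s)"
      proof (intro measure_pmf.finite_measure_mono)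
        show "{z. (fst (fst z), snd (fst z) + snd z) \<in> E} \<subseteq> {z. fst z \<in> ?A s} \<union> ?B s"
        proof
          fix z assume "z \<in> {z. (fst (fst z), snd (fst z) + snd z) \<in> E}"
          then have z: "real (fst (fst z)) \<le> \<delta> * s"
            "\<eta> / 2 * s powr (3/2) < real (fst (fst z)) * \<bar>real (snd (fst z) + snd z) - \<mu> * real (fst (fst z)) - \<mu>B\<bar>"
            by (auto simp: E_def)
          note z(2)
          also have "real (fst (fst z)) * \<bar>real (snd (fst z) + snd z) - \<mu> * real (fst (fst z)) - \<mu>B\<bar>
              \<le> real (fst (fst z)) * (\<bar>real (snd (fst z)) - \<mu> * real (fst (fst z))\<bar> + (real (snd z) + \<bar>\<mu>B\<bar>))"
            by (intro mult_left_mono) auto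
          finally have "\<eta> / 2 * s powr (3/2) < real (fst (fst z)) * \<bar>real (snd (fst z)) - \<mu> * real (fst (fst z))\<bar>
              + real (fst (fst z)) * (real (snd z) + \<bar>\<mu>B\<bar>)" by (simp add: distrib_left)
          then have "\<eta> / 4 * s powr (3/2) < real (fst (fst z)) * \<bar>real (snd (fst z)) - \<mu> * real (fst (fst z))\<bar>
              \<or> \<eta> / 4 * s powr (3/2) < real (fst (fst z)) * (real (snd z) + \<bar>\<mu>B\<bar>)" by linarith
          then show "z \<in> {z. fst z \<in> ?A s} \<union> ?B s" using z by auto
        qed
      qed auto
      also have "\<dots> \<le> measure_pmf.prob (pair_pmf MS Bp) {z. fst z \<in> ?A s} + measure_pmf.prob (pair_pmf MS Bp) (?B s)"
        by (rule measure_Un_le) auto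
      also have "measure_pmf.prob (pair_pmf MS Bp) {z. fst z \<in> ?A s} = measure_pmf.prob MS (?A s)"
        using prob_MS_B1[of "\<lambda>z. z \<in> ?A s"] by simp
      also have "\<dots> \<le> \<kappa> / 2 * H s"
        using elim(2) \<delta>(2) H_pos[of s] by (meson mult_right_mono less_imp_le order_trans)
      also have "measure_pmf.prob (pair_pmf MS Bp) (?B s) \<le> \<kappa> / 2 * H s"
        using elim(1) H_pos[of s] by (simp add: divide_less_eq)
      finally show ?case by simp
    qed
  qed (use \<delta>1 in simp)
qed

text \<open>Either the start is above $\delta s$, which regular variation makes comparable with $H(s)$, or the previous lemma applies.\<close>

lemma zeta_tail: assumes "0 < \<epsilon>"
  shows "\<exists>D>0. \<forall>\<^sub>F s in at_top. measure_pmf.prob (path 1) {p. \<epsilon> < norm (zeta (s powr (3/2)) p 0)} \<le> D * H s"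
proof -
  obtain \<delta> where \<delta>: "0 < \<delta>" "\<forall>\<^sub>F s in at_top.
    measure_pmf.prob (path 1) {p. real (p 0) \<le> \<delta> * s \<and> \<epsilon> < norm (zeta (s powr (3/2)) p 0)} \<le> 1 * H s"
    using small_start_negligible[OF assms, of 1] by auto
  have ev: "\<forall>\<^sub>F s in at_top. H (\<delta> * s) / H s < \<delta> powr (- \<alpha>) + 1"
    using \<delta> by (intro order_tendstoD(2)[OF H_ratio]) auto
  have p0: "measure_pmf.prob (path 1) {p. x < real (p 0)} = H x" for x
  proof -
    have "map_pmf (\<lambda>p. p 0) (path 1) = map_pmf fst (map_pmf (\<lambda>p. (p 0, p 1)) (path 1))" by (simp only: pmf.map_comp o_def fst_conv)
    also have "\<dots> = map_pmf fst (map_pmf fst (pair_pmf MS Bp))" unfolding path_1_MS by (simp only: pmf.map_comp o_def fst_conv)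
    also have "\<dots> = \<pi>" by (simp only: map_fst_pair_pmf MS_fst)
    finally have eq: "map_pmf (\<lambda>p. p 0) (path 1) = \<pi>" .
    have "H x = measure_pmf.prob (map_pmf (\<lambda>p. p 0) (path 1)) {l. x < real l}" by (simp only: tail_def eq)
    then show ?thesis by (simp only: measure_map_pmf vimage_Collect_eq)
  qed
  have "\<forall>\<^sub>F s in at_top. measure_pmf.prob (path 1) {p. \<epsilon> < norm (zeta (s powr (3/2)) p 0)} \<le> (\<delta> powr (- \<alpha>) + 2) * H s"
    using \<delta>(2) ev
  proof eventually_elim
    case (elim s)
    have "measure_pmf.prob (path 1) {p. \<epsilon> < norm (zeta (s powr (3/2)) p 0)}
      \<le> measure_pmf.prob (path 1) ({p. \<delta> * s < real (p 0)} \<union> {p. real (p 0) \<le> \<delta> * s \<and> \<epsilon> < norm (zeta (s powr (3/2)) p 0)})"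
      by (intro measure_pmf.finite_measure_mono) auto
    also have "\<dots> \<le> H (\<delta> * s) + measure_pmf.prob (path 1) {p. real (p 0) \<le> \<delta> * s \<and> \<epsilon> < norm (zeta (s powr (3/2)) p 0)}"
      unfolding p0[symmetric] by (rule measure_Un_le) auto
    also have "H (\<delta> * s) \<le> (\<delta> powr (- \<alpha>) + 1) * H s" using elim(2) H_pos[of s] by (simp add: divide_less_eq)
    finally show ?case using elim(1) by (simp add: algebra_simps)
  qed
  then show ?thesis by (intro exI[of _ "\<delta> powr (- \<alpha>) + 2"]) (auto intro: add_nonneg_pos)
qed

text \<open>Combines the limit for starting values above $\delta s$ with the negligibility of those below, letting $\delta \rightarrow 0$ after $s \rightarrow \infty$.\<close>

lemma anchored_limit:
  fixes g :: "(nat \<Rightarrow> real \<times> real) \<Rightarrow> real"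
  assumes gm: "g \<in> borel_measurable (PiM UNIV (\<lambda>_. borel))" and C: "\<And>y. \<bar>g y\<bar> \<le> C"
    and cont: "\<And>Y y. (\<And>k. k \<le> n \<Longrightarrow> (\<lambda>i. Y i k) \<longlonglongrightarrow> y k) \<Longrightarrow> (\<lambda>i. g (Y i)) \<longlonglongrightarrow> g y"
    and L: "0 < L" "\<And>y. \<bar>g y\<bar> \<le> L * norm (y 0)"
    and \<epsilon>: "0 < \<epsilon>" "\<And>y. (\<And>k. k \<le> n \<Longrightarrow> norm (y k) \<le> \<epsilon>) \<Longrightarrow> g y = 0"
  shows "((\<lambda>s. measure_pmf.expectation (path (Suc n)) (\<lambda>p. g (zeta (s powr (3/2)) p)) / H s)
     \<longlongrightarrow> (\<integral>\<omega>. g (trail (fst \<omega>) (snd \<omega>)) \<partial>QN)) at_top"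
proof (rule tendsto_at_topI_sequentially)
  fix s :: "nat \<Rightarrow> real" assume s: "filterlim s at_top sequentially"
  interpret PS: pair_sigma_finite nu NN by (rule pair_sf)
  interpret I: prob_space NN by (rule prob_space_NN)
  note [measurable] = gm
  let ?z = "\<lambda>i p. zeta (s i powr (3/2)) p"
  let ?E = "measure_pmf.expectation (path (Suc n))"
  have C0: "0 \<le> C" using order_trans[OF abs_ge_zero C] .
  define G where "G q = (\<integral>z. g (trail q z) \<partial>NN)" for q
  have hm: "(\<lambda>(q, z). g (trail q z)) \<in> borel_measurable (borel \<Otimes>\<^sub>M PiM UNIV (\<lambda>_. borel))"
    by (simp add: case_prod_beta')
  have dep: "g y = g y'" if "\<And>k. k \<le> n \<Longrightarrow> y k = y' k" for y y'
    using cont[of "\<lambda>_. y" y'] that by (simp add: LIMSEQ_const_iff)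
  have iQ: "integrable QN (\<lambda>\<omega>. g (trail (fst \<omega>) (snd \<omega>)))"
    by (rule integrable_QN[where C=C and \<epsilon>=\<epsilon> and n=n]) (use C \<epsilon> in auto)
  then have iQ': "integrable QN (\<lambda>(q, z). g (trail q z))" by (simp add: case_prod_beta')
  have iG: "integrable nu G" unfolding G_def by (rule PS.integrable_fst[OF iQ'])
  have aG: "(\<integral>\<omega>. g (trail (fst \<omega>) (snd \<omega>)) \<partial>QN) = (\<integral>q. G q \<partial>nu)"
    unfolding G_def using PS.integral_fst[OF iQ'] by (simp add: case_prod_beta')
  have lim: "(\<lambda>i. ?E (\<lambda>p. g (?z i p) * indicator {p. \<delta> * s i < real (p 0)} p) / H (s i)) \<longlonglongrightarrow> (\<integral>q. G q * indicator {\<delta><..} q \<partial>nu)"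
    if "0 < \<delta>" for \<delta>
    unfolding G_def
  proof (rule path_limit[OF s that C _ hm])
    show "g (trail q z) = g (trail q z')" if "\<And>k. k < Suc n \<Longrightarrow> z k = z' k" for q z z'
      using that by (intro dep) (simp add: trail_def)
    show "(\<lambda>i. g (?z i (p i))) \<longlonglongrightarrow> g (trail q z)"
      if "(\<lambda>i. real (p i 0) / s i) \<longlonglongrightarrow> q" "0 < q" "\<And>k. k < Suc n \<Longrightarrow> (\<lambda>i. innov (p i) k) \<longlonglongrightarrow> z k" for p q z
      by (intro cont zeta_tendsto[OF s that])
  qed (use C in auto)
  have dct: "(\<lambda>m. \<integral>q. G q * indicator {1 / real (Suc m)<..} q \<partial>nu) \<longlonglongrightarrow> (\<integral>q. G q \<partial>nu)"
  proof (rule integral_dominated_convergence[where w="\<lambda>q. \<bar>G q\<bar>"])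
    show "integrable nu (\<lambda>q. \<bar>G q\<bar>)" using iG by simp
    show "AE q in nu. (\<lambda>m. G q * indicator {1 / real (Suc m)<..} q) \<longlonglongrightarrow> G q"
      using AE_nu_pos
    proof eventually_elim
      case (elim q)
      have "(\<lambda>m. 1 / real (Suc m)) \<longlonglongrightarrow> 0" by (rule LIMSEQ_Suc[OF lim_1_over_n])
      then have "\<forall>\<^sub>F m in sequentially. 1 / real (Suc m) < q" using elim by (rule order_tendstoD)
      then have "\<forall>\<^sub>F m in sequentially. G q * indicator {1 / real (Suc m)<..} q = G q" by eventually_elim simp
      then show ?case by (rule tendsto_eventually)
    qed
    have "G \<in> borel_measurable nu" using iG by simp
    then show "G \<in> borel_measurable nu" "(\<lambda>q. G q * indicator {1 / real (Suc m)<..} q) \<in> borel_measurable nu" for m by auto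
  qed (auto simp: indicator_def)
  show "(\<lambda>i. ?E (\<lambda>p. g (?z i p)) / H (s i)) \<longlonglongrightarrow> (\<integral>\<omega>. g (trail (fst \<omega>) (snd \<omega>)) \<partial>QN)"
    unfolding aG
  proof (rule tendstoI)
    fix e :: real assume e: "0 < e"
    obtain D where D: "0 < D" and evD: "\<forall>\<^sub>F s in at_top. measure_pmf.prob (path 1) {p. \<epsilon> < norm (zeta (s powr (3/2)) p 0)} \<le> D * H s"
      using zeta_tail[OF \<epsilon>(1)] by blast
    define \<eta> where "\<eta> = e / (6 * L * real (Suc n) * D)"
    define \<kappa> where "\<kappa> = e / (6 * (C + 1))"
    have \<eta>: "0 < \<eta>" using e L D by (simp add: \<eta>_def)
    have \<kappa>: "0 < \<kappa>" using e C0 by (simp add: \<kappa>_def)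
    obtain \<delta>0 where \<delta>0: "0 < \<delta>0" and ev\<delta>: "\<And>\<delta>. 0 < \<delta> \<Longrightarrow> \<delta> \<le> \<delta>0 \<Longrightarrow> \<forall>\<^sub>F s in at_top.
       measure_pmf.prob (path 1) {p. real (p 0) \<le> \<delta> * s \<and> \<eta> < norm (zeta (s powr (3/2)) p 0)} \<le> \<kappa> * H s"
      using small_start_negligible[OF \<eta> \<kappa>] by blast
    have "(\<lambda>m. 1 / real (Suc m)) \<longlonglongrightarrow> 0" by (rule LIMSEQ_Suc[OF lim_1_over_n])
    then have "\<forall>\<^sub>F m in sequentially. 1 / real (Suc m) < \<delta>0" using \<delta>0 by (rule order_tendstoD)
    moreover have "\<forall>\<^sub>F m in sequentially. dist (\<integral>q. G q * indicator {1 / real (Suc m)<..} q \<partial>nu) (\<integral>q. G q \<partial>nu) < e / 3"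
      using e by (intro tendstoD[OF dct]) simp
    ultimately obtain m where m: "1 / real (Suc m) < \<delta>0" "dist (\<integral>q. G q * indicator {1 / real (Suc m)<..} q \<partial>nu) (\<integral>q. G q \<partial>nu) < e / 3"
      using eventually_happens'[OF sequentially_bot eventually_conj] by blast
    define \<delta> where "\<delta> = 1 / real (Suc m)"
    have \<delta>: "0 < \<delta>" "\<delta> \<le> \<delta>0" using m by (auto simp: \<delta>_def)
    have ev1: "\<forall>\<^sub>F i in sequentially. dist (?E (\<lambda>p. g (?z i p) * indicator {p. \<delta> * s i < real (p 0)} p) / H (s i)) (\<integral>q. G q * indicator {\<delta><..} q \<partial>nu) < e / 3"
      using e by (intro tendstoD[OF lim] \<delta>) simp
    have ev2: "\<forall>\<^sub>F i in sequentially. measure_pmf.prob (path 1) {p. \<epsilon> < norm (?z i p 0)} \<le> D * H (s i)"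
      using eventually_compose_filterlim[OF evD s] .
    have ev3: "\<forall>\<^sub>F i in sequentially. measure_pmf.prob (path 1) {p. real (p 0) \<le> \<delta> * s i \<and> \<eta> < norm (?z i p 0)} \<le> \<kappa> * H (s i)"
      using eventually_compose_filterlim[OF ev\<delta>[OF \<delta>] s] .
    show "\<forall>\<^sub>F i in sequentially. dist (?E (\<lambda>p. g (?z i p)) / H (s i)) (\<integral>q. G q \<partial>nu) < e"
      using ev1 ev2 ev3
    proof eventually_elim
      case (elim i)
      have Hp: "0 < H (s i)" by (rule H_pos)
      let ?P = "measure_pmf.prob (path (Suc n))"
      define A where "A = {p. real (p 0) \<le> \<delta> * s i \<and> \<eta> < norm (?z i p 0)}"
      define B where "B k = {p. \<epsilon> < norm (?z i p k)}" for k
      have ib: "integrable (path (Suc n)) (\<lambda>p. g (?z i p) * indicator S p)" for S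
        by (rule integrable_pmf_bounded[where C=C]) (use C C0 in \<open>auto simp: indicator_def\<close>)
      have split: "g (?z i p) = g (?z i p) * indicator {p. \<delta> * s i < real (p 0)} p + g (?z i p) * indicator {p. real (p 0) \<le> \<delta> * s i} p" for p
        by (auto simp: indicator_def)
      have E: "?E (\<lambda>p. g (?z i p)) = ?E (\<lambda>p. g (?z i p) * indicator {p. \<delta> * s i < real (p 0)} p) + ?E (\<lambda>p. g (?z i p) * indicator {p. real (p 0) \<le> \<delta> * s i} p)"
        by (subst split) (rule Bochner_Integration.integral_add[OF ib ib])
      have ptw: "\<bar>g (?z i p) * indicator {p. real (p 0) \<le> \<delta> * s i} p\<bar> \<le> C * indicator A p + L * \<eta> * (\<Sum>k\<le>n. indicator (B k) p)" for p
      proof -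
        have S0: "0 \<le> L * \<eta> * (\<Sum>k\<le>n. indicator (B k) p :: real)" using L \<eta> by (intro mult_nonneg_nonneg sum_nonneg) auto
        consider "p \<in> A" | "\<not> real (p 0) \<le> \<delta> * s i" | "\<forall>k\<le>n. norm (?z i p k) \<le> \<epsilon>" |
          k where "real (p 0) \<le> \<delta> * s i" "norm (?z i p 0) \<le> \<eta>" "k \<le> n" "p \<in> B k"
          unfolding A_def B_def by (auto simp: not_le) (meson not_le)
        then show ?thesis
        proof cases
          case 1 then show ?thesis using C[of "?z i p"] S0 C0 by (auto simp: indicator_def)
        next
          case 2 then show ?thesis using S0 C0 by (auto simp: indicator_def)
        next
          case 3 then show ?thesis using S0 C0 \<epsilon>(2)[of "?z i p"] by (auto simp: indicator_def)
        next
          case 4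
          have "\<bar>g (?z i p)\<bar> \<le> L * norm (?z i p 0)" by (rule L)
          also have "\<dots> \<le> L * \<eta> * 1" using 4 L by simp
          also have "\<dots> \<le> L * \<eta> * (\<Sum>k\<le>n. indicator (B k) p)"
          proof (rule mult_left_mono)
            have "indicator (B k) p \<le> (\<Sum>k\<le>n. indicator (B k) p :: real)" using 4 by (intro member_le_sum) auto
            then show "1 \<le> (\<Sum>k\<le>n. indicator (B k) p :: real)" using 4 by simp
          qed (use L \<eta> in simp)
          finally have "\<bar>g (?z i p)\<bar> \<le> L * \<eta> * (\<Sum>k\<le>n. indicator (B k) p)" .
          moreover have "0 \<le> C * indicator A p" using C0 by simp
          ultimately show ?thesis using 4 by simp
        qed
      qed
      have iA: "integrable (path (Suc n)) (indicator S :: _ \<Rightarrow> real)" for S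
        by (rule integrable_pmf_bounded[where C=1]) (auto simp: indicator_def)
      have "\<bar>?E (\<lambda>p. g (?z i p) * indicator {p. real (p 0) \<le> \<delta> * s i} p)\<bar>
         \<le> ?E (\<lambda>p. \<bar>g (?z i p) * indicator {p. real (p 0) \<le> \<delta> * s i} p\<bar>)" by (rule integral_abs_bound)
      also have "\<dots> \<le> ?E (\<lambda>p. C * indicator A p + L * \<eta> * (\<Sum>k\<le>n. indicator (B k) p))"
        by (rule integral_mono[OF integrable_abs[OF ib] _ ptw]) (intro Bochner_Integration.integrable_add integrable_mult_right Bochner_Integration.integrable_sum iA)
      also have "\<dots> = C * ?P A + L * \<eta> * (\<Sum>k\<le>n. ?P (B k))"
        using iA by (subst Bochner_Integration.integral_add) (auto simp: Bochner_Integration.integral_sum)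
      also have "?P A = measure_pmf.prob (path 1) A"
      proof -
        have "?P A = measure_pmf.prob (map_pmf (\<lambda>p. (p 0, p (Suc 0))) (path (Suc n))) {w. real (fst w) \<le> \<delta> * s i \<and> \<eta> < norm (?z i (\<lambda>k. if k = 0 then fst w else snd w) 0)}"
          by (simp add: vimage_def A_def zeta_def)
        also have "\<dots> = measure_pmf.prob (path 1) A"
          unfolding path_pair[OF zero_less_Suc] by (simp add: vimage_def A_def zeta_def)
        finally show ?thesis .
      qed
      also have "\<dots> \<le> \<kappa> * H (s i)" using elim(3) by (simp add: A_def)
      also have "(\<Sum>k\<le>n. ?P (B k)) \<le> (\<Sum>k\<le>n. D * H (s i))"
      proof (rule sum_mono)
        fix k assume k: "k \<in> {..n}"
        have "?P (B k) = measure_pmf.prob (map_pmf (\<lambda>p. (p k, p (Suc k))) (path (Suc n))) {w. \<epsilon> < norm (?z i (\<lambda>k. if k = 0 then fst w else snd w) 0)}"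
          by (simp add: vimage_def B_def zeta_def)
        also have "\<dots> = measure_pmf.prob (path 1) {p. \<epsilon> < norm (?z i p 0)}"
          using k by (subst path_pair) (simp_all add: vimage_def zeta_def)
        also have "\<dots> \<le> D * H (s i)" by (rule elim(2))
        finally show "?P (B k) \<le> D * H (s i)" .
      qed
      finally have "\<bar>?E (\<lambda>p. g (?z i p) * indicator {p. real (p 0) \<le> \<delta> * s i} p)\<bar> \<le> C * (\<kappa> * H (s i)) + L * \<eta> * (real (Suc n) * (D * H (s i)))"
        using C0 L \<eta> by (simp add: mult_left_mono)
      also have "\<dots> = (C * \<kappa> + L * \<eta> * real (Suc n) * D) * H (s i)" by (simp add: algebra_simps)
      also have "\<dots> \<le> (e / 6 + e / 6) * H (s i)"
      proof (intro mult_right_mono add_mono)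
        have "C * \<kappa> = e / 6 * (C / (C + 1))" using C0 by (simp add: \<kappa>_def)
        also have "\<dots> \<le> e / 6 * 1" using C0 e by (intro mult_left_mono) (auto simp: divide_le_eq)
        finally show "C * \<kappa> \<le> e / 6" by simp
        show "L * \<eta> * real (Suc n) * D \<le> e / 6" using L D by (simp add: \<eta>_def)
      qed (use Hp in simp)
      finally have "\<bar>?E (\<lambda>p. g (?z i p) * indicator {p. real (p 0) \<le> \<delta> * s i} p) / H (s i)\<bar> \<le> e / 3"
        using Hp by (simp add: abs_divide divide_le_eq)
      then show ?case using elim(1) m(2) unfolding E add_divide_distrib \<delta>_def[symmetric] dist_real_def by linarith
    qed
  qed
qed

end

section \<open>From anchored to arbitrary windows\<close>

definition wdist :: "int \<Rightarrow> int \<Rightarrow> (int \<Rightarrow> real \<times> real) \<Rightarrow> (int \<Rightarrow> real \<times> real) \<Rightarrow> real" where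
  "wdist a b x y = (\<Sum>k\<in>{a..b}. norm (x k - y k))"

definition wsize :: "int \<Rightarrow> int \<Rightarrow> real" where
  "wsize a b = real (card {a..b})"

lemma wsize_ge_1: "a \<le> b \<Longrightarrow> 1 \<le> wsize a b"
  by (simp add: wsize_def)

lemma wsize_sum: "(\<Sum>k\<in>{a..b}. c) = wsize a b * c"
  by (simp only: sum_constant wsize_def)

lemma wdist_nonneg: "0 \<le> wdist a b x y"
  unfolding wdist_def by (rule sum_nonneg) simp

lemma wdist_refl: "wdist a b x x = 0"
  by (simp add: wdist_def)

lemma wdist_commute: "wdist a b x y = wdist a b y x"
  unfolding wdist_def by (subst norm_minus_commute) (rule refl)

lemma wdist_triangle: "wdist a b x z \<le> wdist a b x y + wdist a b y z"
  unfolding wdist_def sum.distrib[symmetric]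
proof (intro sum_mono)
  fix k show "norm (x k - z k) \<le> norm (x k - y k) + norm (y k - z k)"
    using norm_triangle_ineq[of "x k - y k" "y k - z k"] by simp
qed

lemma wdist_cong: "(\<And>k. k \<in> {a..b} \<Longrightarrow> x k = x' k) \<Longrightarrow> wdist a b x y = wdist a b x' y"
  unfolding wdist_def by (rule sum.cong) simp_all

lemma wdist_tendsto:
  assumes "\<And>k. k \<in> {a..b} \<Longrightarrow> ((\<lambda>i. X i k) \<longlongrightarrow> x k) F"
  shows "((\<lambda>i. wdist a b (X i) x) \<longlongrightarrow> 0) F"
proof -
  have "((\<lambda>i. \<Sum>k\<in>{a..b}. norm (X i k - x k)) \<longlongrightarrow> (\<Sum>k\<in>{a..b}. norm (x k - x k))) F"
    by (intro tendsto_sum tendsto_norm tendsto_diff assms tendsto_const)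
  then show ?thesis by (simp add: wdist_def)
qed

definition wlip :: "int \<Rightarrow> int \<Rightarrow> real \<Rightarrow> ((int \<Rightarrow> real \<times> real) \<Rightarrow> real) \<Rightarrow> bool" where
  "wlip a b L f \<longleftrightarrow> 0 \<le> L \<and> (\<forall>x y. \<bar>f x - f y\<bar> \<le> L * wdist a b x y)"

definition wcont :: "int \<Rightarrow> int \<Rightarrow> (int \<Rightarrow> real \<times> real) \<Rightarrow> ((int \<Rightarrow> real \<times> real) \<Rightarrow> real) \<Rightarrow> bool" where
  "wcont a b x f \<longleftrightarrow> (\<forall>e>0. \<exists>r>0. \<forall>y. wdist a b x y < r \<longrightarrow> \<bar>f y - f x\<bar> < e)"

lemma wlip_tendsto:
  assumes f: "wlip a b L f" and "\<And>k. k \<in> {a..b} \<Longrightarrow> ((\<lambda>i. X i k) \<longlongrightarrow> x k) F"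
  shows "((\<lambda>i. f (X i)) \<longlongrightarrow> f x) F"
proof (rule Lim_transform[OF tendsto_const], rule Lim_null_comparison)
  show "\<forall>\<^sub>F i in F. norm (f (X i) - f x) \<le> L * wdist a b (X i) x"
    using f by (auto simp: wlip_def)
  show "((\<lambda>i. L * wdist a b (X i) x) \<longlongrightarrow> 0) F"
    using tendsto_mult[OF tendsto_const[of L] wdist_tendsto[OF assms(2)]] by simp
qed

lemma wlip_continuous: "wlip a b L f \<Longrightarrow> continuous_on UNIV f"
proof (rule continuous_at_imp_continuous_on, safe)
  fix x :: "int \<Rightarrow> real \<times> real" assume f: "wlip a b L f"
  have "((\<lambda>y. y k) \<longlongrightarrow> x k) (at x)" for k :: int
  proof -
    have "continuous_on UNIV (\<lambda>y::int \<Rightarrow> real \<times> real. y k)" by (rule continuous_on_product_coordinates)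
    then show ?thesis by (simp add: continuous_on_def)
  qed
  then show "isCont f x" unfolding isCont_def by (intro wlip_tendsto[OF f])
qed

lemma wlip_measurable: "wlip a b L f \<Longrightarrow> f \<in> borel_measurable (PiM UNIV (\<lambda>_. borel))"
  using borel_measurable_continuous_onI[OF wlip_continuous] measurable_cong_sets[OF sets_PiM_equal_borel refl] by blast

lemma wlip_wcont: assumes "wlip a b L f" shows "wcont a b x f"
  unfolding wcont_def
proof (intro allI impI)
  fix e :: real assume e: "0 < e"
  have L: "0 \<le> L" using assms by (simp add: wlip_def)
  show "\<exists>r>0. \<forall>y. wdist a b x y < r \<longrightarrow> \<bar>f y - f x\<bar> < e"
  proof (intro exI[of _ "e / (L + 1)"] conjI allI impI)
    fix y assume "wdist a b x y < e / (L + 1)"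
    then have "(L + 1) * wdist a b x y < e" using L by (simp add: less_divide_eq mult.commute)
    moreover have "\<bar>f y - f x\<bar> \<le> L * wdist a b x y" using assms by (simp add: wlip_def wdist_commute[of a b x])
    ultimately show "\<bar>f y - f x\<bar> < e" using wdist_nonneg[of a b x y] by (simp add: distrib_right)
  qed (use e L in simp)
qed

text \<open>The filter of neighbourhoods in the window, so that continuity there can be handled by limit rules.\<close>

definition wnhd where "wnhd a b x = (INF r\<in>{0<..}. principal {y. wdist a b y x < r})"

lemma wcont_iff_tendsto: "wcont a b x f \<longleftrightarrow> (f \<longlongrightarrow> f x) (wnhd a b x)"
proof -
  have ev: "eventually P (wnhd a b x) \<longleftrightarrow> (\<exists>r>0. \<forall>y. wdist a b y x < r \<longrightarrow> P y)" for P
    unfolding wnhd_def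
  proof (subst eventually_INF_base)
    fix r r' :: real assume "r \<in> {0<..}" "r' \<in> {0<..}"
    then show "\<exists>x'\<in>{0<..}. principal {y. wdist a b y x < x'} \<le> inf (principal {y. wdist a b y x < r}) (principal {y. wdist a b y x < r'})"
      by (intro bexI[of _ "min r r'"]) auto
  qed (auto simp: eventually_principal)
  show ?thesis unfolding tendsto_iff ev wcont_def dist_real_def by (simp add: wdist_commute[of a b x])
qed

lemma wcont_mult: "wcont a b x f \<Longrightarrow> wcont a b x g \<Longrightarrow> wcont a b x (\<lambda>x. f x * g x)"
  and wcont_add: "wcont a b x f \<Longrightarrow> wcont a b x g \<Longrightarrow> wcont a b x (\<lambda>x. f x + g x)"
  and wcont_diff: "wcont a b x f \<Longrightarrow> wcont a b x g \<Longrightarrow> wcont a b x (\<lambda>x. f x - g x)"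
  unfolding wcont_iff_tendsto by (rule tendsto_mult, assumption, assumption) (rule tendsto_add, assumption, assumption, rule tendsto_diff, assumption, assumption)

lemma wcont_compose: "wcont a b x f \<Longrightarrow> isCont g (f x) \<Longrightarrow> wcont a b x (\<lambda>x. g (f x))"
  unfolding wcont_iff_tendsto by (rule isCont_tendsto_compose)

lemma wcont_const: "wcont a b x (\<lambda>_. c)" unfolding wcont_iff_tendsto by simp

lemma wcont_eventually_eq:
  "wcont a b x f \<Longrightarrow> 0 < r \<Longrightarrow> (\<And>y. wdist a b y x < r \<Longrightarrow> g y = f y) \<Longrightarrow> wcont a b x g"
  unfolding wcont_def
proof (intro allI impI)
  fix e :: real
  assume f: "\<forall>e>0. \<exists>r>0. \<forall>y. wdist a b x y < r \<longrightarrow> \<bar>f y - f x\<bar> < e" and r: "0 < r"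
    and g: "\<And>y. wdist a b y x < r \<Longrightarrow> g y = f y" and e: "0 < e"
  obtain r' where r': "0 < r'" "\<And>y. wdist a b x y < r' \<Longrightarrow> \<bar>f y - f x\<bar> < e" using f e by blast
  have gx: "g x = f x" using g[of x] r by (simp add: wdist_refl)
  show "\<exists>r>0. \<forall>y. wdist a b x y < r \<longrightarrow> \<bar>g y - g x\<bar> < e"
  proof (intro exI[of _ "min r r'"] conjI allI impI)
    fix y assume y: "wdist a b x y < min r r'"
    then have "g y = f y" by (intro g) (simp add: wdist_commute[of a b y x])
    then show "\<bar>g y - g x\<bar> < e" using r'(2)[of y] y gx by simp
  qed (use r r' in simp)
qed

definition infconv :: "int \<Rightarrow> int \<Rightarrow> ((int \<Rightarrow> real \<times> real) \<Rightarrow> real) \<Rightarrow> real \<Rightarrow> (int \<Rightarrow> real \<times> real) \<Rightarrow> real" where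
  "infconv a b f m x = (INF y. f y + m * wdist a b x y)"

text \<open>The infimal convolution with a multiple of the window distance: the classical approximation of a function from below by Lipschitz functions. Lying between $0$ and $f$, it vanishes wherever $f$ does.\<close>

lemma infconv_props:
  assumes f: "\<And>x. 0 \<le> f x" and m: "0 \<le> m"
  shows "0 \<le> infconv a b f m x" and "infconv a b f m x \<le> f x" and "wlip a b m (infconv a b f m)"
    and "infconv a b f m x \<le> f y + m * wdist a b x y"
proof -
  have bdd: "bdd_below (range (\<lambda>y. f y + m * wdist a b x y))" for x
    using f m wdist_nonneg by (intro bdd_belowI[of _ 0]) (auto intro!: add_nonneg_nonneg mult_nonneg_nonneg)
  show le: "infconv a b f m x \<le> f y + m * wdist a b x y" for x y
    unfolding infconv_def by (rule cINF_lower[OF bdd]) simp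
  show "0 \<le> infconv a b f m x"
    unfolding infconv_def using f m wdist_nonneg by (intro cINF_greatest) (auto intro!: add_nonneg_nonneg mult_nonneg_nonneg)
  show "infconv a b f m x \<le> f x" using le[of x x] by (simp add: wdist_refl)
  have one: "infconv a b f m x \<le> infconv a b f m x' + m * wdist a b x x'" for x x'
  proof -
    have "infconv a b f m x - m * wdist a b x x' \<le> infconv a b f m x'"
      unfolding infconv_def[of a b f m x']
    proof (rule cINF_greatest)
      fix y
      have "m * wdist a b x y \<le> m * (wdist a b x x' + wdist a b x' y)" using m by (intro mult_left_mono wdist_triangle)
      then show "infconv a b f m x - m * wdist a b x x' \<le> f y + m * wdist a b x' y"
        using le[of x y] by (simp add: distrib_left)
    qed simp
    then show ?thesis by simp
  qed
  show "wlip a b m (infconv a b f m)"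
    unfolding wlip_def
  proof (intro conjI allI m)
    fix x y show "\<bar>infconv a b f m x - infconv a b f m y\<bar> \<le> m * wdist a b x y"
      using one[of x y] one[of y x] wdist_commute[of a b y x] by (simp add: abs_le_iff)
  qed
qed

text \<open>At points of continuity the Lipschitz approximations recover the function.\<close>

lemma infconv_tendsto:
  assumes f: "\<And>x. 0 \<le> f x" "\<And>x. f x \<le> C" and x: "wcont a b x f"
  shows "(\<lambda>m. infconv a b f (real m) x) \<longlonglongrightarrow> f x"
proof (rule tendstoI)
  fix e :: real assume e: "0 < e"
  obtain r where r: "0 < r" "\<And>y. wdist a b x y < r \<Longrightarrow> \<bar>f y - f x\<bar> < e / 2"
    using x e unfolding wcont_def by (meson half_gt_zero)
  have "\<forall>\<^sub>F m in sequentially. C / r \<le> real m" using filterlim_real_sequentially by (simp add: filterlim_at_top)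
  then show "\<forall>\<^sub>F m in sequentially. dist (infconv a b f (real m) x) (f x) < e"
  proof eventually_elim
    case (elim m)
    have "f x - e / 2 \<le> infconv a b f (real m) x"
      unfolding infconv_def
    proof (rule cINF_greatest)
      fix y
      show "f x - e / 2 \<le> f y + real m * wdist a b x y"
      proof (cases "wdist a b x y < r")
        case True
        then have "f x - e / 2 \<le> f y" using r(2)[OF True] by linarith
        then show ?thesis using wdist_nonneg[of a b x y] by (simp add: add_increasing2)
      next
        case False
        have "C \<le> real m * r" using elim r by (simp add: divide_le_eq)
        also have "\<dots> \<le> real m * wdist a b x y" using False by (intro mult_left_mono) auto
        finally show ?thesis using f(1)[of y] f(2)[of x] e by linarith
      qed
    qed simp
    then show ?case using infconv_props(2)[of f "real m" a b x, OF f(1)] e by (simp add: dist_real_def)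
  qed
qed

context branching begin

lemma zeta_shift: "zeta x (\<lambda>j. p (j + i)) = (\<lambda>j. zeta x p (j + i))"
  by (simp add: zeta_def fun_eq_iff)

abbreviation pathE :: "int \<Rightarrow> int \<Rightarrow> ((int \<Rightarrow> real \<times> real) \<Rightarrow> real) \<Rightarrow> real \<Rightarrow> real" where
  "pathE a b f s \<equiv> measure_pmf.expectation (path (Suc (nat (b - a)))) (\<lambda>p. f (embed a (zeta (s powr (3/2)) p))) / H s"

definition Lam :: "((int \<Rightarrow> real \<times> real) \<Rightarrow> real) \<Rightarrow> real" where
  "Lam f = (1 - \<mu> powr \<alpha>) * (\<integral>\<omega>. f (U \<omega>) \<partial>Xi)"

text \<open>Telescoping: a window functional is the sum over $i$ of the difference between its values on the path from time $i$ on and from time $i+1$ on, with zeros put before. Each difference vanishes with the coordinate at time $i$ and is Lipschitz, so it is anchored, and stationarity moves the starting time $i$ to the start of a path.\<close>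

lemma lipschitz_limit:
  assumes f: "window_test a b C \<epsilon> f" and L: "wlip a b L f" and ab: "a \<le> b"
  shows "(pathE a b f \<longlongrightarrow> Lam f) at_top"
proof -
  define n where "n = nat (b - a)"
  have b: "b = a + int n" using ab by (simp add: n_def)
  have fm[measurable]: "f \<in> borel_measurable (PiM UNIV (\<lambda>_. borel))" and C: "\<And>x. \<bar>f x\<bar> \<le> C"
    and \<epsilon>: "0 < \<epsilon>" "\<And>x. (\<And>k. k \<in> {a..b} \<Longrightarrow> norm (x k) \<le> \<epsilon>) \<Longrightarrow> f x = 0"
    using f unfolding window_test_def by auto
  have L0: "0 \<le> L" using L by (simp add: wlip_def)
  define g where "g i y = f (embed i y) - f (embed (i + 1) (\<lambda>j. y (Suc j)))" for i :: int and y :: "nat \<Rightarrow> real \<times> real"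
  have lim: "((\<lambda>s. measure_pmf.expectation (path (Suc (n - i))) (\<lambda>p. g (a + int i) (zeta (s powr (3/2)) p)) / H s)
      \<longlongrightarrow> (\<integral>\<omega>. g (a + int i) (trail (fst \<omega>) (snd \<omega>)) \<partial>QN)) at_top" if i: "i \<le> n" for i
  proof (rule anchored_limit[where C="2 * C" and L="L + 1" and \<epsilon>=\<epsilon>])
    have sh: "(\<lambda>y j. y (Suc j)) \<in> PiM UNIV (\<lambda>_. borel) \<rightarrow>\<^sub>M PiM UNIV (\<lambda>_. borel :: (real \<times> real) measure)"
      by (rule measurable_PiM_single') (auto intro: measurable_component_singleton)
    show "g (a + int i) \<in> borel_measurable (PiM UNIV (\<lambda>_. borel))"
      unfolding g_def by (intro borel_measurable_diff measurable_compose[OF embed_measurable fm]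
          measurable_compose[OF measurable_compose[OF sh embed_measurable] fm])
    show "\<bar>g (a + int i) y\<bar> \<le> 2 * C" for y
      unfolding g_def using C[of "embed (a + int i) y"] C[of "embed (a + int i + 1) (\<lambda>j. y (Suc j))"] by linarith
    show "(\<lambda>m. g (a + int i) (Y m)) \<longlonglongrightarrow> g (a + int i) y" if Y: "\<And>k. k \<le> n - i \<Longrightarrow> (\<lambda>m. Y m k) \<longlonglongrightarrow> y k" for Y y
      unfolding g_def
    proof (intro tendsto_diff wlip_tendsto[OF L])
      fix k assume k: "k \<in> {a..b}"
      have "nat (k - (a + int i)) \<le> n - i" "a + int i + 1 \<le> k \<Longrightarrow> Suc (nat (k - (a + int i + 1))) \<le> n - i"
        using k i b by auto
      then show "(\<lambda>m. embed (a + int i) (Y m) k) \<longlonglongrightarrow> embed (a + int i) y k"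
        "(\<lambda>m. embed (a + int i + 1) (\<lambda>j. Y m (Suc j)) k) \<longlonglongrightarrow> embed (a + int i + 1) (\<lambda>j. y (Suc j)) k"
        using Y by (auto simp: embed_def)
    qed
    show "0 < L + 1" using L0 by simp
    show "\<bar>g (a + int i) y\<bar> \<le> (L + 1) * norm (y 0)" for y
    proof -
      have "\<bar>g (a + int i) y\<bar> \<le> L * wdist a b (embed (a + int i) y) (embed (a + int i + 1) (\<lambda>j. y (Suc j)))"
        unfolding g_def using L by (simp add: wlip_def)
      also have "wdist a b (embed (a + int i) y) (embed (a + int i + 1) (\<lambda>j. y (Suc j)))
          = (\<Sum>k\<in>{a..b}. if k = a + int i then norm (y 0) else 0)"
        unfolding wdist_def
      proof (intro sum.cong refl)
        fix k
        have "nat (k - (a + int i)) = Suc (nat (k - (a + int i + 1)))" if "a + int i + 1 \<le> k" using that by auto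
        then show "norm (embed (a + int i) y k - embed (a + int i + 1) (\<lambda>j. y (Suc j)) k) = (if k = a + int i then norm (y 0) else 0)"
          by (auto simp: embed_def)
      qed
      also have "\<dots> = norm (y 0)" using i b by simp
      also have "L * norm (y 0) \<le> (L + 1) * norm (y 0)" by (simp add: distrib_right)
      finally show ?thesis .
    qed
    show "g (a + int i) y = 0" if y: "\<And>k. k \<le> n - i \<Longrightarrow> norm (y k) \<le> \<epsilon>" for y
    proof -
      have "norm (embed (a + int i) y k) \<le> \<epsilon>" "norm (embed (a + int i + 1) (\<lambda>j. y (Suc j)) k) \<le> \<epsilon>" if k: "k \<in> {a..b}" for k
      proof -
        have "nat (k - (a + int i)) \<le> n - i" "a + int i + 1 \<le> k \<Longrightarrow> Suc (nat (k - (a + int i + 1))) \<le> n - i"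
          using k i b by auto
        then show "norm (embed (a + int i) y k) \<le> \<epsilon>" "norm (embed (a + int i + 1) (\<lambda>j. y (Suc j)) k) \<le> \<epsilon>"
          using y \<epsilon> by (auto simp: embed_def)
      qed
      then show ?thesis unfolding g_def using \<epsilon>(2) by simp
    qed
  qed (rule \<epsilon>)
  have tele: "f (embed a z) = (\<Sum>i\<le>n. g (a + int i) (\<lambda>j. z (j + i)))" for z
  proof -
    define h where "h i = f (embed (a + int i) (\<lambda>j. z (j + i)))" for i
    have "(\<Sum>i\<le>n. g (a + int i) (\<lambda>j. z (j + i))) = (\<Sum>i<Suc n. h i - h (Suc i))"
      by (intro sum.cong) (auto simp: g_def h_def lessThan_Suc_atMost ac_simps)
    also have "\<dots> = h 0 - h (Suc n)" by (rule sum_lessThan_telescope')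
    also have "h (Suc n) = 0" unfolding h_def by (rule \<epsilon>(2)) (use \<epsilon> b in \<open>auto simp: embed_def\<close>)
    finally show ?thesis by (simp add: h_def)
  qed
  have E: "pathE a b f s = (\<Sum>i\<le>n. measure_pmf.expectation (path (Suc (n - i))) (\<lambda>p. g (a + int i) (zeta (s powr (3/2)) p)) / H s)" for s
  proof -
    have "measure_pmf.expectation (path (Suc n)) (\<lambda>p. f (embed a (zeta (s powr (3/2)) p)))
        = measure_pmf.expectation (path (Suc n)) (\<lambda>p. \<Sum>i\<le>n. g (a + int i) (\<lambda>j. zeta (s powr (3/2)) p (j + i)))"
      by (simp only: tele)
    also have "\<dots> = (\<Sum>i\<le>n. measure_pmf.expectation (path (Suc n)) (\<lambda>p. g (a + int i) (\<lambda>j. zeta (s powr (3/2)) p (j + i))))"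
    proof (rule Bochner_Integration.integral_sum, rule integrable_pmf_bounded[where C="2 * C"])
      fix i p show "\<bar>g (a + int i) (\<lambda>j. zeta (s powr (3/2)) p (j + i))\<bar> \<le> 2 * C"
        unfolding g_def using C[of "embed (a + int i) (\<lambda>j. zeta (s powr (3/2)) p (j + i))"]
          C[of "embed (a + int i + 1) (\<lambda>j. zeta (s powr (3/2)) p (Suc j + i))"] by linarith
    qed
    also have "\<dots> = (\<Sum>i\<le>n. measure_pmf.expectation (path (Suc (n - i))) (\<lambda>p. g (a + int i) (zeta (s powr (3/2)) p)))"
    proof (rule sum.cong[OF refl])
      fix i assume i: "i \<in> {..n}"
      have "measure_pmf.expectation (path (Suc (n - i))) (\<lambda>p. g (a + int i) (zeta (s powr (3/2)) p))
          = measure_pmf.expectation (map_pmf (\<lambda>p j. p (j + i)) (path (Suc (n - i) + i))) (\<lambda>p. g (a + int i) (zeta (s powr (3/2)) p))"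
        by (simp only: path_shift_iter)
      also have "\<dots> = measure_pmf.expectation (path (Suc n)) (\<lambda>p. g (a + int i) (\<lambda>j. zeta (s powr (3/2)) p (j + i)))"
        using i by (simp add: zeta_shift)
      finally show "measure_pmf.expectation (path (Suc n)) (\<lambda>p. g (a + int i) (\<lambda>j. zeta (s powr (3/2)) p (j + i)))
        = measure_pmf.expectation (path (Suc (n - i))) (\<lambda>p. g (a + int i) (zeta (s powr (3/2)) p))" ..
    qed
    finally show ?thesis by (simp add: n_def sum_divide_distrib)
  qed
  have gQ: "(\<integral>\<omega>. g i (trail (fst \<omega>) (snd \<omega>)) \<partial>QN) = Q f i - \<mu> powr \<alpha> * Q f (i + 1)" for i
    unfolding g_def Bochner_Integration.integral_diff[OF integrable_window[OF f] integrable_window_shift[OF f]] Q_shift[OF f]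
    by (simp add: Q_def)
  have "(pathE a b f \<longlongrightarrow> (\<Sum>i\<le>n. \<integral>\<omega>. g (a + int i) (trail (fst \<omega>) (snd \<omega>)) \<partial>QN)) at_top"
    unfolding E by (intro tendsto_sum lim) auto
  also have "(\<Sum>i\<le>n. \<integral>\<omega>. g (a + int i) (trail (fst \<omega>) (snd \<omega>)) \<partial>QN) = (\<Sum>i=a..b. Q f i - \<mu> powr \<alpha> * Q f (i + 1))"
    unfolding gQ
    by (rule sum.reindex_bij_witness[where i="\<lambda>k. nat (k - a)" and j="\<lambda>i. a + int i"]) (auto simp: b)
  also have "\<dots> = Lam f" unfolding Lam_def by (rule Xi_integral[OF f, symmetric])
  finally show ?thesis .
qed

lemma integrable_path: "(\<And>x. \<bar>f x\<bar> \<le> C) \<Longrightarrow> integrable (measure_pmf (path n)) (\<lambda>p. (f (embed a (zeta x p)) :: real))"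
  by (rule integrable_pmf_bounded) auto

lemma pathE_mono:
  assumes "\<And>x. f x \<le> g x" "\<And>x. \<bar>f x\<bar> \<le> C" "\<And>x. \<bar>g x\<bar> \<le> D"
  shows "pathE a b f s \<le> pathE a b g s"
  by (intro divide_right_mono integral_mono[OF integrable_path[of f C, OF assms(2)] integrable_path[of g D, OF assms(3)]]
      assms(1) less_imp_le[OF H_pos])

lemma window_testI:
  assumes "0 < \<epsilon>" "f \<in> borel_measurable (PiM UNIV (\<lambda>_. borel))" "\<And>x. \<bar>f x\<bar> \<le> C"
    "\<And>x. (\<And>k. k \<in> {a..b} \<Longrightarrow> norm (x k) \<le> \<epsilon>) \<Longrightarrow> f x = 0"
    "\<And>x y. (\<And>k. k \<in> {a..b} \<Longrightarrow> x k = y k) \<Longrightarrow> f x = f y"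
  shows "window_test a b C \<epsilon> f"
  using assms unfolding window_test_def by blast

lemma window_testD:
  assumes "window_test a b C \<epsilon> f"
  shows "0 < \<epsilon>" "\<bar>f x\<bar> \<le> C" "(\<And>k. k \<in> {a..b} \<Longrightarrow> norm (x k) \<le> \<epsilon>) \<Longrightarrow> f x = 0"
    "(\<And>k. k \<in> {a..b} \<Longrightarrow> x k = y k) \<Longrightarrow> f x = f y"
  using assms unfolding window_test_def by blast+

text \<open>Approximation from below by Lipschitz functionals gives the lower half of the limit for nonnegative functionals.\<close>

lemma pathE_liminf:
  assumes f: "window_test a b C \<epsilon> f" "\<And>x. 0 \<le> f x" and c: "\<And>x. wcont a b x f" and ab: "a \<le> b" and e: "0 < e"
  shows "\<forall>\<^sub>F s in at_top. Lam f - e < pathE a b f s"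
proof -
  have C: "\<bar>f x\<bar> \<le> C" for x using window_testD(2)[OF f(1)] .
  have fC: "f x \<le> C" for x using C[of x] by simp
  let ?f = "\<lambda>m. infconv a b f (real m)"
  have w: "window_test a b C \<epsilon> (?f m)" for m
  proof (rule window_testI)
    show "0 < \<epsilon>" by (rule window_testD(1)[OF f(1)])
    show "?f m \<in> borel_measurable (PiM UNIV (\<lambda>_. borel))"
      by (rule wlip_measurable[OF infconv_props(3)[OF f(2)]]) simp
    show "\<bar>?f m x\<bar> \<le> C" for x
      using infconv_props(1,2)[of f "real m" a b x, OF f(2)] fC[of x] by simp
    show "?f m x = 0" if "\<And>k. k \<in> {a..b} \<Longrightarrow> norm (x k) \<le> \<epsilon>" for x
      using infconv_props(1,2)[of f "real m" a b x, OF f(2)] window_testD(3)[OF f(1) that] by simp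
    show "?f m x = ?f m y" if "\<And>k. k \<in> {a..b} \<Longrightarrow> x k = y k" for x y
      unfolding infconv_def using wdist_cong[of a b x y, OF that] by simp
  qed
  have "(\<lambda>m. \<integral>\<omega>. ?f m (U \<omega>) \<partial>Xi) \<longlonglongrightarrow> (\<integral>\<omega>. f (U \<omega>) \<partial>Xi)"
  proof (rule integral_dominated_convergence[where w="\<lambda>\<omega>. f (U \<omega>)"])
    show "integrable Xi (\<lambda>\<omega>. f (U \<omega>))" by (rule integrable_Xi[OF f(1)])
    then show "(\<lambda>\<omega>. f (U \<omega>)) \<in> borel_measurable Xi" by simp
    show "(\<lambda>\<omega>. ?f m (U \<omega>)) \<in> borel_measurable Xi" for m using integrable_Xi[OF w] by simp
    show "AE \<omega> in Xi. (\<lambda>m. ?f m (U \<omega>)) \<longlonglongrightarrow> f (U \<omega>)"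
      by (intro AE_I2 infconv_tendsto[OF f(2) fC c])
    show "AE \<omega> in Xi. norm (?f m (U \<omega>)) \<le> f (U \<omega>)" for m
      using infconv_props(1,2)[of f "real m" a b, OF f(2)] by simp
  qed
  then have "(\<lambda>m. Lam (?f m)) \<longlonglongrightarrow> Lam f" unfolding Lam_def by (intro tendsto_intros)
  then have "\<forall>\<^sub>F m in sequentially. Lam f - e < Lam (?f m)" by (rule order_tendstoD) (use e in simp)
  then obtain m where m: "Lam f - e < Lam (?f m)" using eventually_happens'[OF sequentially_bot] by blast
  have "(pathE a b (?f m) \<longlongrightarrow> Lam (?f m)) at_top"
    by (rule lipschitz_limit[OF w infconv_props(3)[OF f(2)] ab]) simp
  then have "\<forall>\<^sub>F s in at_top. Lam f - e < pathE a b (?f m) s" using m by (rule order_tendstoD)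
  then show ?thesis
  proof eventually_elim
    case (elim s)
    also have "pathE a b (?f m) s \<le> pathE a b f s"
      by (rule pathE_mono[OF infconv_props(2)[OF f(2)] window_testD(2)[OF w] C]) simp
    finally show ?case .
  qed
qed

definition cutoff :: "int \<Rightarrow> int \<Rightarrow> real \<Rightarrow> (int \<Rightarrow> real \<times> real) \<Rightarrow> real" where
  "cutoff a b \<epsilon> x = min 1 (max 0 (2 * wdist a b x (\<lambda>_. 0) / \<epsilon> - 1))"

lemma cutoff_props:
  assumes \<epsilon>: "0 < \<epsilon>" and ab: "a \<le> b"
  shows "wlip a b (2 / \<epsilon>) (cutoff a b \<epsilon>)" "0 \<le> cutoff a b \<epsilon> x" "cutoff a b \<epsilon> x \<le> 1"
    "window_test a b 1 (\<epsilon> / (2 * wsize a b)) (cutoff a b \<epsilon>)"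
    "k \<in> {a..b} \<Longrightarrow> \<epsilon> < norm (x k) \<Longrightarrow> cutoff a b \<epsilon> x = 1"
proof -
  show lip: "wlip a b (2 / \<epsilon>) (cutoff a b \<epsilon>)"
    unfolding wlip_def
  proof (intro conjI allI)
    fix x y
    have "\<bar>cutoff a b \<epsilon> x - cutoff a b \<epsilon> y\<bar> \<le> \<bar>2 * wdist a b x (\<lambda>_. 0) / \<epsilon> - 2 * wdist a b y (\<lambda>_. 0) / \<epsilon>\<bar>"
      unfolding cutoff_def by linarith
    also have "\<dots> = 2 / \<epsilon> * \<bar>wdist a b x (\<lambda>_. 0) - wdist a b y (\<lambda>_. 0)\<bar>"
    proof -
      have "2 * wdist a b x (\<lambda>_. 0) / \<epsilon> - 2 * wdist a b y (\<lambda>_. 0) / \<epsilon>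
          = 2 / \<epsilon> * (wdist a b x (\<lambda>_. 0) - wdist a b y (\<lambda>_. 0))" by (simp add: right_diff_distrib)
      moreover have "\<bar>2 / \<epsilon>\<bar> = 2 / \<epsilon>" using \<epsilon> by simp
      ultimately show ?thesis by (simp only: abs_mult)
    qed
    also have "\<dots> \<le> 2 / \<epsilon> * wdist a b x y"
      using \<epsilon> wdist_triangle[of a b x "\<lambda>_. 0" y] wdist_triangle[of a b y "\<lambda>_. 0" x] wdist_commute[of a b y x]
      by (intro mult_left_mono) auto
    finally show "\<bar>cutoff a b \<epsilon> x - cutoff a b \<epsilon> y\<bar> \<le> 2 / \<epsilon> * wdist a b x y" .
  qed (use \<epsilon> in simp)
  show "0 \<le> cutoff a b \<epsilon> x" "cutoff a b \<epsilon> x \<le> 1" by (auto simp: cutoff_def)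
  show "cutoff a b \<epsilon> x = 1" if "k \<in> {a..b}" "\<epsilon> < norm (x k)"
  proof -
    have "norm (x k - 0) \<le> wdist a b x (\<lambda>_. 0)" unfolding wdist_def using that by (intro member_le_sum) auto
    then have "\<epsilon> < wdist a b x (\<lambda>_. 0)" using that by simp
    then have "1 \<le> 2 * wdist a b x (\<lambda>_. 0) / \<epsilon> - 1" using \<epsilon> by (simp add: field_simps)
    then show ?thesis by (simp add: cutoff_def)
  qed
  have N: "0 < wsize a b" using wsize_ge_1[OF ab] by simp
  show "window_test a b 1 (\<epsilon> / (2 * wsize a b)) (cutoff a b \<epsilon>)"
  proof (rule window_testI)
    show "0 < \<epsilon> / (2 * wsize a b)" using \<epsilon> N by simp
    show "cutoff a b \<epsilon> \<in> borel_measurable (PiM UNIV (\<lambda>_. borel))" by (rule wlip_measurable[OF lip])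
    show "\<bar>cutoff a b \<epsilon> x\<bar> \<le> 1" for x by (auto simp: cutoff_def)
    show "cutoff a b \<epsilon> x = 0" if "\<And>k. k \<in> {a..b} \<Longrightarrow> norm (x k) \<le> \<epsilon> / (2 * wsize a b)" for x
    proof -
      have "wdist a b x (\<lambda>_. 0) \<le> (\<Sum>k\<in>{a..b}. \<epsilon> / (2 * wsize a b))"
        unfolding wdist_def using that by (intro sum_mono) simp
      also have "\<dots> = \<epsilon> / 2" unfolding wsize_sum using N by simp
      finally have "2 * wdist a b x (\<lambda>_. 0) / \<epsilon> - 1 \<le> 0" using \<epsilon> by (simp add: field_simps)
      then show ?thesis by (simp add: cutoff_def)
    qed
    show "cutoff a b \<epsilon> x = cutoff a b \<epsilon> y" if "\<And>k. k \<in> {a..b} \<Longrightarrow> x k = y k" for x y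
      unfolding cutoff_def using wdist_cong[of a b x y, OF that] by simp
  qed
qed

lemma window_test_weaken:
  assumes "window_test a b C \<epsilon> f" "0 < \<epsilon>'" "\<epsilon>' \<le> \<epsilon>" "C \<le> C'"
  shows "window_test a b C' \<epsilon>' f"
proof (rule window_testI)
  show "\<bar>f x\<bar> \<le> C'" for x using window_testD(2)[OF assms(1), of x] assms(4) by linarith
  show "f x = 0" if "\<And>k. k \<in> {a..b} \<Longrightarrow> norm (x k) \<le> \<epsilon>'" for x
    using that assms(3) by (intro window_testD(3)[OF assms(1)]) force
  show "f x = f y" if "\<And>k. k \<in> {a..b} \<Longrightarrow> x k = y k" for x y
    by (rule window_testD(4)[OF assms(1) that])
qed (use assms(2) window_test_measurable[OF assms(1)] in auto)

lemma window_test_lincomb: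
  assumes "window_test a b C \<epsilon> f" "window_test a b D \<epsilon> g"
  shows "window_test a b (C + \<bar>c\<bar> * D) \<epsilon> (\<lambda>x. f x + c * g x)"
proof (rule window_testI)
  show "\<bar>f x + c * g x\<bar> \<le> C + \<bar>c\<bar> * D" for x
    using window_testD(2)[OF assms(1), of x] mult_left_mono[OF window_testD(2)[OF assms(2), of x], of "\<bar>c\<bar>"]
    by (simp add: abs_mult[symmetric])
  show "f x + c * g x = 0" if "\<And>k. k \<in> {a..b} \<Longrightarrow> norm (x k) \<le> \<epsilon>" for x
    using window_testD(3)[OF assms(1) that] window_testD(3)[OF assms(2) that] by simp
  show "f x + c * g x = f y + c * g y" if "\<And>k. k \<in> {a..b} \<Longrightarrow> x k = y k" for x y
    using window_testD(4)[OF assms(1) that] window_testD(4)[OF assms(2) that] by simp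
qed (use assms window_testD(1)[OF assms(1)] window_test_measurable[OF assms(1)] window_test_measurable[OF assms(2)] in auto)

lemma pathE_lincomb:
  assumes "\<And>x. \<bar>f x\<bar> \<le> C" "\<And>x. \<bar>g x\<bar> \<le> D"
  shows "pathE a b (\<lambda>x. f x + c * g x) s = pathE a b f s + c * pathE a b g s"
proof -
  have "measure_pmf.expectation p (\<lambda>p. f (h p) + c * g (h p)) = measure_pmf.expectation p (\<lambda>p. f (h p)) + c * measure_pmf.expectation p (\<lambda>p. g (h p))"
    for h :: "(nat \<Rightarrow> nat) \<Rightarrow> _" and p
    using assms by (subst Bochner_Integration.integral_add) (auto intro!: integrable_pmf_bounded)
  then show ?thesis by (simp add: add_divide_distrib)
qed

lemma Lam_lincomb:
  assumes "window_test a b C \<epsilon> f" "window_test a b C' \<epsilon>' g"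
  shows "Lam (\<lambda>x. f x + c * g x) = Lam f + c * Lam g"
  unfolding Lam_def using integrable_Xi[OF assms(1)] integrable_Xi[OF assms(2)]
  by (simp add: algebra_simps)

text \<open>Applies the lower bound to $C\chi + f$ and $C\chi - f$, with $\chi$ a Lipschitz cutoff that dominates the support of $f$ and for which the limit is known.\<close>

lemma continuous_limit:
  assumes f: "window_test a b C \<epsilon> f" and c: "\<And>x. wcont a b x f" and ab: "a \<le> b"
  shows "(pathE a b f \<longlongrightarrow> Lam f) at_top"
proof -
  have \<epsilon>: "0 < \<epsilon>" by (rule window_testD(1)[OF f])
  define \<epsilon>' where "\<epsilon>' = \<epsilon> / (2 * wsize a b)"
  have N: "1 \<le> wsize a b" by (rule wsize_ge_1[OF ab])
  have e': "0 < \<epsilon>'" "\<epsilon>' \<le> \<epsilon>" using \<epsilon> N divide_left_mono[of 1 "2 * wsize a b" \<epsilon>] by (auto simp: \<epsilon>'_def)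
  let ?\<chi> = "cutoff a b \<epsilon>"
  have \<chi>: "window_test a b 1 \<epsilon>' ?\<chi>" unfolding \<epsilon>'_def by (rule cutoff_props(4)[OF \<epsilon> ab])
  have f': "window_test a b C \<epsilon>' f" by (rule window_test_weaken[OF f e']) simp
  have \<chi>b: "\<bar>?\<chi> x\<bar> \<le> 1" for x by (rule window_testD(2)[OF \<chi>])
  have fb: "\<bar>f x\<bar> \<le> C" for x by (rule window_testD(2)[OF f])
  have dom: "\<bar>f x\<bar> \<le> C * ?\<chi> x" for x
  proof (cases "\<exists>k\<in>{a..b}. \<epsilon> < norm (x k)")
    case True then show ?thesis using cutoff_props(5)[OF \<epsilon> ab] fb[of x] by auto
  next
    case False
    then have "f x = 0" by (intro window_testD(3)[OF f]) (auto simp: not_less)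
    then show ?thesis using cutoff_props(2)[OF \<epsilon> ab, of x] order_trans[OF abs_ge_zero fb] by simp
  qed
  have \<chi>lim: "(pathE a b ?\<chi> \<longlongrightarrow> Lam ?\<chi>) at_top"
    by (rule lipschitz_limit[OF \<chi> cutoff_props(1)[OF \<epsilon> ab] ab])
  have wc\<chi>: "wcont a b x (\<lambda>x. c * ?\<chi> x)" for x c
    by (intro wcont_mult wcont_const wlip_wcont[OF cutoff_props(1)[OF \<epsilon> ab]])
  have neg: "window_test a b (0 + \<bar>- 1\<bar> * C) \<epsilon>' (\<lambda>x. 0 + (- 1) * f x)"
    by (rule window_test_lincomb[OF _ f']) (use e' in \<open>auto simp: window_test_def\<close>)
  then have nf: "window_test a b C \<epsilon>' (\<lambda>x. - f x)" by simp
  have wnf: "wcont a b x (\<lambda>x. - f x)" for x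
    using wcont_mult[OF wcont_const[of a b x "- 1"] c] by simp
  have up: "\<forall>\<^sub>F s in at_top. Lam g + C * Lam ?\<chi> - e < pathE a b g s + C * pathE a b ?\<chi> s"
    if g: "window_test a b C \<epsilon>' g" "\<And>x. wcont a b x g" "\<And>x. \<bar>g x\<bar> \<le> C * ?\<chi> x" and e: "0 < e" for g and e :: real
  proof -
    have "\<forall>\<^sub>F s in at_top. Lam (\<lambda>x. g x + C * ?\<chi> x) - e < pathE a b (\<lambda>x. g x + C * ?\<chi> x) s"
    proof (rule pathE_liminf[OF window_test_lincomb[OF g(1) \<chi>] _ _ ab e])
      show "0 \<le> g x + C * ?\<chi> x" for x using g(3)[of x] by linarith
      show "wcont a b x (\<lambda>x. g x + C * ?\<chi> x)" for x by (rule wcont_add[OF g(2) wc\<chi>])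
    qed
    then show ?thesis
      by (simp only: Lam_lincomb[OF g(1) \<chi>] pathE_lincomb[of g C ?\<chi> 1, OF window_testD(2)[OF g(1)] \<chi>b])
  qed
  show ?thesis
  proof (rule tendstoI)
    fix e :: real assume e: "0 < e"
    then have e2: "0 < e / 2" by simp
    have dom': "\<bar>- f x\<bar> \<le> C * ?\<chi> x" for x using dom[of x] by simp
    have "((\<lambda>s. C * pathE a b ?\<chi> s) \<longlongrightarrow> C * Lam ?\<chi>) at_top" by (intro tendsto_intros \<chi>lim)
    from tendstoD[OF this e2] up[OF f' c dom e2] up[OF nf wnf dom' e2]
    show "\<forall>\<^sub>F s in at_top. dist (pathE a b f s) (Lam f) < e"
    proof eventually_elim
      case (elim s)
      moreover have "pathE a b (\<lambda>x. - f x) s = - pathE a b f s" by simp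
      moreover have "Lam (\<lambda>x. - f x) = - Lam f" by (simp add: Lam_def)
      ultimately show ?case unfolding dist_real_def by linarith
    qed
  qed
qed

end

section \<open>Exceedances of a norm\<close>

definition ramp :: "real \<Rightarrow> real \<Rightarrow> real \<Rightarrow> real" where
  "ramp u v t = min 1 (max 0 ((t - u) / (v - u)))"

lemma ramp_bounds: "0 \<le> ramp u v t" "ramp u v t \<le> 1"
  by (auto simp: ramp_def)

lemma ramp_0: "u < v \<Longrightarrow> t \<le> u \<Longrightarrow> ramp u v t = 0"
  by (simp add: ramp_def divide_nonpos_pos)

lemma ramp_1: "u < v \<Longrightarrow> v \<le> t \<Longrightarrow> ramp u v t = 1"
  by (simp add: ramp_def)

lemma ramp_isCont: "u < v \<Longrightarrow> isCont (ramp u v) t"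
  unfolding ramp_def[abs_def] by (intro continuous_intros) auto

lemma ramp_measurable[measurable]: "ramp u v \<in> borel_measurable borel"
  unfolding ramp_def[abs_def] by measurable

text \<open>The norms of coordinates in a window and the norm of a single coordinate are both covered: positivity is required only when no coordinate of the window vanishes.\<close>

definition wnorm :: "int \<Rightarrow> int \<Rightarrow> real \<Rightarrow> ((int \<Rightarrow> real \<times> real) \<Rightarrow> real) \<Rightarrow> bool" where
  "wnorm a b L N \<longleftrightarrow> wlip a b L N \<and> (\<forall>x. 0 \<le> N x) \<and>
     (\<forall>c x. 0 \<le> c \<longrightarrow> N (\<lambda>k. c *\<^sub>R x k) = c * N x) \<and> (\<forall>x. (\<forall>k\<in>{a..b}. x k \<noteq> 0) \<longrightarrow> 0 < N x)"

lemma wnormD: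
  assumes "wnorm a b L N"
  shows "wlip a b L N" "0 \<le> N x" "0 \<le> c \<Longrightarrow> N (\<lambda>k. c *\<^sub>R x k) = c * N x"
    "(\<And>k. k \<in> {a..b} \<Longrightarrow> x k \<noteq> 0) \<Longrightarrow> 0 < N x" "0 \<le> L" "N \<in> borel_measurable (PiM UNIV (\<lambda>_. borel))"
  using assms wlip_measurable unfolding wnorm_def wlip_def by blast+

lemma wnorm_le: assumes N: "wnorm a b L N" shows "N x \<le> L * wdist a b x (\<lambda>_. 0)"
proof -
  have "N (\<lambda>k. 0 *\<^sub>R x k) = 0 * N x" by (rule wnormD(3)[OF N]) simp
  then have "N (\<lambda>_. 0) = 0" by simp
  moreover have "\<bar>N x - N (\<lambda>_. 0)\<bar> \<le> L * wdist a b x (\<lambda>_. 0)" using wnormD(1)[OF N] by (simp add: wlip_def)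
  ultimately show ?thesis by simp
qed

lemma wnorm_cong: 
  assumes N: "wnorm a b L N" and "\<And>k. k \<in> {a..b} \<Longrightarrow> x k = y k" shows "N x = N y"
proof -
  have "\<bar>N x - N y\<bar> \<le> L * wdist a b x y" using wnormD(1)[OF N] by (simp add: wlip_def)
  moreover have "wdist a b x y = wdist a b y y" by (rule wdist_cong) (rule assms(2))
  ultimately show ?thesis by (simp add: wdist_refl)
qed

lemma wnorm_small:
  assumes N: "wnorm a b L N" and ab: "a \<le> b" and u: "0 < u"
    and x: "\<And>k. k \<in> {a..b} \<Longrightarrow> norm (x k) \<le> u / ((L + 1) * wsize a b)"
  shows "N x \<le> u"
proof -
  have n: "0 < wsize a b" using wsize_ge_1[OF ab] by simp
  have L: "0 \<le> L" by (rule wnormD(5)[OF N])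
  have "wdist a b x (\<lambda>_. 0) \<le> (\<Sum>k\<in>{a..b}. u / ((L + 1) * wsize a b))"
    unfolding wdist_def using x by (intro sum_mono) simp
  also have "\<dots> = u / (L + 1)" unfolding wsize_sum using n L by simp
  finally have "L * wdist a b x (\<lambda>_. 0) \<le> L * (u / (L + 1))" using L by (intro mult_left_mono)
  also have "\<dots> \<le> u" using L u by (simp add: field_simps)
  finally show ?thesis using wnorm_le[OF N, of x] by simp
qed

text \<open>Continuity is required only where the norm is positive; this admits functions of the direction.\<close>

definition wfun :: "int \<Rightarrow> int \<Rightarrow> real \<Rightarrow> ((int \<Rightarrow> real \<times> real) \<Rightarrow> real) \<Rightarrow> ((int \<Rightarrow> real \<times> real) \<Rightarrow> real) \<Rightarrow> bool" where
  "wfun a b C N h \<longleftrightarrow> h \<in> borel_measurable (PiM UNIV (\<lambda>_. borel)) \<and> (\<forall>x. \<bar>h x\<bar> \<le> C) \<and>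
     (\<forall>x y. (\<forall>k\<in>{a..b}. x k = y k) \<longrightarrow> h x = h y) \<and> (\<forall>x. 0 < N x \<longrightarrow> wcont a b x h)"

lemma wfunD:
  assumes "wfun a b C N h"
  shows "h \<in> borel_measurable (PiM UNIV (\<lambda>_. borel))" "\<bar>h x\<bar> \<le> C"
    "(\<And>k. k \<in> {a..b} \<Longrightarrow> x k = y k) \<Longrightarrow> h x = h y" "0 < N x \<Longrightarrow> wcont a b x h"
  using assms unfolding wfun_def by blast+

lemma wfun_const: "wfun a b \<bar>c\<bar> N (\<lambda>_. c)"
  by (auto simp: wfun_def wcont_const)

context branching begin

lemma window_test_cut:
  assumes N: "wnorm a b L N" and h: "wfun a b C N h" and ab: "a \<le> b" and u: "0 < u"
    and \<psi>: "\<psi> \<in> borel_measurable borel" "\<And>t. \<bar>\<psi> t\<bar> \<le> 1" "\<And>t. t \<le> u \<Longrightarrow> \<psi> t = 0"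
  shows "window_test a b C (u / ((L + 1) * wsize a b)) (\<lambda>x. h x * \<psi> (N x))"
proof (rule window_testI)
  show "0 < u / ((L + 1) * wsize a b)" using u wsize_ge_1[OF ab] wnormD(5)[OF N] by simp
  note [measurable] = wnormD(6)[OF N] wfunD(1)[OF h] \<psi>(1)
  show "(\<lambda>x. h x * \<psi> (N x)) \<in> borel_measurable (PiM UNIV (\<lambda>_. borel))" by measurable
  show "\<bar>h x * \<psi> (N x)\<bar> \<le> C" for x
    using mult_mono[OF wfunD(2)[OF h, of x] \<psi>(2)[of "N x"]] order_trans[OF abs_ge_zero wfunD(2)[OF h, of x]]
    by (simp add: abs_mult)
  show "h x * \<psi> (N x) = 0" if "\<And>k. k \<in> {a..b} \<Longrightarrow> norm (x k) \<le> u / ((L + 1) * wsize a b)" for x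
    using \<psi>(3)[OF wnorm_small[OF N ab u that]] by simp
  show "h x * \<psi> (N x) = h y * \<psi> (N y)" if "\<And>k. k \<in> {a..b} \<Longrightarrow> x k = y k" for x y
    using wfunD(3)[OF h that] wnorm_cong[OF N that] by simp
qed

lemma wcont_cut:
  assumes N: "wnorm a b L N" and h: "wfun a b C N h" and u: "0 < u" "u < v"
  shows "wcont a b x (\<lambda>x. h x * ramp u v (N x))"
proof -
  have cN: "wcont a b x N" by (rule wlip_wcont[OF wnormD(1)[OF N]])
  show ?thesis
  proof (cases "0 < N x")
    case True
    then show ?thesis by (intro wcont_mult wfunD(4)[OF h] wcont_compose[OF cN] ramp_isCont u)
  next
    case False
    then have N0: "N x = 0" using wnormD(2)[OF N, of x] by simp
    obtain r where r: "0 < r" "\<And>y. wdist a b x y < r \<Longrightarrow> \<bar>N y - N x\<bar> < u" using cN u unfolding wcont_def by blast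
    show ?thesis
    proof (rule wcont_eventually_eq[OF wcont_const[of a b x 0] r(1)])
      fix y assume "wdist a b y x < r"
      then have "N y < u" using r(2)[of y] N0 by (simp add: wdist_commute[of a b y x])
      then show "h y * ramp u v (N y) = 0" using ramp_0[OF u(2)] by simp
    qed
  qed
qed

lemma trail_scale: assumes "0 < c" "0 < q" shows "trail (c * q) z k = c powr (3/2) *\<^sub>R trail q z k"
  using assms mu by (simp add: trail_def powr_mult mult.left_commute[of "\<mu> ^ k"] mult_ac)

lemma U_scale: "0 < c \<Longrightarrow> 0 < q \<Longrightarrow> U (i, c * q, z) = (\<lambda>k. c powr (3/2) *\<^sub>R U (i, q, z) k)"
  by (auto simp: U_def embed_def trail_scale fun_eq_iff)

text \<open>Along each trail the norm scales with $q^{3/2}$, so it attains a given positive value for at most one $q$: spheres carry no mass and exceedance indicators are almost everywhere continuous.\<close>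

lemma Xi_sphere_null:
  assumes N: "wnorm a b L N" and u: "0 < u"
  shows "AE \<omega> in Xi. N (U \<omega>) \<noteq> u"
proof -
  interpret X: pair_sigma_finite "count_space (UNIV :: int set)" QN by (rule pair_sf_Xi)
  interpret P: pair_sigma_finite nu NN by (rule pair_sf)
  note [measurable] = wnormD(6)[OF N]
  have NU: "(\<lambda>\<omega>. N (U \<omega>)) \<in> borel_measurable Xi" by measurable
  have NUi: "(\<lambda>\<omega>. N (U (i, \<omega>))) \<in> borel_measurable QN" for i
    using measurable_compose[OF measurable_Pair1' NU, of i] by simp
  have AEz: "AE q in nu. N (U (i, q, z)) \<noteq> u" for i z
  proof (cases "\<exists>q0>0. N (U (i, q0, z)) = u")
    case True
    then obtain q0 where q0: "0 < q0" "N (U (i, q0, z)) = u" by blast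
    have pt: "N (U (i, q, z)) \<noteq> u" if q: "0 < q" "q \<noteq> q0" for q
    proof
      assume e: "N (U (i, q, z)) = u"
      have "N (U (i, (q / q0) * q0, z)) = (q / q0) powr (3/2) * N (U (i, q0, z))"
        using q q0 by (subst U_scale) (auto intro!: wnormD(3)[OF N])
      then have "(q / q0) powr (3/2) = 1" using e q0 u by simp
      moreover have "(q / q0) powr (3/2) \<noteq> 1"
      proof -
        have "r powr (3/2) \<noteq> 1" if "0 < r" "r \<noteq> 1" for r :: real using that by (simp add: powr_def)
        moreover have "q / q0 \<noteq> 1" "0 < q / q0" using q q0 by auto
        ultimately show ?thesis by blast
      qed
      ultimately show False by simp
    qed
    have "AE q in nu. q \<noteq> q0"
      unfolding nu_def using AE_lborel_singleton[of q0] by (subst AE_density) (auto elim: eventually_mono)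
    then show ?thesis using AE_nu_pos by eventually_elim (use pt in blast)
  next
    case False
    then show ?thesis using AE_nu_pos by (auto elim!: eventually_mono)
  qed
  have AEi: "AE \<omega> in QN. N (U (i, \<omega>)) \<noteq> u" for i
  proof (rule P.AE_pair_measure)
    have s: "{\<omega> \<in> space QN. N (U (i, \<omega>)) \<noteq> u} \<in> sets QN" using NUi[of i] by measurable
    then show "{\<omega> \<in> space QN. N (U (i, \<omega>)) \<noteq> u} \<in> sets QN" .
    have "{x \<in> space QN. case x of (q, z) \<Rightarrow> N (U (i, q, z)) \<noteq> u} \<in> sets QN"
      using s by (simp add: case_prod_beta')
    then have "(AE q in nu. AE z in NN. N (U (i, q, z)) \<noteq> u) \<longleftrightarrow> (AE z in NN. AE q in nu. N (U (i, q, z)) \<noteq> u)"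
      by (intro P.AE_commute) (simp add: case_prod_beta')
    then show "AE q in nu. AE z in NN. N (U (i, q, z)) \<noteq> u" using AEz by simp
  qed
  show ?thesis
  proof (rule X.AE_pair_measure)
    show "{\<omega> \<in> space Xi. N (U \<omega>) \<noteq> u} \<in> sets Xi" using NU by measurable
  qed (use AEi in simp)
qed

text \<open>The indicator of an exceedance is squeezed between continuous ramps; the difference is a shell whose mass vanishes because spheres are null.\<close>

lemma norm_exceedance_limit:
  assumes N: "wnorm a b L N" and h: "wfun a b C N h" and ab: "a \<le> b" and u: "0 < u"
  shows "(pathE a b (\<lambda>x. h x * indicator {u<..} (N x)) \<longlongrightarrow> Lam (\<lambda>x. h x * indicator {u<..} (N x))) at_top"
proof -
  note [measurable] = wnormD(6)[OF N] wfunD(1)[OF h]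
  define eps where "eps t = t / ((L + 1) * wsize a b)" for t
  have C0: "0 \<le> C" using order_trans[OF abs_ge_zero wfunD(2)[OF h]] .
  have h1: "wfun a b 1 N (\<lambda>_. 1)" using wfun_const[of a b 1 N] by simp
  let ?I = "\<lambda>x. h x * indicator {u<..} (N x)"
  have wI: "window_test a b C (eps u) ?I"
    unfolding eps_def by (rule window_test_cut[OF N h ab u]) (auto simp: indicator_def)
  have R: "window_test a b C' (eps s) (\<lambda>x. g x * ramp s t (N x))" "(pathE a b (\<lambda>x. g x * ramp s t (N x)) \<longlongrightarrow> Lam (\<lambda>x. g x * ramp s t (N x))) at_top"
    if g: "wfun a b C' N g" and st: "0 < s" "s < t" for g C' s t
  proof -
    show 1: "window_test a b C' (eps s) (\<lambda>x. g x * ramp s t (N x))"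
      unfolding eps_def using st ramp_bounds
      by (intro window_test_cut[OF N g ab]) (auto intro: ramp_0)
    show "(pathE a b (\<lambda>x. g x * ramp s t (N x)) \<longlongrightarrow> Lam (\<lambda>x. g x * ramp s t (N x))) at_top"
      by (rule continuous_limit[OF 1 wcont_cut[OF N g st] ab])
  qed
  define r where "r m = u / (4 * real (Suc m))" for m
  have r: "0 < r m" "2 * r m < u" "r m \<le> u / 4" for m
    using u by (auto simp: r_def field_simps intro: add_pos_nonneg)
  define up where "up m x = 1 * ramp (u - r m) u (N x)" for m x
  define lo where "lo m x = 1 * ramp (u + r m) (u + 2 * r m) (N x)" for m x
  define mid where "mid m x = h x * ramp u (u + r m) (N x)" for m x
  have U1: "window_test a b 1 (eps (u - r m)) (up m)" "(pathE a b (up m) \<longlongrightarrow> Lam (up m)) at_top" for m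
    unfolding up_def[abs_def] using R[OF h1, of "u - r m" u] r[of m] by auto
  have U2: "window_test a b 1 (eps (u + r m)) (lo m)" "(pathE a b (lo m) \<longlongrightarrow> Lam (lo m)) at_top" for m
    unfolding lo_def[abs_def] using R[OF h1, of "u + r m" "u + 2 * r m"] r[of m] u by auto
  have U3: "window_test a b C (eps u) (mid m)" "(pathE a b (mid m) \<longlongrightarrow> Lam (mid m)) at_top" for m
    unfolding mid_def[abs_def] using R[OF h, of u "u + r m"] r[of m] u by auto
  have lu: "lo m x \<le> up m x" for m x
  proof (cases "u \<le> N x")
    case True then show ?thesis using ramp_1[of "u - r m" u "N x"] r[of m] ramp_bounds by (simp add: up_def lo_def)
  next
    case False
    then have "lo m x = 0" using r[of m] by (simp add: lo_def ramp_0)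
    then show ?thesis using ramp_bounds by (simp add: up_def)
  qed
  have sand: "\<bar>?I x - mid m x\<bar> \<le> C * (up m x - lo m x)" for x m
  proof -
    consider "N x \<le> u" | "u < N x" "N x \<le> u + r m" | "u + r m < N x" by linarith
    then show ?thesis
    proof cases
      case 1 then show ?thesis using r[of m] C0 lu[of m x] by (simp add: mid_def ramp_0)
    next
      case 2
      have "\<bar>?I x - mid m x\<bar> = \<bar>h x\<bar> * \<bar>1 - ramp u (u + r m) (N x)\<bar>"
        using 2 by (simp add: mid_def abs_mult[symmetric] right_diff_distrib)
      also have "\<dots> \<le> C * 1" using wfunD(2)[OF h, of x] C0 ramp_bounds[of u "u + r m" "N x"] by (intro mult_mono) auto
      also have "up m x - lo m x = 1" using 2 r[of m] by (simp add: up_def lo_def ramp_0 ramp_1)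
      then have "C * 1 = C * (up m x - lo m x)" by simp
      finally show ?thesis .
    next
      case 3
      then have "mid m x = h x" using r[of m] by (simp add: mid_def ramp_1)
      then show ?thesis using 3 r[of m] C0 lu[of m x] by simp
    qed
  qed
  have b1: "\<bar>?I x\<bar> \<le> C" "\<bar>mid m x\<bar> \<le> C" "\<bar>up m x\<bar> \<le> 1" "\<bar>lo m x\<bar> \<le> 1" for x m
    using window_testD(2)[OF wI] window_testD(2)[OF U3(1)] window_testD(2)[OF U1(1)] window_testD(2)[OF U2(1)] by auto
  have tent0: "(\<lambda>m. \<integral>\<omega>. up m (U \<omega>) - lo m (U \<omega>) \<partial>Xi) \<longlonglongrightarrow> (\<integral>\<omega>. 0 \<partial>Xi)"
  proof (rule integral_dominated_convergence[where w="\<lambda>\<omega>. 1 * ramp (u / 4) (u / 2) (N (U \<omega>))"])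
    show "integrable Xi (\<lambda>\<omega>. 1 * ramp (u / 4) (u / 2) (N (U \<omega>)))"
      using u by (intro integrable_Xi[OF R(1)[OF h1]]) auto
    show "(\<lambda>\<omega>. up m (U \<omega>) - lo m (U \<omega>)) \<in> borel_measurable Xi" for m
      unfolding up_def lo_def by measurable
    show "AE \<omega> in Xi. norm (up m (U \<omega>) - lo m (U \<omega>)) \<le> 1 * ramp (u / 4) (u / 2) (N (U \<omega>))" for m
    proof (rule AE_I2)
      fix \<omega>
      show "norm (up m (U \<omega>) - lo m (U \<omega>)) \<le> 1 * ramp (u / 4) (u / 2) (N (U \<omega>))"
      proof (cases "u / 2 \<le> N (U \<omega>)")
        case True
        then show ?thesis using ramp_1[of "u/4" "u/2" "N (U \<omega>)"] u lu[of m "U \<omega>"]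
            ramp_bounds[of "u - r m" u "N (U \<omega>)"] ramp_bounds[of "u + r m" "u + 2 * r m" "N (U \<omega>)"]
          by (simp add: up_def lo_def)
      next
        case False
        then have "N (U \<omega>) \<le> u - r m" "N (U \<omega>) \<le> u + r m" using r[of m] by auto
        then show ?thesis using r[of m] ramp_bounds by (simp add: up_def lo_def ramp_0)
      qed
    qed
    show "AE \<omega> in Xi. (\<lambda>m. up m (U \<omega>) - lo m (U \<omega>)) \<longlonglongrightarrow> 0"
      using Xi_sphere_null[OF N u]
    proof eventually_elim
      case (elim \<omega>)
      have "(\<lambda>m. u / 4 * (1 / real (Suc m))) \<longlonglongrightarrow> u / 4 * 0" by (intro tendsto_intros LIMSEQ_Suc[OF lim_1_over_n])
      then have "r \<longlonglongrightarrow> 0" by (simp add: r_def[abs_def])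
      then have "\<forall>\<^sub>F m in sequentially. r m < \<bar>N (U \<omega>) - u\<bar> / 2" by (rule order_tendstoD) (use elim in simp)
      then have "\<forall>\<^sub>F m in sequentially. up m (U \<omega>) - lo m (U \<omega>) = 0"
      proof eventually_elim
        case (elim m)
        then consider "N (U \<omega>) \<le> u - r m" | "u + 2 * r m \<le> N (U \<omega>)" using r[of m] by (auto simp: abs_if split: if_splits)
        then show ?case using r[of m] by cases (simp_all add: up_def lo_def ramp_0 ramp_1)
      qed
      then show ?case by (rule tendsto_eventually)
    qed
  qed simp
  have "(\<lambda>m. (1 - \<mu> powr \<alpha>) * (\<integral>\<omega>. up m (U \<omega>) - lo m (U \<omega>) \<partial>Xi)) \<longlonglongrightarrow> (1 - \<mu> powr \<alpha>) * (\<integral>\<omega>. 0 \<partial>Xi)"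
    by (intro tendsto_intros tent0)
  moreover have Ltent: "(1 - \<mu> powr \<alpha>) * (\<integral>\<omega>. up m (U \<omega>) - lo m (U \<omega>) \<partial>Xi) = Lam (up m) - Lam (lo m)" for m
    unfolding Lam_def using integrable_Xi[OF U1(1)] integrable_Xi[OF U2(1)] by (simp add: right_diff_distrib)
  ultimately have tent: "(\<lambda>m. C * (Lam (up m) - Lam (lo m))) \<longlonglongrightarrow> C * 0" by (intro tendsto_intros) simp
  have LamI: "\<bar>Lam ?I - Lam (mid m)\<bar> \<le> C * (Lam (up m) - Lam (lo m))" for m
  proof -
    have "Lam ?I - Lam (mid m) = (1 - \<mu> powr \<alpha>) * (\<integral>\<omega>. ?I (U \<omega>) - mid m (U \<omega>) \<partial>Xi)"
      unfolding Lam_def using integrable_Xi[OF wI] integrable_Xi[OF U3(1)] by (simp add: right_diff_distrib)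
    moreover have "\<bar>\<integral>\<omega>. ?I (U \<omega>) - mid m (U \<omega>) \<partial>Xi\<bar> \<le> (\<integral>\<omega>. C * (up m (U \<omega>) - lo m (U \<omega>)) \<partial>Xi)"
    proof (rule order_trans[OF integral_abs_bound], rule integral_mono)
      show "integrable Xi (\<lambda>\<omega>. \<bar>?I (U \<omega>) - mid m (U \<omega>)\<bar>)" using integrable_Xi[OF wI] integrable_Xi[OF U3(1)] by (intro integrable_abs Bochner_Integration.integrable_diff)
      show "integrable Xi (\<lambda>\<omega>. C * (up m (U \<omega>) - lo m (U \<omega>)))" using integrable_Xi[OF U1(1)] integrable_Xi[OF U2(1)] by (intro integrable_mult_right Bochner_Integration.integrable_diff)
    qed (rule sand)
    ultimately show ?thesis
      using mu_powr_less_1 unfolding Ltent[symmetric] by (simp add: abs_mult mult_left_mono mult.left_commute)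
  qed
  have pathI: "\<bar>pathE a b ?I s - pathE a b (mid m) s\<bar> \<le> C * (pathE a b (up m) s - pathE a b (lo m) s)" for m s
  proof -
    let ?p = "measure_pmf (path (Suc (nat (b - a))))" and ?z = "\<lambda>p. embed a (zeta (s powr (3/2)) p)"
    have i: "integrable ?p (\<lambda>p. ?I (?z p))" "integrable ?p (\<lambda>p. mid m (?z p))" "integrable ?p (\<lambda>p. up m (?z p))" "integrable ?p (\<lambda>p. lo m (?z p))"
      by (rule integrable_path[OF b1(1)] integrable_path[OF b1(2)] integrable_path[OF b1(3)] integrable_path[OF b1(4)])+
    have "\<bar>(\<integral>p. ?I (?z p) \<partial>?p) - (\<integral>p. mid m (?z p) \<partial>?p)\<bar> = \<bar>\<integral>p. ?I (?z p) - mid m (?z p) \<partial>?p\<bar>"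
      using i by (simp only: Bochner_Integration.integral_diff)
    also have "\<dots> \<le> (\<integral>p. C * (up m (?z p) - lo m (?z p)) \<partial>?p)"
      by (rule order_trans[OF integral_abs_bound], rule integral_mono)
        (use i sand in \<open>auto intro!: integrable_abs Bochner_Integration.integrable_diff\<close>)
    also have "\<dots> = C * ((\<integral>p. up m (?z p) \<partial>?p) - (\<integral>p. lo m (?z p) \<partial>?p))"
      using i by (simp only: Bochner_Integration.integral_diff integral_mult_right_zero)
    finally have "\<bar>(\<integral>p. ?I (?z p) \<partial>?p) - (\<integral>p. mid m (?z p) \<partial>?p)\<bar> / H s \<le> C * ((\<integral>p. up m (?z p) \<partial>?p) - (\<integral>p. lo m (?z p) \<partial>?p)) / H s"
      by (intro divide_right_mono less_imp_le[OF H_pos])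
    moreover have "\<bar>(\<integral>p. ?I (?z p) \<partial>?p) - (\<integral>p. mid m (?z p) \<partial>?p)\<bar> / H s = \<bar>pathE a b ?I s - pathE a b (mid m) s\<bar>"
    proof -
      have "\<bar>A\<bar> / H s = \<bar>A / H s\<bar>" for A using H_pos[of s] by (simp add: abs_divide)
      then show ?thesis by (simp only: diff_divide_distrib)
    qed
    ultimately show ?thesis by (simp only: diff_divide_distrib times_divide_eq_right[symmetric])
  qed
  show ?thesis
  proof (rule tendstoI)
    fix e :: real assume e: "0 < e"
    then have "\<forall>\<^sub>F m in sequentially. C * (Lam (up m) - Lam (lo m)) < e / 4" using order_tendstoD(2)[OF tent, of "e / 4"] by simp
    then obtain m where m: "C * (Lam (up m) - Lam (lo m)) < e / 4" using eventually_happens'[OF sequentially_bot] by blast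
    have "((\<lambda>s. C * (pathE a b (up m) s - pathE a b (lo m) s)) \<longlongrightarrow> C * (Lam (up m) - Lam (lo m))) at_top"
      by (intro tendsto_intros U1 U2)
    then have "\<forall>\<^sub>F s in at_top. C * (pathE a b (up m) s - pathE a b (lo m) s) < e / 4" using m by (rule order_tendstoD)
    moreover have "\<forall>\<^sub>F s in at_top. dist (pathE a b (mid m) s) (Lam (mid m)) < e / 4" using e by (intro tendstoD[OF U3(2)]) simp
    ultimately show "\<forall>\<^sub>F s in at_top. dist (pathE a b ?I s) (Lam ?I) < e"
    proof eventually_elim
      case (elim s)
      then show ?case using pathI[of s m] LamI[of m] m unfolding dist_real_def by linarith
    qed
  qed
qed

text \<open>Rescaling the functional amounts to rescaling $q$, so homogeneity of \<open>nu\<close> becomes homogeneity of the limit, with the exponent $3/2$ relating the two scales.\<close>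

lemma Lam_scale:
  assumes f: "window_test a b C \<epsilon> f" and c: "0 < c"
  shows "Lam (\<lambda>x. f (\<lambda>k. c powr (3/2) *\<^sub>R x k)) = c powr \<alpha> * Lam f"
proof -
  interpret X: pair_sigma_finite "count_space (UNIV :: int set)" QN by (rule pair_sf_Xi)
  interpret P: pair_sigma_finite nu NN by (rule pair_sf)
  note [measurable] = window_test_measurable[OF f]
  define d where "d = c powr (3/2)"
  have d: "0 < d" using c by (simp add: d_def)
  have sm: "(\<lambda>x k. d *\<^sub>R x k) \<in> PiM UNIV (\<lambda>_. borel) \<rightarrow>\<^sub>M PiM (UNIV :: int set) (\<lambda>_. borel :: (real \<times> real) measure)"
    by (rule measurable_PiM_single') (auto intro!: borel_measurable_scaleR measurable_component_singleton)
  let ?g = "\<lambda>x. f (\<lambda>k. d *\<^sub>R x k)"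
  have g: "window_test a b C (\<epsilon> / d) ?g"
  proof (rule window_testI)
    show "?g \<in> borel_measurable (PiM UNIV (\<lambda>_. borel))"
      by (rule measurable_compose[OF sm window_test_measurable[OF f]])
    show "0 < \<epsilon> / d" using window_testD(1)[OF f] d by simp
    show "\<bar>?g x\<bar> \<le> C" for x by (rule window_testD(2)[OF f])
    show "?g x = 0" if "\<And>k. k \<in> {a..b} \<Longrightarrow> norm (x k) \<le> \<epsilon> / d" for x
      using that d by (intro window_testD(3)[OF f]) (simp add: pos_le_divide_eq mult.commute)
    show "?g x = ?g y" if "\<And>k. k \<in> {a..b} \<Longrightarrow> x k = y k" for x y
      using that by (intro window_testD(4)[OF f]) simp
  qed
  have Qc: "Q ?g i = c powr \<alpha> * Q f i" for i
  proof -
    have Gm: "(\<lambda>\<omega>. f (U (i, \<omega>))) \<in> borel_measurable QN"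
      using window_test_embed_measurable[OF f, of i] by (simp add: U_def)
    have i1: "integrable QN (\<lambda>\<omega>. f (U (i, \<omega>)))" using integrable_window[OF f, of i] by (simp add: U_def)
    have i2: "integrable QN (\<lambda>\<omega>. ?g (U (i, \<omega>)))" using integrable_window[OF g, of i] by (simp add: U_def)
    have "(\<lambda>(q, z). f (U (i, q, z))) \<in> borel_measurable (borel \<Otimes>\<^sub>M NN)" using Gm
      by (simp add: case_prod_beta' measurable_cong_sets[OF sets_pair_measure_cong[OF sets_nu refl] refl])
    then have Im: "(\<lambda>q. \<integral>z. f (U (i, q, z)) \<partial>NN) \<in> borel_measurable borel"
      by (rule P.M2.borel_measurable_lebesgue_integral)
    have "Q ?g i = (\<integral>q. (\<integral>z. ?g (U (i, q, z)) \<partial>NN) \<partial>nu)"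
      using P.integral_fst'[OF i2] by (simp add: Q_def U_def)
    also have "\<dots> = (\<integral>q. (\<integral>z. f (U (i, c * q, z)) \<partial>NN) \<partial>nu)"
      using AE_nu_pos
    proof (intro integral_cong_AE)
      show "(\<lambda>q. \<integral>z. ?g (U (i, q, z)) \<partial>NN) \<in> borel_measurable nu" using P.integrable_fst'[OF i2] by simp
      show "(\<lambda>q. \<integral>z. f (U (i, c * q, z)) \<partial>NN) \<in> borel_measurable nu"
        using measurable_compose[OF _ Im, of "\<lambda>q. c * q" nu] by simp
    qed (auto elim!: eventually_mono simp: U_scale[OF c] d_def)
    also have "\<dots> = c powr \<alpha> * (\<integral>q. (\<integral>z. f (U (i, q, z)) \<partial>NN) \<partial>nu)"
      by (rule nu_scaling[OF c Im])
    also have "(\<integral>q. (\<integral>z. f (U (i, q, z)) \<partial>NN) \<partial>nu) = Q f i"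
      using P.integral_fst'[OF i1] by (simp add: Q_def U_def)
    finally show ?thesis .
  qed
  have "(\<integral>\<omega>. ?g (U \<omega>) \<partial>Xi) = (\<integral>i. Q ?g i \<partial>count_space UNIV)"
    using X.integral_fst'[OF integrable_Xi[OF g]] by (simp add: Q_def[abs_def] U_def)
  also have "\<dots> = c powr \<alpha> * (\<integral>i. Q f i \<partial>count_space UNIV)"
    by (simp add: Qc)
  also have "(\<integral>i. Q f i \<partial>count_space UNIV) = (\<integral>\<omega>. f (U \<omega>) \<partial>Xi)"
    using X.integral_fst'[OF integrable_Xi[OF f]] by (simp add: Q_def[abs_def] U_def)
  finally show ?thesis by (simp add: Lam_def d_def)
qed

end

section \<open>From random variables to probability mass functions\<close>

context prob_space begin

text \<open>Random elements with values almost surely in a countable set; the path space itself is uncountable.\<close>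

definition discrete_rv :: "('a \<Rightarrow> 'c) \<Rightarrow> bool" where
  "discrete_rv f \<longleftrightarrow> f \<in> measurable M (count_space UNIV) \<and> countable (f ` space M)"

definition law :: "('a \<Rightarrow> 'c) \<Rightarrow> 'c pmf" where
  "law f = (SOME p. measure_pmf p = distr M (count_space UNIV) f)"

lemma discrete_rv_countable:
  fixes f :: "'a \<Rightarrow> 'c::countable"
  shows "f \<in> measurable M (count_space UNIV) \<Longrightarrow> discrete_rv f"
  by (auto simp: discrete_rv_def intro: countable_subset[OF subset_UNIV])

lemma measure_pmf_law:
  assumes f: "discrete_rv f"
  shows "measure_pmf (law f) = distr M (count_space UNIV) f"
proof -
  have fm: "f \<in> measurable M (count_space UNIV)" using f by (simp add: discrete_rv_def)
  let ?D = "distr M (count_space UNIV) f"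
  interpret D: prob_space ?D by (rule prob_space_distr[OF fm])
  have "AE x in ?D. x \<in> f ` space M" by (subst AE_distr_iff[OF fm]) (auto intro!: AE_I2)
  then have "AE x in ?D. measure ?D {x} \<noteq> 0"
    using f by (subst D.AE_support_countable) (auto simp: discrete_rv_def)
  then have "measure_pmf (Abs_pmf ?D) = ?D"
    by (intro Abs_pmf_inverse) (auto simp: D.prob_space_axioms)
  then show ?thesis unfolding law_def by (rule someI)
qed

lemma prob_law: "discrete_rv f \<Longrightarrow> measure_pmf.prob (law f) S = prob (f -` S \<inter> space M)"
  by (simp add: measure_pmf_law measure_distr discrete_rv_def)

lemma pmf_law: "discrete_rv f \<Longrightarrow> pmf (law f) x = prob {\<omega> \<in> space M. f \<omega> = x}"
  by (simp add: pmf.rep_eq prob_law) (auto intro!: arg_cong[where f=prob])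

lemma expectation_law: 
  fixes g :: "'c \<Rightarrow> real"
  shows "discrete_rv f \<Longrightarrow> measure_pmf.expectation (law f) g = expectation (\<lambda>\<omega>. g (f \<omega>))"
  by (simp add: measure_pmf_law integral_distr discrete_rv_def)

lemma integrable_law:
  fixes g :: "'c \<Rightarrow> real"
  shows "discrete_rv f \<Longrightarrow> integrable (measure_pmf (law f)) g \<longleftrightarrow> integrable M (\<lambda>\<omega>. g (f \<omega>))"
  by (simp add: measure_pmf_law integrable_distr_eq discrete_rv_def)

lemma discrete_rv_compose: assumes "discrete_rv f" shows "discrete_rv (\<lambda>\<omega>. \<phi> (f \<omega>))"
  using assms countable_image[of "f ` space M" \<phi>]
  by (auto simp: discrete_rv_def image_image intro: measurable_compose[of f M "count_space UNIV"])

lemma law_compose: assumes f: "discrete_rv f" shows "law (\<lambda>\<omega>. \<phi> (f \<omega>)) = map_pmf \<phi> (law f)"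
proof (rule pmf_eqI)
  fix x
  have "pmf (map_pmf \<phi> (law f)) x = measure_pmf.prob (law f) (\<phi> -` {x})" by (simp add: pmf_map)
  also have "\<dots> = prob {\<omega> \<in> space M. \<phi> (f \<omega>) = x}"
    by (simp add: prob_law[OF f]) (auto intro!: arg_cong[where f=prob])
  finally show "pmf (law (\<lambda>\<omega>. \<phi> (f \<omega>))) x = pmf (map_pmf \<phi> (law f)) x"
    by (simp add: pmf_law[OF discrete_rv_compose[OF f]])
qed

lemma discrete_rv_pair:
  assumes f: "discrete_rv f" and g: "discrete_rv g"
  shows "discrete_rv (\<lambda>\<omega>. (f \<omega>, g \<omega>))"
  unfolding discrete_rv_def
proof
  have c: "countable (f ` space M \<times> g ` space M)" using f g by (auto simp: discrete_rv_def)
  then show "countable ((\<lambda>\<omega>. (f \<omega>, g \<omega>)) ` space M)" by (rule countable_subset[rotated]) auto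
  show "(\<lambda>\<omega>. (f \<omega>, g \<omega>)) \<in> measurable M (count_space UNIV)"
  proof (rule measurableI)
    fix S assume "S \<in> sets (count_space (UNIV :: ('b \<times> 'c) set))"
    have eq: "(\<lambda>\<omega>. (f \<omega>, g \<omega>)) -` S \<inter> space M
        = (\<Union>x\<in>S \<inter> f ` space M \<times> g ` space M. (f -` {fst x} \<inter> space M) \<inter> (g -` {snd x} \<inter> space M))"
      by auto
    show "(\<lambda>\<omega>. (f \<omega>, g \<omega>)) -` S \<inter> space M \<in> sets M"
      unfolding eq using f g by (intro sets.countable_UN'' countable_Int2 c) (auto simp: discrete_rv_def intro: measurable_sets)
  qed simp
qed

lemma law_pair_indep:
  assumes f: "discrete_rv f" and g: "discrete_rv g"
    and i: "\<And>a b. prob {\<omega> \<in> space M. f \<omega> = a \<and> g \<omega> = b} = prob {\<omega> \<in> space M. f \<omega> = a} * prob {\<omega> \<in> space M. g \<omega> = b}"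
  shows "law (\<lambda>\<omega>. (f \<omega>, g \<omega>)) = pair_pmf (law f) (law g)"
proof (rule pmf_eqI)
  fix x show "pmf (law (\<lambda>\<omega>. (f \<omega>, g \<omega>))) x = pmf (pair_pmf (law f) (law g)) x"
    by (cases x) (simp add: pmf_law[OF discrete_rv_pair[OF f g]] pmf_law[OF f] pmf_law[OF g] pmf_pair i)
qed

end

lemma pmf_bind_Pair: "pmf (bind_pmf p (\<lambda>x. map_pmf (Pair x) (k x))) (a, b) = pmf p a * pmf (k a) b"
proof -
  have e: "pmf (map_pmf (Pair x) (k x)) (a, b) = pmf (k a) b * indicator {a} x" for x
  proof (cases "x = a")
    case True then show ?thesis by (simp add: pmf_map_inj' inj_def)
  next
    case False
    then have "(a, b) \<notin> Pair x ` set_pmf (k x)" by auto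
    then show ?thesis using False by (simp add: pmf_map_outside)
  qed
  show ?thesis unfolding pmf_bind e by (simp add: measure_pmf_single mult.commute)
qed

lemma measurable_nat_add:
  fixes f g :: "'b \<Rightarrow> nat"
  assumes "f \<in> measurable N (count_space UNIV)" "g \<in> measurable N (count_space UNIV)"
  shows "(\<lambda>x. f x + g x) \<in> measurable N (count_space UNIV)"
proof (rule measurable_compose_countable[OF _ assms(1)])
  show "(\<lambda>x. i + g x) \<in> measurable N (count_space UNIV)" for i
    by (rule measurable_compose[OF assms(2)]) simp
qed

lemma measurable_nat_sum:
  fixes f :: "'i \<Rightarrow> 'b \<Rightarrow> nat"
  assumes "\<And>i. i \<in> J \<Longrightarrow> f i \<in> measurable N (count_space UNIV)"
  shows "(\<lambda>x. \<Sum>i\<in>J. f i x) \<in> measurable N (count_space UNIV)"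
  using assms by (induction J rule: infinite_finite_induct) (auto intro: measurable_nat_add)

text \<open>The process as given, with its noise.\<close>

locale inar = prob_space M for M :: "'a measure" +
  fixes A0 B0 :: "'a \<Rightarrow> nat" and A :: "nat \<Rightarrow> int \<Rightarrow> 'a \<Rightarrow> nat" and B X :: "int \<Rightarrow> 'a \<Rightarrow> nat"
    and \<alpha> \<mu>A \<mu>B \<sigma>A :: real
  assumes A0: "A0 \<in> measurable M (count_space UNIV)" and B0: "B0 \<in> measurable M (count_space UNIV)"
    and indep: "indep_vars (\<lambda>_. count_space UNIV) (noise A B) (({1..} \<times> UNIV) <+> UNIV)"
    and dA: "\<And>j i. 1 \<le> j \<Longrightarrow> distr M (count_space UNIV) (A j i) = distr M (count_space UNIV) A0"
    and dB: "\<And>i. distr M (count_space UNIV) (B i) = distr M (count_space UNIV) B0"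
    and muA: "\<mu>A = expectation (\<lambda>\<omega>. real (A0 \<omega>))" "0 < \<mu>A" "\<mu>A < 1"
    and sqA: "integrable M (\<lambda>\<omega>. (real (A0 \<omega>))\<^sup>2)"
    and sigA: "\<sigma>A = sqrt (variance (\<lambda>\<omega>. real (A0 \<omega>)))" "0 < \<sigma>A"
    and alpha: "1 < \<alpha>" "\<alpha> < 2"
    and rvB: "regularly_varying_rv M (\<lambda>\<omega>. real (B0 \<omega>)) \<alpha>"
    and statX: "strongly_stationary M (count_space UNIV) X"
    and recX: "\<And>i. AE \<omega> in M. X i \<omega> = (\<Sum>j = 1..X (i - 1) \<omega>. A j i \<omega>) + B i \<omega>"
    and indX: "\<And>i. indep_elements M (count_space UNIV) (X (i - 1))
           (PiM (({1..} \<times> {i..}) <+> {i..}) (\<lambda>_. count_space UNIV))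
           (\<lambda>\<omega>. \<lambda>t\<in>({1..} \<times> {i..}) <+> {i..}. noise A B t \<omega>)"
begin

lemma noise_meas: "t \<in> ({1..} \<times> UNIV) <+> UNIV \<Longrightarrow> noise A B t \<in> measurable M (count_space UNIV)"
  using indep unfolding indep_vars_def2 by blast

lemma A_meas: "1 \<le> j \<Longrightarrow> A j i \<in> measurable M (count_space UNIV)"
  using noise_meas[of "Inl (j, i)"] by (auto simp: noise_def)

lemma B_meas: "B i \<in> measurable M (count_space UNIV)"
  using noise_meas[of "Inr i"] by (auto simp: noise_def)

lemma X_meas: "X i \<in> measurable M (count_space UNIV)"
  using statX by (simp add: strongly_stationary_def)

lemma law_eq: "f \<in> measurable M (count_space UNIV) \<Longrightarrow> g \<in> measurable M (count_space UNIV) \<Longrightarrow>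
   distr M (count_space UNIV) f = distr M (count_space UNIV) g \<Longrightarrow> law f = law (g :: 'a \<Rightarrow> nat)"
  by (simp add: law_def)

text \<open>Functions of disjoint finite groups of noise variables are independent.\<close>

lemma noise_groups:
  assumes L: "finite L" "L \<noteq> {}" "disjoint_family_on K L" "\<And>l. l \<in> L \<Longrightarrow> K l \<subseteq> ({1..} \<times> UNIV) <+> UNIV"
    and F: "\<And>l. l \<in> L \<Longrightarrow> F l \<in> measurable (PiM (K l) (\<lambda>_. count_space UNIV)) (count_space (UNIV :: nat set))"
    and f: "\<And>l \<omega>. l \<in> L \<Longrightarrow> f l \<omega> = F l (\<lambda>t\<in>K l. noise A B t \<omega>)"
  shows "prob {\<omega> \<in> space M. \<forall>l\<in>L. f l \<omega> = p l} = (\<Prod>l\<in>L. prob {\<omega> \<in> space M. f l \<omega> = p l})"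
proof -
  have "indep_vars (\<lambda>l. PiM (K l) (\<lambda>_. count_space UNIV)) (\<lambda>l \<omega>. \<lambda>t\<in>K l. noise A B t \<omega>) L"
    by (rule indep_vars_restrict[OF indep L(4,3)])
  then have "indep_vars (\<lambda>_. count_space UNIV) (\<lambda>l \<omega>. F l (\<lambda>t\<in>K l. noise A B t \<omega>)) L"
    by (rule indep_vars_compose2) (rule F)
  from indep_varsD[OF this L(2,1) order_refl, of "\<lambda>l. {p l}"]
  have "prob (\<Inter>l\<in>L. (\<lambda>\<omega>. F l (\<lambda>t\<in>K l. noise A B t \<omega>)) -` {p l} \<inter> space M)
    = (\<Prod>l\<in>L. prob ((\<lambda>\<omega>. F l (\<lambda>t\<in>K l. noise A B t \<omega>)) -` {p l} \<inter> space M))" by simp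
  moreover have "(\<Inter>l\<in>L. (\<lambda>\<omega>. F l (\<lambda>t\<in>K l. noise A B t \<omega>)) -` {p l} \<inter> space M) = {\<omega> \<in> space M. \<forall>l\<in>L. f l \<omega> = p l}"
    using L(2) f by auto
  moreover have "(\<lambda>\<omega>. F l (\<lambda>t\<in>K l. noise A B t \<omega>)) -` {p l} \<inter> space M = {\<omega> \<in> space M. f l \<omega> = p l}" if "l \<in> L" for l
    using f[OF that] by auto
  ultimately show ?thesis by simp
qed

definition offspring :: "int \<Rightarrow> nat \<Rightarrow> 'a \<Rightarrow> nat" where
  "offspring k m \<omega> = (\<Sum>j = 1..m. A j k \<omega>)"

definition reproduction :: "int \<Rightarrow> nat \<Rightarrow> 'a \<Rightarrow> nat" where
  "reproduction k m \<omega> = offspring k m \<omega> + B k \<omega>"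

lemma offspring_rv: "discrete_rv (offspring k m)"
  unfolding offspring_def[abs_def] by (intro discrete_rv_countable measurable_nat_sum A_meas) auto

lemma A_rv: "1 \<le> j \<Longrightarrow> discrete_rv (A j i)"
  by (rule discrete_rv_countable[OF A_meas])

lemma B_rv: "discrete_rv (B i)" and X_rv: "discrete_rv (X i)"
  by (rule discrete_rv_countable[OF B_meas] discrete_rv_countable[OF X_meas])+

lemma reproduction_rv: "discrete_rv (reproduction k m)"
  unfolding reproduction_def[abs_def]
  using offspring_rv[of k m] B_meas[of k] by (intro discrete_rv_countable measurable_nat_add) (auto simp: discrete_rv_def)

lemma two_groups:
  assumes K: "K1 \<inter> K2 = {}" "K1 \<subseteq> ({1..} \<times> UNIV) <+> UNIV" "K2 \<subseteq> ({1..} \<times> UNIV) <+> UNIV"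
    and F: "F \<in> measurable (PiM K1 (\<lambda>_. count_space UNIV)) (count_space (UNIV :: nat set))"
      "G \<in> measurable (PiM K2 (\<lambda>_. count_space UNIV)) (count_space (UNIV :: nat set))"
    and f: "\<And>\<omega>. f \<omega> = F (\<lambda>t\<in>K1. noise A B t \<omega>)" "\<And>\<omega>. g \<omega> = G (\<lambda>t\<in>K2. noise A B t \<omega>)"
  shows "prob {\<omega> \<in> space M. f \<omega> = a \<and> g \<omega> = b} = prob {\<omega> \<in> space M. f \<omega> = a} * prob {\<omega> \<in> space M. g \<omega> = b}"
proof -
  have "prob {\<omega> \<in> space M. \<forall>l\<in>UNIV. (case_bool f g l) \<omega> = case_bool a b l}
     = (\<Prod>l\<in>UNIV. prob {\<omega> \<in> space M. (case_bool f g l) \<omega> = case_bool a b l})"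
    by (rule noise_groups[where K="case_bool K1 K2" and F="case_bool F G"])
      (use K F f in \<open>auto simp: disjoint_family_on_def split: bool.split\<close>)
  moreover have "(\<forall>l\<in>UNIV. (case_bool f g l) \<omega> = case_bool a b l) \<longleftrightarrow> f \<omega> = a \<and> g \<omega> = b" for \<omega>
    by (simp only: ball_UNIV all_bool_eq bool.case)
  ultimately show ?thesis by (simp add: UNIV_bool mult.commute)
qed

text \<open>One more parent adds one independent summand.\<close>

lemma law_offspring_Suc:
  "law (offspring k (Suc m)) = map_pmf (\<lambda>(s, a). s + a) (pair_pmf (law (offspring k m)) (law A0))"
proof -
  have "law (\<lambda>\<omega>. (offspring k m \<omega>, A (Suc m) k \<omega>)) = pair_pmf (law (offspring k m)) (law (A (Suc m) k))"
  proof (rule law_pair_indep[OF offspring_rv A_rv])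
    show "prob {\<omega> \<in> space M. offspring k m \<omega> = a \<and> A (Suc m) k \<omega> = b}
       = prob {\<omega> \<in> space M. offspring k m \<omega> = a} * prob {\<omega> \<in> space M. A (Suc m) k \<omega> = b}" for a b
    proof (rule two_groups[where ?K1.0="Inl ` ({1..m} \<times> {k})" and ?K2.0="{Inl (Suc m, k)}"
          and F="\<lambda>x. \<Sum>j = 1..m. x (Inl (j, k))" and G="\<lambda>x. x (Inl (Suc m, k))"])
      show "(\<lambda>x. \<Sum>j = 1..m. x (Inl (j, k))) \<in> measurable (PiM (Inl ` ({1..m} \<times> {k})) (\<lambda>_. count_space UNIV)) (count_space (UNIV :: nat set))"
        by (intro measurable_nat_sum measurable_component_singleton) auto
      show "(\<lambda>x. x (Inl (Suc m, k))) \<in> measurable (PiM {Inl (Suc m, k)} (\<lambda>_. count_space UNIV)) (count_space (UNIV :: nat set))"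
        by (rule measurable_component_singleton) simp
      show "offspring k m \<omega> = (\<Sum>j = 1..m. (\<lambda>t\<in>Inl ` ({1..m} \<times> {k}). noise A B t \<omega>) (Inl (j, k)))" for \<omega>
        unfolding offspring_def by (intro sum.cong) (auto simp: noise_def)
    qed (auto simp: noise_def)
  qed simp
  moreover have "law (A (Suc m) k) = law A0" by (rule law_eq[OF A_meas A0 dA]) simp_all
  ultimately have "law (\<lambda>\<omega>. (offspring k m \<omega>, A (Suc m) k \<omega>)) = pair_pmf (law (offspring k m)) (law A0)" by simp
  moreover have "offspring k (Suc m) = (\<lambda>\<omega>. (\<lambda>(s, a). s + a) (offspring k m \<omega>, A (Suc m) k \<omega>))"
    by (simp add: offspring_def fun_eq_iff)
  ultimately show ?thesis
    using law_compose[OF discrete_rv_pair[OF offspring_rv A_rv], of "Suc m" "\<lambda>(s, a). s + a" k m k] by simp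
qed

lemma law_offspring: "law (offspring k m) = law (offspring 0 m)"
proof (induction m)
  case 0 then show ?case by (simp add: offspring_def[abs_def])
qed (simp add: law_offspring_Suc)

text \<open>Offspring and immigration of the same generation use disjoint parts of the noise.\<close>

lemma law_reproduction: "law (reproduction k m) = map_pmf (\<lambda>(s, b). s + b) (pair_pmf (law (offspring 0 m)) (law B0))"
proof -
  have "law (\<lambda>\<omega>. (offspring k m \<omega>, B k \<omega>)) = pair_pmf (law (offspring k m)) (law (B k))"
  proof (rule law_pair_indep[OF offspring_rv B_rv])
    show "prob {\<omega> \<in> space M. offspring k m \<omega> = a \<and> B k \<omega> = b}
       = prob {\<omega> \<in> space M. offspring k m \<omega> = a} * prob {\<omega> \<in> space M. B k \<omega> = b}" for a b
    proof (rule two_groups[where ?K1.0="Inl ` ({1..m} \<times> {k})" and ?K2.0="{Inr k}"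
          and F="\<lambda>x. \<Sum>j = 1..m. x (Inl (j, k))" and G="\<lambda>x. x (Inr k)"])
      show "(\<lambda>x. \<Sum>j = 1..m. x (Inl (j, k))) \<in> measurable (PiM (Inl ` ({1..m} \<times> {k})) (\<lambda>_. count_space UNIV)) (count_space (UNIV :: nat set))"
        by (intro measurable_nat_sum measurable_component_singleton) auto
      show "(\<lambda>x. x (Inr k)) \<in> measurable (PiM {Inr k} (\<lambda>_. count_space UNIV)) (count_space (UNIV :: nat set))"
        by (rule measurable_component_singleton) simp
      show "offspring k m \<omega> = (\<Sum>j = 1..m. (\<lambda>t\<in>Inl ` ({1..m} \<times> {k}). noise A B t \<omega>) (Inl (j, k)))" for \<omega>
        unfolding offspring_def by (intro sum.cong) (auto simp: noise_def)
    qed (auto simp: noise_def)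
  qed
  moreover have "law (B k) = law B0" by (rule law_eq[OF B_meas B0 dB])
  moreover have "reproduction k m = (\<lambda>\<omega>. (\<lambda>(s, b). s + b) (offspring k m \<omega>, B k \<omega>))"
    by (simp add: reproduction_def fun_eq_iff)
  ultimately show ?thesis
    using law_compose[OF discrete_rv_pair[OF offspring_rv B_rv], of "\<lambda>(s, b). s + b" k m k] law_offspring[of k m] by simp
qed

lemma A_moment:
  fixes g :: "nat \<Rightarrow> real"
  assumes "1 \<le> j"
  shows "expectation (\<lambda>\<omega>. g (A j i \<omega>)) = expectation (\<lambda>\<omega>. g (A0 \<omega>))"
    "integrable M (\<lambda>\<omega>. g (A j i \<omega>)) \<longleftrightarrow> integrable M (\<lambda>\<omega>. g (A0 \<omega>))"
proof -
  have "law (A j i) = law A0" by (rule law_eq[OF A_meas A0 dA]) (use assms in simp_all)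
  then show "expectation (\<lambda>\<omega>. g (A j i \<omega>)) = expectation (\<lambda>\<omega>. g (A0 \<omega>))"
    "integrable M (\<lambda>\<omega>. g (A j i \<omega>)) \<longleftrightarrow> integrable M (\<lambda>\<omega>. g (A0 \<omega>))"
    using expectation_law[where g=g, OF A_rv[OF assms, of i]] expectation_law[where g=g, OF discrete_rv_countable[OF A0]]
      integrable_law[where g=g, OF A_rv[OF assms, of i]] integrable_law[where g=g, OF discrete_rv_countable[OF A0]] by simp_all
qed

lemma A0_integrable: "integrable M (\<lambda>\<omega>. real (A0 \<omega>))"
  by (rule square_integrable_imp_integrable[OF _ sqA]) (rule measurable_compose[OF A0], simp)

lemma A0_centered: "integrable M (\<lambda>\<omega>. (real (A0 \<omega>) - \<mu>A)\<^sup>2)" "expectation (\<lambda>\<omega>. (real (A0 \<omega>) - \<mu>A)\<^sup>2) = \<sigma>A\<^sup>2"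
proof -
  show "integrable M (\<lambda>\<omega>. (real (A0 \<omega>) - \<mu>A)\<^sup>2)"
    using sqA A0_integrable by (simp add: power2_diff)
  have "0 \<le> variance (\<lambda>\<omega>. real (A0 \<omega>))" by (auto intro!: integral_nonneg_AE)
  then show "expectation (\<lambda>\<omega>. (real (A0 \<omega>) - \<mu>A)\<^sup>2) = \<sigma>A\<^sup>2"
    using sigA(1) muA(1) by simp
qed

lemma centered_indep: "indep_vars (\<lambda>_. borel) (\<lambda>j \<omega>. real (A j i \<omega>) - \<mu>A) {1..}"
proof -
  have "indep_vars (\<lambda>j. PiM {Inl (j, i)} (\<lambda>_. count_space UNIV)) (\<lambda>j \<omega>. \<lambda>t\<in>{Inl (j, i)}. noise A B t \<omega>) {1..}"
    by (rule indep_vars_restrict[OF indep]) (auto simp: disjoint_family_on_def)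
  then have "indep_vars (\<lambda>_. borel) (\<lambda>j \<omega>. real ((\<lambda>t\<in>{Inl (j, i)}. noise A B t \<omega>) (Inl (j, i))) - \<mu>A) {1..}"
  proof (rule indep_vars_compose2)
    fix j
    show "(\<lambda>x. real (x (Inl (j, i))) - \<mu>A) \<in> borel_measurable (PiM {Inl (j, i)} (\<lambda>_. count_space UNIV))"
      by (rule measurable_compose[OF measurable_component_singleton[of "Inl (j, i)"]]) auto
  qed
  then show ?thesis by (simp add: noise_def)
qed

lemma offspring_moments:
  "integrable M (\<lambda>\<omega>. (real (offspring i m \<omega>) - \<mu>A * real m)\<^sup>2)"
  "expectation (\<lambda>\<omega>. (real (offspring i m \<omega>) - \<mu>A * real m)\<^sup>2) = \<sigma>A\<^sup>2 * real m"
  "expectation (\<lambda>\<omega>. real (offspring i m \<omega>)) = \<mu>A * real m"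
proof -
  define Y where "Y j \<omega> = real (A j i \<omega>) - \<mu>A" for j \<omega>
  have Yi: "integrable M (Y j)" "expectation (Y j) = 0" "integrable M (\<lambda>\<omega>. (Y j \<omega>)\<^sup>2)" "expectation (\<lambda>\<omega>. (Y j \<omega>)\<^sup>2) = \<sigma>A\<^sup>2" if "1 \<le> j" for j
    using A_moment[OF that, of "\<lambda>l. real l - \<mu>A" i] A_moment[OF that, of "\<lambda>l. (real l - \<mu>A)\<^sup>2" i]
      A0_integrable A0_centered muA(1) by (simp_all add: Y_def[abs_def] prob_space)
  have off: "real (offspring i m \<omega>) - \<mu>A * real m = (\<Sum>j\<in>{1..m}. Y j \<omega>)" for m \<omega>
    by (simp add: offspring_def Y_def sum_subtractf)
  have ind: "integrable M (\<lambda>\<omega>. \<Sum>j\<in>{1..m}. Y j \<omega>)" "expectation (\<lambda>\<omega>. \<Sum>j\<in>{1..m}. Y j \<omega>) = 0" for m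
    using Yi by (auto intro!: Bochner_Integration.integrable_sum sum.neutral simp: Bochner_Integration.integral_sum)
  have sq: "integrable M (\<lambda>\<omega>. (\<Sum>j\<in>{1..m}. Y j \<omega>)\<^sup>2) \<and> expectation (\<lambda>\<omega>. (\<Sum>j\<in>{1..m}. Y j \<omega>)\<^sup>2) = \<sigma>A\<^sup>2 * real m"
  proof (induction m)
    case (Suc m)
    have "indep_vars (\<lambda>_. borel) Y (insert (Suc m) {1..m})"
      unfolding Y_def[abs_def] by (rule indep_vars_subset[OF centered_indep]) auto
    then have iv: "indep_var borel (Y (Suc m)) borel (\<lambda>\<omega>. \<Sum>j\<in>{1..m}. Y j \<omega>)"
      by (rule indep_vars_sum[rotated 2]) auto
    have cross: "integrable M (\<lambda>\<omega>. Y (Suc m) \<omega> * (\<Sum>j\<in>{1..m}. Y j \<omega>))" "expectation (\<lambda>\<omega>. Y (Suc m) \<omega> * (\<Sum>j\<in>{1..m}. Y j \<omega>)) = 0"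
      using indep_var_integrable[OF iv Yi(1) ind(1)] indep_var_lebesgue_integral[OF iv Yi(1) ind(1)] Yi(2)[of "Suc m"] by auto
    have e: "(\<Sum>j\<in>{1..Suc m}. Y j \<omega>)\<^sup>2 = (\<Sum>j\<in>{1..m}. Y j \<omega>)\<^sup>2 + 2 * (Y (Suc m) \<omega> * (\<Sum>j\<in>{1..m}. Y j \<omega>)) + (Y (Suc m) \<omega>)\<^sup>2" for \<omega>
      by (simp add: power2_sum)
    show ?case unfolding e using Suc cross Yi(3,4)[of "Suc m"] by (simp add: distrib_left)
  qed simp
  show "integrable M (\<lambda>\<omega>. (real (offspring i m \<omega>) - \<mu>A * real m)\<^sup>2)"
    "expectation (\<lambda>\<omega>. (real (offspring i m \<omega>) - \<mu>A * real m)\<^sup>2) = \<sigma>A\<^sup>2 * real m"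
    using sq by (auto simp: off)
  have "real (offspring i m \<omega>) = (\<Sum>j\<in>{1..m}. Y j \<omega>) + \<mu>A * real m" for \<omega> using off[of m \<omega>] by simp
  then show "expectation (\<lambda>\<omega>. real (offspring i m \<omega>)) = \<mu>A * real m" using ind[of m] by (simp add: prob_space)
qed

text \<open>The central limit theorem for the sum of $m$ i.i.d. offspring numbers, transported to laws on the natural numbers.\<close>

lemma offspring_clt:
  "weak_conv_m (\<lambda>m. distr (law (offspring 0 m)) borel (\<lambda>l. (real l - \<mu>A * real m) / sqrt (real m))) (normal_law \<sigma>A)"
proof -
  define Z where "Z j \<omega> = real (A (Suc j) 0 \<omega>) - \<mu>A" for j \<omega>
  have Zm: "Z j \<in> borel_measurable M" for j
    unfolding Z_def[abs_def] using A_meas[of "Suc j" 0] by simp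
  have "indep_vars (\<lambda>j. PiM {Inl (Suc j, 0)} (\<lambda>_. count_space UNIV)) (\<lambda>j \<omega>. \<lambda>t\<in>{Inl (Suc j, 0)}. noise A B t \<omega>) UNIV"
    by (rule indep_vars_restrict[OF indep]) (auto simp: disjoint_family_on_def)
  then have "indep_vars (\<lambda>_. borel) (\<lambda>j \<omega>. real ((\<lambda>t\<in>{Inl (Suc j, 0)}. noise A B t \<omega>) (Inl (Suc j, 0))) - \<mu>A) UNIV"
  proof (rule indep_vars_compose2)
    fix j
    show "(\<lambda>x. real (x (Inl (Suc j, 0))) - \<mu>A) \<in> borel_measurable (PiM {Inl (Suc j, 0)} (\<lambda>_. count_space UNIV))"
      by (rule measurable_compose[OF measurable_component_singleton[of "Inl (Suc j, 0)"]]) auto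
  qed
  then have Zi: "indep_vars (\<lambda>_. borel) Z UNIV" by (simp add: noise_def Z_def[abs_def])
  have Z0: "expectation (Z j) = 0" "integrable M (\<lambda>\<omega>. (Z j \<omega>)\<^sup>2)" "expectation (\<lambda>\<omega>. (Z j \<omega>)\<^sup>2) = \<sigma>A\<^sup>2" for j
    using A_moment[of "Suc j" "\<lambda>l. real l - \<mu>A" 0] A_moment[of "Suc j" "\<lambda>l. (real l - \<mu>A)\<^sup>2" 0]
      A0_integrable A0_centered muA(1) by (simp_all add: Z_def[abs_def] prob_space)
  have Zd: "distr M borel (Z j) = distr (distr M (count_space UNIV) A0) borel (\<lambda>l. real l - \<mu>A)" for j
    unfolding Z_def[abs_def] dA[of "Suc j" 0, simplified, symmetric]
    by (subst distr_distr) (auto simp: o_def A_meas)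
  have clt: "weak_conv_m (\<lambda>n. distr M borel (\<lambda>\<omega>. (\<Sum>i<n. Z i \<omega>) / sqrt (real n * \<sigma>A\<^sup>2))) std_normal_distribution"
    by (rule central_limit_theorem_zero_mean[OF Zi Z0(1) sigA(2) Z0(2) _ Zd]) (simp add: Z0)
  have sums: "(\<Sum>i<n. Z i \<omega>) = real (offspring 0 n \<omega>) - \<mu>A * real n" for n \<omega>
  proof -
    have "(\<Sum>i<n. Z i \<omega>) = (\<Sum>j\<in>{1..n}. real (A j 0 \<omega>) - \<mu>A)"
      unfolding Z_def by (rule sum.reindex_bij_witness[where i="\<lambda>j. j - 1" and j=Suc]) auto
    then show ?thesis by (simp add: offspring_def sum_subtractf)
  qed
  have law_d: "distr (law (offspring 0 m)) borel (\<lambda>l. (real l - \<mu>A * real m) / sqrt (real m))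
      = distr M borel (\<lambda>\<omega>. (real (offspring 0 m \<omega>) - \<mu>A * real m) / sqrt (real m))" for m
    unfolding measure_pmf_law[OF offspring_rv]
    by (subst distr_distr) (use offspring_rv[of 0 m] in \<open>auto simp: o_def discrete_rv_def\<close>)
  have cdf1: "cdf (distr M borel (\<lambda>\<omega>. (real (offspring 0 m \<omega>) - \<mu>A * real m) / sqrt (real m))) x
     = cdf (distr M borel (\<lambda>\<omega>. (\<Sum>i<m. Z i \<omega>) / sqrt (real m * \<sigma>A\<^sup>2))) (x / \<sigma>A)" for m x
  proof -
    have om: "(\<lambda>\<omega>. real (offspring 0 m \<omega>)) \<in> borel_measurable M"
      using offspring_rv[of 0 m] by (auto simp: discrete_rv_def)
    have "(real (offspring 0 m \<omega>) - \<mu>A * real m) / sqrt (real m) \<le> x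
      \<longleftrightarrow> (\<Sum>i<m. Z i \<omega>) / sqrt (real m * \<sigma>A\<^sup>2) \<le> x / \<sigma>A" for \<omega>
    proof -
      have "(\<Sum>i<m. Z i \<omega>) / sqrt (real m * \<sigma>A\<^sup>2) = ((real (offspring 0 m \<omega>) - \<mu>A * real m) / sqrt (real m)) / \<sigma>A"
        using sigA(2) by (simp add: sums real_sqrt_mult)
      then show ?thesis using sigA(2) by (simp only: divide_le_cancel) simp
    qed
    then show ?thesis unfolding cdf_def using om Zm
      by (subst (1 2) measure_distr) (auto intro!: arg_cong[where f=prob])
  qed
  have cdf2: "cdf (normal_law \<sigma>A) x = cdf std_normal_distribution (x / \<sigma>A)" for x
  proof -
    interpret N: prob_space "std_normal_distribution" by (rule prob_space_normal_density) simp
    have "distributed std_normal_distribution lborel (\<lambda>x. x) std_normal_density"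
      by (auto simp: distributed_def distr_id2)
    from N.normal_density_affine[OF this, of \<sigma>A 0] have "distributed std_normal_distribution lborel (\<lambda>x. \<sigma>A * x) (normal_density 0 \<sigma>A)"
      using sigA(2) by simp
    then have "normal_law \<sigma>A = distr std_normal_distribution lborel (\<lambda>x. \<sigma>A * x)" by (simp add: distributed_def)
    then have "cdf (normal_law \<sigma>A) x = measure std_normal_distribution ((\<lambda>x. \<sigma>A * x) -` {..x} \<inter> UNIV)"
      unfolding cdf_def by (simp add: measure_distr)
    also have "(\<lambda>x. \<sigma>A * x) -` {..x} \<inter> UNIV = {..x / \<sigma>A}" using sigA(2) by (auto simp: field_simps)
    finally show ?thesis by (simp add: cdf_def)
  qed
  show ?thesis
    unfolding weak_conv_m_def weak_conv_def
  proof (intro allI impI)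
    fix x assume c: "isCont (cdf (normal_law \<sigma>A)) x"
    have "cdf std_normal_distribution = (\<lambda>y. cdf (normal_law \<sigma>A) (\<sigma>A * y))" using cdf2 sigA(2) by (simp add: fun_eq_iff)
    moreover have "isCont (\<lambda>y. cdf (normal_law \<sigma>A) (\<sigma>A * y)) (x / \<sigma>A)"
      by (rule continuous_within_compose3[where f="\<lambda>y. \<sigma>A * y", simplified]) (use c sigA(2) in \<open>auto intro!: continuous_intros\<close>)
    ultimately have "isCont (cdf std_normal_distribution) (x / \<sigma>A)" by simp
    then show "(\<lambda>n. cdf (distr (law (offspring 0 n)) borel (\<lambda>l. (real l - \<mu>A * real n) / sqrt (real n))) x) \<longlonglongrightarrow> cdf (normal_law \<sigma>A) x"
      unfolding law_d cdf1 cdf2 using clt unfolding weak_conv_m_def weak_conv_def by blast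
  qed
qed

end

section \<open>The process is a Markov chain with the branching kernel\<close>

context branching begin

text \<open>If exceedances had mass zero, then by scaling all levels would, so the norm would vanish on almost every trail; but trails started at the first time of the window are nonzero throughout it.\<close>

lemma Lam_exceedance_pos:
  assumes N: "wnorm a b L N" and ab: "a \<le> b" and u: "0 < u"
  shows "0 < Lam (\<lambda>x. indicator {u<..} (N x))"
proof (rule ccontr)
  assume neg: "\<not> 0 < Lam (\<lambda>x. indicator {u<..} (N x))"
  interpret X: pair_sigma_finite "count_space (UNIV :: int set)" QN by (rule pair_sf_Xi)
  interpret P: pair_sigma_finite nu NN by (rule pair_sf)
  interpret I: prob_space NN by (rule prob_space_NN)
  note [measurable] = wnormD(6)[OF N]
  have h1: "wfun a b 1 N (\<lambda>_. 1)" using wfun_const[of a b 1 N] by simp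
  have w: "window_test a b 1 (v / ((L + 1) * wsize a b)) (\<lambda>x. indicator {v<..} (N x))" if "0 < v" for v
    using window_test_cut[OF N h1 ab that, of "indicator {v<..}"] by (simp add: indicator_def)
  have nn: "0 \<le> Lam (\<lambda>x. indicator {v<..} (N x))" for v
    unfolding Lam_def using mu_powr_less_1 by (intro mult_nonneg_nonneg integral_nonneg_AE) auto
  have zero: "AE \<omega> in Xi. N (U \<omega>) \<le> v" if v: "0 < v" for v
  proof -
    define c where "c = (u / v) powr (2/3)"
    have c: "0 < c" "c powr (3/2) = u / v" using u v by (auto simp: c_def powr_powr)
    have "(\<lambda>x. indicator {u<..} (N (\<lambda>k. c powr (3/2) *\<^sub>R x k))) = (\<lambda>x. indicator {v<..} (N x) :: real)"
    proof
      fix x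
      have "N (\<lambda>k. c powr (3/2) *\<^sub>R x k) = u / v * N x" unfolding c(2) using u v by (intro wnormD(3)[OF N]) auto
      moreover have "u < u / v * N x \<longleftrightarrow> v < N x" using u v by (simp add: field_simps)
      ultimately show "indicator {u<..} (N (\<lambda>k. c powr (3/2) *\<^sub>R x k)) = (indicator {v<..} (N x) :: real)" by (simp add: indicator_def)
    qed
    then have "Lam (\<lambda>x. indicator {v<..} (N x)) = 0"
      using Lam_scale[OF w[OF u] c(1)] neg nn[of u] by simp
    then have "(\<integral>\<omega>. indicator {v<..} (N (U \<omega>)) \<partial>Xi) = (0::real)"
      using mu_powr_less_1 by (simp add: Lam_def)
    then have "AE \<omega> in Xi. indicator {v<..} (N (U \<omega>)) = (0::real)"
      using integral_nonneg_eq_0_iff_AE[OF integrable_Xi[OF w[OF v]]] by simp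
    then show ?thesis by eventually_elim (auto simp: indicator_def split: if_splits)
  qed
  have "AE \<omega> in Xi. \<forall>m::nat. N (U \<omega>) \<le> 1 / real (Suc m)"
    unfolding AE_all_countable by (intro allI zero) simp
  then have AE0: "AE \<omega> in Xi. N (U \<omega>) \<le> 0"
  proof eventually_elim
    case (elim \<omega>)
    show ?case
    proof (rule ccontr)
      assume "\<not> N (U \<omega>) \<le> 0"
      then obtain n where "1 / real (Suc n) < N (U \<omega>)" using nat_approx_posE[of "N (U \<omega>)"] by (auto simp: not_le)
      then show False using elim[rule_format, of n] by linarith
    qed
  qed
  let ?A = "{a} \<times> ({1<..} \<times> (UNIV :: (nat \<Rightarrow> real) set))"
  have Nu: "UNIV \<in> sets NN" using sets.top[of NN] by simp
  have B: "{1<..} \<times> UNIV \<in> sets QN" using Nu by auto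
  have A: "?A \<in> sets Xi" using B by auto
  have "emeasure Xi ?A = emeasure (count_space UNIV) {a} * emeasure QN ({1<..} \<times> UNIV)"
    by (rule X.M2.emeasure_pair_measure_Times) (use B in auto)
  also have "emeasure QN ({1<..} \<times> UNIV) = emeasure nu {1<..} * emeasure NN UNIV"
    by (rule P.M2.emeasure_pair_measure_Times) (use Nu in auto)
  also have "emeasure NN UNIV = 1" using I.emeasure_space_1 by simp
  finally have eA: "emeasure Xi ?A = 1" by (simp add: emeasure_nu)
  have "AE \<omega> in Xi. \<omega> \<notin> ?A"
    using AE0
  proof eventually_elim
    case (elim \<omega>)
    show ?case
    proof
      assume "\<omega> \<in> ?A"
      then obtain q z where \<omega>: "\<omega> = (a, q, z)" "1 < q" by auto
      have "0 < N (U \<omega>)"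
      proof (rule wnormD(4)[OF N])
        fix k assume "k \<in> {a..b}"
        then show "U \<omega> k \<noteq> 0" using \<omega> mu by (simp add: U_def embed_def trail_def zero_prod_def)
      qed
      then show False using elim by simp
    qed
  qed
  then have "emeasure Xi ?A = 0" using A by (subst (asm) AE_iff_measurable[OF A]) (auto simp: space_pair_measure)
  then show False using eA by simp
qed

end

context inar begin

definition Kp :: "nat \<Rightarrow> nat pmf" where
  "Kp m = map_pmf (\<lambda>(s, b). s + b) (pair_pmf (law (offspring 0 m)) (law B0))"

definition chain_event :: "int \<Rightarrow> nat \<Rightarrow> (nat \<Rightarrow> nat) \<Rightarrow> 'a set" where
  "chain_event a n p = {\<omega> \<in> space M. X a \<omega> = p 0 \<and> (\<forall>k\<in>{1..n}. reproduction (a + int k) (p (k - 1)) \<omega> = p k)}"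

text \<open>The independence of the start from all later noise, together with the independence of the noise of different generations, factorises the probability of a path.\<close>

lemma prob_chain_event:
  "prob (chain_event a n p) = prob {\<omega> \<in> space M. X a \<omega> = p 0} * (\<Prod>k\<in>{1..n}. pmf (Kp (p (k - 1))) (p k))"
proof -
  let ?T = "({1..} \<times> {a + 1..}) <+> {a + 1..} :: ((nat \<times> int) + int) set"
  let ?P = "PiM ?T (\<lambda>_. count_space (UNIV :: nat set))"
  define V where "V \<omega> = (\<lambda>t\<in>?T. noise A B t \<omega>)" for \<omega>
  define G where "G k x = (\<Sum>j = 1..p (k - 1). x (Inl (j, a + int k))) + x (Inr (a + int k))" for k and x :: "(nat \<times> int) + int \<Rightarrow> nat"
  define D where "D = {x \<in> space ?P. \<forall>k\<in>{1..n}. G k x = p k}"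
  have Gm: "G k \<in> measurable ?P (count_space UNIV)" if "k \<in> {1..n}" for k
    unfolding G_def[abs_def] using that
    by (intro measurable_nat_add measurable_nat_sum measurable_component_singleton) auto
  have "{x \<in> space ?P. G k x = p k} \<in> sets ?P" if "k \<in> {1..n}" for k
    using measurable_sets[OF Gm[OF that], of "{p k}"] by (simp add: vimage_def Int_def conj_commute)
  then have D: "D \<in> sets ?P" unfolding D_def by (intro sets.sets_Collect_finite_All) auto
  have GV: "G k (V \<omega>) = reproduction (a + int k) (p (k - 1)) \<omega>" if "k \<in> {1..n}" for k \<omega>
    unfolding G_def V_def reproduction_def offspring_def using that
    by (intro arg_cong2[where f="(+)"] sum.cong) (auto simp: noise_def)
  have Vs: "V \<omega> \<in> space ?P" for \<omega> by (simp add: V_def space_PiM)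
  have 1: "X a -` {p 0} \<inter> space M = {\<omega> \<in> space M. X a \<omega> = p 0}" by auto
  have 2: "V -` D \<inter> space M = {\<omega> \<in> space M. \<forall>k\<in>{1..n}. reproduction (a + int k) (p (k - 1)) \<omega> = p k}"
    using GV Vs by (auto simp: D_def)
  have ind: "indep_set {X a -` C \<inter> space M |C. C \<in> sets (count_space UNIV)} {V -` D \<inter> space M |D. D \<in> sets ?P}"
    using indX[of "a + 1"] unfolding indep_elements_def V_def[abs_def] by simp
  have "prob ((X a -` {p 0} \<inter> space M) \<inter> (V -` D \<inter> space M)) = prob (X a -` {p 0} \<inter> space M) * prob (V -` D \<inter> space M)"
    by (rule indep_setD[OF ind]) (use D in auto)
  moreover have "(X a -` {p 0} \<inter> space M) \<inter> (V -` D \<inter> space M) = chain_event a n p"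
    unfolding 1 2 chain_event_def by auto
  moreover have "prob (V -` D \<inter> space M) = (\<Prod>k\<in>{1..n}. pmf (Kp (p (k - 1))) (p k))"
  proof (cases "n = 0")
    case True then show ?thesis unfolding 2 by (simp add: prob_space)
  next
    case False
    have "prob {\<omega> \<in> space M. \<forall>k\<in>{1..n}. reproduction (a + int k) (p (k - 1)) \<omega> = p k}
       = (\<Prod>k\<in>{1..n}. prob {\<omega> \<in> space M. reproduction (a + int k) (p (k - 1)) \<omega> = p k})"
    proof (rule noise_groups[where K="\<lambda>k. Inl ` ({1..p (k - 1)} \<times> {a + int k}) \<union> {Inr (a + int k)}" and F=G])
      show "G k \<in> measurable (PiM (Inl ` ({1..p (k - 1)} \<times> {a + int k}) \<union> {Inr (a + int k)}) (\<lambda>_. count_space UNIV)) (count_space UNIV)" for k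
        unfolding G_def[abs_def] by (intro measurable_nat_add measurable_nat_sum measurable_component_singleton) auto
      show "reproduction (a + int k) (p (k - 1)) \<omega> = G k (\<lambda>t\<in>Inl ` ({1..p (k - 1)} \<times> {a + int k}) \<union> {Inr (a + int k)}. noise A B t \<omega>)" for k \<omega>
        unfolding reproduction_def offspring_def G_def by (intro arg_cong2[where f="(+)"] sum.cong) (auto simp: noise_def)
    qed (use False in \<open>auto simp: disjoint_family_on_def\<close>)
    also have "\<dots> = (\<Prod>k\<in>{1..n}. pmf (Kp (p (k - 1))) (p k))"
      by (simp add: pmf_law[OF reproduction_rv, symmetric] law_reproduction Kp_def)
    finally show ?thesis unfolding 2 .
  qed
  ultimately show ?thesis unfolding 1 by simp
qed

text \<open>Values after time $n$ are set to zero, so that only countably many paths occur.\<close>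

definition path_var :: "int \<Rightarrow> nat \<Rightarrow> 'a \<Rightarrow> nat \<Rightarrow> nat" where
  "path_var a n \<omega> k = (if k \<le> n then X (a + int k) \<omega> else 0)"

lemma path_var_0: "path_var a 0 = (\<lambda>\<omega>. (\<lambda>_. 0)(0 := X a \<omega>))"
  by (auto simp: path_var_def fun_eq_iff)

lemma path_var_Suc: "path_var a (Suc n) = (\<lambda>\<omega>. (\<lambda>(p, l). p(Suc n := l)) (path_var a n \<omega>, X (a + int (Suc n)) \<omega>))"
proof (intro ext)
  fix \<omega> k
  show "path_var a (Suc n) \<omega> k = (\<lambda>(p, l). p(Suc n := l)) (path_var a n \<omega>, X (a + int (Suc n)) \<omega>) k"
    by (cases "k = Suc n") (simp_all add: path_var_def le_Suc_eq)
qed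

lemma path_var_rv: "discrete_rv (path_var a n)"
proof (induction n)
  case 0 show ?case unfolding path_var_0 by (rule discrete_rv_compose[OF X_rv])
next
  case (Suc n) show ?case unfolding path_var_Suc by (rule discrete_rv_compose[OF discrete_rv_pair[OF Suc X_rv]])
qed

lemma rv_event: "discrete_rv f \<Longrightarrow> {\<omega> \<in> space M. f \<omega> = x} \<in> sets M"
  using measurable_sets[of f M "count_space UNIV" "{x}"] by (simp add: discrete_rv_def vimage_def Int_def conj_commute)

text \<open>Prescribing the whole path is, almost surely, prescribing the start and the outcome of reproduction in each generation from the prescribed parents; the random parents have disappeared.\<close>

lemma prob_path_var:
  assumes p: "\<And>k. n < k \<Longrightarrow> p k = 0"
  shows "prob {\<omega> \<in> space M. path_var a n \<omega> = p} = prob (chain_event a n p)"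
proof (rule finite_measure_eq_AE)
  have "AE \<omega> in M. \<forall>k::nat. X (a + int k) \<omega> = reproduction (a + int k) (X (a + int k - 1) \<omega>) \<omega>"
    unfolding AE_all_countable using recX by (simp add: reproduction_def offspring_def)
  then show "AE \<omega> in M. \<omega> \<in> {\<omega> \<in> space M. path_var a n \<omega> = p} \<longleftrightarrow> \<omega> \<in> chain_event a n p"
  proof eventually_elim
    case (elim \<omega>)
    have rec: "X (a + int k) \<omega> = reproduction (a + int k) (X (a + int (k - 1)) \<omega>) \<omega>" if "1 \<le> k" for k
    proof -
      have e: "a + int (k - 1) = a + int k - 1" using that by auto
      show ?thesis unfolding e by (rule elim[rule_format])
    qed
    have "path_var a n \<omega> = p \<longleftrightarrow> (\<forall>k\<le>n. X (a + int k) \<omega> = p k)"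
    proof
      assume e: "path_var a n \<omega> = p"
      show "\<forall>k\<le>n. X (a + int k) \<omega> = p k"
      proof (intro allI impI)
        fix k assume "k \<le> n" then show "X (a + int k) \<omega> = p k" using fun_cong[OF e, of k] by (simp add: path_var_def)
      qed
    next
      assume e: "\<forall>k\<le>n. X (a + int k) \<omega> = p k"
      show "path_var a n \<omega> = p"
      proof
        fix k show "path_var a n \<omega> k = p k" using e p[of k] by (cases "k \<le> n") (simp_all add: path_var_def)
      qed
    qed
    also have "\<dots> \<longleftrightarrow> X a \<omega> = p 0 \<and> (\<forall>k\<in>{1..n}. reproduction (a + int k) (p (k - 1)) \<omega> = p k)"
    proof safe
      assume *: "\<forall>k\<le>n. X (a + int k) \<omega> = p k"
      show "X a \<omega> = p 0" using *[rule_format, of 0] by simp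
      fix k assume k: "k \<in> {1..n}"
      then have "X (a + int k) \<omega> = p k" "X (a + int (k - 1)) \<omega> = p (k - 1)" using *[rule_format, of k] *[rule_format, of "k - 1"] by auto
      then show "reproduction (a + int k) (p (k - 1)) \<omega> = p k" using rec[of k] k by simp
    next
      fix k assume X0: "X a \<omega> = p 0" and *: "\<forall>k\<in>{1..n}. reproduction (a + int k) (p (k - 1)) \<omega> = p k" and "k \<le> n"
      then show "X (a + int k) \<omega> = p k"
      proof (induction k)
        case (Suc k)
        then have "X (a + int k) \<omega> = p k" by simp
        then show ?case using rec[of "Suc k"] Suc.prems(2)[rule_format, of "Suc k"] Suc.prems(3) by simp
      qed (simp add: X0)
    qed
    finally show ?case by (auto simp: chain_event_def)
  qed
  show "{\<omega> \<in> space M. path_var a n \<omega> = p} \<in> sets M" by (rule rv_event[OF path_var_rv])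
  have "chain_event a n p = {\<omega> \<in> space M. X a \<omega> = p 0} \<inter> {\<omega> \<in> space M. \<forall>k\<in>{1..n}. reproduction (a + int k) (p (k - 1)) \<omega> = p k}"
    by (auto simp: chain_event_def)
  also have "\<dots> \<in> sets M"
    by (intro sets.Int rv_event[OF X_rv] sets.sets_Collect_finite_All rv_event[OF reproduction_rv]) auto
  finally show "chain_event a n p \<in> sets M" .
qed

lemma law_path_step:
  "law (\<lambda>\<omega>. (path_var a n \<omega>, X (a + int (Suc n)) \<omega>)) = bind_pmf (law (path_var a n)) (\<lambda>p. map_pmf (Pair p) (Kp (p n)))"
proof (rule pmf_eqI, clarify)
  fix p :: "nat \<Rightarrow> nat" and l :: nat
  have rv: "discrete_rv (\<lambda>\<omega>. (path_var a n \<omega>, X (a + int (Suc n)) \<omega>))" by (rule discrete_rv_pair[OF path_var_rv X_rv])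
  show "pmf (law (\<lambda>\<omega>. (path_var a n \<omega>, X (a + int (Suc n)) \<omega>))) (p, l) =
       pmf (bind_pmf (law (path_var a n)) (\<lambda>p. map_pmf (Pair p) (Kp (p n)))) (p, l)"
  proof (cases "\<forall>k>n. p k = 0")
    case True
    let ?p = "p(Suc n := l)"
    have "{\<omega> \<in> space M. (path_var a n \<omega>, X (a + int (Suc n)) \<omega>) = (p, l)} = {\<omega> \<in> space M. path_var a (Suc n) \<omega> = ?p}"
    proof -
      have "path_var a n \<omega> = p \<and> X (a + int (Suc n)) \<omega> = l \<longleftrightarrow> path_var a (Suc n) \<omega> = ?p" for \<omega>
      proof
        assume e: "path_var a n \<omega> = p \<and> X (a + int (Suc n)) \<omega> = l"
        show "path_var a (Suc n) \<omega> = ?p"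
        proof
          fix k show "path_var a (Suc n) \<omega> k = ?p k"
            using e fun_cong[OF conjunct1[OF e], of k] by (cases "k \<le> n"; cases "k = Suc n") (auto simp: path_var_def)
        qed
      next
        assume e: "path_var a (Suc n) \<omega> = ?p"
        have "path_var a n \<omega> k = p k" for k
          using fun_cong[OF e, of k] True by (cases "k \<le> n") (auto simp: path_var_def)
        moreover have "X (a + int (Suc n)) \<omega> = l" using fun_cong[OF e, of "Suc n"] by (simp add: path_var_def)
        ultimately show "path_var a n \<omega> = p \<and> X (a + int (Suc n)) \<omega> = l" by blast
      qed
      then show ?thesis by auto
    qed
    then have "pmf (law (\<lambda>\<omega>. (path_var a n \<omega>, X (a + int (Suc n)) \<omega>))) (p, l) = prob (chain_event a (Suc n) ?p)"
      unfolding pmf_law[OF rv] using True by (subst prob_path_var[symmetric]) auto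
    also have "\<dots> = prob (chain_event a n p) * pmf (Kp (p n)) l"
    proof -
      have "(\<Prod>k\<in>{1..Suc n}. pmf (Kp (?p (k - 1))) (?p k)) = (\<Prod>k\<in>{1..n}. pmf (Kp (?p (k - 1))) (?p k)) * pmf (Kp (p n)) l"
        by (simp add: prod.nat_ivl_Suc' mult.commute)
      also have "(\<Prod>k\<in>{1..n}. pmf (Kp (?p (k - 1))) (?p k)) = (\<Prod>k\<in>{1..n}. pmf (Kp (p (k - 1))) (p k))"
        by (intro prod.cong) auto
      finally show ?thesis unfolding prob_chain_event by simp
    qed
    also have "prob (chain_event a n p) = pmf (law (path_var a n)) p"
      using True by (subst prob_path_var[symmetric]) (auto simp: pmf_law[OF path_var_rv])
    finally show ?thesis by (simp add: pmf_bind_Pair)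
  next
    case False
    then obtain k where k: "n < k" "p k \<noteq> 0" by blast
    have ne: "path_var a n \<omega> \<noteq> p" for \<omega>
    proof
      assume "path_var a n \<omega> = p"
      from fun_cong[OF this, of k] show False using k by (simp add: path_var_def)
    qed
    have "pmf (law (path_var a n)) p = 0" unfolding pmf_law[OF path_var_rv] using ne by simp
    moreover have "pmf (law (\<lambda>\<omega>. (path_var a n \<omega>, X (a + int (Suc n)) \<omega>))) (p, l) = 0" unfolding pmf_law[OF rv] using ne by simp
    ultimately show ?thesis by (simp add: pmf_bind_Pair)
  qed
qed

lemma law_X: "law (X a) = law (X 0)"
proof (rule pmf_eqI)
  fix l
  have "fdd M (count_space UNIV) (\<lambda>k. X (k + a)) {0} = fdd M (count_space UNIV) X {0}"
    using statX unfolding strongly_stationary_def by blast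
  moreover have "measure (fdd M (count_space UNIV) (\<lambda>k. X (k + c)) {0}) {x \<in> space (PiM {0} (\<lambda>_. count_space UNIV)). x 0 = l} = prob {\<omega> \<in> space M. X c \<omega> = l}" for c
  proof -
    have "{x \<in> space (PiM {0::int} (\<lambda>_. count_space (UNIV :: nat set))). x 0 = l} \<in> sets (PiM {0} (\<lambda>_. count_space UNIV))"
      using measurable_sets[OF measurable_component_singleton[of 0 "{0::int}" "\<lambda>_. count_space (UNIV :: nat set)"], of "{l}"]
      by (simp add: vimage_def Int_def conj_commute)
    then show ?thesis
      unfolding fdd_def using X_meas
      by (subst measure_distr) (auto intro!: arg_cong[where f=prob] measurable_restrict simp: space_PiM)
  qed
  from this[of a] this[of 0] calculation show "pmf (law (X a)) l = pmf (law (X 0)) l"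
    unfolding pmf_law[OF X_rv] by simp
qed

lemma law_path_var_0: "law (path_var a 0) = map_pmf (\<lambda>m. (\<lambda>_. 0)(0 := m)) (law (X 0))"
  unfolding path_var_0 law_X[of a, symmetric] by (rule law_compose[OF X_rv])

lemma law_stationary: "bind_pmf (law (X 0)) Kp = law (X 0)"
proof -
  have "law (X (0 + int (Suc 0))) = map_pmf snd (law (\<lambda>\<omega>. (path_var 0 0 \<omega>, X (0 + int (Suc 0)) \<omega>)))"
    by (subst law_compose[OF discrete_rv_pair[OF path_var_rv X_rv], symmetric]) simp
  also have "\<dots> = bind_pmf (law (X 0)) Kp"
    unfolding law_path_step law_path_var_0 by (simp add: map_bind_pmf pmf.map_comp o_def bind_map_pmf)
  finally have e: "law (X (0 + int (Suc 0))) = bind_pmf (law (X 0)) Kp" .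
  show ?thesis by (rule trans[OF e[symmetric] law_X])
qed

end

context inar begin

sublocale br: branching "\<lambda>m. law (offspring 0 m)" "law B0" "law (X 0)" \<mu>A \<sigma>A \<alpha> \<mu>B
proof
  show "integrable (law (offspring 0 m)) (\<lambda>l. (real l - \<mu>A * real m)\<^sup>2)" for m
    using offspring_moments(1)[of 0 m] by (subst integrable_law[OF offspring_rv])
  show "measure_pmf.expectation (law (offspring 0 m)) (\<lambda>l. real l) = \<mu>A * real m" for m
    using offspring_moments(3)[of 0 m] by (subst expectation_law[OF offspring_rv])
  show "measure_pmf.expectation (law (offspring 0 m)) (\<lambda>l. (real l - \<mu>A * real m)\<^sup>2) = \<sigma>A\<^sup>2 * real m" for m
    using offspring_moments(2)[of 0 m] by (subst expectation_law[OF offspring_rv])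
  show "weak_conv_m (\<lambda>m. distr (law (offspring 0 m)) borel (\<lambda>l. (real l - \<mu>A * real m) / sqrt (real m))) (normal_law \<sigma>A)"
    by (rule offspring_clt)
  have "measure_pmf.prob (law B0) {l. real l > x} = prob {\<omega> \<in> space M. real (B0 \<omega>) > x}" for x
    by (simp add: prob_law[OF discrete_rv_countable[OF B0]]) (auto intro!: arg_cong[where f=prob])
  then show "regularly_varying_rv (measure_pmf (law B0)) (\<lambda>l. real l) \<alpha>"
    using rvB unfolding regularly_varying_rv_def by simp
  show "bind_pmf (law (X 0)) (\<lambda>m. map_pmf (\<lambda>(s, b). s + b) (pair_pmf (law (offspring 0 m)) (law B0))) = law (X 0)"
    using law_stationary unfolding Kp_def[abs_def] .
qed (fact muA(2) muA(3) sigA(2) alpha)+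

lemma law_path_var: "law (path_var a n) = br.path n"
proof (induction n)
  case 0 show ?case by (simp add: law_path_var_0)
next
  case (Suc n)
  have "law (path_var a (Suc n)) = map_pmf (\<lambda>(p, l). p(Suc n := l)) (law (\<lambda>\<omega>. (path_var a n \<omega>, X (a + int (Suc n)) \<omega>)))"
    unfolding path_var_Suc by (rule law_compose[OF discrete_rv_pair[OF path_var_rv X_rv]])
  also have "\<dots> = bind_pmf (br.path n) (\<lambda>p. map_pmf (\<lambda>l. p(Suc n := l)) (br.K (p n)))"
    unfolding law_path_step Suc by (simp add: map_bind_pmf pmf.map_comp o_def Kp_def br.K_def)
  finally show ?case by (simp only: br.path_Suc)
qed

definition xi :: "int \<Rightarrow> 'a \<Rightarrow> real \<times> real" where
  "xi k \<omega> = (real (X k \<omega>) powr (3/2), real (X k \<omega>) * (real (X (k + 1) \<omega>) - \<mu>A * real (X k \<omega>) - \<mu>B))"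

lemma window_expectation:
  fixes f :: "(int \<Rightarrow> real \<times> real) \<Rightarrow> real"
  assumes f: "\<And>x y. (\<And>k. k \<in> {a..b} \<Longrightarrow> x k = y k) \<Longrightarrow> f x = f y" and ab: "a \<le> b"
  shows "expectation (\<lambda>\<omega>. f (\<lambda>k. (1 / x) *\<^sub>R xi k \<omega>))
    = measure_pmf.expectation (br.path (Suc (nat (b - a)))) (\<lambda>p. f (embed a (br.zeta x p)))"
proof -
  let ?n = "Suc (nat (b - a))"
  have "f (\<lambda>k. (1 / x) *\<^sub>R xi k \<omega>) = f (embed a (br.zeta x (path_var a ?n \<omega>)))" for \<omega>
  proof (rule f)
    fix k assume k: "k \<in> {a..b}"
    then obtain j where j: "k = a + int j" using zle_iff_zadd by auto
    then have "j \<le> nat (b - a)" using k by auto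
    then show "(1 / x) *\<^sub>R xi k \<omega> = embed a (br.zeta x (path_var a ?n \<omega>)) k"
      by (simp add: j embed_def br.zeta_def xi_def path_var_def add_ac)
  qed
  then have "expectation (\<lambda>\<omega>. f (\<lambda>k. (1 / x) *\<^sub>R xi k \<omega>)) = expectation (\<lambda>\<omega>. f (embed a (br.zeta x (path_var a ?n \<omega>))))" by (simp only:)
  also have "\<dots> = measure_pmf.expectation (law (path_var a ?n)) (\<lambda>p. f (embed a (br.zeta x p)))"
    by (subst expectation_law[OF path_var_rv]) (rule refl)
  finally show ?thesis by (simp only: law_path_var)
qed

lemma exceedance_limit:
  assumes N: "wnorm a b L N" and h: "wfun a b C N h" and ab: "a \<le> b" and u: "0 < u"
  shows "((\<lambda>x. expectation (\<lambda>\<omega>. h (\<lambda>k. (1 / x) *\<^sub>R xi k \<omega>) * indicator {u<..} (N (\<lambda>k. (1 / x) *\<^sub>R xi k \<omega>))) / tail (law (X 0)) (x powr (2/3)))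
    \<longlongrightarrow> br.Lam (\<lambda>x. h x * indicator {u<..} (N x))) at_top"
proof -
  have "((\<lambda>x. br.pathE a b (\<lambda>x. h x * indicator {u<..} (N x)) (x powr (2/3))) \<longlongrightarrow> br.Lam (\<lambda>x. h x * indicator {u<..} (N x))) at_top"
    by (rule filterlim_compose[OF br.norm_exceedance_limit[OF N h ab u] br.powr_at_top]) simp
  moreover have "\<forall>\<^sub>F x in at_top. br.pathE a b (\<lambda>x. h x * indicator {u<..} (N x)) (x powr (2/3))
     = expectation (\<lambda>\<omega>. h (\<lambda>k. (1 / x) *\<^sub>R xi k \<omega>) * indicator {u<..} (N (\<lambda>k. (1 / x) *\<^sub>R xi k \<omega>))) / tail (law (X 0)) (x powr (2/3))"
    using eventually_gt_at_top[of 0]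
  proof eventually_elim
    case (elim x)
    have "expectation (\<lambda>\<omega>. h (\<lambda>k. (1 / x) *\<^sub>R xi k \<omega>) * indicator {u<..} (N (\<lambda>k. (1 / x) *\<^sub>R xi k \<omega>)))
      = measure_pmf.expectation (br.path (Suc (nat (b - a)))) (\<lambda>p. h (embed a (br.zeta x p)) * indicator {u<..} (N (embed a (br.zeta x p))))"
    proof (rule window_expectation[OF _ ab])
      fix x y :: "int \<Rightarrow> real \<times> real" assume "\<And>k. k \<in> {a..b} \<Longrightarrow> x k = y k"
      then show "h x * indicator {u<..} (N x) = h y * indicator {u<..} (N y)"
        by (intro arg_cong2[where f="(*)"] arg_cong[where f="indicator {u<..}"] wfunD(3)[OF h] wnorm_cong[OF N])
    qed
    moreover have "(x powr (2/3)) powr (3/2) = x" using elim by (simp add: powr_powr)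
    ultimately show ?case by simp
  qed
  ultimately show ?thesis by (rule Lim_transform_eventually)
qed

end

section \<open>Ratio limits and conditional limits for the process\<close>

lemma tendsto_continuous_map:
  fixes f :: "('j \<Rightarrow> real \<times> real) \<Rightarrow> real"
  assumes f: "continuous_map (product_topology (\<lambda>_. euclidean) J) euclideanreal f"
    and y: "\<And>k. k \<in> J \<Longrightarrow> ((\<lambda>c. y c k) \<longlongrightarrow> l k) F"
  shows "((\<lambda>c. f (\<lambda>k\<in>J. y c k)) \<longlongrightarrow> f (\<lambda>k\<in>J. l k)) F"
proof -
  have "limitin (product_topology (\<lambda>_. euclidean) J) (\<lambda>c. \<lambda>k\<in>J. y c k) (\<lambda>k\<in>J. l k) F"
    using y by (simp add: limitin_componentwise cong: conj_cong)
  then have "limitin euclideanreal (f \<circ> (\<lambda>c. \<lambda>k\<in>J. y c k)) (f (\<lambda>k\<in>J. l k)) F"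
    by (rule continuous_map_limit[OF f])
  then show ?thesis by (simp add: o_def)
qed

lemma measurable_from_restrict:
  fixes f :: "('j \<Rightarrow> real \<times> real) \<Rightarrow> real"
  assumes 1: "(\<lambda>y. f (\<lambda>k\<in>J. y k)) \<in> borel_measurable (PiM UNIV (\<lambda>_. borel))"
  shows "f \<in> borel_measurable (PiM J (\<lambda>_. borel))"
proof -
  have "(\<lambda>\<theta> k. if k \<in> J then \<theta> k else 0) \<in> PiM J (\<lambda>_. borel) \<rightarrow>\<^sub>M PiM UNIV (\<lambda>_. borel :: (real \<times> real) measure)"
  proof (rule measurable_PiM_single')
    fix k :: 'j show "(\<lambda>\<theta>. if k \<in> J then \<theta> k else 0) \<in> PiM J (\<lambda>_. borel) \<rightarrow>\<^sub>M (borel :: (real \<times> real) measure)"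
      by (cases "k \<in> J") (auto intro: measurable_component_singleton)
  qed auto
  from measurable_compose[OF this 1]
  have "(\<lambda>\<theta>. f (\<lambda>k\<in>J. if k \<in> J then \<theta> k else 0)) \<in> borel_measurable (PiM J (\<lambda>_. borel))" .
  moreover have "f (\<lambda>k\<in>J. if k \<in> J then \<theta> k else 0) = f \<theta>" if "\<theta> \<in> space (PiM J (\<lambda>_. borel :: (real \<times> real) measure))" for \<theta>
  proof -
    have "(\<lambda>k\<in>J. if k \<in> J then \<theta> k else 0) = \<theta>" using that by (auto simp: space_PiM PiE_def extensional_def fun_eq_iff)
    then show ?thesis by simp
  qed
  ultimately show ?thesis by (subst (asm) measurable_cong) auto
qed

lemma continuous_map_measurable:
  fixes f :: "('j::countable \<Rightarrow> real \<times> real) \<Rightarrow> real"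
  assumes f: "continuous_map (product_topology (\<lambda>_. euclidean) J) euclideanreal f"
  shows "(\<lambda>y. f (\<lambda>k\<in>J. y k)) \<in> borel_measurable (PiM UNIV (\<lambda>_. borel))"
    and "f \<in> borel_measurable (PiM J (\<lambda>_. borel))"
proof -
  have "continuous_map (product_topology (\<lambda>_. euclidean) UNIV) (product_topology (\<lambda>_. euclidean) J) (\<lambda>y::'j \<Rightarrow> real \<times> real. \<lambda>k\<in>J. y k)"
    unfolding continuous_map_componentwise
  proof (intro conjI ballI)
    fix k assume k: "k \<in> J"
    have "continuous_on UNIV (\<lambda>y::'j \<Rightarrow> real \<times> real. y k)" by (rule continuous_on_product_coordinates)
    then show "continuous_map (product_topology (\<lambda>_. euclidean) UNIV) euclidean (\<lambda>y::'j \<Rightarrow> real \<times> real. (\<lambda>k\<in>J. y k) k)"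
      using k by (simp add: euclidean_product_topology)
  qed auto
  from continuous_map_compose[OF this f] have "continuous_on UNIV (\<lambda>y. f (\<lambda>k\<in>J. y k))"
    by (simp add: euclidean_product_topology o_def)
  then show 1: "(\<lambda>y. f (\<lambda>k\<in>J. y k)) \<in> borel_measurable (PiM UNIV (\<lambda>_. borel))"
    using borel_measurable_continuous_onI measurable_cong_sets[OF sets_PiM_equal_borel refl] by blast
  show "f \<in> borel_measurable (PiM J (\<lambda>_. borel))" by (rule measurable_from_restrict[OF 1])
qed

lemma wnhd_tendsto:
  assumes k: "k \<in> {a..b}"
  shows "((\<lambda>y. y k) \<longlongrightarrow> x k) (wnhd a b x)"
proof -
  have "wlip a b 1 (\<lambda>y. wdist a b y x)"
    unfolding wlip_def
  proof (intro conjI allI)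
    fix y z
    have "wdist a b y x \<le> wdist a b y z + wdist a b z x" "wdist a b z x \<le> wdist a b z y + wdist a b y x"
      by (rule wdist_triangle)+
    moreover have "wdist a b z y = wdist a b y z" by (rule wdist_commute)
    ultimately show "\<bar>wdist a b y x - wdist a b z x\<bar> \<le> 1 * wdist a b y z" by linarith
  qed simp
  then have lim: "((\<lambda>y. wdist a b y x) \<longlongrightarrow> 0) (wnhd a b x)"
    using wlip_wcont[of a b 1 "\<lambda>y. wdist a b y x" x] by (simp add: wcont_iff_tendsto wdist_refl)
  have "\<forall>\<^sub>F y in wnhd a b x. norm (y k - x k) \<le> wdist a b y x"
    unfolding wdist_def using k by (intro always_eventually allI member_le_sum) auto
  then have "((\<lambda>y. y k - x k) \<longlongrightarrow> 0) (wnhd a b x)" by (rule Lim_null_comparison[OF _ lim])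
  then show ?thesis by (rule LIM_zero_cancel)
qed

lemma wfun_coordinates:
  fixes f :: "('j::countable \<Rightarrow> real \<times> real) \<Rightarrow> real" and \<iota> :: "'j \<Rightarrow> int"
  assumes f: "continuous_map (product_topology (\<lambda>_. euclidean) J) euclideanreal f"
    and C: "\<And>\<theta>. \<theta> \<in> extensional J \<Longrightarrow> \<bar>f \<theta>\<bar> \<le> C" and J: "\<And>k. k \<in> J \<Longrightarrow> \<iota> k \<in> {a..b}"
  shows "wfun a b C N (\<lambda>y. f (\<lambda>k\<in>J. y (\<iota> k)))"
  unfolding wfun_def
proof (intro conjI allI impI)
  have "(\<lambda>y k. y (\<iota> k)) \<in> PiM UNIV (\<lambda>_. borel) \<rightarrow>\<^sub>M PiM UNIV (\<lambda>_. borel :: (real \<times> real) measure)"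
  proof (rule measurable_PiM_single')
    fix k :: 'j show "(\<lambda>y. y (\<iota> k)) \<in> PiM UNIV (\<lambda>_. borel) \<rightarrow>\<^sub>M (borel :: (real \<times> real) measure)"
      by (rule measurable_component_singleton) simp
  qed simp
  from measurable_compose[OF this continuous_map_measurable(1)[OF f]]
  show "(\<lambda>y. f (\<lambda>k\<in>J. y (\<iota> k))) \<in> borel_measurable (PiM UNIV (\<lambda>_. borel))" .
  show "\<bar>f (\<lambda>k\<in>J. x (\<iota> k))\<bar> \<le> C" for x by (rule C) simp
  show "f (\<lambda>k\<in>J. x (\<iota> k)) = f (\<lambda>k\<in>J. y (\<iota> k))" if "\<forall>k\<in>{a..b}. x k = y k" for x y
    using J that by (intro arg_cong[where f=f] restrict_ext) blast
  show "wcont a b x (\<lambda>y. f (\<lambda>k\<in>J. y (\<iota> k)))" for x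
    unfolding wcont_iff_tendsto by (intro tendsto_continuous_map[OF f] wnhd_tendsto J)
qed

text \<open>The direction $y / N(y)$ is continuous only where the norm does not vanish, which is all that is demanded on exceedances.\<close>

lemma wfun_direction:
  fixes f :: "(int \<Rightarrow> real \<times> real) \<Rightarrow> real"
  assumes f: "continuous_map (product_topology (\<lambda>_. euclidean) J) euclideanreal f"
    and C: "\<And>\<theta>. \<theta> \<in> extensional J \<Longrightarrow> \<bar>f \<theta>\<bar> \<le> C" and J: "J \<subseteq> {a..b}" and N: "wnorm a b L N"
  shows "wfun a b C N (\<lambda>y. f (\<lambda>k\<in>J. y k /\<^sub>R N y))"
  unfolding wfun_def
proof (intro conjI allI impI)
  have "(\<lambda>y k. y k /\<^sub>R N y) \<in> PiM UNIV (\<lambda>_. borel) \<rightarrow>\<^sub>M PiM UNIV (\<lambda>_. borel :: (real \<times> real) measure)"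
  proof (rule measurable_PiM_single')
    fix k :: int
    show "(\<lambda>y. y k /\<^sub>R N y) \<in> PiM UNIV (\<lambda>_. borel) \<rightarrow>\<^sub>M (borel :: (real \<times> real) measure)"
      by (intro borel_measurable_scaleR borel_measurable_inverse wnormD(6)[OF N] measurable_component_singleton) simp
  qed simp
  from measurable_compose[OF this continuous_map_measurable(1)[OF f]]
  show "(\<lambda>y. f (\<lambda>k\<in>J. y k /\<^sub>R N y)) \<in> borel_measurable (PiM UNIV (\<lambda>_. borel))" .
  show "\<bar>f (\<lambda>k\<in>J. x k /\<^sub>R N x)\<bar> \<le> C" for x by (rule C) simp
  show "f (\<lambda>k\<in>J. x k /\<^sub>R N x) = f (\<lambda>k\<in>J. y k /\<^sub>R N y)" if xy: "\<forall>k\<in>{a..b}. x k = y k" for x y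
  proof -
    have "N x = N y" by (rule wnorm_cong[OF N]) (use xy in blast)
    moreover have "x k = y k" if "k \<in> J" for k using J xy that by blast
    ultimately show ?thesis by (intro arg_cong[where f=f] restrict_ext) simp
  qed
  fix x assume "0 < N x"
  moreover have "(N \<longlongrightarrow> N x) (wnhd a b x)"
    using wlip_wcont[OF wnormD(1)[OF N]] by (simp add: wcont_iff_tendsto)
  ultimately show "wcont a b x (\<lambda>y. f (\<lambda>k\<in>J. y k /\<^sub>R N y))"
    unfolding wcont_iff_tendsto using J
    by (intro tendsto_continuous_map[OF f] tendsto_scaleR tendsto_inverse wnhd_tendsto) auto
qed

text \<open>All norms on a finite-dimensional space are dominated by the sum of coordinate norms; the reverse triangle inequality then gives the Lipschitz property.\<close>

lemma norm_on_wnorm: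
  fixes N :: "(int \<Rightarrow> real \<times> real) \<Rightarrow> real"
  assumes N: "norm_on J N" and J: "finite J" "J \<noteq> {}" "J \<subseteq> {a..b}"
  shows "\<exists>L. wnorm a b L (\<lambda>x. N (\<lambda>k\<in>J. x k))"
proof -
  let ?r = "\<lambda>x. \<lambda>k\<in>J. x k"
  have N0: "\<And>x. N (?r x) = 0 \<Longrightarrow> ?r x = (\<lambda>k\<in>J. 0)"
    and sc: "\<And>c x. N (\<lambda>k\<in>J. c *\<^sub>R x k) = \<bar>c\<bar> * N (?r x)"
    and tri: "\<And>x y. N (\<lambda>k\<in>J. x k + y k) \<le> N (?r x) + N (?r y)"
  proof -
    fix c :: real and x y :: "int \<Rightarrow> real \<times> real"
    have e: "?r x \<in> extensional J" "?r y \<in> extensional J" by simp_all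
    show "N (?r x) = 0 \<Longrightarrow> ?r x = (\<lambda>k\<in>J. 0)" using N e unfolding norm_on_def by blast
    have "N (\<lambda>k\<in>J. c *\<^sub>R ?r x k) = \<bar>c\<bar> * N (?r x)" "N (\<lambda>k\<in>J. ?r x k + ?r y k) \<le> N (?r x) + N (?r y)"
      using N e unfolding norm_on_def by blast+
    moreover have "(\<lambda>k\<in>J. c *\<^sub>R ?r x k) = (\<lambda>k\<in>J. c *\<^sub>R x k)" "(\<lambda>k\<in>J. ?r x k + ?r y k) = (\<lambda>k\<in>J. x k + y k)" by auto
    ultimately show "N (\<lambda>k\<in>J. c *\<^sub>R x k) = \<bar>c\<bar> * N (?r x)" "N (\<lambda>k\<in>J. x k + y k) \<le> N (?r x) + N (?r y)" by simp_all
  qed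
  have Nz: "N (\<lambda>k\<in>J. 0) = 0" using sc[of 0 "\<lambda>_. 0"] by simp
  have neg: "N (\<lambda>k\<in>J. - x k) = N (?r x)" for x using sc[of "- 1" x] by simp
  have nn: "0 \<le> N (?r x)" for x
    using tri[of x "\<lambda>k. - x k"] by (simp add: Nz neg)
  define e where "e k v = (\<lambda>j. if j = k then v else 0)" for k :: int and v :: "real \<times> real"
  define c where "c = (\<Sum>k\<in>J. N (?r (e k (1, 0))) + N (?r (e k (0, 1))))"
  have c: "0 \<le> c" unfolding c_def by (intro sum_nonneg add_nonneg_nonneg nn)
  have one: "N (?r (e k v)) \<le> c * norm v" if k: "k \<in> J" for k v
  proof -
    have "?r (e k v) = (\<lambda>j\<in>J. fst v *\<^sub>R e k (1, 0) j + snd v *\<^sub>R e k (0, 1) j)" by (auto simp: e_def)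
    then have "N (?r (e k v)) \<le> N (\<lambda>j\<in>J. fst v *\<^sub>R e k (1, 0) j) + N (\<lambda>j\<in>J. snd v *\<^sub>R e k (0, 1) j)" by (simp only: tri)
    also have "\<dots> = \<bar>fst v\<bar> * N (?r (e k (1, 0))) + \<bar>snd v\<bar> * N (?r (e k (0, 1)))" by (simp only: sc)
    also have "\<dots> \<le> norm v * N (?r (e k (1, 0))) + norm v * N (?r (e k (0, 1)))"
      using norm_fst_le[of "fst v" "snd v"] norm_snd_le[of "snd v" "fst v"] by (intro add_mono mult_right_mono nn) simp_all
    also have "\<dots> = norm v * (N (?r (e k (1, 0))) + N (?r (e k (0, 1))))" by (simp add: distrib_left)
    also have "\<dots> \<le> norm v * c"
      unfolding c_def using k J(1) by (intro mult_left_mono member_le_sum add_nonneg_nonneg nn) auto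
    finally show ?thesis by (simp add: mult.commute)
  qed
  have upper: "N (?r (\<lambda>j. if j \<in> I then x j else 0)) \<le> (\<Sum>k\<in>I. c * norm (x k))" if "finite I" "I \<subseteq> J" for I x
    using that
  proof (induction I rule: finite_induct)
    case empty
    have e: "?r (\<lambda>j. if j \<in> {} then x j else 0) = (\<lambda>k\<in>J. 0)" by (rule restrict_ext) simp
    show ?case unfolding e Nz by simp
  next
    case (insert k I)
    have "?r (\<lambda>j. if j \<in> insert k I then x j else 0) = (\<lambda>j\<in>J. e k (x k) j + (if j \<in> I then x j else 0))"
      using insert.hyps by (auto simp: e_def)
    then have "N (?r (\<lambda>j. if j \<in> insert k I then x j else 0)) \<le> N (?r (e k (x k))) + N (?r (\<lambda>j. if j \<in> I then x j else 0))"
      by (simp only: tri)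
    also have "\<dots> \<le> c * norm (x k) + (\<Sum>k\<in>I. c * norm (x k))"
    proof (intro add_mono one)
      show "k \<in> J" using insert.prems by simp
      show "N (?r (\<lambda>j. if j \<in> I then x j else 0)) \<le> (\<Sum>k\<in>I. c * norm (x k))"
        by (rule insert.IH) (use insert.prems in simp)
    qed
    also have "\<dots> = (\<Sum>k\<in>insert k I. c * norm (x k))" using insert.hyps by simp
    finally show ?case .
  qed
  have up: "N (?r x) \<le> c * wdist a b x (\<lambda>_. 0)" for x
  proof -
    have "?r x = ?r (\<lambda>j. if j \<in> J then x j else 0)" by auto
    then have "N (?r x) \<le> (\<Sum>k\<in>J. c * norm (x k))" using upper[OF J(1) order_refl, of x] by simp
    also have "\<dots> \<le> (\<Sum>k\<in>{a..b}. c * norm (x k))" using J c by (intro sum_mono2) auto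
    finally show ?thesis by (simp add: wdist_def sum_distrib_left)
  qed
  have half: "N (?r x) - N (?r y) \<le> c * wdist a b x y" for x y
  proof -
    have "N (?r x) \<le> N (?r (\<lambda>k. x k - y k)) + N (?r y)" using tri[of "\<lambda>k. x k - y k" y] by simp
    also have "N (?r (\<lambda>k. x k - y k)) \<le> c * wdist a b (\<lambda>k. x k - y k) (\<lambda>_. 0)" by (rule up)
    also have "wdist a b (\<lambda>k. x k - y k) (\<lambda>_. 0) = wdist a b x y" by (simp add: wdist_def)
    finally show ?thesis by linarith
  qed
  have "wnorm a b c (\<lambda>x. N (?r x))"
    unfolding wnorm_def
  proof (intro conjI allI impI)
    show "wlip a b c (\<lambda>x. N (?r x))"
      unfolding wlip_def
    proof (intro conjI allI c)
      fix x y show "\<bar>N (?r x) - N (?r y)\<bar> \<le> c * wdist a b x y"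
        using half[of x y] half[of y x] wdist_commute[of a b y x] by (simp add: abs_le_iff)
    qed
    show "N (?r x) \<ge> 0" for x by (rule nn)
    show "N (\<lambda>k\<in>J. d *\<^sub>R x k) = d * N (?r x)" if "0 \<le> d" for d x using sc[of d x] that by simp
    fix x :: "int \<Rightarrow> real \<times> real" assume x: "\<forall>k\<in>{a..b}. x k \<noteq> 0"
    obtain j where j: "j \<in> J" using J(2) by blast
    have "N (?r x) \<noteq> 0"
    proof
      assume "N (?r x) = 0"
      from fun_cong[OF N0[OF this], of j] show False using j J(3) x by auto
    qed
    then show "0 < N (?r x)" using nn[of x] by simp
  qed
  then show ?thesis ..
qed

lemma infnorm_wnorm: "c \<in> {a..b} \<Longrightarrow> wnorm a b 1 (\<lambda>x. infnorm (x c))"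
  unfolding wnorm_def wlip_def
proof (intro conjI allI impI)
  fix x y :: "int \<Rightarrow> real \<times> real" assume c: "c \<in> {a..b}"
  have "\<bar>infnorm (x c) - infnorm (y c)\<bar> \<le> norm (x c - y c)"
    by (rule order_trans[OF absdiff_infnorm infnorm_le_norm])
  also have "\<dots> \<le> wdist a b x y" unfolding wdist_def using c by (intro member_le_sum) auto
  finally show "\<bar>infnorm (x c) - infnorm (y c)\<bar> \<le> 1 * wdist a b x y" by simp
qed (auto simp: infnorm_pos_le infnorm_mul infnorm_pos_lt)

context branching begin

definition Cond :: "((int \<Rightarrow> real \<times> real) \<Rightarrow> real) \<Rightarrow> (int \<times> real \<times> (nat \<Rightarrow> real)) measure" where
  "Cond N = uniform_measure Xi {\<omega> \<in> space Xi. 1 < N (U \<omega>)}"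

lemma exceedance_window:
  assumes N: "wnorm a b L N" and h: "wfun a b C N h" and ab: "a \<le> b" and v: "0 < v"
  shows "window_test a b C (v / ((L + 1) * wsize a b)) (\<lambda>x. h x * indicator {v<..} (N x))"
  by (rule window_test_cut[OF N h ab v]) (auto simp: indicator_def)

lemma exceedance_set:
  assumes N: "wnorm a b L N" and ab: "a \<le> b"
  shows "{\<omega> \<in> space Xi. 1 < N (U \<omega>)} \<in> sets Xi"
    "emeasure Xi {\<omega> \<in> space Xi. 1 < N (U \<omega>)} \<noteq> 0" "emeasure Xi {\<omega> \<in> space Xi. 1 < N (U \<omega>)} \<noteq> \<infinity>"
    "Lam (\<lambda>x. indicator {1<..} (N x)) = (1 - \<mu> powr \<alpha>) * measure Xi {\<omega> \<in> space Xi. 1 < N (U \<omega>)}"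
proof -
  note [measurable] = wnormD(6)[OF N]
  let ?A = "{\<omega> \<in> space Xi. 1 < N (U \<omega>)}"
  show A: "?A \<in> sets Xi" by measurable
  have h1: "wfun a b 1 N (\<lambda>_. 1)" using wfun_const[of a b 1 N] by simp
  have ind: "indicator {1<..} (N (U \<omega>)) = (indicator ?A \<omega> :: real)" if "\<omega> \<in> space Xi" for \<omega> using that by (simp add: indicator_def)
  have "integrable Xi (\<lambda>\<omega>. indicator {1<..} (N (U \<omega>)) :: real)"
    using integrable_Xi[OF exceedance_window[OF N h1 ab, of 1]] by simp
  moreover have "integrable Xi (\<lambda>\<omega>. indicator {1<..} (N (U \<omega>)) :: real) = integrable Xi (\<lambda>\<omega>. indicator ?A \<omega> :: real)"
    by (rule Bochner_Integration.integrable_cong[OF refl]) (rule ind)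
  ultimately have "integrable Xi (\<lambda>\<omega>. indicator ?A \<omega> :: real)" by blast
  then show fin: "emeasure Xi ?A \<noteq> \<infinity>" using A by (simp add: integrable_indicator_iff)
  have "(\<integral>\<omega>. indicator {1<..} (N (U \<omega>)) \<partial>Xi) = (\<integral>\<omega>. indicator ?A \<omega> \<partial>Xi :: real)"
    by (intro Bochner_Integration.integral_cong refl ind)
  also have "\<dots> = measure Xi ?A" using A fin by simp
  finally show L: "Lam (\<lambda>x. indicator {1<..} (N x)) = (1 - \<mu> powr \<alpha>) * measure Xi ?A" by (simp add: Lam_def)
  then have "measure Xi ?A \<noteq> 0" using Lam_exceedance_pos[OF N ab, of 1] by auto
  then show "emeasure Xi ?A \<noteq> 0" by (auto simp: measure_def)
qed

lemma prob_space_Cond: "wnorm a b L N \<Longrightarrow> a \<le> b \<Longrightarrow> prob_space (Cond N)"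
  unfolding Cond_def by (rule prob_space_uniform_measure) (auto dest: exceedance_set)

lemma sets_Cond[simp, measurable_cong]: "sets (Cond N) = sets Xi"
  by (simp add: Cond_def)

text \<open>Conditioning \<open>Xi\<close> on an exceedance normalises the limit functional; the factor $1-\mu^\alpha$ cancels.\<close>

lemma integral_Cond:
  assumes N: "wnorm a b L N" and h: "wfun a b C N h" and ab: "a \<le> b"
  shows "(\<integral>\<omega>. h (U \<omega>) \<partial>Cond N) = Lam (\<lambda>x. h x * indicator {1<..} (N x)) / Lam (\<lambda>x. indicator {1<..} (N x))"
proof -
  note [measurable] = wfunD(1)[OF h]
  let ?A = "{\<omega> \<in> space Xi. 1 < N (U \<omega>)}"
  have "(\<integral>\<omega>. h (U \<omega>) \<partial>Cond N) = (\<integral>\<omega>. h (U \<omega>) * indicator ?A \<omega> \<partial>Xi) / measure Xi ?A"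
    unfolding Cond_def by (rule integral_uniform_measure_eq[OF exceedance_set(1-3)[OF N ab]]) measurable
  also have "(\<integral>\<omega>. h (U \<omega>) * indicator ?A \<omega> \<partial>Xi) = (\<integral>\<omega>. h (U \<omega>) * indicator {1<..} (N (U \<omega>)) \<partial>Xi)"
    by (intro Bochner_Integration.integral_cong refl) (simp add: indicator_def)
  finally show ?thesis
    unfolding exceedance_set(4)[OF N ab] Lam_def using mu_powr_less_1 by simp
qed

end

context inar begin

abbreviation exceeds :: "((int \<Rightarrow> real \<times> real) \<Rightarrow> real) \<Rightarrow> real \<Rightarrow> 'a set" where
  "exceeds N x \<equiv> {\<omega> \<in> space M. 1 < N (\<lambda>k. (1 / x) *\<^sub>R xi k \<omega>)}"

lemma xi_measurable: "xi k \<in> borel_measurable M"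
  unfolding xi_def[abs_def] using X_meas[of k] X_meas[of "k + 1"] by measurable

lemma scaled_xi_measurable: "(\<lambda>\<omega> k. (1 / x) *\<^sub>R xi k \<omega>) \<in> M \<rightarrow>\<^sub>M PiM UNIV (\<lambda>_. borel)"
proof (rule measurable_PiM_single')
  fix k show "(\<lambda>\<omega>. (1 / x) *\<^sub>R xi k \<omega>) \<in> borel_measurable M"
    by (intro borel_measurable_scaleR borel_measurable_const xi_measurable)
qed simp

lemma exceeds_sets: assumes N: "wnorm a b L N" shows "exceeds N x \<in> sets M"
  using measurable_compose[OF scaled_xi_measurable wnormD(6)[OF N], of x] by measurable

text \<open>Both numerator and denominator are normalised by the same tail $H(x^{2/3})$, which cancels.\<close>

lemma ratio_limit:
  assumes N: "wnorm a b L N" and h: "wfun a b C N h" and ab: "a \<le> b" and u: "0 < u"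
  shows "((\<lambda>x. expectation (\<lambda>\<omega>. h (\<lambda>k. (1 / x) *\<^sub>R xi k \<omega>) * indicator {u<..} (N (\<lambda>k. (1 / x) *\<^sub>R xi k \<omega>))) / prob (exceeds N x))
    \<longlongrightarrow> br.Lam (\<lambda>x. h x * indicator {u<..} (N x)) / br.Lam (\<lambda>x. indicator {1<..} (N x))) at_top"
    "\<forall>\<^sub>F x in at_top. 0 < prob (exceeds N x)"
proof -
  let ?H = "\<lambda>x. tail (law (X 0)) (x powr (2/3))"
  have h1: "wfun a b 1 N (\<lambda>_. 1)" using wfun_const[of a b 1 N] by simp
  have e1: "expectation (\<lambda>\<omega>. indicator {1<..} (N (\<lambda>k. (1 / x) *\<^sub>R xi k \<omega>))) = prob (exceeds N x)" for x
  proof -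
    have "expectation (\<lambda>\<omega>. indicator {1<..} (N (\<lambda>k. (1 / x) *\<^sub>R xi k \<omega>)) :: real) = expectation (indicator (exceeds N x))"
      by (intro Bochner_Integration.integral_cong refl) (simp add: indicator_def)
    then show ?thesis using exceeds_sets[OF N, of x] by simp
  qed
  have l1: "((\<lambda>x. prob (exceeds N x) / ?H x) \<longlongrightarrow> br.Lam (\<lambda>x. indicator {1<..} (N x))) at_top"
    using exceedance_limit[OF N h1 ab, of 1] by (simp add: e1)
  have pos: "0 < br.Lam (\<lambda>x. indicator {1<..} (N x))" by (rule br.Lam_exceedance_pos[OF N ab]) simp
  have "\<forall>\<^sub>F x in at_top. 0 < prob (exceeds N x) / ?H x" using l1 pos by (rule order_tendstoD)
  then show ev: "\<forall>\<^sub>F x in at_top. 0 < prob (exceeds N x)"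
  proof eventually_elim
    case (elim x)
    then show ?case using br.H_pos[of "x powr (2/3)"] by (simp add: zero_less_divide_iff)
  qed
  have e2: "A / ?H x / (B / ?H x) = A / B" for A B x
    using br.H_pos[of "x powr (2/3)"] by simp
  have "((\<lambda>x. (expectation (\<lambda>\<omega>. h (\<lambda>k. (1 / x) *\<^sub>R xi k \<omega>) * indicator {u<..} (N (\<lambda>k. (1 / x) *\<^sub>R xi k \<omega>))) / ?H x) / (prob (exceeds N x) / ?H x))
    \<longlongrightarrow> br.Lam (\<lambda>x. h x * indicator {u<..} (N x)) / br.Lam (\<lambda>x. indicator {1<..} (N x))) at_top"
    by (intro tendsto_divide exceedance_limit[OF N h ab u] l1) (use pos in simp)
  then show "((\<lambda>x. expectation (\<lambda>\<omega>. h (\<lambda>k. (1 / x) *\<^sub>R xi k \<omega>) * indicator {u<..} (N (\<lambda>k. (1 / x) *\<^sub>R xi k \<omega>))) / prob (exceeds N x))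
    \<longlongrightarrow> br.Lam (\<lambda>x. h x * indicator {u<..} (N x)) / br.Lam (\<lambda>x. indicator {1<..} (N x))) at_top" unfolding e2 .
qed

lemma conditional_limit:
  assumes N: "wnorm a b L N" and h: "wfun a b C N h" and ab: "a \<le> b"
  shows "((\<lambda>x. \<integral>\<omega>. h (\<lambda>k. (1 / x) *\<^sub>R xi k \<omega>) \<partial>uniform_measure M (exceeds N x)) \<longlongrightarrow> (\<integral>\<omega>. h (br.U \<omega>) \<partial>br.Cond N)) at_top"
proof -
  have "\<forall>\<^sub>F x in at_top. expectation (\<lambda>\<omega>. h (\<lambda>k. (1 / x) *\<^sub>R xi k \<omega>) * indicator {1<..} (N (\<lambda>k. (1 / x) *\<^sub>R xi k \<omega>))) / prob (exceeds N x)
      = (\<integral>\<omega>. h (\<lambda>k. (1 / x) *\<^sub>R xi k \<omega>) \<partial>uniform_measure M (exceeds N x))"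
    using ratio_limit(2)[OF N h ab zero_less_one]
  proof eventually_elim
    case (elim x)
    have "(\<integral>\<omega>. h (\<lambda>k. (1 / x) *\<^sub>R xi k \<omega>) \<partial>uniform_measure M (exceeds N x))
       = (\<integral>\<omega>. h (\<lambda>k. (1 / x) *\<^sub>R xi k \<omega>) * indicator (exceeds N x) \<omega> \<partial>M) / prob (exceeds N x)"
      using elim measurable_compose[OF scaled_xi_measurable wfunD(1)[OF h], of x]
      by (intro integral_uniform_measure_eq exceeds_sets[OF N]) (auto simp: emeasure_eq_measure)
    also have "(\<integral>\<omega>. h (\<lambda>k. (1 / x) *\<^sub>R xi k \<omega>) * indicator (exceeds N x) \<omega> \<partial>M)
        = expectation (\<lambda>\<omega>. h (\<lambda>k. (1 / x) *\<^sub>R xi k \<omega>) * indicator {1<..} (N (\<lambda>k. (1 / x) *\<^sub>R xi k \<omega>)))"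
      by (intro Bochner_Integration.integral_cong refl) (simp add: indicator_def)
    finally show ?case ..
  qed
  then show ?thesis
    unfolding br.integral_Cond[OF N h ab]
    by (rule Lim_transform_eventually[OF ratio_limit(1)[OF N h ab zero_less_one]])
qed

end

section \<open>Stationarity, regular variation and the two-sided tail process\<close>

lemma integral_scale_measure:
  fixes f :: "'b \<Rightarrow> real"
  assumes f: "f \<in> borel_measurable M" and r: "0 \<le> r"
  shows "(\<integral>x. f x \<partial>scale_measure (ennreal r) M) = r * (\<integral>x. f x \<partial>M)"
proof -
  have "scale_measure (ennreal r) M = density M (\<lambda>_. ennreal r)"
    by (rule measure_eqI) (simp_all add: emeasure_density nn_integral_cmult_indicator)
  then have "(\<integral>x. f x \<partial>scale_measure (ennreal r) M) = (\<integral>x. r *\<^sub>R f x \<partial>M)"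
    using f r by (simp add: integral_density)
  then show ?thesis by simp
qed

lemma topspace_extensional: "topspace (product_topology (\<lambda>_. euclidean) J) = extensional J"
  by (auto simp: PiE_def)

context inar begin

text \<open>The coordinates of a finite window are a function of a path, whose law does not depend on its starting time.\<close>

lemma strongly_stationary_xi: "strongly_stationary M borel xi"
  unfolding strongly_stationary_def
proof (intro conjI allI impI)
  show "xi k \<in> borel_measurable M" for k by (rule xi_measurable)
  fix J :: "int set" and h assume J: "finite J"
  define a where "a = Min (insert 0 J)"
  define n where "n = Suc (nat (Max (insert 0 J) - a))"
  define \<phi> where "\<phi> p = (\<lambda>k\<in>J. (real (p (nat (k - a))) powr (3/2),
     real (p (nat (k - a))) * (real (p (Suc (nat (k - a)))) - \<mu>A * real (p (nat (k - a))) - \<mu>B)))" for p :: "nat \<Rightarrow> nat"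
  have \<phi>m: "\<phi> \<in> count_space UNIV \<rightarrow>\<^sub>M PiM J (\<lambda>_. borel)" by (simp add: \<phi>_def space_PiM)
  have "fdd M borel (\<lambda>k. xi (k + d)) J = distr (measure_pmf (br.path n)) (PiM J (\<lambda>_. borel)) \<phi>" for d
  proof -
    have "(\<lambda>k\<in>J. xi (k + d) \<omega>) = \<phi> (path_var (a + d) n \<omega>)" for \<omega>
      unfolding \<phi>_def
    proof (rule restrict_ext)
      fix k assume k: "k \<in> J"
      then have "a \<le> k" "k \<le> Max (insert 0 J)" using J by (auto simp: a_def)
      then obtain j where j: "k = a + int j" using zle_iff_zadd by auto
      then have "Suc j \<le> n" using \<open>k \<le> Max (insert 0 J)\<close> by (simp add: n_def)
      then show "xi (k + d) \<omega> = (real (path_var (a + d) n \<omega> (nat (k - a))) powr (3/2),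
          real (path_var (a + d) n \<omega> (nat (k - a))) * (real (path_var (a + d) n \<omega> (Suc (nat (k - a)))) - \<mu>A * real (path_var (a + d) n \<omega> (nat (k - a))) - \<mu>B))"
        by (simp add: j xi_def path_var_def add_ac)
    qed
    then have "fdd M borel (\<lambda>k. xi (k + d)) J = distr M (PiM J (\<lambda>_. borel)) (\<phi> \<circ> path_var (a + d) n)"
      by (simp add: fdd_def o_def)
    also have "\<dots> = distr (distr M (count_space UNIV) (path_var (a + d) n)) (PiM J (\<lambda>_. borel)) \<phi>"
      by (rule distr_distr[symmetric, OF \<phi>m]) (use path_var_rv in \<open>simp add: discrete_rv_def\<close>)
    also have "distr M (count_space UNIV) (path_var (a + d) n) = measure_pmf (br.path n)"
      by (simp only: measure_pmf_law[OF path_var_rv, symmetric] law_path_var)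
    finally show ?thesis .
  qed
  from this[of h] this[of 0] show "fdd M borel (\<lambda>k. xi (k + h)) J = fdd M borel xi J" by simp
qed

text \<open>The spectral law is the direction of a random trail conditioned on an exceedance. The factor $u^{-2\alpha/3}$ comes from homogeneity of the limit functional, the direction being invariant under scaling.\<close>

lemma xi_regularly_varying_wrt:
  assumes J: "finite J" "J \<noteq> {}" and N: "norm_on J N"
  shows "regularly_varying_wrt M J N (\<lambda>\<omega>. \<lambda>k\<in>J. xi k \<omega>) (2 * \<alpha> / 3)"
proof -
  define a where "a = Min J"
  define b where "b = Max J"
  have ab: "a \<le> b" unfolding a_def b_def using J by simp
  have Jab: "J \<subseteq> {a..b}" unfolding a_def b_def using J(1) by auto
  define n where "n x = N (\<lambda>k\<in>J. x k)" for x
  obtain L where wn: "wnorm a b L n" using norm_on_wnorm[OF N J Jab] unfolding n_def[abs_def] by blast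
  note [measurable] = wnormD(6)[OF wn]
  interpret C: prob_space "br.Cond n" by (rule br.prob_space_Cond[OF wn ab])
  define D where "D x = (\<lambda>k\<in>J. x k /\<^sub>R n x)" for x
  have Dm: "D \<in> PiM UNIV (\<lambda>_. borel) \<rightarrow>\<^sub>M PiM J (\<lambda>_. borel)"
    unfolding D_def[abs_def]
    by (intro measurable_restrict borel_measurable_scaleR borel_measurable_inverse wnormD(6)[OF wn] measurable_component_singleton) simp
  have DU: "(\<lambda>\<omega>. D (br.U \<omega>)) \<in> br.Cond n \<rightarrow>\<^sub>M PiM J (\<lambda>_. borel)"
    using measurable_compose[OF br.U_measurable Dm] by (simp cong: measurable_cong_sets)
  have Nm: "N \<in> borel_measurable (PiM J (\<lambda>_. borel))"
    by (rule measurable_from_restrict) (use wnormD(6)[OF wn] in \<open>simp add: n_def[abs_def]\<close>)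
  define S where "S = distr (br.Cond n) (PiM J (\<lambda>_. borel)) (\<lambda>\<omega>. D (br.U \<omega>))"
  have nsc: "n (\<lambda>k. c *\<^sub>R x k) = c * n x" if "0 \<le> c" for c x by (rule wnormD(3)[OF wn that])
  have ND: "N (D x) = 1" if "0 < n x" for x
  proof -
    have "N (D x) = n (\<lambda>k. inverse (n x) *\<^sub>R x k)" by (simp add: D_def n_def)
    also have "\<dots> = 1" using that by (subst nsc) auto
    finally show ?thesis .
  qed
  have Dsc: "D (\<lambda>k. c *\<^sub>R x k) = D x" if "0 < c" for c x
    unfolding D_def using that by (intro restrict_ext) (simp add: nsc)
  have "AE \<omega> in br.Cond n. N (D (br.U \<omega>)) = 1"
    unfolding br.Cond_def by (rule AE_uniform_measureI) (use br.exceedance_set(1)[OF wn ab] ND in auto)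
  then have AE: "AE \<theta> in S. N \<theta> = 1"
    unfolding S_def by (subst AE_distr_iff[OF DU]) (use Nm in measurable)
  show ?thesis
    unfolding regularly_varying_wrt_def
  proof (intro exI[of _ S] conjI AE allI impI)
    show "prob_space S" unfolding S_def by (rule C.prob_space_distr[OF DU])
    show "sets S = sets (PiM J (\<lambda>_. borel))" by (simp add: S_def)
    fix u :: real assume u: "0 < u"
    show "weak_conv_in (product_topology (\<lambda>_. euclidean) J)
       (\<lambda>x. scale_measure (ennreal (1 / measure M {\<omega> \<in> space M. N (\<lambda>k\<in>J. xi k \<omega>) > x}))
              (distr (restrict_space M {\<omega> \<in> space M. N (\<lambda>k\<in>J. xi k \<omega>) > u * x}) (PiM J (\<lambda>_. borel))
                 (\<lambda>\<omega>. \<lambda>k\<in>J. (\<lambda>k\<in>J. xi k \<omega>) k /\<^sub>R N (\<lambda>k\<in>J. xi k \<omega>))))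
       (scale_measure (ennreal (u powr (- (2 * \<alpha> / 3)))) S)"
      unfolding weak_conv_in_def topspace_extensional
    proof (intro allI impI, elim conjE)
      fix f :: "(int \<Rightarrow> real \<times> real) \<Rightarrow> real"
      assume f: "continuous_map (product_topology (\<lambda>_. euclidean) J) euclideanreal f" and bd: "bounded (f ` extensional J)"
      obtain C where C: "\<And>\<theta>. \<theta> \<in> extensional J \<Longrightarrow> \<bar>f \<theta>\<bar> \<le> C" using bd unfolding bounded_iff by auto
      have fm: "f \<in> borel_measurable (PiM J (\<lambda>_. borel))" by (rule continuous_map_measurable(2)[OF f])
      define h where "h x = f (D x)" for x
      have h: "wfun a b C n h" unfolding h_def[abs_def] D_def by (rule wfun_direction[OF f C Jab wn])
      let ?L = "\<lambda>u. br.Lam (\<lambda>x. h x * indicator {u<..} (n x))"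
      have scale: "?L u = u powr (- (2 * \<alpha> / 3)) * ?L 1"
      proof -
        let ?c = "u powr (- (2/3))"
        have "?c powr (3/2) = u powr (- 1)" unfolding powr_powr by simp
        then have c: "0 < ?c" "?c powr (3/2) = 1 / u" using u by (simp_all add: powr_minus_divide)
        have "h (\<lambda>k. ?c powr (3/2) *\<^sub>R x k) * indicator {1<..} (n (\<lambda>k. ?c powr (3/2) *\<^sub>R x k)) = h x * indicator {u<..} (n x)" for x
        proof -
          have "n (\<lambda>k. (1 / u) *\<^sub>R x k) = n x / u" using u nsc[of "1 / u" x] by simp
          moreover have "h (\<lambda>k. (1 / u) *\<^sub>R x k) = h x" unfolding h_def using u by (subst Dsc) auto
          moreover have "1 < n x / u \<longleftrightarrow> u < n x" using u by (simp add: field_simps)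
          ultimately show ?thesis unfolding c(2) by (simp add: indicator_def)
        qed
        then have "?L u = ?c powr \<alpha> * ?L 1"
          using br.Lam_scale[OF br.exceedance_window[OF wn h ab zero_less_one] c(1)] by (simp only:)
        also have "?c powr \<alpha> = u powr (- (2 * \<alpha> / 3))" unfolding powr_powr by simp
        finally show ?thesis .
      qed
      have "(\<integral>z. f z \<partial>scale_measure (ennreal (u powr (- (2 * \<alpha> / 3)))) S) = u powr (- (2 * \<alpha> / 3)) * (\<integral>z. f z \<partial>S)"
        using fm by (intro integral_scale_measure) (auto simp: S_def)
      also have "(\<integral>z. f z \<partial>S) = (\<integral>\<omega>. h (br.U \<omega>) \<partial>br.Cond n)"
        unfolding S_def h_def by (rule integral_distr[OF DU fm])
      also have "u powr (- (2 * \<alpha> / 3)) * \<dots> = ?L u / br.Lam (\<lambda>x. indicator {1<..} (n x))"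
        unfolding br.integral_Cond[OF wn h ab] scale by simp
      finally have rhs: "(\<integral>z. f z \<partial>scale_measure (ennreal (u powr (- (2 * \<alpha> / 3)))) S) = ?L u / br.Lam (\<lambda>x. indicator {1<..} (n x))" .
      have "\<forall>\<^sub>F x in at_top. expectation (\<lambda>\<omega>. h (\<lambda>k. (1 / x) *\<^sub>R xi k \<omega>) * indicator {u<..} (n (\<lambda>k. (1 / x) *\<^sub>R xi k \<omega>))) / prob (exceeds n x)
        = (\<integral>z. f z \<partial>scale_measure (ennreal (1 / measure M {\<omega> \<in> space M. N (\<lambda>k\<in>J. xi k \<omega>) > x}))
              (distr (restrict_space M {\<omega> \<in> space M. N (\<lambda>k\<in>J. xi k \<omega>) > u * x}) (PiM J (\<lambda>_. borel))
                 (\<lambda>\<omega>. \<lambda>k\<in>J. (\<lambda>k\<in>J. xi k \<omega>) k /\<^sub>R N (\<lambda>k\<in>J. xi k \<omega>))))"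
        using eventually_gt_at_top[of 0]
      proof eventually_elim
        case (elim x)
        let ?E = "{\<omega> \<in> space M. N (\<lambda>k\<in>J. xi k \<omega>) > u * x}"
        have nx: "n (\<lambda>k. (1 / x) *\<^sub>R xi k \<omega>) = N (\<lambda>k\<in>J. xi k \<omega>) / x" for \<omega>
          using elim nsc[of "1 / x" "\<lambda>k. xi k \<omega>"] by (simp add: n_def)
        have ev: "exceeds n x = {\<omega> \<in> space M. N (\<lambda>k\<in>J. xi k \<omega>) > x}"
          unfolding nx using elim by (simp add: field_simps)
        have xm: "(\<lambda>\<omega> k. xi k \<omega>) \<in> M \<rightarrow>\<^sub>M PiM UNIV (\<lambda>_. borel)"
          by (rule measurable_PiM_single') (rule xi_measurable, simp)
        have nm: "(\<lambda>\<omega>. N (\<lambda>k\<in>J. xi k \<omega>)) \<in> borel_measurable M"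
          using measurable_compose[OF xm wnormD(6)[OF wn]] by (simp add: n_def)
        then have E: "?E \<in> sets M" by measurable
        have DE: "(\<lambda>\<omega>. \<lambda>k\<in>J. (\<lambda>k\<in>J. xi k \<omega>) k /\<^sub>R N (\<lambda>k\<in>J. xi k \<omega>)) = (\<lambda>\<omega>. D (\<lambda>k. xi k \<omega>))"
          by (auto simp: D_def n_def fun_eq_iff)
        have Dm': "(\<lambda>\<omega>. D (\<lambda>k. xi k \<omega>)) \<in> M \<rightarrow>\<^sub>M PiM J (\<lambda>_. borel)" by (rule measurable_compose[OF xm Dm])
        let ?S = "distr (restrict_space M ?E) (PiM J (\<lambda>_. borel)) (\<lambda>\<omega>. D (\<lambda>k. xi k \<omega>))"
        have "(\<integral>z. f z \<partial>scale_measure (ennreal (1 / prob (exceeds n x))) ?S) = 1 / prob (exceeds n x) * (\<integral>z. f z \<partial>?S)"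
          using fm by (intro integral_scale_measure) auto
        also have "(\<integral>z. f z \<partial>?S) = (\<integral>\<omega>. h (\<lambda>k. xi k \<omega>) \<partial>restrict_space M ?E)"
          unfolding h_def by (rule integral_distr[OF measurable_restrict_space1[OF Dm'] fm])
        also have "\<dots> = (\<integral>\<omega>. indicator ?E \<omega> *\<^sub>R h (\<lambda>k. xi k \<omega>) \<partial>M)"
          by (rule integral_restrict_space) (use E in auto)
        also have "\<dots> = expectation (\<lambda>\<omega>. h (\<lambda>k. (1 / x) *\<^sub>R xi k \<omega>) * indicator {u<..} (n (\<lambda>k. (1 / x) *\<^sub>R xi k \<omega>)))"
        proof (intro Bochner_Integration.integral_cong refl)
          fix \<omega> assume \<omega>: "\<omega> \<in> space M"
          have "h (\<lambda>k. (1 / x) *\<^sub>R xi k \<omega>) = h (\<lambda>k. xi k \<omega>)" unfolding h_def using elim by (subst Dsc) auto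
          moreover have "u < N (\<lambda>k\<in>J. xi k \<omega>) / x \<longleftrightarrow> u * x < N (\<lambda>k\<in>J. xi k \<omega>)" using elim by (simp add: field_simps)
          ultimately show "indicator ?E \<omega> *\<^sub>R h (\<lambda>k. xi k \<omega>) = h (\<lambda>k. (1 / x) *\<^sub>R xi k \<omega>) * indicator {u<..} (n (\<lambda>k. (1 / x) *\<^sub>R xi k \<omega>))"
            unfolding nx using \<omega> by (simp add: indicator_def)
        qed
        finally have fin: "(\<integral>z. f z \<partial>scale_measure (ennreal (1 / prob (exceeds n x))) ?S)
          = 1 / prob (exceeds n x) * expectation (\<lambda>\<omega>. h (\<lambda>k. (1 / x) *\<^sub>R xi k \<omega>) * indicator {u<..} (n (\<lambda>k. (1 / x) *\<^sub>R xi k \<omega>)))" .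
        show ?case unfolding DE ev[symmetric] fin by (simp only: times_divide_eq_left mult_1_left)
      qed
      from Lim_transform_eventually[OF ratio_limit(1)[OF wn h ab u] this]
      show "((\<lambda>x. \<integral>z. f z \<partial>scale_measure (ennreal (1 / measure M {\<omega> \<in> space M. N (\<lambda>k\<in>J. xi k \<omega>) > x}))
              (distr (restrict_space M {\<omega> \<in> space M. N (\<lambda>k\<in>J. xi k \<omega>) > u * x}) (PiM J (\<lambda>_. borel))
                 (\<lambda>\<omega>. \<lambda>k\<in>J. (\<lambda>k\<in>J. xi k \<omega>) k /\<^sub>R N (\<lambda>k\<in>J. xi k \<omega>))))
         \<longlongrightarrow> (\<integral>z. f z \<partial>scale_measure (ennreal (u powr (- (2 * \<alpha> / 3)))) S)) at_top" unfolding rhs .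
    qed
  qed
qed

lemma jointly_regularly_varying_xi: "jointly_regularly_varying M xi (2 * \<alpha> / 3)"
  unfolding jointly_regularly_varying_def regularly_varying_def
proof (intro allI impI conjI, elim conjE)
  fix J :: "int set"
  show "0 < 2 * \<alpha> / 3" using alpha by simp
  show "(\<lambda>\<omega>. \<lambda>k\<in>J. xi k \<omega>) \<in> M \<rightarrow>\<^sub>M PiM J (\<lambda>_. borel)" by (intro measurable_restrict xi_measurable)
  fix N :: "(int \<Rightarrow> real \<times> real) \<Rightarrow> real" assume "norm_on J N" and "finite J \<and> J \<noteq> {}"
  then show "regularly_varying_wrt M J N (\<lambda>\<omega>. \<lambda>k\<in>J. xi k \<omega>) (2 * \<alpha> / 3)"
    by (intro xi_regularly_varying_wrt) auto
qed

abbreviation "tail_law \<equiv> br.Cond (\<lambda>x. infnorm (x 0))"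

lemma fdd_tendsto:
  fixes f :: "('j::countable \<Rightarrow> real \<times> real) \<Rightarrow> real" and \<iota> :: "'j \<Rightarrow> int"
  assumes J: "finite J" and f: "continuous_map (product_topology (\<lambda>_. euclidean) J) euclideanreal f"
    and bd: "bounded (f ` extensional J)"
  shows "((\<lambda>x. \<integral>z. f z \<partial>fdd (uniform_measure M {\<omega> \<in> space M. infnorm (xi 0 \<omega>) > x}) borel (\<lambda>k \<omega>. xi (\<iota> k) \<omega> /\<^sub>R x) J)
    \<longlongrightarrow> (\<integral>\<omega>. f (\<lambda>k\<in>J. br.U \<omega> (\<iota> k)) \<partial>tail_law)) at_top"
proof -
  define a where "a = Min (insert 0 (\<iota> ` J))"
  define b where "b = Max (insert 0 (\<iota> ` J))"
  have fin: "finite (insert 0 (\<iota> ` J))" using J by simp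
  have 0: "0 \<in> {a..b}" and Jab: "\<And>k. k \<in> J \<Longrightarrow> \<iota> k \<in> {a..b}" unfolding a_def b_def using fin by auto
  then have ab: "a \<le> b" by simp
  have wn: "wnorm a b 1 (\<lambda>x. infnorm (x 0))" by (rule infnorm_wnorm[OF 0])
  obtain C where C: "\<And>\<theta>. \<theta> \<in> extensional J \<Longrightarrow> \<bar>f \<theta>\<bar> \<le> C" using bd unfolding bounded_iff by auto
  have fm: "f \<in> borel_measurable (PiM J (\<lambda>_. borel))" by (rule continuous_map_measurable(2)[OF f])
  have "\<forall>\<^sub>F x in at_top. (\<integral>\<omega>. f (\<lambda>k\<in>J. (1 / x) *\<^sub>R xi (\<iota> k) \<omega>) \<partial>uniform_measure M (exceeds (\<lambda>x. infnorm (x 0)) x))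
     = (\<integral>z. f z \<partial>fdd (uniform_measure M {\<omega> \<in> space M. infnorm (xi 0 \<omega>) > x}) borel (\<lambda>k \<omega>. xi (\<iota> k) \<omega> /\<^sub>R x) J)"
    using eventually_gt_at_top[of 0]
  proof eventually_elim
    case (elim x)
    have nx: "infnorm ((1 / x) *\<^sub>R xi 0 \<omega>) = infnorm (xi 0 \<omega>) / x" for \<omega> using elim by (simp add: infnorm_mul)
    then have ev: "exceeds (\<lambda>x. infnorm (x 0)) x = {\<omega> \<in> space M. infnorm (xi 0 \<omega>) > x}"
      unfolding nx using elim by (simp add: field_simps)
    have "(\<lambda>\<omega>. \<lambda>k\<in>J. xi (\<iota> k) \<omega> /\<^sub>R x) \<in> uniform_measure M {\<omega> \<in> space M. infnorm (xi 0 \<omega>) > x} \<rightarrow>\<^sub>M PiM J (\<lambda>_. borel)"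
      unfolding measurable_cong_sets[OF sets_uniform_measure refl]
      by (intro measurable_restrict borel_measurable_scaleR borel_measurable_const xi_measurable)
    then show ?case unfolding fdd_def ev by (subst integral_distr[OF _ fm]) (simp_all add: inverse_eq_divide)
  qed
  from Lim_transform_eventually[OF conditional_limit[OF wn wfun_coordinates[OF f C Jab] ab] this]
  show ?thesis .
qed

text \<open>The tail process is a random trail, started at a random time, conditioned to exceed in norm at time $0$.\<close>

lemma tail_process_xi: "tail_process M xi (distr tail_law (PiM UNIV (\<lambda>_. borel)) br.U) (\<lambda>k x. x k)"
proof -
  have wn: "wnorm 0 0 1 (\<lambda>x. infnorm (x 0))" by (rule infnorm_wnorm) simp
  interpret C: prob_space tail_law by (rule br.prob_space_Cond[OF wn]) simp
  have Um: "br.U \<in> tail_law \<rightarrow>\<^sub>M PiM UNIV (\<lambda>_. borel)" using br.U_measurable by (simp cong: measurable_cong_sets)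
  show ?thesis
    unfolding tail_process_def fdd_conv_def weak_conv_in_def topspace_extensional
  proof (intro conjI allI impI, goal_cases)
    case 1 show ?case by (rule C.prob_space_distr[OF Um])
  next
    case (2 k) show ?case by (simp add: measurable_component_singleton cong: measurable_cong_sets)
  next
    case (3 J f)
    then have f: "continuous_map (product_topology (\<lambda>_. euclidean) J) euclideanreal f" and bd: "bounded (f ` extensional J)" by auto
    have fm: "f \<in> borel_measurable (PiM J (\<lambda>_. borel))" by (rule continuous_map_measurable(2)[OF f])
    have r: "(\<lambda>x. \<lambda>k\<in>J. x k) \<in> PiM UNIV (\<lambda>_. borel) \<rightarrow>\<^sub>M PiM J (\<lambda>_. borel :: (real \<times> real) measure)"
      by (intro measurable_restrict measurable_component_singleton) simp
    have "fdd (distr tail_law (PiM UNIV (\<lambda>_. borel)) br.U) borel (\<lambda>k x. x k) J = distr tail_law (PiM J (\<lambda>_. borel)) (\<lambda>\<omega>. \<lambda>k\<in>J. br.U \<omega> k)"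
      unfolding fdd_def using distr_distr[OF r Um] by (simp add: o_def)
    moreover have "(\<integral>z. f z \<partial>distr tail_law (PiM J (\<lambda>_. borel)) (\<lambda>\<omega>. \<lambda>k\<in>J. br.U \<omega> k)) = (\<integral>\<omega>. f (\<lambda>k\<in>J. br.U \<omega> k) \<partial>tail_law)"
      by (rule integral_distr[OF measurable_compose[OF Um r] fm])
    ultimately show ?case using fdd_tendsto[OF 3(1) f bd, of "\<lambda>k. k"] by simp
  qed
qed

end

section \<open>The law of the forward tail\<close>

lemma infnorm_pair: "infnorm (x :: real \<times> real) = max \<bar>fst x\<bar> \<bar>snd x\<bar>"
  by (simp add: infnorm_Max Basis_prod_def inner_prod_def image_Un image_image max.commute)

lemma powr_three_halves_less_iff: assumes "0 < q" "0 < (c::real)" shows "c < q powr (3/2) \<longleftrightarrow> c powr (2/3) < q"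
proof -
  have "q = (q powr (3/2)) powr (2/3)" using assms by (simp add: powr_powr)
  then show ?thesis using powr_less_mono2[of "2/3" c "q powr (3/2)"] powr_mono2[of "2/3" "q powr (3/2)" c] assms
    by (auto simp: not_less[symmetric])
qed

lemma sets_borel_pair_greaterThan:
  "sets (borel :: (real \<times> real) measure) = sigma_sets UNIV (range (\<lambda>(y, v). {y<..} \<times> {v<..}))"
proof -
  have "{x. eucl_less a x} = (\<lambda>(y, v). {y<..} \<times> {v<..}) a" for a :: "real \<times> real"
    by (cases a) (auto simp: eucl_less_def Basis_prod_def)
  then show ?thesis unfolding borel_eq_greaterThan by simp
qed

context branching begin

text \<open>In the telescoped form of the limit functional all terms but the first vanish.\<close>

lemma Lam_anchored:
  assumes f: "window_test a b C \<epsilon> f" and ab: "a \<le> b" and 0: "\<And>x. x a = 0 \<Longrightarrow> f x = 0"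
  shows "Lam f = Q f a"
proof -
  have z: "Q f i = 0" if "a < i" for i
  proof -
    have "f (embed i y) = 0" for y by (rule 0) (use that in \<open>simp add: embed_def\<close>)
    then show ?thesis by (simp add: Q_def)
  qed
  have "Lam f = (\<Sum>i=a..b. Q f i - \<mu> powr \<alpha> * Q f (i + 1))" unfolding Lam_def by (rule Xi_integral[OF f])
  also have "\<dots> = (\<Sum>i=a..b. if i = a then Q f a else 0)" by (intro sum.cong) (auto simp: z)
  finally show ?thesis using ab by simp
qed

text \<open>The pairs of initial size and first noise coordinate for which the trail exceeds level one at time $0$.\<close>

definition hit :: "(real \<times> real) set" where
  "hit = {p. 1 < infnorm (fst p powr (3/2), fst p powr (3/2) * snd p)}"

lemma hit_sets: "hit \<in> sets (nu \<Otimes>\<^sub>M NL)"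
proof -
  have "{p \<in> space (borel \<Otimes>\<^sub>M borel). 1 < infnorm (fst p powr (3/2), fst p powr (3/2) * snd p)} \<in> sets (borel \<Otimes>\<^sub>M (borel :: real measure))"
    unfolding infnorm_pair by measurable
  then show ?thesis by (simp add: hit_def space_pair_measure cong: sets_pair_measure_cong)
qed

lemma pair_sf_NL: "pair_sigma_finite nu NL"
  using sigma_finite_nu prob_space_NL by (simp add: pair_sigma_finite_def prob_space_imp_sigma_finite)

text \<open>Integrate out $q$ first: for given $w$ the conditions on $q^{3/2}$ amount to one lower bound, and the Pareto measure of a half-line is a power.\<close>

lemma emeasure_quadrant:
  assumes C: "C = {p \<in> hit. y < fst p powr (3/2) \<and> v < snd p}"
  shows "C \<in> sets (nu \<Otimes>\<^sub>M NL)"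
    "emeasure (nu \<Otimes>\<^sub>M NL) C = (\<integral>\<^sup>+w. ennreal (max y (1 / max 1 \<bar>w\<bar>) powr (- (2 * \<alpha> / 3)) * indicator {v<..} w) \<partial>NL)"
proof -
  interpret pair_sigma_finite nu NL by (rule pair_sf_NL)
  have "C = hit \<inter> {p \<in> space (nu \<Otimes>\<^sub>M NL). y < fst p powr (3/2) \<and> v < snd p}"
    by (auto simp: C space_pair_measure)
  moreover have "{p \<in> space (nu \<Otimes>\<^sub>M NL). y < fst p powr (3/2) \<and> v < snd p} \<in> sets (nu \<Otimes>\<^sub>M NL)" by measurable
  ultimately show Cs: "C \<in> sets (nu \<Otimes>\<^sub>M NL)" using hit_sets by auto
  have "emeasure nu ((\<lambda>q. (q, w)) -` C) = ennreal (max y (1 / max 1 \<bar>w\<bar>) powr (- (2 * \<alpha> / 3)) * indicator {v<..} w)" for w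
  proof (cases "v < w")
    case True
    define m where "m = max 1 \<bar>w\<bar>"
    define c where "c = max y (1 / m)"
    have m: "1 \<le> m" by (simp add: m_def)
    then have c: "0 < c" by (simp add: c_def less_max_iff_disj)
    have "emeasure nu ((\<lambda>q. (q, w)) -` C) = emeasure nu {c powr (2/3)<..}"
    proof (rule emeasure_eq_AE)
      show "AE q in nu. q \<in> (\<lambda>q. (q, w)) -` C \<longleftrightarrow> q \<in> {c powr (2/3)<..}"
        using AE_nu_pos
      proof eventually_elim
        case (elim q)
        have "infnorm (q powr (3/2), q powr (3/2) * w) = q powr (3/2) * m"
          unfolding infnorm_pair m_def by (simp add: abs_mult max_mult_distrib_left)
        then have "q \<in> (\<lambda>q. (q, w)) -` C \<longleftrightarrow> 1 < q powr (3/2) * m \<and> y < q powr (3/2)"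
          using True by (auto simp: C hit_def)
        also have "\<dots> \<longleftrightarrow> c < q powr (3/2)" using m by (auto simp: c_def field_simps)
        also have "\<dots> \<longleftrightarrow> q \<in> {c powr (2/3)<..}" using powr_three_halves_less_iff[OF elim c] by simp
        finally show ?case .
      qed
      show "(\<lambda>q. (q, w)) -` C \<in> sets nu" using measurable_sets[OF measurable_Pair2'[of w NL nu] Cs] by simp
    qed simp
    also have "\<dots> = ennreal (c powr (- (2 * \<alpha> / 3)))" using c by (simp add: emeasure_nu powr_powr)
    finally show ?thesis using True by (simp add: c_def m_def)
  next
    case False
    then have "(\<lambda>q. (q, w)) -` C = {}" by (auto simp: C)
    then show ?thesis using False by simp
  qed
  then show "emeasure (nu \<Otimes>\<^sub>M NL) C = (\<integral>\<^sup>+w. ennreal (max y (1 / max 1 \<bar>w\<bar>) powr (- (2 * \<alpha> / 3)) * indicator {v<..} w) \<partial>NL)"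
    using emeasure_pair_measure_alt2[OF Cs] by simp
qed

lemma emeasure_hit: "emeasure (nu \<Otimes>\<^sub>M NL) hit = (\<integral>\<^sup>+w. ennreal (max 1 \<bar>w\<bar> powr (2 * \<alpha> / 3)) \<partial>NL)"
proof -
  interpret pair_sigma_finite nu NL by (rule pair_sf_NL)
  have "emeasure nu ((\<lambda>q. (q, w)) -` hit) = ennreal (max 1 \<bar>w\<bar> powr (2 * \<alpha> / 3))" for w
  proof -
    define m where "m = max 1 \<bar>w\<bar>"
    have m: "1 \<le> m" by (simp add: m_def)
    have "emeasure nu ((\<lambda>q. (q, w)) -` hit) = emeasure nu {(1 / m) powr (2/3)<..}"
    proof (rule emeasure_eq_AE)
      show "AE q in nu. q \<in> (\<lambda>q. (q, w)) -` hit \<longleftrightarrow> q \<in> {(1 / m) powr (2/3)<..}"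
        using AE_nu_pos
      proof eventually_elim
        case (elim q)
        have "infnorm (q powr (3/2), q powr (3/2) * w) = q powr (3/2) * m"
          unfolding infnorm_pair m_def by (simp add: abs_mult max_mult_distrib_left)
        then have "q \<in> (\<lambda>q. (q, w)) -` hit \<longleftrightarrow> 1 / m < q powr (3/2)" using m by (simp add: hit_def field_simps)
        also have "\<dots> \<longleftrightarrow> q \<in> {(1 / m) powr (2/3)<..}" using powr_three_halves_less_iff[OF elim, of "1 / m"] m by simp
        finally show ?case .
      qed
      show "(\<lambda>q. (q, w)) -` hit \<in> sets nu" using measurable_sets[OF measurable_Pair2'[of w NL nu] hit_sets] by simp
    qed simp
    also have "\<dots> = ennreal ((1 / m) powr (- (2 * \<alpha> / 3)))" using m by (simp add: emeasure_nu powr_powr)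
    also have "(1 / m) powr (- (2 * \<alpha> / 3)) = m powr (2 * \<alpha> / 3)" using m by (simp add: powr_divide powr_minus_divide)
    finally show ?thesis unfolding m_def .
  qed
  then show ?thesis using emeasure_pair_measure_alt2[OF hit_sets] by simp
qed

lemma nn_integral_NN: 
  assumes F: "F \<in> borel_measurable (PiM UNIV (\<lambda>_. borel))"
  shows "(\<integral>\<^sup>+z. F z \<partial>NN) = (\<integral>\<^sup>+w. \<integral>\<^sup>+z. F (case_nat w z) \<partial>NN \<partial>NL)"
proof -
  interpret product_prob_space "\<lambda>_. NL" "UNIV :: nat set" by (rule product_prob_spaceI[OF prob_space_NL])
  interpret N: prob_space NL by (rule prob_space_NL)
  interpret I: prob_space NN by (rule prob_space_NN)
  interpret S: sequence_space NL ..
  have m: "(\<lambda>(w, z). case_nat w z) \<in> NL \<Otimes>\<^sub>M NN \<rightarrow>\<^sub>M NN" by measurable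
  have F': "F \<in> borel_measurable NN" using F by (simp cong: measurable_cong_sets[OF sets_NN])
  have "(\<integral>\<^sup>+z. F z \<partial>NN) = (\<integral>\<^sup>+z. F z \<partial>distr (NL \<Otimes>\<^sub>M NN) NN (\<lambda>(w, z). case_nat w z))" unfolding S.PiM_iter ..
  also have "\<dots> = (\<integral>\<^sup>+p. F (case p of (w, z) \<Rightarrow> case_nat w z) \<partial>(NL \<Otimes>\<^sub>M NN))" by (subst nn_integral_distr[OF m]) (use F' in simp_all)
  also have "\<dots> = (\<integral>\<^sup>+w. \<integral>\<^sup>+z. F (case_nat w z) \<partial>NN \<partial>NL)"
    using sigma_finite_measure.nn_integral_fst[OF prob_space_imp_sigma_finite[OF prob_space_NN] measurable_compose[OF m F']] by simp
  finally show ?thesis .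
qed

definition first_law :: "(real \<times> real) measure" where
  "first_law = distr (uniform_measure (nu \<Otimes>\<^sub>M NL) hit) borel (\<lambda>p. (fst p powr (3/2), snd p))"

definition exceeding :: "(real \<times> (nat \<Rightarrow> real)) set" where
  "exceeding = {\<omega>. 1 < infnorm (trail (fst \<omega>) (snd \<omega>) 0)}"

lemma exceeding_iff: "\<omega> \<in> exceeding \<longleftrightarrow> (fst \<omega>, snd \<omega> 0) \<in> hit"
  by (simp add: exceeding_def hit_def trail_def)

lemma measurable_head: "(\<lambda>\<omega>. (fst \<omega>, snd \<omega> 0)) \<in> QN \<rightarrow>\<^sub>M nu \<Otimes>\<^sub>M NL"
proof -
  have "(\<lambda>\<omega>. (fst \<omega>, snd \<omega> 0)) \<in> borel \<Otimes>\<^sub>M PiM UNIV (\<lambda>_. borel :: real measure) \<rightarrow>\<^sub>M borel \<Otimes>\<^sub>M borel"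
    by measurable
  then show ?thesis
    by (simp add: measurable_cong_sets[OF sets_QN sets_pair_measure_cong[of nu borel NL borel]] del: borel_prod)
qed

lemma exceeding_sets: "exceeding \<in> sets QN"
proof -
  have "exceeding = (\<lambda>\<omega>. (fst \<omega>, snd \<omega> 0)) -` hit \<inter> space QN" by (auto simp: exceeding_iff)
  then show ?thesis using measurable_sets[OF measurable_head hit_sets] by simp
qed

text \<open>Reads off the limit variables from a trail: first coordinate and noise at time $0$, then the later noise.\<close>

definition unfold_trail :: "real \<times> (nat \<Rightarrow> real) \<Rightarrow> (real \<times> real) \<times> (nat \<Rightarrow> real)" where
  "unfold_trail \<omega> = ((fst \<omega> powr (3/2), snd \<omega> 0), \<lambda>k. snd \<omega> (Suc k))"

lemma unfold_trail_measurable: "unfold_trail \<in> QN \<rightarrow>\<^sub>M borel \<Otimes>\<^sub>M NN"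
proof -
  have "(\<lambda>\<omega>. \<lambda>k. snd \<omega> (Suc k)) \<in> borel \<Otimes>\<^sub>M PiM UNIV (\<lambda>_. borel) \<rightarrow>\<^sub>M PiM (UNIV :: nat set) (\<lambda>_. borel :: real measure)"
    by (rule measurable_PiM_single') (auto intro!: measurable_compose[OF measurable_snd] measurable_component_singleton)
  moreover have "(\<lambda>\<omega>. (fst \<omega> powr (3/2), snd \<omega> 0)) \<in> borel \<Otimes>\<^sub>M PiM UNIV (\<lambda>_. borel :: real measure) \<rightarrow>\<^sub>M (borel :: (real \<times> real) measure)"
    by measurable
  ultimately have "unfold_trail \<in> borel \<Otimes>\<^sub>M PiM UNIV (\<lambda>_. borel) \<rightarrow>\<^sub>M borel \<Otimes>\<^sub>M PiM UNIV (\<lambda>_. borel)"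
    unfolding unfold_trail_def[abs_def] by (rule measurable_Pair[rotated])
  then show ?thesis
    by (simp add: measurable_cong_sets[OF sets_QN sets_pair_measure_cong[OF refl sets_NN]])
qed

text \<open>Whether a trail exceeds at time $0$ depends only on $q$ and the first noise coordinate, so the later noise stays independent under conditioning.\<close>

lemma nn_integral_exceeding:
  assumes G: "G \<in> borel_measurable (borel \<Otimes>\<^sub>M NN)"
  shows "(\<integral>\<^sup>+\<omega>. G (unfold_trail \<omega>) * indicator exceeding \<omega> \<partial>QN)
    = (\<integral>\<^sup>+p. (\<integral>\<^sup>+z. G ((fst p powr (3/2), snd p), z) \<partial>NN) * indicator hit p \<partial>(nu \<Otimes>\<^sub>M NL))"
proof -
  interpret I: prob_space NN by (rule prob_space_NN)
  interpret N: prob_space NL by (rule prob_space_NL)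
  have m: "(\<lambda>\<omega>. G (unfold_trail \<omega>) * indicator exceeding \<omega>) \<in> borel_measurable QN"
    using measurable_compose[OF unfold_trail_measurable G] exceeding_sets by measurable
  have m1: "(\<lambda>z. G (unfold_trail (q, z)) * indicator exceeding (q, z)) \<in> borel_measurable (PiM UNIV (\<lambda>_. borel))" for q
    using measurable_compose[OF measurable_Pair1'[of q nu NN] m] by (simp cong: measurable_cong_sets[OF sets_NN])
  have Gm: "(\<lambda>p. \<integral>\<^sup>+z. G ((fst p powr (3/2), snd p), z) \<partial>NN) \<in> borel_measurable (nu \<Otimes>\<^sub>M NL)"
  proof (rule I.borel_measurable_nn_integral)
    have "(\<lambda>p. (fst p powr (3/2), snd p)) \<in> nu \<Otimes>\<^sub>M NL \<rightarrow>\<^sub>M (borel :: (real \<times> real) measure)" by measurable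
    then have "(\<lambda>x. ((fst (fst x) powr (3/2), snd (fst x)), snd x)) \<in> (nu \<Otimes>\<^sub>M NL) \<Otimes>\<^sub>M NN \<rightarrow>\<^sub>M (borel :: (real \<times> real) measure) \<Otimes>\<^sub>M NN"
      by (intro measurable_Pair measurable_compose[OF measurable_fst] measurable_snd)
    from measurable_compose[OF this G]
    show "(\<lambda>(p, z). G ((fst p powr (3/2), snd p), z)) \<in> borel_measurable ((nu \<Otimes>\<^sub>M NL) \<Otimes>\<^sub>M NN)" by (simp add: case_prod_beta)
  qed
  have "(\<integral>\<^sup>+\<omega>. G (unfold_trail \<omega>) * indicator exceeding \<omega> \<partial>QN) = (\<integral>\<^sup>+q. \<integral>\<^sup>+z. G (unfold_trail (q, z)) * indicator exceeding (q, z) \<partial>NN \<partial>nu)"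
    by (rule I.nn_integral_fst[OF m, symmetric])
  also have "\<dots> = (\<integral>\<^sup>+q. \<integral>\<^sup>+w. \<integral>\<^sup>+z. G (unfold_trail (q, case_nat w z)) * indicator exceeding (q, case_nat w z) \<partial>NN \<partial>NL \<partial>nu)"
    by (intro nn_integral_cong nn_integral_NN m1)
  also have "\<dots> = (\<integral>\<^sup>+q. \<integral>\<^sup>+w. (\<integral>\<^sup>+z. G ((q powr (3/2), w), z) \<partial>NN) * indicator hit (q, w) \<partial>NL \<partial>nu)"
  proof (intro nn_integral_cong)
    fix q w
    show "(\<integral>\<^sup>+z. G (unfold_trail (q, case_nat w z)) * indicator exceeding (q, case_nat w z) \<partial>NN) = (\<integral>\<^sup>+z. G ((q powr (3/2), w), z) \<partial>NN) * indicator hit (q, w)"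
      by (cases "(q, w) \<in> hit") (simp_all add: unfold_trail_def exceeding_iff)
  qed
  also have "\<dots> = (\<integral>\<^sup>+p. (\<integral>\<^sup>+z. G ((fst p powr (3/2), snd p), z) \<partial>NN) * indicator hit p \<partial>(nu \<Otimes>\<^sub>M NL))"
    using N.nn_integral_fst[of "\<lambda>p. (\<integral>\<^sup>+z. G ((fst p powr (3/2), snd p), z) \<partial>NN) * indicator hit p" nu] Gm hit_sets
    by (simp add: borel_measurable_times_ennreal)
  finally show ?thesis .
qed

lemma emeasure_exceeding: "emeasure QN exceeding = emeasure (nu \<Otimes>\<^sub>M NL) hit"
proof -
  interpret I: prob_space NN by (rule prob_space_NN)
  have "(\<integral>\<^sup>+\<omega>. indicator exceeding \<omega> \<partial>QN) = (\<integral>\<^sup>+p. indicator hit p \<partial>(nu \<Otimes>\<^sub>M NL))"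
    using nn_integral_exceeding[of "\<lambda>_. 1"] I.emeasure_space_1 by simp
  then show ?thesis using exceeding_sets hit_sets by simp
qed

text \<open>Exceedances have finite and positive mass since they define a window functional vanishing near the origin.\<close>

lemma exceeding_finite: "emeasure QN exceeding \<noteq> \<infinity>" "emeasure QN exceeding \<noteq> 0"
proof -
  have wn: "wnorm 0 0 1 (\<lambda>x. infnorm (x 0))" by (rule infnorm_wnorm) simp
  have h1: "wfun 0 0 1 (\<lambda>x. infnorm (x 0)) (\<lambda>_. 1)" using wfun_const[of 0 0 1] by simp
  note w = exceedance_window[OF wn h1 order_refl zero_less_one]
  let ?f = "\<lambda>x :: int \<Rightarrow> real \<times> real. 1 * indicator {1<..} (infnorm (x 0)) :: real"
  have ind: "?f (embed 0 (trail (fst \<omega>) (snd \<omega>))) = indicator exceeding \<omega>" for \<omega>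
    by (simp add: embed_def exceeding_def indicator_def)
  have "integrable QN (indicator exceeding :: _ \<Rightarrow> real)" using integrable_window[OF w, of 0] unfolding ind .
  then show fin: "emeasure QN exceeding \<noteq> \<infinity>" by (auto simp: integrable_indicator_iff)
  have "0 < Lam ?f" using Lam_exceedance_pos[OF wn order_refl, of 1] by simp
  also have "Lam ?f = Q ?f 0" by (rule Lam_anchored[OF w]) (simp_all add: infnorm_0)
  also have "\<dots> = measure QN exceeding" unfolding Q_def ind using exceeding_sets fin by simp
  finally show "emeasure QN exceeding \<noteq> 0" by (auto simp: measure_def)
qed

lemma prob_space_first_law: "prob_space first_law"
proof -
  interpret U: prob_space "uniform_measure (nu \<Otimes>\<^sub>M NL) hit"
    by (rule prob_space_uniform_measure) (use exceeding_finite in \<open>simp_all add: emeasure_exceeding\<close>)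
  show ?thesis unfolding first_law_def by (rule U.prob_space_distr) measurable
qed

lemma sets_first_law[simp, measurable_cong]: "sets first_law = sets borel"
  by (simp add: first_law_def)

lemma law_unfold_trail:
  "distr (uniform_measure QN exceeding) (borel \<Otimes>\<^sub>M NN) unfold_trail = first_law \<Otimes>\<^sub>M NN"
proof (rule measure_eqI)
  interpret I: prob_space NN by (rule prob_space_NN)
  show "sets (distr (uniform_measure QN exceeding) (borel \<Otimes>\<^sub>M NN) unfold_trail) = sets (first_law \<Otimes>\<^sub>M NN)"
    by (simp cong: sets_pair_measure_cong)
  fix B assume "B \<in> sets (distr (uniform_measure QN exceeding) (borel \<Otimes>\<^sub>M NN) unfold_trail)"
  then have B: "B \<in> sets (borel \<Otimes>\<^sub>M NN)" by simp
  let ?\<tau> = "\<lambda>p. (fst p powr (3/2), snd p) :: real \<times> real"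
  have um: "unfold_trail \<in> uniform_measure QN exceeding \<rightarrow>\<^sub>M borel \<Otimes>\<^sub>M NN"
    using unfold_trail_measurable by (simp cong: measurable_cong_sets)
  have tm: "?\<tau> \<in> uniform_measure (nu \<Otimes>\<^sub>M NL) hit \<rightarrow>\<^sub>M borel" by measurable
  have Bm: "(\<lambda>y. emeasure NN (Pair y -` B)) \<in> borel_measurable borel" by (rule I.measurable_emeasure_Pair[OF B])
  have "emeasure (distr (uniform_measure QN exceeding) (borel \<Otimes>\<^sub>M NN) unfold_trail) B
    = (\<integral>\<^sup>+x. indicator B x \<partial>distr (uniform_measure QN exceeding) (borel \<Otimes>\<^sub>M NN) unfold_trail)" using B by simp
  also have "\<dots> = (\<integral>\<^sup>+\<omega>. indicator B (unfold_trail \<omega>) \<partial>uniform_measure QN exceeding)"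
    by (subst nn_integral_distr[OF um]) (use B in simp_all)
  also have "\<dots> = (\<integral>\<^sup>+\<omega>. indicator B (unfold_trail \<omega>) * indicator exceeding \<omega> \<partial>QN) / emeasure QN exceeding"
    using B by (intro nn_integral_uniform_measure exceeding_sets measurable_compose[OF unfold_trail_measurable]) auto
  also have "(\<integral>\<^sup>+\<omega>. indicator B (unfold_trail \<omega>) * indicator exceeding \<omega> \<partial>QN)
      = (\<integral>\<^sup>+p. (\<integral>\<^sup>+z. indicator B (?\<tau> p, z) \<partial>NN) * indicator hit p \<partial>(nu \<Otimes>\<^sub>M NL))"
    by (rule nn_integral_exceeding) (use B in auto)
  also have "(\<lambda>p. \<integral>\<^sup>+z. indicator B (?\<tau> p, z) \<partial>NN) = (\<lambda>p. emeasure NN (Pair (?\<tau> p) -` B))"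
  proof
    fix p
    have "(\<integral>\<^sup>+z. indicator B (?\<tau> p, z) \<partial>NN) = (\<integral>\<^sup>+z. indicator (Pair (?\<tau> p) -` B) z \<partial>NN)"
      by (intro nn_integral_cong) (simp add: indicator_def)
    then show "(\<integral>\<^sup>+z. indicator B (?\<tau> p, z) \<partial>NN) = emeasure NN (Pair (?\<tau> p) -` B)" using sets_Pair1[OF B, of "?\<tau> p"] by simp
  qed
  also have "(\<integral>\<^sup>+p. emeasure NN (Pair (?\<tau> p) -` B) * indicator hit p \<partial>(nu \<Otimes>\<^sub>M NL)) / emeasure QN exceeding
      = (\<integral>\<^sup>+p. emeasure NN (Pair (?\<tau> p) -` B) \<partial>uniform_measure (nu \<Otimes>\<^sub>M NL) hit)"
    unfolding emeasure_exceeding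
  proof (rule nn_integral_uniform_measure[symmetric, OF _ hit_sets])
    have "?\<tau> \<in> nu \<Otimes>\<^sub>M NL \<rightarrow>\<^sub>M borel" by measurable
    from measurable_compose[OF this Bm] show "(\<lambda>p. emeasure NN (Pair (?\<tau> p) -` B)) \<in> borel_measurable (nu \<Otimes>\<^sub>M NL)" .
  qed
  also have "\<dots> = (\<integral>\<^sup>+y. emeasure NN (Pair y -` B) \<partial>first_law)"
    unfolding first_law_def by (subst nn_integral_distr[OF tm]) (use Bm in simp_all)
  also have "\<dots> = emeasure (first_law \<Otimes>\<^sub>M NN) B"
    by (rule I.emeasure_pair_measure_alt[symmetric]) (use B in \<open>simp cong: sets_pair_measure_cong\<close>)
  finally show "emeasure (distr (uniform_measure QN exceeding) (borel \<Otimes>\<^sub>M NN) unfold_trail) B = emeasure (first_law \<Otimes>\<^sub>M NN) B" .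
qed

lemma measure_first_law:
  "measure first_law ({y<..} \<times> {v<..}) =
     (\<integral>w. max y (1 / max 1 \<bar>w\<bar>) powr (- (2 * \<alpha> / 3)) * indicator {v<..} w \<partial>NL) / (\<integral>w. max 1 \<bar>w\<bar> powr (2 * \<alpha> / 3) \<partial>NL)"
proof -
  define C where "C = {p \<in> hit. y < fst p powr (3/2) \<and> v < snd p}"
  have "measure first_law ({y<..} \<times> {v<..}) = measure (uniform_measure (nu \<Otimes>\<^sub>M NL) hit) ((\<lambda>p. (fst p powr (3/2), snd p)) -` ({y<..} \<times> {v<..}) \<inter> space (uniform_measure (nu \<Otimes>\<^sub>M NL) hit))"
    unfolding first_law_def
  proof (rule measure_distr)
    show "(\<lambda>p. (fst p powr (3/2), snd p)) \<in> uniform_measure (nu \<Otimes>\<^sub>M NL) hit \<rightarrow>\<^sub>M borel" by measurable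
    show "{y<..} \<times> {v<..} \<in> sets borel" by (intro borel_open open_Times) auto
  qed
  also have "\<dots> = measure (nu \<Otimes>\<^sub>M NL) (hit \<inter> ((\<lambda>p. (fst p powr (3/2), snd p)) -` ({y<..} \<times> {v<..}) \<inter> space (nu \<Otimes>\<^sub>M NL))) / measure (nu \<Otimes>\<^sub>M NL) hit"
  proof (subst measure_uniform_measure)
    have "(\<lambda>p. (fst p powr (3/2), snd p)) \<in> nu \<Otimes>\<^sub>M NL \<rightarrow>\<^sub>M (borel :: (real \<times> real) measure)" by measurable
    moreover have "{y<..} \<times> {v<..} \<in> sets (borel :: (real \<times> real) measure)" by (intro borel_open open_Times) auto
    ultimately show "(\<lambda>p. (fst p powr (3/2), snd p)) -` ({y<..} \<times> {v<..}) \<inter> space (uniform_measure (nu \<Otimes>\<^sub>M NL) hit) \<in> sets (nu \<Otimes>\<^sub>M NL)"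
      using measurable_sets by (simp only: space_uniform_measure)
  qed (use exceeding_finite in \<open>simp_all add: emeasure_exceeding\<close>)
  also have "hit \<inter> ((\<lambda>p. (fst p powr (3/2), snd p)) -` ({y<..} \<times> {v<..}) \<inter> space (nu \<Otimes>\<^sub>M NL)) = C"
    by (auto simp: C_def space_pair_measure)
  also have "measure (nu \<Otimes>\<^sub>M NL) C = (\<integral>w. max y (1 / max 1 \<bar>w\<bar>) powr (- (2 * \<alpha> / 3)) * indicator {v<..} w \<partial>NL)"
    unfolding measure_def emeasure_quadrant(2)[OF C_def] by (rule integral_eq_nn_integral[symmetric]) auto
  also have "measure (nu \<Otimes>\<^sub>M NL) hit = (\<integral>w. max 1 \<bar>w\<bar> powr (2 * \<alpha> / 3) \<partial>NL)"
    unfolding measure_def emeasure_hit by (rule integral_eq_nn_integral[symmetric]) auto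
  finally show ?thesis .
qed

text \<open>Quadrants form an intersection-stable generator of the Borel sets of the plane.\<close>

lemma first_law_unique:
  assumes D: "prob_space D" "sets D = sets borel"
    and eq: "\<And>y v. measure D ({y<..} \<times> {v<..}) = measure first_law ({y<..} \<times> {v<..})"
  shows "D = first_law"
proof (rule measure_eqI_generator_eq[where \<Omega>=UNIV and E="range (\<lambda>(y, v). {y<..} \<times> {v<..})" and A="\<lambda>n. {- real n<..} \<times> {- real n<..}"])
  interpret D: prob_space D by fact
  interpret F: prob_space first_law by (rule prob_space_first_law)
  show "Int_stable (range (\<lambda>(y :: real, v :: real). {y<..} \<times> {v<..}))"
  proof (rule Int_stableI, clarify)
    fix y v y' v' :: real
    have "{y<..} \<times> {v<..} \<inter> {y'<..} \<times> {v'<..} = (\<lambda>(y, v). {y<..} \<times> {v<..}) (max y y', max v v')" by auto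
    then show "{y<..} \<times> {v<..} \<inter> {y'<..} \<times> {v'<..} \<in> range (\<lambda>(y, v). {y<..} \<times> {v<..})" by blast
  qed
  show "sets D = sigma_sets UNIV (range (\<lambda>(y, v). {y<..} \<times> {v<..}))" unfolding D(2) by (rule sets_borel_pair_greaterThan)
  show "sets first_law = sigma_sets UNIV (range (\<lambda>(y, v). {y<..} \<times> {v<..}))" unfolding sets_first_law by (rule sets_borel_pair_greaterThan)
  show "emeasure D X = emeasure first_law X" if "X \<in> range (\<lambda>(y, v). {y<..} \<times> {v<..})" for X
    using that eq by (auto simp: D.emeasure_eq_measure F.emeasure_eq_measure)
  show "emeasure D ({- real n<..} \<times> {- real n<..}) \<noteq> \<infinity>" for n using D.emeasure_finite by simp
  show "(\<Union>n. {- real n<..} \<times> {- real n<..}) = UNIV"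
  proof -
    have "\<exists>n. - real n < y \<and> - real n < v" for y v
    proof -
      obtain n where "max (- y) (- v) < real n" using reals_Archimedean2 by blast
      then show ?thesis by (intro exI[of _ n]) auto
    qed
    then show ?thesis by auto
  qed
qed auto

end

section \<open>The limit variables\<close>

context branching begin

definition tail_path :: "(real \<times> real) \<times> (nat \<Rightarrow> real) \<Rightarrow> nat \<Rightarrow> real \<times> real" where
  "tail_path s k = (\<mu> powr (3 * real k / 2) * fst (fst s),
     \<mu> powr (3 * real k / 2) * fst (fst s) * (case k of 0 \<Rightarrow> snd (fst s) | Suc j \<Rightarrow> snd s j))"

lemma trail_tail_path: "trail q z k = tail_path (unfold_trail (q, z)) k"
proof -
  have "(\<mu> ^ k * q) powr (3/2) = \<mu> powr (3 * real k / 2) * q powr (3/2)"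
    using mu by (simp add: powr_mult powr_realpow[symmetric] powr_powr mult.commute)
  then show ?thesis by (simp add: trail_def tail_path_def unfold_trail_def split: nat.split)
qed

lemma tail_path_measurable: "(\<lambda>s. tail_path s k) \<in> borel \<Otimes>\<^sub>M NN \<rightarrow>\<^sub>M borel"
proof -
  have 1: "(\<lambda>s. fst (fst s)) \<in> borel_measurable ((borel :: (real \<times> real) measure) \<Otimes>\<^sub>M NN)"
    and 2: "(\<lambda>s. snd (fst s)) \<in> borel_measurable ((borel :: (real \<times> real) measure) \<Otimes>\<^sub>M NN)"
    by (auto intro!: borel_measurable_continuous_onI continuous_intros measurable_compose[OF measurable_fst])
  have 3: "(\<lambda>s. snd s j) \<in> borel_measurable ((borel :: (real \<times> real) measure) \<Otimes>\<^sub>M NN)" for j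
  proof (rule measurable_compose[OF measurable_snd])
    show "(\<lambda>z. z j) \<in> borel_measurable NN"
      using measurable_component_singleton[of j UNIV "\<lambda>_. NL"] by (simp cong: measurable_cong_sets)
  qed
  show ?thesis
    unfolding tail_path_def using 1 2 3
    by (cases k) (auto intro!: borel_measurable_Pair borel_measurable_times borel_measurable_const)
qed

text \<open>On the times $k \ge 0$ the conditioned two-sided process is the path read off from the conditioned trail started at time $0$.\<close>

lemma tail_law_integral:
  assumes h: "wfun 0 b C (\<lambda>x. infnorm (x 0)) h" and b: "0 \<le> b"
  shows "(\<integral>\<omega>. h (U \<omega>) \<partial>Cond (\<lambda>x. infnorm (x 0))) = (\<integral>s. h (embed 0 (tail_path s)) \<partial>(first_law \<Otimes>\<^sub>M NN))"
proof -
  have wn: "wnorm 0 b 1 (\<lambda>x. infnorm (x 0))" by (rule infnorm_wnorm) (use b in simp)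
  have h1: "wfun 0 b 1 (\<lambda>x. infnorm (x 0)) (\<lambda>_. 1)" using wfun_const[of 0 b 1] by simp
  have L: "Lam (\<lambda>x. g x * indicator {1<..} (infnorm (x 0))) = (\<integral>\<omega>. g (embed 0 (trail (fst \<omega>) (snd \<omega>))) * indicator exceeding \<omega> \<partial>QN)"
    if g: "wfun 0 b D (\<lambda>x. infnorm (x 0)) g" for g D
  proof -
    have "Lam (\<lambda>x. g x * indicator {1<..} (infnorm (x 0))) = Q (\<lambda>x. g x * indicator {1<..} (infnorm (x 0))) 0"
      by (rule Lam_anchored[OF exceedance_window[OF wn g b zero_less_one] b]) (simp add: infnorm_0)
    also have "\<dots> = (\<integral>\<omega>. g (embed 0 (trail (fst \<omega>) (snd \<omega>))) * indicator exceeding \<omega> \<partial>QN)"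
      unfolding Q_def by (intro Bochner_Integration.integral_cong refl) (simp add: embed_def exceeding_def indicator_def)
    finally show ?thesis .
  qed
  have hm: "(\<lambda>\<omega>. h (embed 0 (trail (fst \<omega>) (snd \<omega>)))) \<in> borel_measurable QN"
    using wfunD(1)[OF h] by measurable
  have pm: "(\<lambda>s. embed 0 (tail_path s)) \<in> borel \<Otimes>\<^sub>M NN \<rightarrow>\<^sub>M PiM UNIV (\<lambda>_. borel)"
    by (rule measurable_compose[OF _ embed_measurable]) (rule measurable_PiM_single'[OF tail_path_measurable], simp)
  have um: "unfold_trail \<in> uniform_measure QN exceeding \<rightarrow>\<^sub>M borel \<Otimes>\<^sub>M NN"
    using unfold_trail_measurable by (simp cong: measurable_cong_sets)
  have "(\<integral>\<omega>. h (U \<omega>) \<partial>Cond (\<lambda>x. infnorm (x 0)))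
     = (\<integral>\<omega>. h (embed 0 (trail (fst \<omega>) (snd \<omega>))) * indicator exceeding \<omega> \<partial>QN) / measure QN exceeding"
    unfolding integral_Cond[OF wn h b] L[OF h] using L[OF h1] exceeding_sets exceeding_finite by simp
  also have "\<dots> = (\<integral>\<omega>. h (embed 0 (trail (fst \<omega>) (snd \<omega>))) \<partial>uniform_measure QN exceeding)"
    by (rule integral_uniform_measure_eq[OF exceeding_sets exceeding_finite(2,1) hm, symmetric])
  also have "\<dots> = (\<integral>\<omega>. h (embed 0 (tail_path (unfold_trail \<omega>))) \<partial>uniform_measure QN exceeding)"
  proof -
    have "trail (fst \<omega>) (snd \<omega>) = tail_path (unfold_trail \<omega>)" for \<omega>
    proof
      fix k show "trail (fst \<omega>) (snd \<omega>) k = tail_path (unfold_trail \<omega>) k"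
        using trail_tail_path[of "fst \<omega>" "snd \<omega>" k] by simp
    qed
    then show ?thesis by (simp only:)
  qed
  also have "\<dots> = (\<integral>s. h (embed 0 (tail_path s)) \<partial>distr (uniform_measure QN exceeding) (borel \<Otimes>\<^sub>M NN) unfold_trail)"
    by (rule integral_distr[OF um measurable_compose[OF pm wfunD(1)[OF h]], symmetric])
  finally show ?thesis unfolding law_unfold_trail .
qed

lemma NN_coordinate: "distr NN borel (\<lambda>z. z j) = NL"
proof -
  have "distr NN NL (\<lambda>z. z j) = NL" by (rule distr_PiM_component) (simp_all add: prob_space_NL)
  moreover have "distr NN NL (\<lambda>z. z j) = distr NN borel (\<lambda>z. z j)" by (rule distr_cong) simp_all
  ultimately show ?thesis by simp
qed

lemma component_NN[measurable]: "(\<lambda>z. z j) \<in> borel_measurable NN"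
  using measurable_component_singleton[of j UNIV "\<lambda>_. NL"] by (simp cong: measurable_cong_sets)

text \<open>Quadrant probabilities determine the law of the pair, independence and the normal marginals determine the rest; so any choice of limit variables has the law of a conditioned trail.\<close>

lemma limit_variables_law:
  fixes P :: "'b measure"
  assumes "limit_variables \<alpha> \<sigma> P Y Z"
  shows "distr P (borel \<Otimes>\<^sub>M NN) (\<lambda>\<omega>. ((Y \<omega>, Z 0 \<omega>), \<lambda>k. Z (Suc k) \<omega>)) = first_law \<Otimes>\<^sub>M NN"
    "(\<lambda>\<omega>. ((Y \<omega>, Z 0 \<omega>), \<lambda>k. Z (Suc k) \<omega>)) \<in> P \<rightarrow>\<^sub>M borel \<Otimes>\<^sub>M NN" "prob_space P"
proof -
  note lv = assms[unfolded limit_variables_def]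
  show "prob_space P" using lv by blast
  interpret P: prob_space P using lv by blast
  interpret I: prob_space NN by (rule prob_space_NN)
  interpret F: prob_space first_law by (rule prob_space_first_law)
  have Y: "Y \<in> borel_measurable P" and Z0: "Z 0 \<in> borel_measurable P"
    and dZ: "\<And>k. 1 \<le> k \<Longrightarrow> distributed P lborel (Z k) (normal_density 0 \<sigma>)"
    and iZ: "P.indep_vars (\<lambda>_. borel) Z {1..}"
    and iYZ: "indep_elements P borel (\<lambda>\<omega>. (Y \<omega>, Z 0 \<omega>)) (PiM {1..} (\<lambda>_. borel)) (\<lambda>\<omega>. \<lambda>k\<in>{1..}. Z k \<omega>)"
    and form: "\<And>y v. P.prob {\<omega> \<in> space P. Y \<omega> > y \<and> Z 0 \<omega> > v} =
        (\<integral>z. max y (1 / max 1 \<bar>z\<bar>) powr (- (2 * \<alpha> / 3)) * indicator {v<..} z \<partial>normal_law \<sigma>) /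
        (\<integral>z. max 1 \<bar>z\<bar> powr (2 * \<alpha> / 3) \<partial>normal_law \<sigma>)"
    using lv by blast+
  let ?W = "\<lambda>\<omega>. (Y \<omega>, Z 0 \<omega>)" and ?V = "\<lambda>\<omega>. \<lambda>k\<in>{1..}. Z k \<omega>" and ?S = "\<lambda>\<omega> k. Z (Suc k) \<omega>"
  have Wm: "?W \<in> borel_measurable P" using Y Z0 by (rule borel_measurable_Pair)
  have Zm: "Z k \<in> borel_measurable P" if "1 \<le> k" for k
    using distributed_measurable[OF dZ[OF that]] by (simp cong: measurable_cong_sets)
  have Zl: "distr P borel (Z k) = NL" if "1 \<le> k" for k
  proof -
    have "distr P borel (Z k) = distr P lborel (Z k)" by (rule distr_cong) simp_all
    then show ?thesis using distributed_distr_eq_density[OF dZ[OF that]] by simp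
  qed
  have Vm: "?V \<in> P \<rightarrow>\<^sub>M PiM {1..} (\<lambda>_. borel)" by (rule measurable_restrict) (use Zm in auto)
  have "distr P (PiM {1..} (\<lambda>_. borel)) ?V = PiM {1..} (\<lambda>k. distr P borel (Z k))"
    using iZ Zm by (subst (asm) P.indep_vars_iff_distr_eq_PiM') auto
  also have "\<dots> = PiM {1..} (\<lambda>_. NL)" by (rule PiM_cong) (use Zl in auto)
  finally have Vl: "distr P (PiM {1..} (\<lambda>_. borel)) ?V = PiM {1..} (\<lambda>_. NL)" .
  have sh: "(\<lambda>v k. v (Suc k)) \<in> PiM {1..} (\<lambda>_. borel) \<rightarrow>\<^sub>M NN"
  proof -
    have "(\<lambda>v k. v (Suc k)) \<in> PiM {1..} (\<lambda>_. borel :: real measure) \<rightarrow>\<^sub>M PiM UNIV (\<lambda>_. borel)"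
    proof (rule measurable_PiM_single')
      fix k show "(\<lambda>v. v (Suc k)) \<in> PiM {1..} (\<lambda>_. borel :: real measure) \<rightarrow>\<^sub>M borel"
        by (rule measurable_component_singleton) simp
    qed simp
    then show ?thesis by (simp add: measurable_cong_sets[OF refl sets_NN])
  qed
  have SV: "?S \<omega> = (\<lambda>v k. v (Suc k)) (?V \<omega>)" for \<omega> by (simp add: fun_eq_iff)
  have Sm: "?S \<in> P \<rightarrow>\<^sub>M NN" unfolding SV by (rule measurable_compose[OF Vm sh])
  show pm: "(\<lambda>\<omega>. (?W \<omega>, ?S \<omega>)) \<in> P \<rightarrow>\<^sub>M borel \<Otimes>\<^sub>M NN" by (rule measurable_Pair[OF Wm Sm])
  have "distr P NN ?S = distr (distr P (PiM {1..} (\<lambda>_. borel)) ?V) NN (\<lambda>v k. v (Suc k))"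
    unfolding distr_distr[OF sh Vm] by (simp add: o_def)
  also have "\<dots> = distr (PiM {1..} (\<lambda>_. NL)) NN (\<lambda>v. \<lambda>k\<in>UNIV. v (Suc k))" unfolding Vl by (simp add: restrict_def)
  also have "\<dots> = NN"
    by (rule distr_PiM_reindex) (auto simp: prob_space_NL)
  finally have Sl: "distr P NN ?S = NN" .
  have Wl: "distr P borel ?W = first_law"
  proof (rule first_law_unique)
    show "prob_space (distr P borel ?W)" by (rule P.prob_space_distr[OF Wm])
    fix y v
    have "measure (distr P borel ?W) ({y<..} \<times> {v<..}) = P.prob (?W -` ({y<..} \<times> {v<..}) \<inter> space P)"
      by (rule measure_distr[OF Wm]) (intro borel_open open_Times open_greaterThan)
    also have "?W -` ({y<..} \<times> {v<..}) \<inter> space P = {\<omega> \<in> space P. Y \<omega> > y \<and> Z 0 \<omega> > v}" by auto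
    finally show "measure (distr P borel ?W) ({y<..} \<times> {v<..}) = measure first_law ({y<..} \<times> {v<..})"
      unfolding form measure_first_law .
  qed simp
  show "distr P (borel \<Otimes>\<^sub>M NN) (\<lambda>\<omega>. (?W \<omega>, ?S \<omega>)) = first_law \<Otimes>\<^sub>M NN"
  proof (rule pair_measure_eqI[symmetric])
    show "sigma_finite_measure first_law" "sigma_finite_measure NN" by unfold_locales
    show "sets (first_law \<Otimes>\<^sub>M NN) = sets (distr P (borel \<Otimes>\<^sub>M NN) (\<lambda>\<omega>. (?W \<omega>, ?S \<omega>)))"
      by (simp cong: sets_pair_measure_cong)
    fix C D assume "C \<in> sets first_law" and D: "D \<in> sets NN"
    then have C: "C \<in> sets borel" by simp
    have D': "(\<lambda>v k. v (Suc k)) -` D \<inter> space (PiM {1..} (\<lambda>_. borel :: real measure)) \<in> sets (PiM {1..} (\<lambda>_. borel))"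
      by (rule measurable_sets[OF sh D])
    have DV: "?S -` D \<inter> space P = ?V -` ((\<lambda>v k. v (Suc k)) -` D \<inter> space (PiM {1..} (\<lambda>_. borel :: real measure))) \<inter> space P"
      using measurable_space[OF Vm] by auto
    have ind: "P.indep_set {?W -` C \<inter> space P | C. C \<in> sets borel} {?V -` D \<inter> space P | D. D \<in> sets (PiM {1..} (\<lambda>_. borel))}"
      using iYZ by (simp only: indep_elements_def)
    have "P.prob ((?W -` C \<inter> space P) \<inter> (?S -` D \<inter> space P)) = P.prob (?W -` C \<inter> space P) * P.prob (?S -` D \<inter> space P)"
      by (rule P.indep_setD[OF ind]) (use C D' DV in blast)+
    moreover have "(\<lambda>\<omega>. (?W \<omega>, ?S \<omega>)) -` (C \<times> D) \<inter> space P = (?W -` C \<inter> space P) \<inter> (?S -` D \<inter> space P)" by auto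
    ultimately have "emeasure P ((\<lambda>\<omega>. (?W \<omega>, ?S \<omega>)) -` (C \<times> D) \<inter> space P) = emeasure P (?W -` C \<inter> space P) * emeasure P (?S -` D \<inter> space P)"
      by (simp add: P.emeasure_eq_measure ennreal_mult)
    also have "emeasure P (?W -` C \<inter> space P) = emeasure first_law C" unfolding Wl[symmetric] by (rule emeasure_distr[OF Wm C, symmetric])
    also have "emeasure P (?S -` D \<inter> space P) = emeasure NN D"
      using emeasure_distr[OF Sm D] by (simp only: Sl)
    finally show "emeasure first_law C * emeasure NN D = emeasure (distr P (borel \<Otimes>\<^sub>M NN) (\<lambda>\<omega>. (?W \<omega>, ?S \<omega>))) (C \<times> D)"
      by (subst emeasure_distr[OF pm]) (use C D in auto)
  qed
qed

text \<open>The canonical coordinates of the product measure.\<close>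

lemma limit_variables_exist:
  "limit_variables \<alpha> \<sigma> (first_law \<Otimes>\<^sub>M NN) (\<lambda>s. fst (fst s)) (\<lambda>k s. case k of 0 \<Rightarrow> snd (fst s) | Suc j \<Rightarrow> snd s j)"
proof -
  interpret I: prob_space NN by (rule prob_space_NN)
  interpret F: prob_space first_law by (rule prob_space_first_law)
  interpret P: pair_prob_space first_law NN ..
  let ?P = "first_law \<Otimes>\<^sub>M NN"
  let ?Z = "\<lambda>k (s :: (real \<times> real) \<times> (nat \<Rightarrow> real)). case k of 0 \<Rightarrow> snd (fst s) | Suc j \<Rightarrow> snd s j"
  have sp: "space first_law = UNIV" by (simp add: first_law_def)
  have tops: "UNIV \<in> sets first_law" "UNIV \<in> sets NN" using sets.top[of NN] by simp_all
  have F1: "emeasure first_law UNIV = 1" and I1: "emeasure NN UNIV = 1"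
    using F.emeasure_space_1 I.emeasure_space_1 by (simp_all add: sp)
  have sndl: "emeasure ?P (snd -` A \<inter> space ?P) = emeasure NN A" if "A \<in> sets NN" for A
  proof -
    have "snd -` A \<inter> space ?P = UNIV \<times> A" by (auto simp: space_pair_measure sp)
    then show ?thesis using I.emeasure_pair_measure_Times[OF tops(1) that] by (simp add: F1)
  qed
  have fstl: "emeasure ?P (fst -` A \<inter> space ?P) = emeasure first_law A" if "A \<in> sets borel" for A
  proof -
    have A: "A \<in> sets first_law" using that by simp
    have "fst -` A \<inter> space ?P = A \<times> UNIV" by (auto simp: space_pair_measure sp)
    then show ?thesis using I.emeasure_pair_measure_Times[OF A tops(2)] by (simp add: I1)
  qed
  have Sm: "(\<lambda>s. snd s j) \<in> borel_measurable ?P" for j by (rule measurable_compose[OF measurable_snd component_NN])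
  have Sl: "distr ?P borel (\<lambda>s. snd s j) = NL" for j
  proof -
    have "distr ?P borel (\<lambda>s. snd s j) = distr (distr ?P NN snd) borel (\<lambda>z. z j)"
      by (subst distr_distr[OF component_NN measurable_snd]) (simp add: o_def)
    also have "distr ?P NN snd = NN" by (rule measure_eqI) (simp_all add: emeasure_distr sndl)
    finally show ?thesis by (simp only: NN_coordinate)
  qed
  have fm: "fst \<in> ?P \<rightarrow>\<^sub>M borel" using measurable_fst[of first_law NN] by (simp cong: measurable_cong_sets)
  have Ym: "(\<lambda>s. fst (fst s)) \<in> borel_measurable ?P" and Z0m: "(\<lambda>s. snd (fst s)) \<in> borel_measurable ?P"
    by (auto intro!: measurable_compose[OF fm] borel_measurable_continuous_onI continuous_intros)
  have Zm: "?Z k \<in> borel_measurable ?P" for k by (cases k) (use Sm Z0m in simp_all)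
  have Zl: "distr ?P borel (?Z k) = NL" if "1 \<le> k" for k using that Sl by (cases k) simp_all
  have shm: "(\<lambda>z. \<lambda>k\<in>{1..}. z (k - 1)) \<in> NN \<rightarrow>\<^sub>M PiM {1..} (\<lambda>_. borel)"
    by (intro measurable_restrict component_NN)
  have V: "(\<lambda>s. \<lambda>k\<in>{1..}. ?Z k s) = (\<lambda>s. (\<lambda>z. \<lambda>k\<in>{1..}. z (k - 1)) (snd s))"
    by (auto simp: fun_eq_iff restrict_def split: nat.split)
  have Vm: "(\<lambda>s. \<lambda>k\<in>{1..}. ?Z k s) \<in> ?P \<rightarrow>\<^sub>M PiM {1..} (\<lambda>_. borel)"
    unfolding V by (rule measurable_compose[OF measurable_snd shm])
  have "distr ?P (PiM {1..} (\<lambda>_. borel)) (\<lambda>s. \<lambda>k\<in>{1..}. ?Z k s) = PiM {1..} (\<lambda>_. NL)"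
  proof -
    have "distr ?P NN snd = NN" by (rule measure_eqI) (simp_all add: emeasure_distr sndl)
    then have "distr ?P (PiM {1..} (\<lambda>_. borel)) (\<lambda>s. \<lambda>k\<in>{1..}. ?Z k s) = distr NN (PiM {1..} (\<lambda>_. borel)) (\<lambda>z. \<lambda>k\<in>{1..}. z (k - 1))"
      unfolding V using distr_distr[OF shm measurable_snd, of first_law] by (simp add: o_def)
    also have "\<dots> = distr NN (PiM {1..} (\<lambda>_. NL)) (\<lambda>z. \<lambda>k\<in>{1..}. z (k - 1))"
      by (rule distr_cong) (auto intro!: sets_PiM_cong)
    also have "\<dots> = PiM {1..} (\<lambda>_. NL)"
      by (rule distr_PiM_reindex) (auto simp: prob_space_NL inj_on_def)
    finally show ?thesis .
  qed
  also have "PiM {1..} (\<lambda>_. NL) = PiM {1..} (\<lambda>k. distr ?P borel (?Z k))" by (rule PiM_cong) (use Zl in auto)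
  finally have iZ: "P.indep_vars (\<lambda>_. borel) ?Z {1..}"
    using Zm by (subst P.indep_vars_iff_distr_eq_PiM') auto
  have W: "(\<lambda>s. (fst (fst s), ?Z 0 s)) = fst" by auto
  have ind: "indep_elements ?P borel (\<lambda>s. (fst (fst s), ?Z 0 s)) (PiM {1..} (\<lambda>_. borel)) (\<lambda>s. \<lambda>k\<in>{1..}. ?Z k s)"
    unfolding indep_elements_def W
  proof (intro conjI fm Vm P.indep_setI)
    show "{fst -` C \<inter> space ?P |C. C \<in> sets borel} \<subseteq> P.events" using measurable_sets[OF fm] by blast
    show "{(\<lambda>s. \<lambda>k\<in>{1..}. ?Z k s) -` D \<inter> space ?P |D. D \<in> sets (PiM {1..} (\<lambda>_. borel))} \<subseteq> P.events"
      using measurable_sets[OF Vm] by blast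
    fix a b assume "a \<in> {fst -` C \<inter> space ?P |C. C \<in> sets borel}" and "b \<in> {(\<lambda>s. \<lambda>k\<in>{1..}. ?Z k s) -` D \<inter> space ?P |D. D \<in> sets (PiM {1..} (\<lambda>_. borel))}"
    then obtain C D where C: "C \<in> sets borel" "a = fst -` C \<inter> space ?P"
      and D: "D \<in> sets (PiM {1..} (\<lambda>_. borel))" "b = (\<lambda>s. \<lambda>k\<in>{1..}. ?Z k s) -` D \<inter> space ?P" by blast
    define D' where "D' = (\<lambda>z. \<lambda>k\<in>{1..}. z (k - 1)) -` D \<inter> space NN"
    have D': "D' \<in> sets NN" unfolding D'_def by (rule measurable_sets[OF shm D(1)])
    have b: "b = snd -` D' \<inter> space ?P" unfolding D(2) V D'_def by (auto simp: space_pair_measure)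
    have C': "C \<in> sets first_law" using C(1) by simp
    have "a \<inter> b = C \<times> D'" unfolding C(2) b by (auto simp: space_pair_measure sp)
    then have "emeasure ?P (a \<inter> b) = emeasure first_law C * emeasure NN D'"
      using I.emeasure_pair_measure_Times[OF C' D'] by simp
    also have "\<dots> = emeasure ?P a * emeasure ?P b" unfolding C(2) b fstl[OF C(1)] sndl[OF D'] ..
    finally have "emeasure ?P (a \<inter> b) = emeasure ?P a * emeasure ?P b" .
    then show "P.prob (a \<inter> b) = P.prob a * P.prob b"
      by (simp add: measure_def enn2real_mult)
  qed
  have form: "P.prob {s \<in> space ?P. y < fst (fst s) \<and> v < ?Z 0 s} =
        (\<integral>z. max y (1 / max 1 \<bar>z\<bar>) powr (- (2 * \<alpha> / 3)) * indicator {v<..} z \<partial>NL) / (\<integral>z. max 1 \<bar>z\<bar> powr (2 * \<alpha> / 3) \<partial>NL)" for y v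
  proof -
    have "{s \<in> space ?P. y < fst (fst s) \<and> v < ?Z 0 s} = fst -` ({y<..} \<times> {v<..}) \<inter> space ?P" by (auto simp: space_pair_measure)
    moreover have "{y<..} \<times> {v<..} \<in> sets (borel :: (real \<times> real) measure)" by (intro borel_open open_Times open_greaterThan)
    ultimately show ?thesis unfolding measure_first_law[symmetric] by (simp add: measure_def fstl)
  qed
  have dist: "distributed ?P lborel (?Z k) (normal_density 0 \<sigma>)" if "1 \<le> k" for k
  proof -
    have "distr ?P lborel (?Z k) = distr ?P borel (?Z k)" by (rule distr_cong) simp_all
    then show ?thesis unfolding distributed_def using Zl[OF that] Zm[of k] by (simp cong: measurable_cong_sets)
  qed
  show ?thesis
    unfolding limit_variables_def
    using P.prob_space_axioms Ym Zm[of 0] dist iZ ind form by blast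
qed

end

context inar begin

text \<open>The limit of the conditional laws, expressed through the trail, is transferred to arbitrary limit variables by their common law.\<close>

lemma forward_fdd:
  fixes P :: "'b measure"
  assumes lv: "limit_variables \<alpha> \<sigma>A P Y Z"
  shows "fdd_conv (\<lambda>x. uniform_measure M {\<omega> \<in> space M. infnorm (xi 0 \<omega>) > x}) (\<lambda>x k \<omega>. xi (int k) \<omega> /\<^sub>R x) P
     (\<lambda>k \<omega>. (\<mu>A powr (3 * real k / 2) * Y \<omega>, \<mu>A powr (3 * real k / 2) * Y \<omega> * Z k \<omega>))"
    "(\<lambda>\<omega>. (\<mu>A powr (3 * real k / 2) * Y \<omega>, \<mu>A powr (3 * real k / 2) * Y \<omega> * Z k \<omega>)) \<in> borel_measurable P"
proof -
  let ?s = "\<lambda>\<omega>. ((Y \<omega>, Z 0 \<omega>), \<lambda>k. Z (Suc k) \<omega>)"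
  let ?Y = "\<lambda>k \<omega>. (\<mu>A powr (3 * real k / 2) * Y \<omega>, \<mu>A powr (3 * real k / 2) * Y \<omega> * Z k \<omega>)"
  note law = br.limit_variables_law[OF lv]
  have Yt: "?Y k \<omega> = br.tail_path (?s \<omega>) k" for k \<omega>
    by (simp add: br.tail_path_def split: nat.split)
  show Ym: "?Y k \<in> borel_measurable P" for k
    unfolding Yt by (rule measurable_compose[OF law(2) br.tail_path_measurable])
  show "fdd_conv (\<lambda>x. uniform_measure M {\<omega> \<in> space M. infnorm (xi 0 \<omega>) > x}) (\<lambda>x k \<omega>. xi (int k) \<omega> /\<^sub>R x) P ?Y"
    unfolding fdd_conv_def weak_conv_in_def topspace_extensional
  proof (intro allI impI, elim conjE)
    fix J :: "nat set" and f :: "(nat \<Rightarrow> real \<times> real) \<Rightarrow> real"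
    assume J: "finite J" and f: "continuous_map (product_topology (\<lambda>_. euclidean) J) euclideanreal f" and bd: "bounded (f ` extensional J)"
    define b where "b = int (Max (insert 0 J))"
    have b: "0 \<le> b" and Jb: "int k \<in> {0..b}" if "k \<in> J" for k using J that by (auto simp: b_def)
    have b: "0 \<le> b" by (simp add: b_def)
    obtain C where C: "\<And>\<theta>. \<theta> \<in> extensional J \<Longrightarrow> \<bar>f \<theta>\<bar> \<le> C" using bd unfolding bounded_iff by auto
    have fm: "f \<in> borel_measurable (PiM J (\<lambda>_. borel))" by (rule continuous_map_measurable(2)[OF f])
    have tm: "(\<lambda>s. \<lambda>k\<in>J. br.tail_path s k) \<in> borel \<Otimes>\<^sub>M PiM UNIV (\<lambda>_. normal_law \<sigma>A) \<rightarrow>\<^sub>M PiM J (\<lambda>_. borel)"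
      by (intro measurable_restrict br.tail_path_measurable)
    have "(\<integral>z. f z \<partial>fdd P borel ?Y J) = (\<integral>\<omega>. f (\<lambda>k\<in>J. br.tail_path (?s \<omega>) k) \<partial>P)"
      unfolding fdd_def Yt by (rule integral_distr[OF measurable_compose[OF law(2) tm] fm])
    also have "\<dots> = (\<integral>s. f (\<lambda>k\<in>J. br.tail_path s k) \<partial>distr P (borel \<Otimes>\<^sub>M PiM UNIV (\<lambda>_. normal_law \<sigma>A)) ?s)"
      by (rule integral_distr[OF law(2) measurable_compose[OF tm fm], symmetric])
    also have "\<dots> = (\<integral>\<omega>. f (\<lambda>k\<in>J. br.U \<omega> (int k)) \<partial>tail_law)"
      unfolding law(1) using br.tail_law_integral[OF wfun_coordinates[OF f C Jb] b]
      by (simp add: embed_def)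
    finally have "(\<integral>z. f z \<partial>fdd P borel ?Y J) = (\<integral>\<omega>. f (\<lambda>k\<in>J. br.U \<omega> (int k)) \<partial>tail_law)" .
    then show "((\<lambda>x. \<integral>z. f z \<partial>fdd (uniform_measure M {\<omega> \<in> space M. infnorm (xi 0 \<omega>) > x}) borel (\<lambda>k \<omega>. xi (int k) \<omega> /\<^sub>R x) J)
       \<longlongrightarrow> (\<integral>z. f z \<partial>fdd P borel ?Y J)) at_top"
      using fdd_tendsto[OF J f bd, of int] by (simp only:)
  qed
qed

end

theorem theoremE3:
  fixes M :: "'a measure"
    and A0 B0 :: "'a \<Rightarrow> nat"
    and A :: "nat \<Rightarrow> int \<Rightarrow> 'a \<Rightarrow> nat"
    and B X :: "int \<Rightarrow> 'a \<Rightarrow> nat"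
    and Mt :: "int \<Rightarrow> 'a \<Rightarrow> real"
    and \<xi> :: "int \<Rightarrow> 'a \<Rightarrow> real \<times> real"
    and \<alpha> \<mu>A \<mu>B \<sigma>A :: real
  assumes "prob_space M"
    and "A0 \<in> measurable M (count_space UNIV)"
    and "B0 \<in> measurable M (count_space UNIV)"
    and "prob_space.indep_vars M (\<lambda>_. count_space UNIV) (noise A B) (({1..} \<times> UNIV) <+> UNIV)"
    and "\<And>j i. 1 \<le> j \<Longrightarrow> distr M (count_space UNIV) (A j i) = distr M (count_space UNIV) A0"
    and "\<And>i. distr M (count_space UNIV) (B i) = distr M (count_space UNIV) B0"
    and "\<mu>A = prob_space.expectation M (\<lambda>\<omega>. real (A0 \<omega>))" and "0 < \<mu>A" and "\<mu>A < 1"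
    and "integrable M (\<lambda>\<omega>. (real (A0 \<omega>))\<^sup>2)"
    and "\<sigma>A = sqrt (prob_space.variance M (\<lambda>\<omega>. real (A0 \<omega>)))" and "0 < \<sigma>A"
    and "1 < \<alpha>" and "\<alpha> < 2"
    and "regularly_varying_rv M (\<lambda>\<omega>. real (B0 \<omega>)) \<alpha>"
    and "\<mu>B = prob_space.expectation M (\<lambda>\<omega>. real (B0 \<omega>))"
    and "strongly_stationary M (count_space UNIV) X"
    and "\<And>i. AE \<omega> in M. X i \<omega> = (\<Sum>j = 1..X (i - 1) \<omega>. A j i \<omega>) + B i \<omega>"
    and "\<And>i. indep_elements M (count_space UNIV) (X (i - 1))
           (PiM (({1..} \<times> {i..}) <+> {i..}) (\<lambda>_. count_space UNIV))
           (\<lambda>\<omega>. \<lambda>t\<in>({1..} \<times> {i..}) <+> {i..}. noise A B t \<omega>)"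
    and "\<And>i \<omega>. Mt i \<omega> = real (X i \<omega>) - \<mu>A * real (X (i - 1) \<omega>) - \<mu>B"
    and "\<And>k \<omega>. \<xi> k \<omega> = (real (X k \<omega>) powr (3 / 2), real (X k \<omega>) * Mt (k + 1) \<omega>)"
  shows "(\<exists>(P :: ((real \<times> real) \<times> (nat \<Rightarrow> real)) measure) Y Z. limit_variables \<alpha> \<sigma>A P Y Z) \<and>
    (\<forall>(P :: 'b measure) Y Z. limit_variables \<alpha> \<sigma>A P Y Z \<longrightarrow>
       fdd_conv
         (\<lambda>x. uniform_measure M {\<omega> \<in> space M.
            max (real (X 0 \<omega>) powr (3 / 2)) (real (X 0 \<omega>) * \<bar>Mt 1 \<omega>\<bar>) > x})
         (\<lambda>x k \<omega>. (1 / x) *\<^sub>R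
            (real (X (int k) \<omega>) powr (3 / 2), real (X (int k) \<omega>) * Mt (int k + 1) \<omega>))
         P
         (\<lambda>k \<omega>. (\<mu>A powr (3 * real k / 2) * Y \<omega>, \<mu>A powr (3 * real k / 2) * Y \<omega> * Z k \<omega>))) \<and>
    strongly_stationary M borel \<xi> \<and>
    jointly_regularly_varying M \<xi> (2 * \<alpha> / 3) \<and>
    (\<forall>(P :: 'b measure) Y Z. limit_variables \<alpha> \<sigma>A P Y Z \<longrightarrow>
       forward_tail_process M \<xi> P
         (\<lambda>k \<omega>. (\<mu>A powr (3 * real k / 2) * Y \<omega>, \<mu>A powr (3 * real k / 2) * Y \<omega> * Z k \<omega>))) \<and>
    (\<exists>(P :: (int \<Rightarrow> real \<times> real) measure) \<Upsilon>. tail_process M \<xi> P \<Upsilon>)"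
proof -
  interpret inar M A0 B0 A B X \<alpha> \<mu>A \<mu>B \<sigma>A
    using assms(1-19) by (simp only: inar_def inar_axioms_def) blast
  have xi: "\<xi> = xi"
    using assms(20,21) by (auto simp: fun_eq_iff xi_def)
  have inf0: "max (real (X 0 \<omega>) powr (3 / 2)) (real (X 0 \<omega>) * \<bar>Mt 1 \<omega>\<bar>) = infnorm (xi 0 \<omega>)" for \<omega>
    using assms(20)[of 1 \<omega>] by (simp add: infnorm_pair xi_def abs_mult)
  have scaled: "(1 / x) *\<^sub>R (real (X (int k) \<omega>) powr (3 / 2), real (X (int k) \<omega>) * Mt (int k + 1) \<omega>) = xi (int k) \<omega> /\<^sub>R x" for x k \<omega>
    using assms(20)[of "int k + 1" \<omega>] by (simp add: xi_def inverse_eq_divide)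
  have exist: "\<exists>(P :: ((real \<times> real) \<times> (nat \<Rightarrow> real)) measure) Y Z. limit_variables \<alpha> \<sigma>A P Y Z"
    using br.limit_variables_exist by blast
  have fwd: "forward_tail_process M xi P
         (\<lambda>k \<omega>. (\<mu>A powr (3 * real k / 2) * Y \<omega>, \<mu>A powr (3 * real k / 2) * Y \<omega> * Z k \<omega>))"
    if "limit_variables \<alpha> \<sigma>A P Y Z" for P :: "'b measure" and Y Z
    unfolding forward_tail_process_def
    using br.limit_variables_law(3)[OF that] forward_fdd[OF that] by blast
  show ?thesis
    unfolding inf0 scaled xi
    using exist forward_fdd(1) strongly_stationary_xi jointly_regularly_varying_xi fwd tail_process_xi by blast
qed

end
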